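(* Every isotropic curve $f:S\to\mathbb{Q}_3$ of general type is deformable of order four and is rigid to order five.
   Context: Deformation and rigidity. Two holomorphic maps into $\mathbb{Q}_3$ have analytic contact of order $k$ at a point $p$ if they have the same $k$-th order jet at $p$. Let $f,\hat f:S\to\mathbb{Q}_3$ be isotropic curves. $\hat f$ is a $k$-th order conformal deformation of $f$ if there is a holomorphic map $\mathtt D:S\to\mathrm{Sp}(2,\mathbb{C})$ such that $\hat f$ and $\mathtt D(p)\cdot f$ have analytic contact of order $k$ at $p$, for every $p\in S$. A deformation is trivial if it is congruent to $f$, i.e. $\hat f=X\cdot f$ for some $X\in\mathrm{Sp}(2,\mathbb{C})$. $f$ is deformable of order $k$ if for every $p_0\in S\setminus(|\Delta_f|\cup|\Delta_{f^\sharp}|\cup|\Delta_\delta|)$ there exist an open neighborhood $U$ of $p_0$ and an isotropic curve of general type $\hat f:U\to\mathbb{Q}_3$ which is a non-trivial $k$-th order deformation of $f|_U$. Otherwise $f$ is said to be rigid to order $k$. Here $|\Delta_\delta|$ is the support of the divisor (zeros and poles) of the quartic differential $\delta$ of $f$; $|\Delta_f|,|\Delta_{f^\sharp}|$ and $\delta$ are defined below. Symplectic group. $(\mathbf e_1,\dots,\mathbf e_4)$ is the natural basis of $\mathbb{C}^4$, $\omega=dz^1\wedge dz^3+dz^2\wedge dz^4$, $\mathrm{Sp}(2,\mathbb{C})$ is the group of linear automorphisms of $(\mathbb{C}^4,\omega)$. For $A\in\mathrm{Sp}(2,\mathbb{C})$, $A_j=A\mathbf e_j$. $\varphi=(\varphi^i_j)=A^{-1}dA$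 is the Maurer–Cartan form ($i$ = row, $j$ = column). $(\mathbf a_1,\mathbf a_2)$ is the natural basis of $\mathbb{C}^2$. Isotropic curves. $\mathbb{Q}_3$ is the complex 3-fold of Lagrangian 2-planes of $(\mathbb{C}^4,\omega)$; the plane spanned by $\mathbf x,\mathbf y$ is written $[\mathbf x\wedge\mathbf y]$. Its canonical conformal structure is represented, for a local holomorphic section $A$ of $A\mapsto[A_1\wedge A_2]$, by $\varphi^3_1\varphi^4_2-(\varphi^4_1)^2$. An isotropic curve is a nonconstant holomorphic map $f:S\to\mathbb{Q}_3$ from a connected Riemann surface, null for this conformal structure and with image not contained in a null ray $\{P : [\xi]\subset P\}$, $[\xi]\in\mathbb{CP}^3$. If locally $f=[\mathbf u_1\wedge\mathbf u_2]$, the symmetric matrix $\dot{\mathbf m}=(\omega(\mathbf u_i,\mathbf u_j'))$ has zero determinant; the Legendre associate $f^\sharp:S\to\mathbb{CP}^3$ is the holomorphic map which, where $\dot{\mathbf m}\neq0$, is the line spanned by $x_1\mathbf u_1+x_2\mathbf u_2$ with $0\ne(x_1,x_2)\in\ker\dot{\mathbf m}$ (extended holomorphically). $|\Delta_f|,|\Delta_{f^\sharp}|$ are the sets of critical points of $f,f^\sharp$, and $S_\star=S\setminus(|\Delta_f|\cup|\Delta_{f^\sharp}|)$. Quartic differential. $\mathrm{SL}(2,\mathbb{C})_1$ is the group of upper triangular unimodular $2\times2$ matrices. Let $\mathtt F:\mathrm S^3(\mathbb{C}^2)\to\mathbb{C}^4$ be the linear isomorphism with $\mathtt F(\mathbf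 a_1^3)=\mathbf e_1$, $\mathtt F(\mathbf a_1^2\mathbf a_2)=-\sqrt[3]{2/9}\,\mathbf e_2$, $\mathtt F(\mathbf a_1\mathbf a_2^2)=\sqrt[3]{1/6}\,\mathbf e_4$, $\mathtt F(\mathbf a_2^3)=\mathbf e_3$ (symmetric products), $\mathtt S:\mathrm{SL}(2,\mathbb{C})\to\mathrm{Sp}(2,\mathbb{C})$ the representation on $\mathrm S^3(\mathbb{C}^2)$ conjugated by $\mathtt F$, and $\mathrm H_1=\mathtt S(\mathrm{SL}(2,\mathbb{C})_1)$. For an isotropic curve $f$ there is a unique reduction $\pi:\mathcal F\to S_\star$, with group $\mathrm H_1$, of the bundle $\{(p,A)\in S_\star\times \mathrm{Sp}(2,\mathbb{C}): f(p)=[A_1\wedge A_2]\}$ on which $\varphi^3_1=\varphi^4_1=\varphi^2_1-\varphi^4_2=\varphi^1_1-3\varphi^2_2=4\varphi^1_2-3\varphi^2_4=\varphi^1_4=0$ and $\varphi^4_2\neq0$. The quartic differential $\delta$ of $f$ is the meromorphic quartic differential on $S$ with $\pi^*(\delta)=\varphi^1_3(\varphi^4_2)^3$. The curve $f$ is of general type if $\delta$ is not identically zero. *)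

theory Defs
  imports "HOL-Complex_Analysis.Complex_Analysis"
begin

no_notation fps_nth (infixl "$" 75) \<comment> \<open>clashes with the vector component notation\<close>

section \<open>Riemann surfaces and holomorphic functions on them\<close>

type_synonym 'a chart = "'a set \<times> ('a \<Rightarrow> complex)"

text \<open>The atlas need not be maximal.  Second countability is not required; for connected
  surfaces it is automatic (Rado).\<close>

definition riemann_surface :: "'a topology \<Rightarrow> 'a chart set \<Rightarrow> bool" where
  "riemann_surface X \<A> \<longleftrightarrow>
     Hausdorff_space X \<and>
     (\<Union>(V,z)\<in>\<A>. V) = topspace X \<and>
     (\<forall>(V,z)\<in>\<A>. openin X V \<and> open (z ` V) \<and>
        homeomorphic_map (subtopology X V) (top_of_set (z ` V)) z) \<and>
     (\<forall>(V,z)\<in>\<A>. \<forall>(V',z')\<in>\<A>. (z' \<circ> inv_into V z) holomorphic_on z ` (V \<inter> V'))"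

definition coord_expr :: "'a chart \<Rightarrow> ('a \<Rightarrow> complex) \<Rightarrow> complex \<Rightarrow> complex" where
  "coord_expr c h = h \<circ> inv_into (fst c) (snd c)"

definition holo :: "'a chart set \<Rightarrow> 'a set \<Rightarrow> ('a \<Rightarrow> complex) \<Rightarrow> bool" where
  "holo \<A> W h \<longleftrightarrow> (\<forall>c\<in>\<A>. coord_expr c h holomorphic_on snd c ` (fst c \<inter> W))"

definition holo_vec :: "'a chart set \<Rightarrow> 'a set \<Rightarrow> ('a \<Rightarrow> complex^'n) \<Rightarrow> bool" where
  "holo_vec \<A> W v \<longleftrightarrow> (\<forall>i. holo \<A> W (\<lambda>q. v q $ i))"

definition holo_mat :: "'a chart set \<Rightarrow> 'a set \<Rightarrow> ('a \<Rightarrow> complex^'n^'m) \<Rightarrow> bool" where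
  "holo_mat \<A> W M \<longleftrightarrow> (\<forall>i j. holo \<A> W (\<lambda>q. M q $ i $ j))"

definition chart_deriv :: "'a chart \<Rightarrow> nat \<Rightarrow> ('a \<Rightarrow> complex) \<Rightarrow> 'a \<Rightarrow> complex" where
  "chart_deriv c k h p = (deriv ^^ k) (coord_expr c h) (snd c p)"

definition mat_deriv :: "'a chart \<Rightarrow> ('a \<Rightarrow> complex^'n^'m) \<Rightarrow> 'a \<Rightarrow> complex^'n^'m" where
  "mat_deriv c M p = (\<chi> i j. chart_deriv c 1 (\<lambda>q. M q $ i $ j) p)"


section \<open>The symplectic group and the Lagrangian Grassmannian\<close>

definition sympl :: "complex^4 \<Rightarrow> complex^4 \<Rightarrow> complex" where
  "sympl x y = x$1 * y$3 - x$3 * y$1 + x$2 * y$4 - x$4 * y$2"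

definition Sp :: "(complex^4^4) set" where
  "Sp = {A. invertible A \<and> (\<forall>x y. sympl (A *v x) (A *v y) = sympl x y)}"

text \<open>Complex linear span, subspaces and dimension are those of \<open>vec\<close>; the unqualified
  constants refer to the underlying real vector space.\<close>

definition plane :: "complex^4 \<Rightarrow> complex^4 \<Rightarrow> (complex^4) set" where
  "plane x y = vec.span {x, y}"

definition Q3 :: "(complex^4) set set" where
  "Q3 = {P. vec.subspace P \<and> vec.dim P = 2 \<and> (\<forall>x\<in>P. \<forall>y\<in>P. sympl x y = 0)}"

definition act :: "complex^4^4 \<Rightarrow> (complex^4) set \<Rightarrow> (complex^4) set" where
  "act A P = (\<lambda>v. A *v v) ` P"

text \<open>The complex structure of \<open>Q3\<close> is given by the atlas of big cells: for \<open>A \<in> Sp\<close>, the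
  coordinates \<open>m\<close> are the entries of a symmetric 2 x 2 matrix, i.e. \<open>A\<^sup>-\<^sup>1 P\<close> is the graph of a
  symmetric map from the span of \<open>e\<^sub>1, e\<^sub>2\<close> to the span of \<open>e\<^sub>3, e\<^sub>4\<close>.\<close>

definition Q3_param :: "complex^4^4 \<Rightarrow> complex^3 \<Rightarrow> (complex^4) set" where
  "Q3_param A m = act A (plane (axis 1 1 + m$1 *s axis 3 1 + m$2 *s axis 4 1)
                               (axis 2 1 + m$2 *s axis 3 1 + m$3 *s axis 4 1))"

definition Q3_coords ::
  "'a topology \<Rightarrow> 'a chart set \<Rightarrow> 'a set \<Rightarrow> ('a \<Rightarrow> (complex^4) set) \<Rightarrow>
     complex^4^4 \<Rightarrow> ('a \<Rightarrow> complex^3) \<Rightarrow> bool" where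
  "Q3_coords X \<A> W f A m \<longleftrightarrow>
     openin X W \<and> A \<in> Sp \<and> holo_vec \<A> W m \<and> (\<forall>q\<in>W. f q = Q3_param A (m q))"

definition holo_Q3 ::
  "'a topology \<Rightarrow> 'a chart set \<Rightarrow> 'a set \<Rightarrow> ('a \<Rightarrow> (complex^4) set) \<Rightarrow> bool" where
  "holo_Q3 X \<A> U f \<longleftrightarrow>
     f ` U \<subseteq> Q3 \<and> (\<forall>p\<in>U. \<exists>W A m. p \<in> W \<and> W \<subseteq> U \<and> Q3_coords X \<A> W f A m)"

definition crit_Q3 ::
  "'a topology \<Rightarrow> 'a chart set \<Rightarrow> 'a set \<Rightarrow> ('a \<Rightarrow> (complex^4) set) \<Rightarrow> 'a set" where
  "crit_Q3 X \<A> U f =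
     {p\<in>U. \<exists>W A m. \<exists>c\<in>\<A>. p \<in> W \<and> W \<subseteq> U \<and> p \<in> fst c \<and> Q3_coords X \<A> W f A m \<and>
             (\<forall>i. chart_deriv c 1 (\<lambda>q. m q $ i) p = 0)}"

definition analytic_contact ::
  "'a topology \<Rightarrow> 'a chart set \<Rightarrow> nat \<Rightarrow> 'a \<Rightarrow>
     ('a \<Rightarrow> (complex^4) set) \<Rightarrow> ('a \<Rightarrow> (complex^4) set) \<Rightarrow> bool" where
  "analytic_contact X \<A> k p f g \<longleftrightarrow>
     (\<exists>W A m n. \<exists>c\<in>\<A>. p \<in> W \<and> p \<in> fst c \<and>
        Q3_coords X \<A> W f A m \<and> Q3_coords X \<A> W g A n \<and>
        (\<forall>j\<le>k. \<forall>i. chart_deriv c j (\<lambda>q. m q $ i) p = chart_deriv c j (\<lambda>q. n q $ i) p))"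


section \<open>Holomorphic maps into projective 3-space\<close>

text \<open>Points of projective space are lines in \<open>complex^4\<close>; the charts are the standard affine
  ones, a line being represented by its vector with \<open>i\<close>-th component 1.\<close>

definition CP3_coords ::
  "'a topology \<Rightarrow> 'a chart set \<Rightarrow> 'a set \<Rightarrow> ('a \<Rightarrow> (complex^4) set) \<Rightarrow>
     4 \<Rightarrow> ('a \<Rightarrow> complex^4) \<Rightarrow> bool" where
  "CP3_coords X \<A> W g i v \<longleftrightarrow>
     openin X W \<and> holo_vec \<A> W v \<and> (\<forall>q\<in>W. v q $ i = 1 \<and> g q = vec.span {v q})"

definition holo_CP3 ::
  "'a topology \<Rightarrow> 'a chart set \<Rightarrow> 'a set \<Rightarrow> ('a \<Rightarrow> (complex^4) set) \<Rightarrow> bool" where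
  "holo_CP3 X \<A> U g \<longleftrightarrow> (\<forall>p\<in>U. \<exists>W i v. p \<in> W \<and> W \<subseteq> U \<and> CP3_coords X \<A> W g i v)"

definition crit_CP3 ::
  "'a topology \<Rightarrow> 'a chart set \<Rightarrow> 'a set \<Rightarrow> ('a \<Rightarrow> (complex^4) set) \<Rightarrow> 'a set" where
  "crit_CP3 X \<A> U g =
     {p\<in>U. \<exists>W i v. \<exists>c\<in>\<A>. p \<in> W \<and> W \<subseteq> U \<and> p \<in> fst c \<and> CP3_coords X \<A> W g i v \<and>
             (\<forall>j. chart_deriv c 1 (\<lambda>q. v q $ j) p = 0)}"


section \<open>Isotropic curves\<close>

text \<open>\<open>lift X \<A> W f A\<close>: a holomorphic local section along \<open>f\<close> of the bundle
  \<open>Sp \<rightarrow> Q3\<close>, sending \<open>A\<close> to the plane spanned by its first two columns.\<close>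

definition lift ::
  "'a topology \<Rightarrow> 'a chart set \<Rightarrow> 'a set \<Rightarrow> ('a \<Rightarrow> (complex^4) set) \<Rightarrow>
     ('a \<Rightarrow> complex^4^4) \<Rightarrow> bool" where
  "lift X \<A> W f A \<longleftrightarrow>
     openin X W \<and> holo_mat \<A> W A \<and>
     (\<forall>q\<in>W. A q \<in> Sp \<and> f q = plane (column 1 (A q)) (column 2 (A q)))"

text \<open>The pullback \<open>A\<^sup>-\<^sup>1 dA\<close> of the Maurer-Cartan form equals \<open>mc c A p dz\<close> in the chart \<open>c\<close>
  with coordinate \<open>z\<close>; the entry in row \<open>i\<close> and column \<open>j\<close> is \<open>mc c A p $ i $ j\<close>.\<close>

definition mc :: "'a chart \<Rightarrow> ('a \<Rightarrow> complex^4^4) \<Rightarrow> 'a \<Rightarrow> complex^4^4" where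
  "mc c A p = matrix_inv (A p) ** mat_deriv c A p"

definition null_curve ::
  "'a topology \<Rightarrow> 'a chart set \<Rightarrow> 'a set \<Rightarrow> ('a \<Rightarrow> (complex^4) set) \<Rightarrow> bool" where
  "null_curve X \<A> U f \<longleftrightarrow>
     (\<forall>W A. W \<subseteq> U \<and> lift X \<A> W f A \<longrightarrow>
        (\<forall>c\<in>\<A>. \<forall>p\<in>W \<inter> fst c.
           mc c A p $ 3 $ 1 * mc c A p $ 4 $ 2 - (mc c A p $ 4 $ 1)\<^sup>2 = 0))"

definition null_ray :: "complex^4 \<Rightarrow> (complex^4) set set" where
  "null_ray \<xi> = {P\<in>Q3. vec.span {\<xi>} \<subseteq> P}"

definition isotropic_curve ::
  "'a topology \<Rightarrow> 'a chart set \<Rightarrow> 'a set \<Rightarrow> ('a \<Rightarrow> (complex^4) set) \<Rightarrow> bool" where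
  "isotropic_curve X \<A> U f \<longleftrightarrow>
     openin X U \<and> connectedin X U \<and> holo_Q3 X \<A> U f \<and>
     (\<exists>p\<in>U. \<exists>q\<in>U. f p \<noteq> f q) \<and>
     null_curve X \<A> U f \<and>
     (\<forall>\<xi>. \<xi> \<noteq> 0 \<longrightarrow> \<not> f ` U \<subseteq> null_ray \<xi>)"

text \<open>A local frame \<open>(u\<^sub>1, u\<^sub>2)\<close> is stored as a 2 x 4 matrix with rows \<open>u q $ 1\<close>, \<open>u q $ 2\<close>.\<close>

definition mdot :: "'a chart \<Rightarrow> ('a \<Rightarrow> complex^4^2) \<Rightarrow> 'a \<Rightarrow> complex^2^2" where
  "mdot c u q = (\<chi> i j. sympl (u q $ i) (mat_deriv c u q $ j))"

definition is_legendre_associate ::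
  "'a topology \<Rightarrow> 'a chart set \<Rightarrow> 'a set \<Rightarrow> ('a \<Rightarrow> (complex^4) set) \<Rightarrow>
     ('a \<Rightarrow> (complex^4) set) \<Rightarrow> bool" where
  "is_legendre_associate X \<A> U f g \<longleftrightarrow>
     holo_CP3 X \<A> U g \<and>
     (\<forall>W u. \<forall>c\<in>\<A>. openin X W \<and> W \<subseteq> U \<inter> fst c \<and> holo_mat \<A> W u \<and>
          (\<forall>q\<in>W. f q = plane (u q $ 1) (u q $ 2)) \<longrightarrow>
        (\<forall>q\<in>W. mdot c u q \<noteq> 0 \<longrightarrow>
           (\<forall>x. x \<noteq> 0 \<and> mdot c u q *v x = 0 \<longrightarrow>
              g q = vec.span {x$1 *s (u q $ 1) + x$2 *s (u q $ 2)})))"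

text \<open>For an isotropic curve the Legendre associate is unique on \<open>U\<close>; only its (irrelevant) values
  outside \<open>U\<close> are left to the choice operator.\<close>

definition legendre_associate ::
  "'a topology \<Rightarrow> 'a chart set \<Rightarrow> 'a set \<Rightarrow> ('a \<Rightarrow> (complex^4) set) \<Rightarrow>
     'a \<Rightarrow> (complex^4) set" where
  "legendre_associate X \<A> U f = (SOME g. is_legendre_associate X \<A> U f g)"

definition S_star ::
  "'a topology \<Rightarrow> 'a chart set \<Rightarrow> 'a set \<Rightarrow> ('a \<Rightarrow> (complex^4) set) \<Rightarrow> 'a set" where
  "S_star X \<A> U f =
     U - (crit_Q3 X \<A> U f \<union> crit_CP3 X \<A> U (legendre_associate X \<A> U f))"


section \<open>The structure group and the quartic differential\<close>

text \<open>The symmetric cube of \<open>complex^2\<close> is \<open>complex^4\<close>, by coordinates with respect to the basis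
  \<open>a\<^sub>1\<^sup>3, a\<^sub>1\<^sup>2 a\<^sub>2, a\<^sub>1 a\<^sub>2\<^sup>2, a\<^sub>2\<^sup>3\<close>; \<open>sym3 x y z\<close> is the symmetric product of \<open>x, y, z\<close>.\<close>

definition sym3 :: "complex^2 \<Rightarrow> complex^2 \<Rightarrow> complex^2 \<Rightarrow> complex^4" where
  "sym3 x y z =
     (x$1 * y$1 * z$1) *s axis 1 1 +
     (x$1 * y$1 * z$2 + x$1 * y$2 * z$1 + x$2 * y$1 * z$1) *s axis 2 1 +
     (x$1 * y$2 * z$2 + x$2 * y$1 * z$2 + x$2 * y$2 * z$1) *s axis 3 1 +
     (x$2 * y$2 * z$2) *s axis 4 1"

definition sym3_act :: "complex^2^2 \<Rightarrow> complex^4 \<Rightarrow> complex^4" where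
  "sym3_act g c =
     (let b1 = column 1 g; b2 = column 2 g in
        c$1 *s sym3 b1 b1 b1 + c$2 *s sym3 b1 b1 b2 + c$3 *s sym3 b1 b2 b2 + c$4 *s sym3 b2 b2 b2)"

definition F_iso :: "complex^4 \<Rightarrow> complex^4" where
  "F_iso c = c$1 *s axis 1 1 - (of_real (root 3 (2/9)) * c$2) *s axis 2 1
           + (of_real (root 3 (1/6)) * c$3) *s axis 4 1 + c$4 *s axis 3 1"

definition S_rep :: "complex^2^2 \<Rightarrow> complex^4^4" where
  "S_rep g = matrix (F_iso \<circ> sym3_act g \<circ> inv F_iso)"

definition SL2_1 :: "(complex^2^2) set" where
  "SL2_1 = {g. det g = 1 \<and> g$2$1 = 0}"

definition H1 :: "(complex^4^4) set" where
  "H1 = S_rep ` SL2_1"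

definition normalized_form :: "complex^4^4 \<Rightarrow> bool" where
  "normalized_form \<phi> \<longleftrightarrow>
     \<phi>$3$1 = 0 \<and> \<phi>$4$1 = 0 \<and> \<phi>$2$1 - \<phi>$4$2 = 0 \<and> \<phi>$1$1 - 3 * \<phi>$2$2 = 0 \<and>
     4 * \<phi>$1$2 - 3 * \<phi>$2$4 = 0 \<and> \<phi>$1$4 = 0 \<and> \<phi>$4$2 \<noteq> 0"

text \<open>A reduction with group \<open>H1\<close>: locally \<open>F\<close> consists of the \<open>H1\<close>-orbits of a holomorphic section.
  A 1-form vanishes on \<open>F\<close> iff its pullback by every local holomorphic section vanishes, because
  vertical vectors are differences of vectors tangent to such sections; the (4,2) entry of the
  Maurer-Cartan form is semibasic, so its nonvanishing on \<open>F\<close> can be tested on sections as well.\<close>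

definition F_section ::
  "'a topology \<Rightarrow> 'a chart set \<Rightarrow> ('a \<times> (complex^4^4)) set \<Rightarrow> 'a set \<Rightarrow>
     ('a \<Rightarrow> complex^4^4) \<Rightarrow> bool" where
  "F_section X \<A> F W \<sigma> \<longleftrightarrow> openin X W \<and> holo_mat \<A> W \<sigma> \<and> (\<forall>q\<in>W. (q, \<sigma> q) \<in> F)"

definition is_reduction ::
  "'a topology \<Rightarrow> 'a chart set \<Rightarrow> 'a set \<Rightarrow> ('a \<Rightarrow> (complex^4) set) \<Rightarrow>
     ('a \<times> (complex^4^4)) set \<Rightarrow> bool" where
  "is_reduction X \<A> U f F \<longleftrightarrow>
     F \<subseteq> {(p, A). p \<in> S_star X \<A> U f \<and> A \<in> Sp \<and> f p = plane (column 1 A) (column 2 A)} \<and>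
     (\<forall>p\<in>S_star X \<A> U f. \<exists>W \<sigma>. p \<in> W \<and> F_section X \<A> F W \<sigma> \<and>
        (\<forall>q\<in>W. {B. (q, B) \<in> F} = (\<lambda>h. \<sigma> q ** h) ` H1)) \<and>
     (\<forall>W \<sigma>. F_section X \<A> F W \<sigma> \<longrightarrow>
        (\<forall>c\<in>\<A>. \<forall>q\<in>W \<inter> fst c. normalized_form (mc c \<sigma> q)))"

definition reduction ::
  "'a topology \<Rightarrow> 'a chart set \<Rightarrow> 'a set \<Rightarrow> ('a \<Rightarrow> (complex^4) set) \<Rightarrow>
     ('a \<times> (complex^4^4)) set" where
  "reduction X \<A> U f = (THE F. is_reduction X \<A> U f F)"

text \<open>The coefficient of \<open>dz\<^sup>4\<close> in the quartic differential, in the chart \<open>c\<close>.  It is specified on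
  \<open>S_star\<close>, the complement of a discrete set, and determines the meromorphic differential on \<open>U\<close>;
  its values off \<open>S_star\<close> are set to 0 and carry no information.\<close>

definition quartic_coeff ::
  "'a topology \<Rightarrow> 'a chart set \<Rightarrow> 'a set \<Rightarrow> ('a \<Rightarrow> (complex^4) set) \<Rightarrow>
     'a chart \<Rightarrow> 'a \<Rightarrow> complex" where
  "quartic_coeff X \<A> U f c p =
     (if p \<in> S_star X \<A> U f \<inter> fst c
      then THE d. \<exists>W \<sigma>. p \<in> W \<and> F_section X \<A> (reduction X \<A> U f) W \<sigma> \<and>
                    d = mc c \<sigma> p $ 1 $ 3 * (mc c \<sigma> p $ 4 $ 2) ^ 3
      else 0)"

text \<open>Zeros and poles are expressed by limits at the point, which depend only on punctured
  neighbourhoods, hence on the values on \<open>S_star\<close>.\<close>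

definition quartic_support ::
  "'a topology \<Rightarrow> 'a chart set \<Rightarrow> 'a set \<Rightarrow> ('a \<Rightarrow> (complex^4) set) \<Rightarrow> 'a set" where
  "quartic_support X \<A> U f =
     {p\<in>U. \<exists>c\<in>\<A>. p \<in> fst c \<and>
        (let d = coord_expr c (quartic_coeff X \<A> U f c)
         in (d \<longlongrightarrow> 0) (at (snd c p)) \<or> is_pole d (snd c p))}"

definition general_type ::
  "'a topology \<Rightarrow> 'a chart set \<Rightarrow> 'a set \<Rightarrow> ('a \<Rightarrow> (complex^4) set) \<Rightarrow> bool" where
  "general_type X \<A> U f \<longleftrightarrow>
     isotropic_curve X \<A> U f \<and>
     (\<exists>p\<in>S_star X \<A> U f. \<exists>c\<in>\<A>. p \<in> fst c \<and> quartic_coeff X \<A> U f c p \<noteq> 0)"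


section \<open>Deformations\<close>

definition conformal_deformation ::
  "'a topology \<Rightarrow> 'a chart set \<Rightarrow> 'a set \<Rightarrow> nat \<Rightarrow>
     ('a \<Rightarrow> (complex^4) set) \<Rightarrow> ('a \<Rightarrow> (complex^4) set) \<Rightarrow> bool" where
  "conformal_deformation X \<A> U k f g \<longleftrightarrow>
     (\<exists>D. holo_mat \<A> U D \<and> (\<forall>p\<in>U. D p \<in> Sp) \<and>
        (\<forall>p\<in>U. analytic_contact X \<A> k p g (\<lambda>q. act (D p) (f q))))"

definition congruent_on ::
  "'a set \<Rightarrow> ('a \<Rightarrow> (complex^4) set) \<Rightarrow> ('a \<Rightarrow> (complex^4) set) \<Rightarrow> bool" where
  "congruent_on U f g \<longleftrightarrow> (\<exists>B\<in>Sp. \<forall>q\<in>U. g q = act B (f q))"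

definition deformable ::
  "'a topology \<Rightarrow> 'a chart set \<Rightarrow> nat \<Rightarrow> ('a \<Rightarrow> (complex^4) set) \<Rightarrow> bool" where
  "deformable X \<A> k f \<longleftrightarrow>
     (let S = topspace X in
      \<forall>p0 \<in> S - (crit_Q3 X \<A> S f \<union> crit_CP3 X \<A> S (legendre_associate X \<A> S f)
                 \<union> quartic_support X \<A> S f).
        \<exists>U g. openin X U \<and> p0 \<in> U \<and> general_type X \<A> U g \<and>
              conformal_deformation X \<A> U k f g \<and> \<not> congruent_on U f g)"

definition rigid ::
  "'a topology \<Rightarrow> 'a chart set \<Rightarrow> nat \<Rightarrow> ('a \<Rightarrow> (complex^4) set) \<Rightarrow> bool" where
  "rigid X \<A> k f \<longleftrightarrow> \<not> deformable X \<A> k f"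

end

theory Submission
  imports Defs
begin

text \<open>Put \<open>\<Omega> = D\<^sup>-\<^sup>1 D'\<close> for \<open>D : S \<Rightarrow> Sp(2,C)\<close>. Near a point of \<open>S_star\<close> the curve \<open>f\<close> is spanned by \<open>v, v'\<close>
  with \<open>v\<close> a Legendrian lift, \<open>\<omega>(v, v') = 0\<close> and \<open>\<omega>(v', v'') = 1\<close>. Contact of order \<open>k\<close> between \<open>g = D f\<close>
  and \<open>D(p) f\<close> at every \<open>p\<close> means that, for every \<open>p\<close>, the quadratic form \<open>\<omega>(\<Omega>(p) x, x)\<close> vanishes
  to order \<open>k\<close> at \<open>p\<close> along the planes of \<open>f\<close>. For \<open>k = 5\<close> this forces \<open>\<Omega> = 0\<close>, so \<open>D\<close> is constant;
  by analytic continuation the deformation is trivial. For \<open>k = 4\<close> the form may be a multiple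
  of \<open>\<omega>(x, v)\<^sup>2\<close>. Solving \<open>D' = D \<Omega>\<close> for the form \<open>t \<omega>(x, v)\<^sup>2\<close> with constant \<open>t \<noteq> 0\<close> carries a normalized
  frame of \<open>f\<close> to one of \<open>D f\<close> and changes \<open>\<phi>\<^sup>1\<^sub>3\<close> by \<open>- t\<close>; thus \<open>\<delta>\<close> changes, \<open>D f\<close> is not congruent to \<open>f\<close>,
  and \<open>t\<close> can be chosen such that the new \<open>\<delta>\<close> is not zero. The normalized frames are explicit
  in \<open>v\<close> and its derivatives, and two of them differ by an \<open>H1\<close>-valued map.\<close>

text \<open>Contact turns into vanishing of pairings because two Lagrangian planes in one big cell
  differ by a symmetric matrix, and the values of \<open>sympl\<close> between spanning vectors of
  the two depend linearly and invertibly on it. The threshold between four and five comes from the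
  jets of \<open>v\<close>: on derivatives of \<open>v\<close> up to the third, the quadratic form
  keeps fewer orders the higher the derivatives are, and the slowest entry, that of the third
  derivative with itself, keeps order \<open>k - 4\<close>. Order four thus leaves just this entry
  free, and \<open>t \<omega>(x, v)\<^sup>2\<close> is a form with no other entry. A second burden
  is that the Legendre associate and the reduction are named by choice and description operators:
  nothing is known about \<open>\<delta>\<close> until both are shown to exist and the reduction to
  be unique. The obstacle there is that the Legendre associate must also be found at critical points
  of \<open>f\<close>, where the kernel that defines it is the whole plane; dividing the derivative
  of \<open>f\<close> by its common zero restores a line.\<close>

section \<open>Symplectic matrices, Lagrangian planes and big cells\<close>

lemma sympl_linear:
  "sympl (x + y) z = sympl x z + sympl y z" "sympl z (x + y) = sympl z x + sympl z y"
  "sympl (x - y) z = sympl x z - sympl y z" "sympl z (x - y) = sympl z x - sympl z y"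
  "sympl (c *s x) z = c * sympl x z" "sympl z (c *s x) = c * sympl z x"
  "sympl (- x) z = - sympl x z" "sympl z (- x) = - sympl z x"
  "sympl 0 z = 0" "sympl z 0 = 0"
  by (simp_all add: sympl_def algebra_simps)

lemma sympl_self [simp]: "sympl x x = 0"
  by (simp add: sympl_def)

lemma sympl_swap: "sympl y x = - sympl x y"
  by (simp add: sympl_def)

lemma mat_vec_4: "(A::complex^4^'n) *v x =
    x$1 *s column 1 A + x$2 *s column 2 A + x$3 *s column 3 A + x$4 *s column 4 A"
  by (simp add: vec_eq_iff matrix_vector_mult_def sum_4 column_def algebra_simps)

lemma mat_vec_axis: "(A::complex^4^'n) *v axis k 1 = column k A"
  by (simp add: vec_eq_iff matrix_vector_mult_def column_def axis_def if_distrib cong: if_cong)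

lemma column_mult: "column k ((A::complex^'m^'n) ** B) = A *v column k B"
  by (simp add: vec_eq_iff column_def matrix_matrix_mult_def matrix_vector_mult_def)

lemma Sp_columns:
  assumes "A \<in> Sp"
  shows "sympl (column 1 A) (column 2 A) = 0" "sympl (column 1 A) (column 3 A) = 1"
    "sympl (column 1 A) (column 4 A) = 0" "sympl (column 2 A) (column 3 A) = 0"
    "sympl (column 2 A) (column 4 A) = 1" "sympl (column 3 A) (column 4 A) = 0"
proof -
  have "sympl (column i A) (column j A) = sympl (axis i 1) (axis j 1)" for i j
    using assms unfolding Sp_def by (simp flip: mat_vec_axis)
  then show "sympl (column 1 A) (column 2 A) = 0" "sympl (column 1 A) (column 3 A) = 1"
    "sympl (column 1 A) (column 4 A) = 0" "sympl (column 2 A) (column 3 A) = 0"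
    "sympl (column 2 A) (column 4 A) = 1" "sympl (column 3 A) (column 4 A) = 0"
    by (simp_all add: sympl_def axis_def)
qed

text \<open>The inverse of a symplectic matrix, expressed by pairings of its columns. Being
  polynomial in the entries, it is holomorphic along with \<open>A\<close> and makes sense for
  arbitrary matrices, which \<open>linear_ode_symplectic\<close> exploits.\<close>

definition Sp_inv :: "complex^4^4 \<Rightarrow> complex^4^4" where
  "Sp_inv A = (\<chi> i j.
     if i = 1 then sympl (axis j 1) (column 3 A)
     else if i = 2 then sympl (axis j 1) (column 4 A)
     else if i = 3 then sympl (column 1 A) (axis j 1)
     else sympl (column 2 A) (axis j 1))"

lemma Sp_inv_vec:
  "(Sp_inv A *v y) $ 1 = sympl y (column 3 A)" "(Sp_inv A *v y) $ 2 = sympl y (column 4 A)"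
  "(Sp_inv A *v y) $ 3 = sympl (column 1 A) y" "(Sp_inv A *v y) $ 4 = sympl (column 2 A) y"
  by (simp_all add: Sp_inv_def matrix_vector_mult_def sum_4 sympl_def axis_def algebra_simps)

lemma mat_eq_columns: "(A::complex^4^'n) = B \<longleftrightarrow> (\<forall>k. column k A = column k B)"
  by (auto simp: vec_eq_iff column_def)

lemma column_mat1: "column k (mat 1 :: complex^4^4) = axis k 1"
  by (simp add: vec_eq_iff column_def mat_def axis_def eq_commute)

lemma Sp_inv_left_columns:
  assumes "sympl (column 1 A) (column 2 A) = 0" "sympl (column 1 A) (column 3 A) = 1"
    "sympl (column 1 A) (column 4 A) = 0" "sympl (column 2 A) (column 3 A) = 0"
    "sympl (column 2 A) (column 4 A) = 1" "sympl (column 3 A) (column 4 A) = 0"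
  shows "Sp_inv A ** A = mat 1"
proof -
  have "sympl (column 4 A) (column 3 A) = 0" "sympl (column 2 A) (column 1 A) = 0"
    using assms sympl_swap[of "column 4 A" "column 3 A"] sympl_swap[of "column 2 A" "column 1 A"]
    by auto
  then show ?thesis
    by (simp add: mat_eq_columns column_mult column_mat1 forall_4 vec_eq_iff[where 'b=4]
        Sp_inv_vec assms) (simp add: axis_def)
qed

lemma SpI:
  assumes "sympl (column 1 A) (column 2 A) = 0" "sympl (column 1 A) (column 3 A) = 1"
    "sympl (column 1 A) (column 4 A) = 0" "sympl (column 2 A) (column 3 A) = 0"
    "sympl (column 2 A) (column 4 A) = 1" "sympl (column 3 A) (column 4 A) = 0"
  shows "A \<in> Sp"
proof -
  have "sympl (column 2 A) (column 1 A) = 0" "sympl (column 3 A) (column 1 A) = -1"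
    "sympl (column 4 A) (column 1 A) = 0" "sympl (column 3 A) (column 2 A) = 0"
    "sympl (column 4 A) (column 2 A) = -1" "sympl (column 4 A) (column 3 A) = 0"
    using assms by (metis sympl_swap minus_zero)+
  then have "sympl (A *v x) (A *v y) = sympl x y" for x y
    unfolding mat_vec_4[of A] by (simp add: sympl_linear assms) (simp add: sympl_def)
  moreover have "invertible A"
    using Sp_inv_left_columns[OF assms] invertible_left_inverse by blast
  ultimately show ?thesis by (simp add: Sp_def)
qed

lemma sympl_Sp: "A \<in> Sp \<Longrightarrow> sympl (A *v x) (A *v y) = sympl x y"
  by (simp add: Sp_def)

lemma Sp_inv_left: "A \<in> Sp \<Longrightarrow> Sp_inv A ** A = mat 1"
  by (rule Sp_inv_left_columns) (simp_all add: Sp_columns)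

lemma Sp_inv_right: "A \<in> Sp \<Longrightarrow> A ** Sp_inv A = mat 1"
  using Sp_inv_left matrix_left_right_inverse by blast

lemma matrix_inv_Sp: "A \<in> Sp \<Longrightarrow> matrix_inv A = Sp_inv A"
proof -
  assume A: "A \<in> Sp"
  then have "invertible A" by (simp add: Sp_def)
  then have "matrix_inv A ** A = mat 1" unfolding matrix_inv_def invertible_def by (rule someI2_ex) blast
  then have "matrix_inv A ** (A ** Sp_inv A) = Sp_inv A"
    by (simp add: matrix_mul_assoc)
  then show ?thesis using Sp_inv_right[OF A] by simp
qed

lemma Sp_inv_vec_cancel: "A \<in> Sp \<Longrightarrow> Sp_inv A *v (A *v x) = x" "A \<in> Sp \<Longrightarrow> A *v (Sp_inv A *v x) = x"
  by (simp_all add: matrix_vector_mul_assoc Sp_inv_left Sp_inv_right)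

lemma Sp_mult: "A \<in> Sp \<Longrightarrow> B \<in> Sp \<Longrightarrow> A ** B \<in> Sp"
  by (simp add: Sp_def invertible_mult flip: matrix_vector_mul_assoc)

lemma Sp_mat1 [simp]: "mat 1 \<in> Sp"
  by (rule SpI) (simp_all add: column_mat1 sympl_def axis_def)

lemma Sp_Sp_inv: "A \<in> Sp \<Longrightarrow> Sp_inv A \<in> Sp"
proof -
  assume A: "A \<in> Sp"
  have "sympl (Sp_inv A *v x) (Sp_inv A *v y) = sympl x y" for x y
    using sympl_Sp[OF A, of "Sp_inv A *v x" "Sp_inv A *v y"] by (simp add: Sp_inv_vec_cancel A)
  moreover have "invertible (Sp_inv A)"
    using Sp_inv_right[OF A] invertible_left_inverse by blast
  ultimately show ?thesis by (simp add: Sp_def)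
qed

lemma Sp_inv_mult: "A \<in> Sp \<Longrightarrow> B \<in> Sp \<Longrightarrow> Sp_inv (A ** B) = Sp_inv B ** Sp_inv A"
proof -
  assume A: "A \<in> Sp" and B: "B \<in> Sp"
  have "Sp_inv B ** Sp_inv A = (Sp_inv (A ** B) ** (A ** B)) ** (Sp_inv B ** Sp_inv A)"
    by (simp add: Sp_inv_left Sp_mult A B)
  also have "\<dots> = Sp_inv (A ** B) ** A ** (B ** Sp_inv B) ** Sp_inv A"
    by (simp add: matrix_mul_assoc)
  also have "\<dots> = Sp_inv (A ** B) ** (A ** Sp_inv A)"
    by (simp add: Sp_inv_right B flip: matrix_mul_assoc)
  finally show ?thesis by (simp add: Sp_inv_right A)
qed

lemma plane_mem: "v \<in> plane x y \<longleftrightarrow> (\<exists>a b. v = a *s x + b *s y)"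
  unfolding plane_def by (auto simp: vec.span_insert vec.span_empty) (metis add_diff_cancel_left' diff_add_cancel)+

lemma plane_image: "act A (plane x y) = plane (A *v x) (A *v y)"
proof -
  have "A *v (a *s x + b *s y) = a *s (A *v x) + b *s (A *v y)" for a b
    by (simp add: matrix_vector_right_distrib vector_scalar_commute)
  then show ?thesis
    unfolding act_def set_eq_iff image_iff Bex_def plane_mem by metis
qed

lemma act_mat1 [simp]: "act (mat 1) P = P"
  by (simp add: act_def)

lemma act_mem: "A \<in> Sp \<Longrightarrow> v \<in> act A P \<longleftrightarrow> Sp_inv A *v v \<in> P"
  unfolding act_def by (metis (no_types, lifting) Sp_inv_vec_cancel image_iff)

text \<open>A Lagrangian plane is its own symplectic complement. Membership in \<open>f q\<close>
  thereby becomes two equations that can be differentiated.\<close>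

lemma lagrangian_plane_mem:
  assumes "A \<in> Sp"
  shows "v \<in> plane (column 1 A) (column 2 A) \<longleftrightarrow>
    sympl (column 1 A) v = 0 \<and> sympl (column 2 A) v = 0"
proof
  assume "v \<in> plane (column 1 A) (column 2 A)"
  then show "sympl (column 1 A) v = 0 \<and> sympl (column 2 A) v = 0"
    using Sp_columns(1)[OF assms] sympl_swap[of "column 2 A" "column 1 A"]
    by (auto simp: plane_mem sympl_linear)
next
  assume *: "sympl (column 1 A) v = 0 \<and> sympl (column 2 A) v = 0"
  have "v = A *v (Sp_inv A *v v)" by (simp add: Sp_inv_vec_cancel assms)
  also have "\<dots> = sympl v (column 3 A) *s column 1 A + sympl v (column 4 A) *s column 2 A"
    by (subst mat_vec_4) (simp add: Sp_inv_vec *)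
  finally show "v \<in> plane (column 1 A) (column 2 A)" by (auto simp: plane_mem)
qed

lemma Sp_expand:
  assumes "A \<in> Sp"
  shows "v = sympl v (column 3 A) *s column 1 A + sympl v (column 4 A) *s column 2 A
    + sympl (column 1 A) v *s column 3 A + sympl (column 2 A) v *s column 4 A"
  by (subst Sp_inv_vec_cancel(2)[OF assms, of v, symmetric], subst mat_vec_4) (simp add: Sp_inv_vec)

lemma plane_Sp_in_Q3:
  assumes "A \<in> Sp"
  shows "plane (column 1 A) (column 2 A) \<in> Q3"
proof -
  let ?x = "column 1 A" and ?y = "column 2 A"
  note c = Sp_columns[OF assms]
  have ne: "?x \<noteq> ?y" using c by (metis sympl_linear(9) zero_neq_one)
  have "vec.independent {?x, ?y}"
  proof -
    have "?y \<noteq> 0" using c by (metis sympl_linear(9) zero_neq_one)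
    moreover have "?x \<notin> vec.span {?y}"
    proof
      assume "?x \<in> vec.span {?y}"
      then obtain k where "?x = k *s ?y" by (auto simp: vec.span_singleton)
      then have "sympl ?x (column 3 A) = 0" by (simp add: sympl_linear c)
      then show False using c by simp
    qed
    ultimately show ?thesis using ne by (simp add: vec.independent_insert)
  qed
  then have "vec.dim (plane ?x ?y) = 2"
    unfolding plane_def by (simp add: ne vec.dim_eq_card_independent)
  moreover have "sympl u v = 0" if "u \<in> plane ?x ?y" "v \<in> plane ?x ?y" for u v
    using that c sympl_swap[of ?y ?x] by (auto simp: plane_mem sympl_linear)
  ultimately show ?thesis by (simp add: Q3_def plane_def vec.subspace_span)
qed

lemma Q3_param_mem:
  assumes "A \<in> Sp"
  shows "v \<in> Q3_param A m \<longleftrightarrow>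
    (let y = Sp_inv A *v v in y$3 = m$1 * y$1 + m$2 * y$2 \<and> y$4 = m$2 * y$1 + m$3 * y$2)"
proof -
  have "(y \<in> plane (axis 1 1 + m$1 *s axis 3 1 + m$2 *s axis 4 1)
                               (axis 2 1 + m$2 *s axis 3 1 + m$3 *s axis 4 1)) \<longleftrightarrow>
    y$3 = m$1 * y$1 + m$2 * y$2 \<and> y$4 = m$2 * y$1 + m$3 * y$2" for y
  proof
    assume *: "y$3 = m$1 * y$1 + m$2 * y$2 \<and> y$4 = m$2 * y$1 + m$3 * y$2"
    have "y = y$1 *s (axis 1 1 + m$1 *s axis 3 1 + m$2 *s axis 4 1)
             + y$2 *s (axis 2 1 + m$2 *s axis 3 1 + m$3 *s axis 4 1)"
      by (simp add: vec_eq_iff[where 'b=4] forall_4 axis_def * algebra_simps)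
    then show "y \<in> plane (axis 1 1 + m$1 *s axis 3 1 + m$2 *s axis 4 1)
                               (axis 2 1 + m$2 *s axis 3 1 + m$3 *s axis 4 1)"
      unfolding plane_mem by blast
  qed (auto simp: plane_mem axis_def)
  then show ?thesis by (simp add: Q3_param_def act_mem assms Let_def)
qed

text \<open>The lower unipotent symplectic matrix with symmetric block \<open>m\<close>. It carries
  the span of the first two basis vectors to the graph of \<open>m\<close>, so
  \<open>A ** cell m\<close> is a holomorphic section of \<open>Sp\<close> over the big cell of
  \<open>A\<close>.\<close>

definition cell :: "complex^3 \<Rightarrow> complex^4^4" where
  "cell m = (\<chi> i j. if i = j then 1 else
     if i = 3 \<and> j = 1 then m$1 else if i = 3 \<and> j = 2 \<or> i = 4 \<and> j = 1 then m$2 else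
     if i = 4 \<and> j = 2 then m$3 else 0)"

lemma column_cell:
  "column 1 (cell m) = axis 1 1 + m$1 *s axis 3 1 + m$2 *s axis 4 1"
  "column 2 (cell m) = axis 2 1 + m$2 *s axis 3 1 + m$3 *s axis 4 1"
  "column 3 (cell m) = axis 3 1" "column 4 (cell m) = axis 4 1"
  by (auto simp: vec_eq_iff forall_4 column_def cell_def axis_def)

lemma cell_Sp: "cell m \<in> Sp"
  by (rule SpI) (simp_all add: column_cell sympl_def axis_def)

lemma Q3_param_cell:
  "Q3_param A m = plane (column 1 (A ** cell m)) (column 2 (A ** cell m))"
  by (simp add: Q3_param_def plane_image column_mult column_cell)

lemma Q3_param_inj:
  assumes "A \<in> Sp" "Q3_param A m = Q3_param A n"
  shows "m = n"
proof -
  have "A *v column 1 (cell m) \<in> Q3_param A n" "A *v column 2 (cell m) \<in> Q3_param A n"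
    unfolding assms(2)[symmetric] by (simp_all add: Q3_param_mem assms(1) Sp_inv_vec_cancel column_cell Let_def axis_def)
  then show ?thesis
    by (simp add: Q3_param_mem assms(1) Sp_inv_vec_cancel column_cell Let_def axis_def vec_eq_iff forall_3)
qed

section \<open>Entrywise calculus of holomorphic vectors and matrices on plane domains\<close>

text \<open>An identity on an open set may be differentiated; the structure equations below arise in
  this way.\<close>

lemma DERIV_eq_on_open:
  assumes "open D" "z \<in> D" "\<And>w. w \<in> D \<Longrightarrow> f w = g w"
    and "(f has_field_derivative a) (at z)" "(g has_field_derivative b) (at z)"
  shows "a = (b::complex)"
proof -
  have "(g has_field_derivative a) (at z)"
    using has_field_derivative_transform_within_open[OF assms(4,1,2)] assms(3) by blast
  then show ?thesis using assms(5) DERIV_unique by blast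
qed

definition vhol :: "complex set \<Rightarrow> (complex \<Rightarrow> complex^'n) \<Rightarrow> bool" where
  "vhol D v \<longleftrightarrow> (\<forall>i. (\<lambda>z. v z $ i) holomorphic_on D)"

definition vd :: "(complex \<Rightarrow> complex^'n) \<Rightarrow> complex \<Rightarrow> complex^'n" where
  "vd v z = (\<chi> i. deriv (\<lambda>w. v w $ i) z)"

definition mhol :: "complex set \<Rightarrow> (complex \<Rightarrow> complex^'n^'m) \<Rightarrow> bool" where
  "mhol D M \<longleftrightarrow> (\<forall>i j. (\<lambda>z. M z $ i $ j) holomorphic_on D)"

definition md :: "(complex \<Rightarrow> complex^'n^'m) \<Rightarrow> complex \<Rightarrow> complex^'n^'m" where
  "md M z = (\<chi> i j. deriv (\<lambda>w. M w $ i $ j) z)"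

lemma vhol_D: "vhol D v \<Longrightarrow> (\<lambda>z. v z $ i) holomorphic_on D"
  by (simp add: vhol_def)

lemma mhol_D: "mhol D v \<Longrightarrow> (\<lambda>z. v z $ i $ j) holomorphic_on D"
  by (simp add: mhol_def)

lemma vhol_subset: "vhol D v \<Longrightarrow> E \<subseteq> D \<Longrightarrow> vhol E v"
  unfolding vhol_def using holomorphic_on_subset by blast

lemma mhol_subset: "mhol D v \<Longrightarrow> E \<subseteq> D \<Longrightarrow> mhol E v"
  unfolding mhol_def using holomorphic_on_subset by blast

lemma vd_DERIV: "vhol D v \<Longrightarrow> open D \<Longrightarrow> z \<in> D \<Longrightarrow>
  ((\<lambda>w. v w $ i) has_field_derivative vd v z $ i) (at z)"
  by (auto simp: vd_def vhol_def intro: holomorphic_derivI)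

lemma md_DERIV: "mhol D v \<Longrightarrow> open D \<Longrightarrow> z \<in> D \<Longrightarrow>
  ((\<lambda>w. v w $ i $ j) has_field_derivative md v z $ i $ j) (at z)"
  by (auto simp: md_def mhol_def intro: holomorphic_derivI)

lemma vd_unique:
  assumes "\<And>i. ((\<lambda>w. v w $ i) has_field_derivative d $ i) (at z)" shows "vd v z = d"
  using assms by (simp add: vd_def vec_eq_iff DERIV_imp_deriv)

lemma md_unique:
  assumes "\<And>i j. ((\<lambda>w. v w $ i $ j) has_field_derivative d $ i $ j) (at z)" shows "md v z = d"
  using assms by (simp add: md_def vec_eq_iff DERIV_imp_deriv)

lemma vhol_vd: "vhol D v \<Longrightarrow> open D \<Longrightarrow> vhol D (vd v)"
  by (simp add: vhol_def vd_def holomorphic_deriv)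

lemma mhol_md: "mhol D v \<Longrightarrow> open D \<Longrightarrow> mhol D (md v)"
  by (simp add: mhol_def md_def holomorphic_deriv)

lemma vd_cong:
  assumes "open D" "z \<in> D" "\<And>w. w \<in> D \<Longrightarrow> v w = u w"
  shows "vd v z = vd u z"
proof -
  have "\<forall>\<^sub>F w in nhds z. v w = u w"
    using eventually_nhds_in_open[OF assms(1,2)] by (rule eventually_mono) (rule assms(3))
  then have "deriv (\<lambda>w. v w $ i) z = deriv (\<lambda>w. u w $ i) z" for i
    by (intro deriv_cong_ev) (auto elim: eventually_mono)
  then show ?thesis by (simp add: vd_def)
qed

lemma md_cong:
  assumes "open D" "z \<in> D" "\<And>w. w \<in> D \<Longrightarrow> v w = u w"
  shows "md v z = md u z"
proof -
  have "\<forall>\<^sub>F w in nhds z. v w = u w"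
    using eventually_nhds_in_open[OF assms(1,2)] by (rule eventually_mono) (rule assms(3))
  then have "deriv (\<lambda>w. v w $ i $ j) z = deriv (\<lambda>w. u w $ i $ j) z" for i j
    by (intro deriv_cong_ev) (auto elim: eventually_mono)
  then show ?thesis by (simp add: md_def)
qed

lemma vhol_cong: "vhol D u \<Longrightarrow> (\<And>w. w \<in> D \<Longrightarrow> v w = u w) \<Longrightarrow> vhol D v"
  unfolding vhol_def using holomorphic_transform[of "\<lambda>z. u z $ i" D "\<lambda>z. v z $ i" for i] by auto

lemma mhol_cong: "mhol D u \<Longrightarrow> (\<And>w. w \<in> D \<Longrightarrow> v w = u w) \<Longrightarrow> mhol D v"
  unfolding mhol_def using holomorphic_transform[of "\<lambda>z. u z $ i $ j" D "\<lambda>z. v z $ i $ j" for i j] by auto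

lemma vhol_const: "vhol D (\<lambda>z. c)" by (simp add: vhol_def)
lemma mhol_const: "mhol D (\<lambda>z. c)" by (simp add: mhol_def)

lemma vhol_add: "vhol D u \<Longrightarrow> vhol D v \<Longrightarrow> vhol D (\<lambda>z. u z + v z)"
  by (simp add: vhol_def holomorphic_on_add)
lemma vhol_diff: "vhol D u \<Longrightarrow> vhol D v \<Longrightarrow> vhol D (\<lambda>z. u z - v z)"
  by (simp add: vhol_def holomorphic_on_diff)
lemma vhol_scale: "f holomorphic_on D \<Longrightarrow> vhol D v \<Longrightarrow> vhol D (\<lambda>z. f z *s v z)"
  by (simp add: vhol_def holomorphic_on_mult)
lemma vhol_column: "mhol D M \<Longrightarrow> vhol D (\<lambda>z. column k (M z))"
  by (simp add: vhol_def mhol_def column_def)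
lemma vhol_matvec: "mhol D M \<Longrightarrow> vhol D v \<Longrightarrow> vhol D (\<lambda>z. M z *v v z)"
  by (simp add: vhol_def mhol_def matrix_vector_mult_def holomorphic_on_sum holomorphic_on_mult)
lemma mhol_mult: "mhol D M \<Longrightarrow> mhol D N \<Longrightarrow> mhol D (\<lambda>z. M z ** N z)"
  by (simp add: mhol_def matrix_matrix_mult_def holomorphic_on_sum holomorphic_on_mult)
lemma sympl_hol: "vhol D u \<Longrightarrow> vhol D v \<Longrightarrow> (\<lambda>z. sympl (u z) (v z)) holomorphic_on D"
  unfolding sympl_def vhol_def by (auto intro!: holomorphic_intros)

lemma mhol_columns: "(\<And>k. vhol D (\<lambda>z. column k (M z))) \<Longrightarrow> mhol D M"
  by (simp add: vhol_def mhol_def column_def)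

lemma mhol_Sp_inv:
  assumes "mhol D M" shows "mhol D (\<lambda>z. Sp_inv (M z))"
proof -
  have c: "vhol D (\<lambda>z. column k (M z))" for k using vhol_column[OF assms] .
  have "(\<lambda>z. Sp_inv (M z) $ i $ j) holomorphic_on D" for i j
    unfolding Sp_inv_def using sympl_hol[OF vhol_const c] sympl_hol[OF c vhol_const]
    by (cases "i = 1"; cases "i = 2"; cases "i = 3"; simp)
  then show ?thesis by (simp add: mhol_def)
qed

lemma vd_add:
  assumes "vhol D u" "vhol D v" "open D" "z \<in> D"
  shows "vd (\<lambda>z. u z + v z) z = vd u z + vd v z"
  using DERIV_add[OF vd_DERIV[OF assms(1,3,4)] vd_DERIV[OF assms(2,3,4)]]
  by (intro vd_unique) simp

lemma vd_diff:
  assumes "vhol D u" "vhol D v" "open D" "z \<in> D"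
  shows "vd (\<lambda>z. u z - v z) z = vd u z - vd v z"
  using DERIV_diff[OF vd_DERIV[OF assms(1,3,4)] vd_DERIV[OF assms(2,3,4)]]
  by (intro vd_unique) simp

lemma vd_scale:
  assumes "f holomorphic_on D" "vhol D v" "open D" "z \<in> D"
  shows "vd (\<lambda>z. f z *s v z) z = deriv f z *s v z + f z *s vd v z"
  using DERIV_mult[OF holomorphic_derivI[OF assms(1,3,4)] vd_DERIV[OF assms(2,3,4)]]
  by (intro vd_unique) (simp add: mult.commute)

lemma vd_column: "vd (\<lambda>z. column k (M z)) z = column k (md M z)"
  by (simp add: vd_def md_def column_def)

lemma vd_matvec:
  assumes "mhol D M" "vhol D v" "open D" "z \<in> D"
  shows "vd (\<lambda>z. M z *v v z) z = md M z *v v z + M z *v vd v z"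
proof (rule vd_unique)
  fix i
  have "((\<lambda>w. \<Sum>j\<in>UNIV. M w $ i $ j * v w $ j) has_field_derivative
      (\<Sum>j\<in>UNIV. md M z $ i $ j * v z $ j + vd v z $ j * M z $ i $ j)) (at z)"
    by (intro DERIV_sum DERIV_mult md_DERIV[OF assms(1,3,4)] vd_DERIV[OF assms(2,3,4)])
  then show "((\<lambda>w. (M w *v v w) $ i) has_field_derivative (md M z *v v z + M z *v vd v z) $ i) (at z)"
    by (simp add: matrix_vector_mult_def sum.distrib mult.commute)
qed

lemma md_mult:
  assumes "mhol D M" "mhol D N" "open D" "z \<in> D"
  shows "md (\<lambda>z. M z ** N z) z = md M z ** N z + M z ** md N z"
proof (rule md_unique)
  fix i k
  have "((\<lambda>w. \<Sum>j\<in>UNIV. M w $ i $ j * N w $ j $ k) has_field_derivative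
      (\<Sum>j\<in>UNIV. md M z $ i $ j * N z $ j $ k + md N z $ j $ k * M z $ i $ j)) (at z)"
    by (intro DERIV_sum DERIV_mult md_DERIV[OF assms(1,3,4)] md_DERIV[OF assms(2,3,4)])
  then show "((\<lambda>w. (M w ** N w) $ i $ k) has_field_derivative (md M z ** N z + M z ** md N z) $ i $ k) (at z)"
    by (simp add: matrix_matrix_mult_def sum.distrib mult.commute)
qed

lemma md_const: "md (\<lambda>z. c) z = 0"
  by (simp add: md_def vec_eq_iff)

lemma vd_const: "vd (\<lambda>z. c) z = 0"
  by (simp add: vd_def vec_eq_iff)

lemma sympl_DERIV:
  assumes "vhol D u" "vhol D v" "open D" "z \<in> D"
  shows "((\<lambda>z. sympl (u z) (v z)) has_field_derivative
    sympl (vd u z) (v z) + sympl (u z) (vd v z)) (at z)"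
proof -
  have m: "((\<lambda>z. u z $ i * v z $ j) has_field_derivative vd u z $ i * v z $ j + vd v z $ j * u z $ i) (at z)" for i j
    by (intro DERIV_mult vd_DERIV[OF assms(1,3,4)] vd_DERIV[OF assms(2,3,4)])
  show ?thesis unfolding sympl_def
    using DERIV_diff[OF DERIV_add[OF DERIV_diff[OF m[of 1 3] m[of 3 1]] m[of 2 4]] m[of 4 2]]
    by (simp add: algebra_simps)
qed

lemma sympl_const_vd:
  assumes "vhol D u" "vhol D v" "open D" "\<And>w. w \<in> D \<Longrightarrow> sympl (u w) (v w) = c" "z \<in> D"
  shows "sympl (vd u z) (v z) + sympl (u z) (vd v z) = 0"
  using DERIV_eq_on_open[OF assms(3,5,4) sympl_DERIV[OF assms(1,2,3,5)] DERIV_const] by simp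

section \<open>The Maurer-Cartan form\<close>

text \<open>The Maurer-Cartan form of a map on a plane domain. With \<open>Sp_inv\<close> in place
  of \<open>matrix_inv\<close> its entries are pairings of columns with derivatives of columns; on
  \<open>Sp\<close> the two inverses agree, which \<open>mc_pull\<close> uses.\<close>

definition mcP :: "(complex \<Rightarrow> complex^4^4) \<Rightarrow> complex \<Rightarrow> complex^4^4" where
  "mcP S z = Sp_inv (S z) ** md S z"

definition Sp_hol :: "complex set \<Rightarrow> (complex \<Rightarrow> complex^4^4) \<Rightarrow> bool" where
  "Sp_hol D S \<longleftrightarrow> open D \<and> mhol D S \<and> (\<forall>z\<in>D. S z \<in> Sp)"

lemma mcP_nth:
  "mcP S z $ 1 $ j = sympl (column j (md S z)) (column 3 (S z))"
  "mcP S z $ 2 $ j = sympl (column j (md S z)) (column 4 (S z))"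
  "mcP S z $ 3 $ j = sympl (column 1 (S z)) (column j (md S z))"
  "mcP S z $ 4 $ j = sympl (column 2 (S z)) (column j (md S z))"
proof -
  have "mcP S z $ i $ j = (Sp_inv (S z) *v column j (md S z)) $ i" for i
    unfolding mcP_def column_mult[symmetric] by (simp add: column_def)
  then show "mcP S z $ 1 $ j = sympl (column j (md S z)) (column 3 (S z))"
    "mcP S z $ 2 $ j = sympl (column j (md S z)) (column 4 (S z))"
    "mcP S z $ 3 $ j = sympl (column 1 (S z)) (column j (md S z))"
    "mcP S z $ 4 $ j = sympl (column 2 (S z)) (column j (md S z))"
    by (simp_all add: Sp_inv_vec)
qed

lemma md_mcP: "S z \<in> Sp \<Longrightarrow> md S z = S z ** mcP S z"
  by (simp add: mcP_def matrix_mul_assoc Sp_inv_right)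

text \<open>The form has values in the Lie algebra of \<open>Sp\<close>: each identity is a constant
  pairing of two columns, differentiated.\<close>

lemma mcP_sp:
  assumes "Sp_hol D S" "z \<in> D"
  shows "mcP S z $ 3 $ 3 = - mcP S z $ 1 $ 1" "mcP S z $ 3 $ 4 = - mcP S z $ 2 $ 1"
    "mcP S z $ 4 $ 3 = - mcP S z $ 1 $ 2" "mcP S z $ 4 $ 4 = - mcP S z $ 2 $ 2"
    "mcP S z $ 2 $ 3 = mcP S z $ 1 $ 4" "mcP S z $ 3 $ 2 = mcP S z $ 4 $ 1"
proof -
  have S: "open D" "mhol D S" "\<And>z. z \<in> D \<Longrightarrow> S z \<in> Sp" using assms by (auto simp: Sp_hol_def)
  note v = vhol_column[OF S(2)]
  note * = sympl_const_vd[OF v v S(1) _ assms(2), unfolded vd_column]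
  note c = Sp_columns[OF S(3)]
  show "mcP S z $ 3 $ 3 = - mcP S z $ 1 $ 1" "mcP S z $ 3 $ 4 = - mcP S z $ 2 $ 1"
    "mcP S z $ 4 $ 3 = - mcP S z $ 1 $ 2" "mcP S z $ 4 $ 4 = - mcP S z $ 2 $ 2"
    "mcP S z $ 2 $ 3 = mcP S z $ 1 $ 4" "mcP S z $ 3 $ 2 = mcP S z $ 4 $ 1"
    unfolding mcP_nth
    using *[OF c(1)] *[OF c(2)] *[OF c(3)] *[OF c(4)] *[OF c(5)] *[OF c(6)]
      sympl_swap[of "column 3 (S z)" "column 4 (md S z)"]
      sympl_swap[of "column 2 (S z)" "column 1 (md S z)"]
    by (auto simp: add_eq_0_iff)
qed

text \<open>The gauge rule for \<open>T = S X\<close>: differentiating this product gives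
  \<open>X' = X \<tau> - \<phi> X\<close>, where \<open>\<phi>\<close> and \<open>\<tau>\<close> are
  the forms of \<open>S\<close> and \<open>T\<close>.\<close>

lemma md_transition:
  assumes "Sp_hol D S" "Sp_hol D T" "z \<in> D"
  shows "md (\<lambda>z. Sp_inv (S z) ** T z) z =
    (Sp_inv (S z) ** T z) ** mcP T z - mcP S z ** (Sp_inv (S z) ** T z)"
proof -
  have S: "open D" "mhol D S" "\<And>z. z \<in> D \<Longrightarrow> S z \<in> Sp" using assms by (auto simp: Sp_hol_def)
  have T: "mhol D T" "\<And>z. z \<in> D \<Longrightarrow> T z \<in> Sp" using assms by (auto simp: Sp_hol_def)
  let ?X = "\<lambda>z. Sp_inv (S z) ** T z"
  have X: "mhol D ?X" using mhol_mult[OF mhol_Sp_inv[OF S(2)] T(1)] .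
  have "md T z = md (\<lambda>z. S z ** ?X z) z"
    by (rule md_cong[OF S(1) assms(3)]) (simp add: matrix_mul_assoc Sp_inv_right S)
  also have "\<dots> = md S z ** ?X z + S z ** md ?X z" by (rule md_mult[OF S(2) X S(1) assms(3)])
  finally have "Sp_inv (S z) ** md T z = mcP S z ** ?X z + md ?X z"
    by (simp add: matrix_add_ldistrib matrix_mul_assoc mcP_def Sp_inv_left S assms)
  moreover have "Sp_inv (S z) ** md T z = ?X z ** mcP T z"
    by (subst md_mcP) (simp_all add: T assms matrix_mul_assoc)
  ultimately show ?thesis by simp
qed

text \<open>Parametrization of \<^term>\<open>H1\<close>: the matrix \<^term>\<open>hmat a t\<close> is \<^term>\<open>S_rep g\<close> for the upper
  triangular matrix \<open>g\<close> with diagonal \<open>a, 1/a\<close> and upper right entry \<open>- (2/9)\<^bsup>1/3\<^esup> t\<close>.\<close>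

definition hmat :: "complex \<Rightarrow> complex \<Rightarrow> complex^4^4" where
  "hmat a t = (\<chi> i j.
     if i = 1 then (if j = 1 then a^3 else if j = 2 then a^2 * t
                    else if j = 3 then - 2/9 * t^3 else 2/3 * a * t^2)
     else if i = 2 then (if j = 1 then 0 else if j = 2 then a
                    else if j = 3 then - 2/3 * t^2 / a else 4/3 * t)
     else if i = 3 then (if j = 3 then 1 / a^3 else 0)
     else (if j = 3 then - t / a^2 else if j = 4 then 1 / a else 0))"

lemma hmat_nth:
  "hmat a t $ 1 $ 1 = a^3" "hmat a t $ 1 $ 2 = a^2 * t" "hmat a t $ 1 $ 3 = - 2/9 * t^3"
  "hmat a t $ 1 $ 4 = 2/3 * a * t^2"
  "hmat a t $ 2 $ 1 = 0" "hmat a t $ 2 $ 2 = a" "hmat a t $ 2 $ 3 = - 2/3 * t^2 / a"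
  "hmat a t $ 2 $ 4 = 4/3 * t"
  "hmat a t $ 3 $ 1 = 0" "hmat a t $ 3 $ 2 = 0" "hmat a t $ 3 $ 3 = 1 / a^3" "hmat a t $ 3 $ 4 = 0"
  "hmat a t $ 4 $ 1 = 0" "hmat a t $ 4 $ 2 = 0" "hmat a t $ 4 $ 3 = - t / a^2" "hmat a t $ 4 $ 4 = 1 / a"
  by (simp_all add: hmat_def)

lemma hmat_Sp: "a \<noteq> 0 \<Longrightarrow> hmat a t \<in> Sp"
  by (rule SpI) (simp_all add: sympl_def column_def hmat_nth field_simps power2_eq_square power3_eq_cube)

definition F_inv :: "complex^4 \<Rightarrow> complex^4" where
  "F_inv y = y$1 *s axis 1 1 - (y$2 / of_real (root 3 (2/9))) *s axis 2 1
     + (y$4 / of_real (root 3 (1/6))) *s axis 3 1 + y$3 *s axis 4 1"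

lemma inv_F_iso: "inv F_iso = F_inv"
proof (rule inv_equality)
  have nz: "(of_real (root 3 (2/9)) :: complex) \<noteq> 0" "(of_real (root 3 (1/6)) :: complex) \<noteq> 0" by auto
  show "F_inv (F_iso c) = c" for c
    using nz by (simp add: F_inv_def F_iso_def vec_eq_iff[where 'b=4] forall_4 axis_def)
  show "F_iso (F_inv c) = c" for c
    using nz by (simp add: F_inv_def F_iso_def vec_eq_iff[where 'b=4] forall_4 axis_def)
qed

lemma S_rep_upper:
  assumes "a \<noteq> 0" "g $ 1 $ 1 = a" "g $ 2 $ 1 = 0" "g $ 2 $ 2 = 1 / a"
    "g $ 1 $ 2 = - of_real (root 3 (2/9)) * t"
  shows "S_rep g = hmat a t"
proof -
  define \<alpha> \<beta> where "\<alpha> = (of_real (root 3 (2/9)) :: complex)" and "\<beta> = (of_real (root 3 (1/6)) :: complex)"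
  have nz: "\<alpha> \<noteq> 0" "\<beta> \<noteq> 0" by (auto simp: \<alpha>_def \<beta>_def)
  have a3: "\<alpha>^3 = 2/9"
    unfolding \<alpha>_def by (simp flip: of_real_power)
  \<comment> \<open>The two cube roots in \<open>F_iso\<close> have product 1/3, since 2/9 * 1/6 =
    1/27. Together with \<open>\<alpha>^3 = 2/9\<close> this removes all radicals, so the entries of
    \<open>hmat\<close> have rational coefficients.\<close>
  have "root 3 (2/9) * root 3 (1/6) = root 3 (1/27 :: real)"
    by (simp flip: real_root_mult)
  also have "\<dots> = 1/3" by (rule real_root_pos_unique) (auto simp: power3_eq_cube)
  finally have "\<alpha> * \<beta> = of_real (1/3)" unfolding \<alpha>_def \<beta>_def by (metis of_real_mult)
  then have b: "1 / \<beta> = 3 * \<alpha>" "\<beta> = 1 / (3 * \<alpha>)" using nz by (auto simp: field_simps)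
  have g: "g $ 1 $ 2 = - \<alpha> * t" using assms by (simp add: \<alpha>_def)
  have *: "S_rep g $ i $ j = F_iso (sym3_act g (F_inv (axis j 1))) $ i" for i j
    by (simp add: S_rep_def matrix_def inv_F_iso)
  note defs = F_inv_def F_iso_def sym3_act_def sym3_def Let_def column_def axis_def
    \<alpha>_def[symmetric] \<beta>_def[symmetric] assms(2-4) g hmat_nth
  show ?thesis
    using assms(1) nz a3
    by (simp add: vec_eq_iff[where 'b=4] forall_4 *)
      (simp add: defs b field_simps power2_eq_square power3_eq_cube)
qed

lemma H1_eq: "H1 = {hmat a t |a t. a \<noteq> 0}"
proof (intro equalityI subsetI)
  fix h assume "h \<in> H1"
  then obtain g where g: "det g = 1" "g $ 2 $ 1 = 0" "h = S_rep g"
    by (auto simp: H1_def SL2_1_def)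
  then have d: "g $ 1 $ 1 * g $ 2 $ 2 = 1" by (simp add: det_2)
  then have "g $ 1 $ 1 \<noteq> 0" by auto
  moreover have "g $ 2 $ 2 = 1 / g $ 1 $ 1" using d \<open>g $ 1 $ 1 \<noteq> 0\<close> by (simp add: field_simps)
  moreover have "g $ 1 $ 2 = - of_real (root 3 (2/9)) * (- g $ 1 $ 2 / of_real (root 3 (2/9)))" by simp
  ultimately show "h \<in> {hmat a t |a t. a \<noteq> 0}" using S_rep_upper g by blast
next
  fix h assume "h \<in> {hmat a t |a t. a \<noteq> 0}"
  then obtain a t where h: "h = hmat a t" "a \<noteq> 0" by auto
  define g :: "complex^2^2" where "g = (\<chi> i j. if i = 1 then (if j = 1 then a else - of_real (root 3 (2/9)) * t)
     else (if j = 1 then 0 else 1 / a))"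
  have "S_rep g = h" unfolding h(1) by (rule S_rep_upper) (simp_all add: g_def h)
  moreover have "g \<in> SL2_1" using h by (simp add: SL2_1_def det_2 g_def)
  ultimately show "h \<in> H1" by (auto simp: H1_def)
qed

section \<open>Normalized frames are unique up to the structure group\<close>

lemma matrix_mult_4: "((A::complex^4^4) ** B) $ i $ j =
   A$i$1 * B$1$j + A$i$2 * B$2$j + A$i$3 * B$3$j + A$i$4 * B$4$j"
  by (simp add: matrix_matrix_mult_def sum_4)

text \<open>Everything follows by differentiating the transition matrix \<open>X\<close> with the
  gauge rule, each new relation being differentiated again. Equality of planes kills the lower left
  block; its derivative gives \<open>X21 = X34 = 0\<close> and the scaling of
  \<open>\<phi>\<^sup>4\<^sub>2\<close>; then come in turn \<open>X11\<close> as the cube of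
  \<open>X22\<close>, the relation of \<open>X24\<close> to \<open>X12\<close>, and
  \<open>X14\<close>, \<open>X13\<close>. The derivative of the last relation no longer restricts
  \<open>X\<close>: it is the transformation rule of \<open>\<phi>\<^sup>1\<^sub>3\<close>, which
  makes the quartic differential well defined.\<close>

lemma normalized_transition:
  assumes S: "Sp_hol D S" and T: "Sp_hol D T"
    and nS: "\<And>z. z \<in> D \<Longrightarrow> normalized_form (mcP S z)"
    and nT: "\<And>z. z \<in> D \<Longrightarrow> normalized_form (mcP T z)"
    and pl: "\<And>z. z \<in> D \<Longrightarrow> plane (column 1 (S z)) (column 2 (S z)) = plane (column 1 (T z)) (column 2 (T z))"
    and z: "z \<in> D"
  shows "Sp_inv (S z) ** T z \<in> H1"
    and "mcP T z $ 1 $ 3 * (mcP T z $ 4 $ 2) ^ 3 = mcP S z $ 1 $ 3 * (mcP S z $ 4 $ 2) ^ 3"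
proof -
  define X where "X = (\<lambda>z. Sp_inv (S z) ** T z)"
  define p where "p = mcP S"
  define s where "s = mcP T"
  have oD: "open D" and hS: "mhol D S" and hT: "mhol D T" using S T by (auto simp: Sp_hol_def)
  have Sp: "S z \<in> Sp" "T z \<in> Sp" "X z \<in> Sp" if "z \<in> D" for z
    using S T that by (auto simp: Sp_hol_def X_def intro: Sp_mult Sp_Sp_inv)
  have X: "mhol D X" unfolding X_def by (rule mhol_mult[OF mhol_Sp_inv[OF hS] hT])
  have dX: "((\<lambda>w. X w $ i $ j) has_field_derivative
     (X z $ i $ 1 * s z $ 1 $ j + X z $ i $ 2 * s z $ 2 $ j + X z $ i $ 3 * s z $ 3 $ j + X z $ i $ 4 * s z $ 4 $ j)
     - (p z $ i $ 1 * X z $ 1 $ j + p z $ i $ 2 * X z $ 2 $ j + p z $ i $ 3 * X z $ 3 $ j + p z $ i $ 4 * X z $ 4 $ j)) (at z)"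
    if "z \<in> D" for i j z
    using md_DERIV[OF X oD that, of i j] md_transition[OF S T that]
    by (simp add: X_def p_def s_def matrix_mult_4)
  have pn: "p z $ 3 $ 1 = 0" "p z $ 4 $ 1 = 0" "p z $ 2 $ 1 = p z $ 4 $ 2" "p z $ 1 $ 1 = 3 * p z $ 2 $ 2"
     "p z $ 1 $ 2 = 3/4 * p z $ 2 $ 4" "p z $ 1 $ 4 = 0" "p z $ 4 $ 2 \<noteq> 0"
     "p z $ 3 $ 3 = - 3 * p z $ 2 $ 2" "p z $ 3 $ 4 = - p z $ 4 $ 2"
     "p z $ 4 $ 3 = - 3/4 * p z $ 2 $ 4" "p z $ 4 $ 4 = - p z $ 2 $ 2" "p z $ 2 $ 3 = 0" "p z $ 3 $ 2 = 0"
    if "z \<in> D" for z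
    using nS[OF that] mcP_sp[OF S that] unfolding p_def normalized_form_def by (auto simp: field_simps)
  have sn: "s z $ 3 $ 1 = 0" "s z $ 4 $ 1 = 0" "s z $ 2 $ 1 = s z $ 4 $ 2" "s z $ 1 $ 1 = 3 * s z $ 2 $ 2"
     "s z $ 1 $ 2 = 3/4 * s z $ 2 $ 4" "s z $ 1 $ 4 = 0" "s z $ 4 $ 2 \<noteq> 0"
     "s z $ 3 $ 3 = - 3 * s z $ 2 $ 2" "s z $ 3 $ 4 = - s z $ 4 $ 2"
     "s z $ 4 $ 3 = - 3/4 * s z $ 2 $ 4" "s z $ 4 $ 4 = - s z $ 2 $ 2" "s z $ 2 $ 3 = 0" "s z $ 3 $ 2 = 0"
    if "z \<in> D" for z
    using nT[OF that] mcP_sp[OF T that] unfolding s_def normalized_form_def by (auto simp: field_simps)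
  have ll: "X z $ 3 $ 1 = 0" "X z $ 4 $ 1 = 0" "X z $ 3 $ 2 = 0" "X z $ 4 $ 2 = 0" if "z \<in> D" for z
  proof -
    have "column 1 (T z) \<in> plane (column 1 (S z)) (column 2 (S z))"
      "column 2 (T z) \<in> plane (column 1 (S z)) (column 2 (S z))"
      unfolding pl[OF that] plane_mem by (metis vector_smult_lid vector_smult_lzero add.right_neutral add.left_neutral)+
    moreover have "X z $ i $ j = (Sp_inv (S z) *v column j (T z)) $ i" for i j
      unfolding X_def column_mult[symmetric] by (simp add: column_def)
    ultimately show "X z $ 3 $ 1 = 0" "X z $ 4 $ 1 = 0" "X z $ 3 $ 2 = 0" "X z $ 4 $ 2 = 0"
      by (simp_all add: lagrangian_plane_mem[OF Sp(1)[OF that]] Sp_inv_vec)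
  qed
  have DX: "A = B" if "z \<in> D" "\<And>w. w \<in> D \<Longrightarrow> f w = g w"
    "(f has_field_derivative A) (at z)" "(g has_field_derivative B) (at z)" for f g z and A B :: complex
    using DERIV_eq_on_open[OF oD that] .
  note const = DERIV_const
  have e41: "X z $ 2 $ 1 = 0" if "z \<in> D" for z
    using DX[OF that ll(2) dX[OF that] const] that by (simp add: ll pn sn)
  have e42: "X z $ 4 $ 4 * s z $ 4 $ 2 = p z $ 4 $ 2 * X z $ 2 $ 2" if "z \<in> D" for z
    using DX[OF that ll(4) dX[OF that] const] that by (simp add: ll pn sn)
  have e32: "X z $ 3 $ 4 = 0" if "z \<in> D" for z
    using DX[OF that ll(3) dX[OF that] const] that by (simp add: ll pn sn)
  have sp: "X z $ 1 $ 1 * X z $ 3 $ 3 = 1" "X z $ 2 $ 2 * X z $ 4 $ 4 = 1"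
     "X z $ 1 $ 2 * X z $ 3 $ 3 + X z $ 2 $ 2 * X z $ 4 $ 3 = 0"
     "- X z $ 3 $ 3 * X z $ 1 $ 4 + X z $ 2 $ 3 * X z $ 4 $ 4 - X z $ 4 $ 3 * X z $ 2 $ 4 = 0"
    if "z \<in> D" for z
    using Sp_columns[OF Sp(3)[OF that]] that by (simp_all add: sympl_def column_def ll e41 e32)
  have a0: "X z $ 2 $ 2 \<noteq> 0" if "z \<in> D" for z using sp(2)[OF that] by auto
  have h': "s z $ 4 $ 2 = p z $ 4 $ 2 * (X z $ 2 $ 2)^2" if "z \<in> D" for z
    using e42[OF that] sp(2)[OF that] by algebra
  have e21: "X z $ 1 $ 1 = (X z $ 2 $ 2)^3" if "z \<in> D" for z
  proof -
    have "X z $ 2 $ 2 * s z $ 4 $ 2 = p z $ 4 $ 2 * X z $ 1 $ 1"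
      using DX[OF that e41 dX[OF that] const] that by (simp add: ll pn sn e41)
    then have "p z $ 4 $ 2 * X z $ 1 $ 1 = p z $ 4 $ 2 * (X z $ 2 $ 2)^3"
      using h'[OF that] by algebra
    then show ?thesis using pn(7)[OF that] by simp
  qed
  have e24: "3 * (X z $ 2 $ 2)^2 * X z $ 2 $ 4 = 4 * X z $ 1 $ 2" if "z \<in> D" for z
  proof -
    note h = h'[OF that]
    \<comment> \<open>Naming the product keeps \<open>simp\<close> from splitting the equation into
      a disjunction of vanishing factors; it is unfolded only for \<open>algebra\<close>. The same
      device recurs below.\<close>
    define c where "c = p z $ 4 $ 2 * (X z $ 2 $ 2)^2 * (3 * (X z $ 2 $ 2)^2 * X z $ 2 $ 4 - 4 * X z $ 1 $ 2)"
    have "c = 0"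
      using DX[OF that e21 dX[OF that] DERIV_power[OF dX[OF that], of _ _ 3]] that
      by (simp add: ll pn sn e41 e21 h) (unfold c_def, algebra)
    then have "p z $ 4 $ 2 * (X z $ 2 $ 2)^2 * (3 * (X z $ 2 $ 2)^2 * X z $ 2 $ 4 - 4 * X z $ 1 $ 2) = 0"
      unfolding c_def .
    then show ?thesis using pn(7)[OF that] a0[OF that] by simp
  qed
  \<comment> \<open>\<open>t\<close> is the second parameter of \<open>hmat\<close>, read off its
    entry \<open>4/3 * t\<close> in row 2, column 4. The entry \<open>X44\<close> stands for the
    inverse of \<open>X22\<close>, which keeps all identities polynomial.\<close>
  have par: "X z $ 1 $ 2 = (X z $ 2 $ 2)^2 * t" "X z $ 2 $ 4 = 4/3 * t" "X z $ 3 $ 3 = (X z $ 4 $ 4)^3"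
      "X z $ 4 $ 3 = - t * (X z $ 4 $ 4)^2"
      "X z $ 2 $ 3 = X z $ 1 $ 4 * (X z $ 4 $ 4)^2 - 4/3 * t^2 * X z $ 4 $ 4"
    if "z \<in> D" "t = 3/4 * X z $ 2 $ 4" for z t
  proof -
    note r = sp[OF that(1)] e24[OF that(1)] e21[OF that(1)]
    show 1: "X z $ 2 $ 4 = 4/3 * t" by (simp add: that(2))
    show 2: "X z $ 1 $ 2 = (X z $ 2 $ 2)^2 * t" using r(5) unfolding 1 by algebra
    show 3: "X z $ 3 $ 3 = (X z $ 4 $ 4)^3" using r(1,2,6) by algebra
    show 4: "X z $ 4 $ 3 = - t * (X z $ 4 $ 4)^2" using r(2,3) unfolding 2 3 by algebra
    have calc: "X z $ 2 $ 2 * (3 * X z $ 2 $ 3) = X z $ 2 $ 2 * (3 * X z $ 1 $ 4 * (X z $ 4 $ 4)^2 - 4 * t^2 * X z $ 4 $ 4)"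
      using r(2,4) unfolding 1 3 4 by algebra
    show "X z $ 2 $ 3 = X z $ 1 $ 4 * (X z $ 4 $ 4)^2 - 4/3 * t^2 * X z $ 4 $ 4"
    proof -
      have "3 * X z $ 2 $ 3 = 3 * X z $ 1 $ 4 * (X z $ 4 $ 4)^2 - 4 * t^2 * X z $ 4 $ 4"
        using a0[OF that(1)] calc by simp
      then show ?thesis by (simp add: field_simps)
    qed
  qed
  have e14: "3 * (X z $ 2 $ 2)^3 * X z $ 1 $ 4 = 2 * (X z $ 1 $ 2)^2" if "z \<in> D" for z
  proof -
    define t where "t = 3/4 * X z $ 2 $ 4"
    note h = h'[OF that] and par = par[OF that t_def] and ii = sp(2)[OF that]
    define c where "c = p z $ 4 $ 2 * (3 * X z $ 1 $ 4 - 2 * X z $ 2 $ 2 * t^2)"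
    have "c = 0"
      using DX[OF that e24 DERIV_mult[OF DERIV_cmult[OF DERIV_power[OF dX[OF that], of _ _ 2]] dX[OF that]]
          DERIV_cmult[OF dX[OF that]]] ii
      by (simp add: ll[OF that] pn[OF that] sn[OF that] e41[OF that] e21[OF that] e32[OF that] h par)
        (unfold c_def, algebra)
    then have "3 * X z $ 1 $ 4 = 2 * X z $ 2 $ 2 * t^2" using pn(7)[OF that] unfolding c_def by simp
    then show ?thesis unfolding par by algebra
  qed
  have par14: "X z $ 1 $ 4 = 2/3 * X z $ 2 $ 2 * t^2" if "z \<in> D" "t = 3/4 * X z $ 2 $ 4" for z t
  proof -
    have "(X z $ 2 $ 2)^3 * (3 * X z $ 1 $ 4) = (X z $ 2 $ 2)^3 * (2 * X z $ 2 $ 2 * t^2)"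
      using e14[OF that(1)] unfolding par(1)[OF that] by algebra
    then have "3 * X z $ 1 $ 4 = 2 * X z $ 2 $ 2 * t^2" using a0[OF that(1)] by simp
    then have "X z $ 1 $ 4 = (2 * X z $ 2 $ 2 * t^2) / 3"
      by (metis nonzero_mult_div_cancel_left zero_neq_numeral)
    then show ?thesis by simp
  qed
  have e13: "9 * (X z $ 2 $ 2)^6 * X z $ 1 $ 3 = - 2 * (X z $ 1 $ 2)^3" if "z \<in> D" for z
  proof -
    define t where "t = 3/4 * X z $ 2 $ 4"
    note h = h'[OF that] and par = par[OF that t_def] and par14 = par14[OF that t_def] and ii = sp(2)[OF that]
    define c where "c = p z $ 4 $ 2 * (X z $ 2 $ 2)^5 * (9 * X z $ 1 $ 3 + 2 * t^3)"
    have "c = 0"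
      using DX[OF that e14 DERIV_mult[OF DERIV_cmult[OF DERIV_power[OF dX[OF that], of _ _ 3]] dX[OF that]]
          DERIV_cmult[OF DERIV_power[OF dX[OF that], of _ _ 2]]] ii
      by (simp add: ll[OF that] pn[OF that] sn[OF that] e41[OF that] e21[OF that] e32[OF that] h par par14)
        (unfold c_def, algebra)
    then have "9 * X z $ 1 $ 3 + 2 * t^3 = 0" using pn(7)[OF that] a0[OF that] unfolding c_def by simp
    then show ?thesis unfolding par by algebra
  qed
  have par13: "X z $ 1 $ 3 = - 2/9 * t^3" if "z \<in> D" "t = 3/4 * X z $ 2 $ 4" for z t
  proof -
    have "(X z $ 2 $ 2)^6 * (9 * X z $ 1 $ 3) = (X z $ 2 $ 2)^6 * (- 2 * t^3)"
      using e13[OF that(1)] unfolding par(1)[OF that] by algebra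
    then have "9 * X z $ 1 $ 3 = - 2 * t^3"
      by (rule mult_left_cancel[THEN iffD1, rotated]) (simp add: a0[OF that(1)])
    then have "X z $ 1 $ 3 = (- 2 * t^3) / 9"
      by (metis nonzero_mult_div_cancel_left zero_neq_numeral)
    then show ?thesis by simp
  qed
  define t where "t = 3/4 * X z $ 2 $ 4"
  note h = h'[OF z] and par = par[OF z t_def] and par14 = par14[OF z t_def] and par13 = par13[OF z t_def]
    and ii = sp(2)[OF z]
  have x44: "X z $ 4 $ 4 = 1 / X z $ 2 $ 2" using ii a0[OF z] by (simp add: field_simps)
  have "X z = hmat (X z $ 2 $ 2) t"
    by (simp add: vec_eq_iff[where 'b=4] forall_4 hmat_nth ll[OF z] e41[OF z] e32[OF z] e21[OF z] par par14 par13 x44 a0[OF z])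
      (simp add: field_simps power2_eq_square power3_eq_cube a0[OF z])
  then show "Sp_inv (S z) ** T z \<in> H1" using a0[OF z] unfolding X_def H1_eq by blast
  \<comment> \<open>With \<open>a = X22\<close> the derivative of \<open>e13\<close> says that
    \<open>a^6\<close> times the new \<open>\<phi>\<^sup>1\<^sub>3\<close> is the old one. As
    \<open>\<phi>\<^sup>4\<^sub>2\<close> is multiplied by \<open>a^2\<close>, the product with its
    cube is invariant.\<close>
  define c where "c = 9 * (X z $ 2 $ 2)^9 * s z $ 1 $ 3 - 9 * (X z $ 2 $ 2)^3 * p z $ 1 $ 3"
  have "c = 0"
    using DX[OF z e13 DERIV_mult[OF DERIV_cmult[OF DERIV_power[OF dX[OF z], of _ _ 6]] dX[OF z]]
        DERIV_cmult[OF DERIV_power[OF dX[OF z], of _ _ 3]]] ii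
    by (simp add: ll[OF z] pn[OF z] sn[OF z] e41[OF z] e21[OF z] e32[OF z] h par par14 par13)
      (unfold c_def, algebra)
  then have "(X z $ 2 $ 2)^3 * ((X z $ 2 $ 2)^6 * s z $ 1 $ 3) = (X z $ 2 $ 2)^3 * p z $ 1 $ 3"
    unfolding c_def by algebra
  then have "(X z $ 2 $ 2)^6 * s z $ 1 $ 3 = p z $ 1 $ 3"
    by (rule mult_left_cancel[THEN iffD1, rotated]) (simp add: a0[OF z])
  then show "mcP T z $ 1 $ 3 * (mcP T z $ 4 $ 2) ^ 3 = mcP S z $ 1 $ 3 * (mcP S z $ 4 $ 2) ^ 3"
    unfolding p_def[symmetric] s_def[symmetric] h
    by (simp add: power_mult_distrib mult.assoc mult.left_commute[of "s z $ 1 $ 3"] flip: power_mult)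
      (simp add: mult.commute mult.left_commute)
qed

text \<open>The counterpart of \<open>normalized_transition\<close>: moving a normalized frame
  within \<open>H1\<close> keeps it normalized. It is checked by direct computation of
  \<open>X\<^sup>-\<^sup>1 (\<phi> X + X')\<close> with \<open>X = hmat a t\<close>, where
  \<open>a\<close> and \<open>t\<close> are holomorphic because they are read off entries of
  \<open>X\<close>.\<close>

lemma normalized_mult_H1:
  assumes S: "Sp_hol D S" and X: "mhol D X" "\<And>z. z \<in> D \<Longrightarrow> X z \<in> H1"
    and z: "z \<in> D" and nS: "normalized_form (mcP S z)"
  shows "normalized_form (mcP (\<lambda>z. S z ** X z) z)"
proof -
  have oD: "open D" and hS: "mhol D S" and Sp: "S z \<in> Sp" using S z by (auto simp: Sp_hol_def)
  define a where "a = (\<lambda>w. X w $ 2 $ 2)"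
  define t where "t = (\<lambda>w. 3/4 * X w $ 2 $ 4)"
  have Xh: "X w = hmat (a w) (t w)" "a w \<noteq> 0" if "w \<in> D" for w
    using X(2)[OF that] by (auto simp: a_def t_def H1_eq hmat_nth)
  define a' where "a' = deriv a z"
  define t' where "t' = deriv t z"
  have da: "(a has_field_derivative a') (at z)"
    unfolding a'_def a_def by (rule holomorphic_derivI[OF mhol_D[OF X(1)] oD z])
  have dt: "(t has_field_derivative t') (at z)"
    unfolding t'_def t_def by (rule holomorphic_derivI[OF _ oD z]) (intro holomorphic_intros mhol_D[OF X(1)])
  have dX: "((\<lambda>w. hmat (a w) (t w) $ i $ j) has_field_derivative md X z $ i $ j) (at z)" for i j
    by (rule has_field_derivative_transform_within_open[OF md_DERIV[OF X(1) oD z] oD z]) (simp add: Xh)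
  define p where "p = mcP S z"
  define s where "s = mcP (\<lambda>z. S z ** X z) z"
  have az: "a z \<noteq> 0" by (rule Xh(2)[OF z])
  have XSp: "X z \<in> Sp" using Xh[OF z] hmat_Sp by simp
  have e: "s = Sp_inv (X z) ** (p ** X z + md X z)"
  proof -
    have "s = Sp_inv (X z) ** (Sp_inv (S z) ** (md S z ** X z + S z ** md X z))"
      unfolding s_def mcP_def using md_mult[OF hS X(1) oD z] Sp_inv_mult[OF Sp XSp] by (simp add: matrix_mul_assoc)
    also have "Sp_inv (S z) ** (md S z ** X z + S z ** md X z) = p ** X z + md X z"
      by (simp add: matrix_add_ldistrib matrix_mul_assoc p_def mcP_def Sp_inv_left Sp)
    finally show ?thesis .
  qed
  have pn: "p $ 3 $ 1 = 0" "p $ 4 $ 1 = 0" "p $ 2 $ 1 = p $ 4 $ 2" "p $ 1 $ 1 = 3 * p $ 2 $ 2"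
     "p $ 1 $ 2 = 3/4 * p $ 2 $ 4" "p $ 1 $ 4 = 0" "p $ 4 $ 2 \<noteq> 0"
     "p $ 3 $ 3 = - 3 * p $ 2 $ 2" "p $ 3 $ 4 = - p $ 4 $ 2"
     "p $ 4 $ 3 = - 3/4 * p $ 2 $ 4" "p $ 4 $ 4 = - p $ 2 $ 2" "p $ 2 $ 3 = 0" "p $ 3 $ 2 = 0"
    using nS mcP_sp[OF S z] unfolding p_def normalized_form_def by (auto simp: field_simps)
  have m: "md X z $ i $ j = d" if "((\<lambda>w. hmat (a w) (t w) $ i $ j) has_field_derivative d) (at z)" for i j d
    using DERIV_unique[OF dX that] .
  \<comment> \<open>The conditions in \<open>normalized_form\<close> concern columns 1, 2 and
    4.\<close>
  have md: "md X z $ 1 $ 1 = 3 * a z ^ 2 * a'"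
    "md X z $ 1 $ 2 = 2 * a z * a' * t z + a z ^ 2 * t'"
    "md X z $ 1 $ 4 = 2/3 * (a' * t z ^ 2 + 2 * a z * t z * t')"
    "md X z $ 2 $ 1 = 0"
    "md X z $ 2 $ 2 = a'"
    "md X z $ 2 $ 4 = 4/3 * t'"
    "md X z $ 3 $ 1 = 0"
    "md X z $ 3 $ 2 = 0"
    "md X z $ 3 $ 4 = 0"
    "md X z $ 4 $ 1 = 0"
    "md X z $ 4 $ 2 = 0"
    "md X z $ 4 $ 4 = - a' / a z ^ 2"
    subgoal by (rule m, unfold hmat_nth) (auto intro!: derivative_eq_intros da dt simp: az power2_eq_square field_simps)
    subgoal by (rule m, unfold hmat_nth) (auto intro!: derivative_eq_intros da dt simp: az power2_eq_square field_simps)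
    subgoal by (rule m, unfold hmat_nth) (auto intro!: derivative_eq_intros da dt simp: az power2_eq_square field_simps)
    subgoal by (rule m, unfold hmat_nth) (auto intro!: derivative_eq_intros da dt simp: az power2_eq_square field_simps)
    subgoal by (rule m, unfold hmat_nth) (auto intro!: derivative_eq_intros da dt simp: az power2_eq_square field_simps)
    subgoal by (rule m, unfold hmat_nth) (auto intro!: derivative_eq_intros da dt simp: az power2_eq_square field_simps)
    subgoal by (rule m, unfold hmat_nth) (auto intro!: derivative_eq_intros da dt simp: az power2_eq_square field_simps)
    subgoal by (rule m, unfold hmat_nth) (auto intro!: derivative_eq_intros da dt simp: az power2_eq_square field_simps)
    subgoal by (rule m, unfold hmat_nth) (auto intro!: derivative_eq_intros da dt simp: az power2_eq_square field_simps)
    subgoal by (rule m, unfold hmat_nth) (auto intro!: derivative_eq_intros da dt simp: az power2_eq_square field_simps)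
    subgoal by (rule m, unfold hmat_nth) (auto intro!: derivative_eq_intros da dt simp: az power2_eq_square field_simps)
    subgoal by (rule m, unfold hmat_nth) (auto intro!: derivative_eq_intros da dt simp: az power2_eq_square field_simps)
    done
  have si: "Sp_inv (X z) $ 1 $ j = (if j = 1 then 1 / a z ^ 3 else if j = 2 then - t z / a z ^ 2
       else if j = 3 then 2/9 * t z ^ 3 else 2/3 * t z ^ 2 / a z)"
    "Sp_inv (X z) $ 2 $ j = (if j = 1 then 0 else if j = 2 then 1 / a z
       else if j = 3 then - 2/3 * a z * t z ^ 2 else - 4/3 * t z)"
    "Sp_inv (X z) $ 3 $ j = (if j = 3 then a z ^ 3 else 0)"
    "Sp_inv (X z) $ 4 $ j = (if j = 3 then a z ^ 2 * t z else if j = 4 then a z else 0)" for j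
    using exhaust_4[of j] by (auto simp: Sp_inv_def sympl_def column_def axis_def Xh[OF z] hmat_nth)
  note si' = si[unfolded Xh(1)[OF z]]
  then show ?thesis
    unfolding s_def[symmetric] normalized_form_def
    using az pn(7)
    by (simp only: e matrix_mult_4 vector_add_component)
       (simp add: si' md Xh(1)[OF z] hmat_nth pn field_simps power2_eq_square power3_eq_cube)
qed

lemma md_zero_const:
  assumes M: "mhol D M" and D: "open D" "connected D" and 0: "\<And>z. z \<in> D \<Longrightarrow> md M z = 0"
    and zw: "z \<in> D" "w \<in> D"
  shows "M z = M w"
proof -
  have "M z $ i $ j = M w $ i $ j" for i j
  proof (rule has_derivative_zero_unique_connected[OF D _ zw])
    show "((\<lambda>z. M z $ i $ j) has_derivative (\<lambda>h. 0)) (at x)" if "x \<in> D" for x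
      using md_DERIV[OF M D(1) that, of i j] 0[OF that] by (simp add: has_field_derivative_def lambda_zero)
  qed
  then show ?thesis by (simp add: vec_eq_iff)
qed

section \<open>Linear differential equations\<close>

text \<open>Taylor coefficients of the solution of \<open>Y' = Y N\<close> with
  \<open>Y(0) = 1\<close>, found by comparing coefficients: \<open>k + 1\<close> times coefficient
  \<open>k + 1\<close> of \<open>Y\<close> is coefficient \<open>k\<close> of the Cauchy product
  \<open>Y N\<close>.\<close>

fun ode_coeff :: "(nat \<Rightarrow> complex^'n^'n) \<Rightarrow> nat \<Rightarrow> complex^'n^'n" where
  "ode_coeff N 0 = mat 1"
| "ode_coeff N (Suc k) = (\<chi> i j. (\<Sum>l\<le>k. \<Sum>m\<in>UNIV. ode_coeff N l $ i $ m * N (k - l) $ m $ j) / of_nat (Suc k))"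

text \<open>A geometric majorant. If the bound holds up to \<open>k\<close>, each product in the
  recursion is at most \<open>B * K ^ k\<close>; there are \<open>k + 1\<close> values of
  \<open>l\<close>, which the division cancels, and \<open>CARD('n)\<close> values of
  \<open>m\<close>, which are absorbed by one more factor \<open>K\<close>.\<close>

lemma ode_coeff_bound:
  fixes N :: "nat \<Rightarrow> complex^'n^'n"
  assumes N: "\<And>k i j. norm (N k $ i $ j) \<le> B * q ^ k" and B: "B \<ge> 0" and q: "q \<ge> 0"
    and K: "q \<le> K" "of_nat CARD('n) * B \<le> K"
  shows "norm (ode_coeff N k $ i $ j) \<le> K ^ k"
proof (induction k arbitrary: i j rule: less_induct)
  case (less k)
  have K0: "K \<ge> 0" using q K by linarith
  show ?case
  proof (cases k)
    case 0 then show ?thesis by (simp add: mat_def)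
  next
    case (Suc n)
    have t: "norm (ode_coeff N l $ i $ m * N (n - l) $ m $ j) \<le> B * K ^ n" if "l \<le> n" for l m
    proof -
      have "norm (ode_coeff N l $ i $ m * N (n - l) $ m $ j) \<le> K ^ l * (B * K ^ (n - l))"
        unfolding norm_mult
      proof (rule mult_mono)
        show "norm (ode_coeff N l $ i $ m) \<le> K ^ l" using less Suc that by auto
        have "norm (N (n - l) $ m $ j) \<le> B * q ^ (n - l)" by (rule N)
        also have "\<dots> \<le> B * K ^ (n - l)" using B q K by (intro mult_left_mono power_mono) auto
        finally show "norm (N (n - l) $ m $ j) \<le> B * K ^ (n - l)" .
      qed (use K0 in auto)
      also have "\<dots> = B * K ^ n" using that by (simp flip: power_add)
      finally show ?thesis .
    qed
    have "norm (\<Sum>l\<le>n. \<Sum>m\<in>UNIV. ode_coeff N l $ i $ m * N (n - l) $ m $ j)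
        \<le> (\<Sum>l\<le>n. \<Sum>m\<in>(UNIV::'n set). B * K ^ n)"
      by (intro sum_norm_le) (use t in auto)
    also have "\<dots> = real (Suc n) * (of_nat CARD('n) * B * K ^ n)" by (simp add: algebra_simps)
    also have "\<dots> \<le> real (Suc n) * K ^ Suc n"
      using K K0 by (intro mult_left_mono) (auto intro: mult_right_mono)
    finally have "norm (\<Sum>l\<le>n. \<Sum>m\<in>UNIV. ode_coeff N l $ i $ m * N (n - l) $ m $ j) \<le> real (Suc n) * K ^ Suc n" .
    then show ?thesis unfolding Suc
      by (simp add: norm_divide divide_le_eq mult.commute del: of_nat_Suc power_Suc)
  qed
qed

lemma eval_fps_sum:
  fixes f :: "'i \<Rightarrow> complex fps"
  assumes "finite I" "\<And>i. i \<in> I \<Longrightarrow> ereal (norm z) < fps_conv_radius (f i)"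
  shows "eval_fps (\<Sum>i\<in>I. f i) z = (\<Sum>i\<in>I. eval_fps (f i) z) \<and> ereal (norm z) < fps_conv_radius (\<Sum>i\<in>I. f i)"
  using assms
proof (induction I rule: finite_induct)
  case empty then show ?case by (simp add: fps_conv_radius_def)
next
  case (insert x F)
  then have "ereal (norm z) < fps_conv_radius (f x)" "ereal (norm z) < fps_conv_radius (sum f F)"
    and e: "eval_fps (sum f F) z = (\<Sum>i\<in>F. eval_fps (f i) z)" by auto
  then have "ereal (norm z) < fps_conv_radius (f x + sum f F)"
    using fps_conv_radius_add[of "f x" "sum f F"] by (meson less_le_trans min_less_iff_conj)
  then show ?case using insert e by (simp add: eval_fps_add)
qed

lemma linear_ode_exists:
  fixes N :: "complex \<Rightarrow> complex^'n^'n"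
  assumes N: "mhol (ball z0 r) N" and r: "r > 0"
  obtains \<rho> M where "\<rho> > 0" "\<rho> \<le> r" "mhol (ball z0 \<rho>) M" "M z0 = mat 1"
    "\<And>z. z \<in> ball z0 \<rho> \<Longrightarrow> md M z = M z ** N z"
proof -
  define F where "F = (\<lambda>i j. fps_expansion (\<lambda>z. N z $ i $ j) z0)"
  define n :: "nat \<Rightarrow> complex^'n^'n" where "n = (\<lambda>k. \<chi> i j. fps_nth (F i j) k)"
  \<comment> \<open>On the closed disc of half the radius \<open>N\<close> is bounded, so that
    Cauchy's inequality gives geometric bounds for its coefficients.\<close>
  define r2 where "r2 = r / 2"
  have r2: "r2 > 0" "cball z0 r2 \<subseteq> ball z0 r" using r by (auto simp: r2_def)
  have hN: "(\<lambda>z. N z $ i $ j) holomorphic_on ball z0 r" for i j using N by (rule mhol_D)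
  have "\<exists>B\<ge>0. \<forall>k. norm (n k $ i $ j) \<le> B * (1 / r2) ^ k" for i j
  proof -
    have c: "continuous_on (cball z0 r2) (\<lambda>z. N z $ i $ j)"
      using holomorphic_on_imp_continuous_on[OF holomorphic_on_subset[OF hN r2(2)]] .
    then have "bounded ((\<lambda>z. N z $ i $ j) ` cball z0 r2)"
      by (intro compact_imp_bounded compact_continuous_image) auto
    then obtain B where B: "B > 0" "\<And>z. z \<in> cball z0 r2 \<Longrightarrow> norm (N z $ i $ j) \<le> B"
      unfolding bounded_pos by auto
    have "norm ((deriv ^^ k) (\<lambda>z. N z $ i $ j) z0) \<le> fact k * B / r2 ^ k" for k
    proof (rule Cauchy_inequality[OF _ c r2(1)])
      show "(\<lambda>z. N z $ i $ j) holomorphic_on ball z0 r2"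
        by (rule holomorphic_on_subset[OF hN]) (use r2 ball_subset_cball in blast)
      show "norm (N x $ i $ j) \<le> B" if "norm (z0 - x) = r2" for x
        using that by (intro B) (simp add: dist_norm)
    qed
    then have "norm (n k $ i $ j) \<le> B * (1 / r2) ^ k" for k
      by (simp add: n_def F_def fps_expansion_def norm_divide divide_le_eq power_one_over field_simps)
    then show ?thesis using B by (intro exI[of _ B]) auto
  qed
  then obtain b where b: "\<And>i j. b i j \<ge> 0" "\<And>i j k. norm (n k $ i $ j) \<le> b i j * (1 / r2) ^ k" by metis
  define B where "B = (\<Sum>i\<in>UNIV. \<Sum>j\<in>UNIV. b i j)"
  have bB: "b i j \<le> B" for i j
  proof -
    have "b i j \<le> (\<Sum>j\<in>UNIV. b i j)" by (rule member_le_sum) (auto simp: b)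
    also have "\<dots> \<le> B" unfolding B_def by (rule member_le_sum[of i UNIV "\<lambda>i. \<Sum>j\<in>UNIV. b i j"]) (auto simp: b sum_nonneg)
    finally show ?thesis .
  qed
  have B0: "B \<ge> 0" unfolding B_def by (intro sum_nonneg b)
  have nb: "norm (n k $ i $ j) \<le> B * (1 / r2) ^ k" for i j k
    using b(2)[of k i j] bB[of i j] mult_right_mono[OF bB, of "(1 / r2) ^ k" i j] r2 by (smt (verit) divide_nonneg_pos zero_le_power)
  \<comment> \<open>The first entry of the maximum dominates the growth of the coefficients of
    \<open>N\<close>, the second the sum over \<open>m\<close>; the series for \<open>Y\<close> then
    converges on radius \<open>1 / K\<close>.\<close>
  define K where "K = max (1 / r2) (of_nat CARD('n) * B)"
  have K: "1 / r2 \<le> K" "of_nat CARD('n) * B \<le> K" by (auto simp: K_def)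
  have K0: "K > 0" using K(1) r2 by (smt (verit) divide_pos_pos)
  define c where "c = ode_coeff n"
  have cb: "norm (c k $ i $ j) \<le> K ^ k" for k i j
    unfolding c_def by (rule ode_coeff_bound[OF nb B0 _ K]) (use r2 in auto)
  define Y where "Y = (\<lambda>i j. Abs_fps (\<lambda>k. c k $ i $ j))"
  have Yr: "fps_conv_radius (Y i j) \<ge> ereal (1 / K)" for i j
    unfolding fps_conv_radius_def
  proof (rule conv_radius_geI_ex')
    fix t assume t: "0 < t" "ereal t < ereal (1 / K)"
    then have "K * t < 1" using K0 by (simp add: field_simps)
    then have "summable (\<lambda>k. (K * t) ^ k)" using t K0 by (intro summable_geometric) auto
    then show "summable (\<lambda>k. fps_nth (Y i j) k * of_real t ^ k)"
    proof (rule summable_comparison_test')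
      show "norm (fps_nth (Y i j) k * of_real t ^ k) \<le> (K * t) ^ k" for k
        using cb[of k i j] t by (simp add: Y_def norm_mult norm_power power_mult_distrib mult_right_mono)
    qed
  qed
  have Yd: "fps_deriv (Y i j) = (\<Sum>m\<in>UNIV. Y i m * F m j)" for i j
  proof (rule fps_ext)
    fix k
    have "fps_nth (fps_deriv (Y i j)) k = of_nat (Suc k) * c (Suc k) $ i $ j" by (simp add: Y_def)
    also have "\<dots> = (\<Sum>l\<le>k. \<Sum>m\<in>UNIV. c l $ i $ m * n (k - l) $ m $ j)"
      by (simp add: c_def del: of_nat_Suc)
    also have "\<dots> = (\<Sum>m\<in>UNIV. \<Sum>l\<le>k. c l $ i $ m * n (k - l) $ m $ j)" by (rule sum.swap)
    also have "\<dots> = fps_nth (\<Sum>m\<in>UNIV. Y i m * F m j) k"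
      by (simp add: fps_sum_nth fps_mult_nth Y_def n_def atLeast0AtMost)
    finally show "fps_nth (fps_deriv (Y i j)) k = fps_nth (\<Sum>m\<in>UNIV. Y i m * F m j) k" .
  qed
  have Fr: "fps_conv_radius (F i j) \<ge> ereal r" for i j
    unfolding F_def by (rule conv_radius_fps_expansion) (use hN in simp)
  have Fe: "eval_fps (F i j) (z - z0) = N z $ i $ j" if "z \<in> ball z0 r" for i j z
    unfolding F_def by (rule eval_fps_expansion[of _ _ "ereal r"]) (use hN that in simp_all)
  define \<rho> where "\<rho> = min r (1 / K)"
  define M :: "complex \<Rightarrow> complex^'n^'n" where "M = (\<lambda>z. \<chi> i j. eval_fps (Y i j) (z - z0))"
  have zr: "ereal (norm (z - z0)) < fps_conv_radius (Y i j)" "ereal (norm (z - z0)) < fps_conv_radius (F i j)"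
     "z \<in> ball z0 r" if "z \<in> ball z0 \<rho>" for z i j
  proof -
    have "norm (z - z0) < r" "norm (z - z0) < 1 / K"
      using that by (auto simp: \<rho>_def dist_norm norm_minus_commute)
    then have n: "ereal (norm (z - z0)) < ereal r" "ereal (norm (z - z0)) < ereal (1 / K)" "norm (z - z0) < r"
      by simp_all
    then show "ereal (norm (z - z0)) < fps_conv_radius (Y i j)" "ereal (norm (z - z0)) < fps_conv_radius (F i j)"
     "z \<in> ball z0 r"
      using less_le_trans[OF n(2) Yr] less_le_trans[OF n(1) Fr] by (simp_all add: dist_norm norm_minus_commute)
  qed
  have dM: "((\<lambda>z. M z $ i $ j) has_field_derivative (M z ** N z) $ i $ j) (at z)" if z: "z \<in> ball z0 \<rho>" for z i j
  proof -
    have "(eval_fps (Y i j) has_field_derivative eval_fps (fps_deriv (Y i j)) (z - z0)) (at (z - z0))"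
      by (rule has_field_derivative_eval_fps) (rule zr(1)[OF z])
    then have "((\<lambda>w. eval_fps (Y i j) (w - z0)) has_field_derivative eval_fps (fps_deriv (Y i j)) (z - z0) * 1) (at z)"
      by (rule DERIV_chain2) (auto intro!: derivative_eq_intros)
    moreover have "eval_fps (fps_deriv (Y i j)) (z - z0) = (\<Sum>m\<in>UNIV. eval_fps (Y i m * F m j) (z - z0))"
    proof -
      have "ereal (norm (z - z0)) < fps_conv_radius (Y i m * F m j)" for m
        using fps_conv_radius_mult[of "Y i m" "F m j"] zr(1,2)[OF z] by (meson less_le_trans min_less_iff_conj)
      then show ?thesis unfolding Yd using eval_fps_sum[of UNIV "z - z0" "\<lambda>m. Y i m * F m j"] by simp
    qed
    moreover have "\<dots> = (\<Sum>m\<in>UNIV. M z $ i $ m * N z $ m $ j)"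
      by (simp add: eval_fps_mult zr(1,2)[OF z] Fe[OF zr(3)[OF z]] M_def)
    ultimately show ?thesis by (simp add: M_def matrix_matrix_mult_def)
  qed
  show ?thesis
  proof
    show "\<rho> > 0" "\<rho> \<le> r" using r K0 by (auto simp: \<rho>_def)
    show "mhol (ball z0 \<rho>) M" unfolding mhol_def holomorphic_on_open[OF open_ball]
      using dM by blast
    show "M z0 = mat 1" by (simp add: M_def eval_fps_at_0 Y_def c_def vec_eq_iff)
    show "md M z = M z ** N z" if "z \<in> ball z0 \<rho>" for z by (rule md_unique) (rule dM[OF that])
  qed
qed

text \<open>Symplecticity: \<^term>\<open>Sp_inv (M z)\<close>, extended by the formula for arbitrary matrices, solves
  the adjoint equation, so its product with \<^term>\<open>M z\<close> is constant; no uniqueness theorem is needed.\<close>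

lemma linear_ode_symplectic:
  fixes N :: "complex \<Rightarrow> complex^4^4"
  assumes N: "mhol (ball z0 r) N" and r: "r > 0"
    and sp: "\<And>z x y. z \<in> ball z0 r \<Longrightarrow> sympl (N z *v x) y + sympl x (N z *v y) = 0"
  obtains \<rho> M where "\<rho> > 0" "\<rho> \<le> r" "Sp_hol (ball z0 \<rho>) M" "M z0 = mat 1"
    "\<And>z. z \<in> ball z0 \<rho> \<Longrightarrow> md M z = M z ** N z"
proof -
  obtain \<rho> M where M: "\<rho> > 0" "\<rho> \<le> r" "mhol (ball z0 \<rho>) M" "M z0 = mat 1"
    "\<And>z. z \<in> ball z0 \<rho> \<Longrightarrow> md M z = M z ** N z"
    using linear_ode_exists[OF N r] by blast
  let ?D = "ball z0 \<rho>"
  define P where "P = (\<lambda>z. M z ** Sp_inv (M z))"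
  have hI: "mhol ?D (\<lambda>z. Sp_inv (M z))" by (rule mhol_Sp_inv[OF M(3)])
  have dI: "md (\<lambda>z. Sp_inv (M z)) z = - (N z ** Sp_inv (M z))" if z: "z \<in> ?D" for z
  proof -
    have zr: "z \<in> ball z0 r" using z M(2) by auto
    have c: "vhol ?D (\<lambda>w. column k (M w))" for k by (rule vhol_column[OF M(3)])
    have vc: "vd (\<lambda>w. column k (M w)) z = M z *v column k (N z)" for k
      by (simp add: vd_column M(5)[OF z] column_mult)
    have s1: "md (\<lambda>z. Sp_inv (M z)) z $ i $ j =
      (if i = 1 then sympl (axis j 1) (M z *v column 3 (N z))
     else if i = 2 then sympl (axis j 1) (M z *v column 4 (N z))
     else if i = 3 then sympl (M z *v column 1 (N z)) (axis j 1)
     else sympl (M z *v column 2 (N z)) (axis j 1))" for i j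
    proof -
      have "((\<lambda>w. Sp_inv (M w) $ i $ j) has_field_derivative (if i = 1 then sympl (axis j 1) (M z *v column 3 (N z))
     else if i = 2 then sympl (axis j 1) (M z *v column 4 (N z))
     else if i = 3 then sympl (M z *v column 1 (N z)) (axis j 1)
     else sympl (M z *v column 2 (N z)) (axis j 1))) (at z)"
        unfolding Sp_inv_def
        using sympl_DERIV[OF vhol_const[of ?D "axis j 1"] c open_ball z] sympl_DERIV[OF c vhol_const[of ?D "axis j 1"] open_ball z]
        by (cases "i = 1"; cases "i = 2"; cases "i = 3"; simp add: vd_const sympl_linear vc)
      then show ?thesis by (simp add: md_def DERIV_imp_deriv)
    qed
    \<comment> \<open>The assumption \<open>sp\<close> on basis vectors: \<open>N z\<close> lies in
      the Lie algebra of \<open>Sp\<close>.\<close>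
    have n: "N z $ 3 $ 3 = - N z $ 1 $ 1" "N z $ 3 $ 4 = - N z $ 2 $ 1" "N z $ 4 $ 3 = - N z $ 1 $ 2" "N z $ 4 $ 4 = - N z $ 2 $ 2"
      "N z $ 2 $ 3 = N z $ 1 $ 4" "N z $ 3 $ 2 = N z $ 4 $ 1"
      using sp[OF zr, of "axis 1 1" "axis 3 1"] sp[OF zr, of "axis 1 1" "axis 4 1"] sp[OF zr, of "axis 2 1" "axis 3 1"]
       sp[OF zr, of "axis 2 1" "axis 4 1"] sp[OF zr, of "axis 3 1" "axis 4 1"] sp[OF zr, of "axis 1 1" "axis 2 1"]
      by (simp_all add: mat_vec_axis) (simp_all add: sympl_def column_def axis_def add_eq_0_iff)
    show ?thesis
      by (simp add: vec_eq_iff[where 'b=4] forall_4 s1 matrix_mult_4)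
        (simp add: mat_vec_4[of "M z"] sympl_def column_def axis_def Sp_inv_def n algebra_simps)
  qed
  \<comment> \<open>The two terms are \<open>M N\<close> times \<open>Sp_inv M\<close> and its
    negative, so they cancel.\<close>
  have PD: "md P z = 0" if z: "z \<in> ?D" for z
    unfolding P_def md_mult[OF M(3) hI open_ball z] dI[OF z] M(5)[OF z]
    by (simp add: vec_eq_iff matrix_mult_4 algebra_simps)
  have P1: "P z = mat 1" if z: "z \<in> ?D" for z
  proof -
    have "P z = P z0"
      by (rule md_zero_const[OF _ open_ball connected_ball PD z])
        (use mhol_mult[OF M(3) hI] M(1) in \<open>simp_all add: P_def\<close>)
    moreover have "P z0 = mat 1" by (simp add: P_def M(4) Sp_inv_left[OF Sp_mat1, simplified])
    ultimately show ?thesis by simp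
  qed
  have "M z \<in> Sp" if z: "z \<in> ?D" for z
  proof -
    have L: "Sp_inv (M z) ** M z = mat 1" using P1[OF z] matrix_left_right_inverse unfolding P_def by blast
    have e: "sympl (column i (M z)) (column j (M z)) = sympl (axis i 1) (axis j 1)"
      if "i = 1 \<or> i = 2" for i j
    proof -
      have "(Sp_inv (M z) *v column j (M z)) $ k = axis j 1 $ k" for k
        unfolding column_mult[symmetric] L column_mat1 ..
      from this[of 3] this[of 4] show ?thesis using that by (auto simp: Sp_inv_vec) (auto simp: sympl_def axis_def)
    qed
    moreover have "sympl (column 3 (M z)) (column 4 (M z)) = 0"
    proof -
      have "(Sp_inv (M z) *v column 3 (M z)) $ 2 = axis (3::4) 1 $ 2"
        unfolding column_mult[symmetric] L column_mat1 ..
      then show ?thesis by (simp add: Sp_inv_vec axis_def)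
    qed
    ultimately show ?thesis by (intro SpI) (simp_all, simp_all add: sympl_def axis_def)
  qed
  then show ?thesis using that[OF M(1,2) _ M(4,5)] M(3) by (auto simp: Sp_hol_def)
qed

section \<open>Order of vanishing\<close>

text \<open>The bound on \<open>j\<close> is strict: \<open>vanish k\<close> means a zero of order
  at least \<open>k\<close>. Contact of order \<open>k\<close> therefore corresponds to
  \<open>vanish (Suc k)\<close>.\<close>

definition vanish :: "nat \<Rightarrow> (complex \<Rightarrow> complex) \<Rightarrow> complex \<Rightarrow> bool" where
  "vanish k h p \<longleftrightarrow> (\<forall>j<k. (deriv ^^ j) h p = 0)"

lemma vanish_0 [simp]: "vanish 0 h p" by (simp add: vanish_def)

lemma vanish_Suc: "vanish (Suc k) h p \<longleftrightarrow> h p = 0 \<and> vanish k (deriv h) p"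
  unfolding vanish_def by (auto simp: less_Suc_eq_0_disj simp flip: funpow_Suc_right simp del: funpow.simps)
    (metis funpow_swap1 funpow_simps_right(2) comp_apply)+

lemma vanish_mono: "vanish k h p \<Longrightarrow> l \<le> k \<Longrightarrow> vanish l h p"
  by (auto simp: vanish_def)

lemma vanish_cong:
  assumes "\<forall>\<^sub>F w in nhds p. f w = g w"
  shows "vanish k f p \<longleftrightarrow> vanish k g p"
  using higher_deriv_cong_ev[OF assms refl] by (simp add: vanish_def)

lemma vanish_cong_open:
  assumes "open D" "p \<in> D" "\<And>w. w \<in> D \<Longrightarrow> f w = g w"
  shows "vanish k f p \<longleftrightarrow> vanish k g p"
  by (rule vanish_cong, rule eventually_mono[OF eventually_nhds_in_open[OF assms(1,2)]], rule assms(3))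

lemma vanish_congI:
  assumes "open D" "p \<in> D" "\<And>w. w \<in> D \<Longrightarrow> f w = g w" "vanish k g p"
  shows "vanish k f p"
  using vanish_cong_open[OF assms(1-3)] assms(4) by simp

lemma vanish_add:
  assumes "f analytic_on {p}" "g analytic_on {p}" "vanish k f p" "vanish k g p"
  shows "vanish k (\<lambda>w. f w + g w) p"
  using assms by (simp add: vanish_def higher_deriv_add_at)

lemma vanish_diff:
  assumes "f analytic_on {p}" "g analytic_on {p}" "vanish k f p" "vanish k g p"
  shows "vanish k (\<lambda>w. f w - g w) p"
  using assms by (simp add: vanish_def higher_deriv_diff_at)

text \<open>Orders of vanishing add: in each Leibniz term of total order below \<open>k + l\<close>,
  the derivative of \<open>f\<close> has order below \<open>k\<close> or that of \<open>g\<close>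
  has order below \<open>l\<close>.\<close>

lemma vanish_mult2:
  assumes "f analytic_on {p}" "g analytic_on {p}" "vanish k f p" "vanish l g p"
  shows "vanish (k + l) (\<lambda>w. f w * g w) p"
  unfolding vanish_def
proof (intro allI impI)
  fix j assume j: "j < k + l"
  have "(deriv ^^ i) f p * (deriv ^^ (j - i)) g p = 0" if "i \<le> j" for i
  proof (cases "i < k")
    case False then have "j - i < l" using j that by linarith
    then show ?thesis using assms(4) by (simp add: vanish_def)
  qed (use assms(3) in \<open>simp add: vanish_def\<close>)
  then show "(deriv ^^ j) (\<lambda>w. f w * g w) p = 0"
    unfolding higher_deriv_mult_at[OF assms(1,2)] mult.assoc by (intro sum.neutral) simp
qed

lemma vanish_mult:
  assumes "f analytic_on {p}" "g analytic_on {p}" "vanish k g p"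
  shows "vanish k (\<lambda>w. f w * g w) p"
  using vanish_mult2[OF assms(1,2) vanish_0 assms(3)] by simp

text \<open>By the chain rule and induction on \<open>k\<close>. This is why the order of vanishing,
  and hence contact, does not depend on the chart.\<close>

lemma vanish_compose:
  assumes "\<tau> analytic_on {p}" "h analytic_on {\<tau> p}" "vanish k h (\<tau> p)"
  shows "vanish k (\<lambda>w. h (\<tau> w)) p"
  using assms(2,3)
proof (induction k arbitrary: h)
  case (Suc k)
  have ev: "\<forall>\<^sub>F w in nhds p. deriv (\<lambda>w. h (\<tau> w)) w = deriv \<tau> w * deriv h (\<tau> w)"
  proof -
    obtain A where A: "open A" "p \<in> A" "\<tau> holomorphic_on A" using assms(1) analytic_at by blast
    obtain B where B: "open B" "\<tau> p \<in> B" "h holomorphic_on B" using Suc.prems analytic_at by blast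
    let ?C = "A \<inter> \<tau> -` B"
    have "open ?C" using A B by (metis continuous_open_preimage holomorphic_on_imp_continuous_on)
    moreover have "p \<in> ?C" using A B by simp
    moreover have "deriv (\<lambda>w. h (\<tau> w)) w = deriv \<tau> w * deriv h (\<tau> w)" if "w \<in> ?C" for w
    proof -
      have "\<tau> field_differentiable at w" "h field_differentiable at (\<tau> w)"
        using that A B by (auto simp: holomorphic_on_imp_differentiable_at)
      from deriv_chain[OF this] show ?thesis by (simp add: o_def mult.commute)
    qed
    ultimately show ?thesis unfolding eventually_nhds by blast
  qed
  have a: "deriv h analytic_on {\<tau> p}" "deriv \<tau> analytic_on {p}" using Suc.prems assms(1) by (auto intro: analytic_deriv)
  have "vanish k (\<lambda>w. deriv h (\<tau> w)) p" by (rule Suc.IH[OF a(1)]) (use Suc.prems in \<open>simp add: vanish_Suc\<close>)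
  moreover have "(\<lambda>w. deriv h (\<tau> w)) analytic_on {p}"
    using analytic_on_compose[OF assms(1), of "deriv h"] a by (simp add: o_def)
  ultimately have "vanish k (\<lambda>w. deriv \<tau> w * deriv h (\<tau> w)) p" using a(2) by (intro vanish_mult)
  then show ?case using Suc.prems by (simp add: vanish_Suc vanish_cong[OF ev])
qed simp

text \<open>Contact along the diagonal: with \<open>E p w = (\<Sum>k\<in>I. a k p * b k w)\<close>, differentiating the
  \<open>w\<close>-derivatives of \<open>E\<close> along \<open>w = p\<close> relates the orders of vanishing of \<open>E\<close> and of \<open>\<partial>E/\<partial>p\<close>.\<close>

lemma diagonal_derivative:
  assumes D: "open D" and I: "finite I"
    and a: "\<And>k. k \<in> I \<Longrightarrow> a k holomorphic_on D" and b: "\<And>k. k \<in> I \<Longrightarrow> b k holomorphic_on D"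
    and p: "p \<in> D"
  shows "(deriv ^^ m) (\<lambda>w. \<Sum>k\<in>I. c k * b k w) p = (\<Sum>k\<in>I. c k * (deriv ^^ m) (b k) p)"
    and "((\<lambda>p. (deriv ^^ m) (\<lambda>w. \<Sum>k\<in>I. a k p * b k w) p) has_field_derivative
      (deriv ^^ m) (\<lambda>w. \<Sum>k\<in>I. deriv (a k) p * b k w) p + (deriv ^^ Suc m) (\<lambda>w. \<Sum>k\<in>I. a k p * b k w) p) (at p)"
proof -
  have 1: "(deriv ^^ m) (\<lambda>w. \<Sum>k\<in>I. c k * b k w) q = (\<Sum>k\<in>I. c k * (deriv ^^ m) (b k) q)" if "q \<in> D" for m c q
    using I b
  proof (induction I rule: finite_induct)
    case (insert x F)
    have h: "(\<lambda>w. c x * b x w) holomorphic_on D" "(\<lambda>w. \<Sum>k\<in>F. c k * b k w) holomorphic_on D"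
      using insert.prems by (auto intro!: holomorphic_intros)
    show ?case using insert higher_deriv_add[OF h D that, of m] higher_deriv_cmult[of "b x" D q m "c x"] that D by simp
  qed simp
  show "(deriv ^^ m) (\<lambda>w. \<Sum>k\<in>I. c k * b k w) p = (\<Sum>k\<in>I. c k * (deriv ^^ m) (b k) p)" by (rule 1[OF p])
  have "((\<lambda>p. \<Sum>k\<in>I. a k p * (deriv ^^ m) (b k) p) has_field_derivative
     (\<Sum>k\<in>I. deriv (a k) p * (deriv ^^ m) (b k) p + (deriv ^^ Suc m) (b k) p * a k p)) (at p)"
    using a b by (intro DERIV_sum DERIV_mult holomorphic_derivI[OF _ D p] has_field_derivative_higher_deriv[OF _ D p])
  then have "((\<lambda>p. (deriv ^^ m) (\<lambda>w. \<Sum>k\<in>I. a k p * b k w) p) has_field_derivative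
     (\<Sum>k\<in>I. deriv (a k) p * (deriv ^^ m) (b k) p + (deriv ^^ Suc m) (b k) p * a k p)) (at p)"
    by (rule has_field_derivative_transform_within_open[OF _ D p]) (simp only: 1)
  then show "((\<lambda>p. (deriv ^^ m) (\<lambda>w. \<Sum>k\<in>I. a k p * b k w) p) has_field_derivative
      (deriv ^^ m) (\<lambda>w. \<Sum>k\<in>I. deriv (a k) p * b k w) p + (deriv ^^ Suc m) (\<lambda>w. \<Sum>k\<in>I. a k p * b k w) p) (at p)"
    unfolding 1[OF p] by (simp only: sum.distrib mult.commute)
qed

text \<open>On the diagonal the \<open>m\<close>-th \<open>w\<close>-derivative of the sum is
  identically zero, so its total derivative vanishes; the latter is the \<open>w\<close>-derivative
  of order \<open>m + 1\<close>, again zero, plus the required \<open>m\<close>-th derivative. One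
  order is lost because order \<open>m + 1\<close> is used.\<close>

lemma diagonal_vanish_down:
  assumes D: "open D" and I: "finite I"
    and a: "\<And>k. k \<in> I \<Longrightarrow> a k holomorphic_on D" and b: "\<And>k. k \<in> I \<Longrightarrow> b k holomorphic_on D"
    and v: "\<And>p. p \<in> D \<Longrightarrow> vanish (Suc n) (\<lambda>w. \<Sum>k\<in>I. a k p * b k w) p"
    and p: "p \<in> D"
  shows "vanish n (\<lambda>w. \<Sum>k\<in>I. deriv (a k) p * b k w) p"
  unfolding vanish_def
proof (intro allI impI)
  fix m assume m: "m < n"
  have "(deriv ^^ m) (\<lambda>w. \<Sum>k\<in>I. deriv (a k) p * b k w) p + (deriv ^^ Suc m) (\<lambda>w. \<Sum>k\<in>I. a k p * b k w) p = 0"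
    by (rule DERIV_eq_on_open[OF D p _ diagonal_derivative(2)[OF D I a b p] DERIV_const[of 0]])
      (use v m in \<open>auto simp: vanish_def\<close>)
  moreover have "(deriv ^^ Suc m) (\<lambda>w. \<Sum>k\<in>I. a k p * b k w) p = 0"
    using v[OF p] m unfolding vanish_def by blast
  ultimately show "(deriv ^^ m) (\<lambda>w. \<Sum>k\<in>I. deriv (a k) p * b k w) p = 0" by simp
qed

text \<open>The same total derivative read the other way: once the \<open>m\<close>-th
  \<open>w\<close>-derivative is zero along the whole diagonal and the part with
  \<open>deriv (a k)\<close> is known to vanish, the next \<open>w\<close>-derivative vanishes. One
  order is gained.\<close>

lemma diagonal_vanish_up:
  assumes D: "open D" and I: "finite I"
    and a: "\<And>k. k \<in> I \<Longrightarrow> a k holomorphic_on D" and b: "\<And>k. k \<in> I \<Longrightarrow> b k holomorphic_on D"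
    and v: "\<And>p. p \<in> D \<Longrightarrow> vanish n (\<lambda>w. \<Sum>k\<in>I. deriv (a k) p * b k w) p"
    and 0: "\<And>p. p \<in> D \<Longrightarrow> (\<Sum>k\<in>I. a k p * b k p) = 0"
    and p: "p \<in> D"
  shows "vanish (Suc n) (\<lambda>w. \<Sum>k\<in>I. a k p * b k w) p"
proof -
  have "\<forall>p\<in>D. (deriv ^^ m) (\<lambda>w. \<Sum>k\<in>I. a k p * b k w) p = 0" if "m < Suc n" for m
    using that
  proof (induction m)
    case (Suc m)
    show ?case
    proof
      fix q assume q: "q \<in> D"
      have "(deriv ^^ m) (\<lambda>w. \<Sum>k\<in>I. deriv (a k) q * b k w) q + (deriv ^^ Suc m) (\<lambda>w. \<Sum>k\<in>I. a k q * b k w) q = 0"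
        by (rule DERIV_eq_on_open[OF D q _ diagonal_derivative(2)[OF D I a b q] DERIV_const[of 0]])
          (use Suc in auto)
      moreover have "(deriv ^^ m) (\<lambda>w. \<Sum>k\<in>I. deriv (a k) q * b k w) q = 0"
        using v[OF q] Suc.prems unfolding vanish_def by simp
      ultimately show "(deriv ^^ Suc m) (\<lambda>w. \<Sum>k\<in>I. a k q * b k w) q = 0" by simp
    qed
  qed (use 0 in simp)
  then show ?thesis using p by (simp add: vanish_def)
qed

text \<open>Separates the variables for the diagonal lemmas: the matrix entries will depend on
  \<open>p\<close>, the other factors on \<open>w\<close>, and the sum runs over pairs of
  indices.\<close>

lemma sympl_matvec_sum:
  fixes A :: "complex^4^4"
  shows "sympl (A *v x) y = (\<Sum>k\<in>UNIV. A $ fst k $ snd k * (x $ snd k * sympl (axis (fst k) 1) y))"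
proof -
  have "(\<Sum>k\<in>UNIV. A $ fst k $ snd k * (x $ snd k * sympl (axis (fst k) 1) y)) =
    (\<Sum>i\<in>UNIV. \<Sum>j\<in>UNIV. A $ i $ j * (x $ j * sympl (axis i 1) y))"
    by (simp add: sum.cartesian_product split_def)
  also have "\<dots> = sympl (A *v x) y"
    unfolding sympl_def matrix_vector_mult_def sum_4 vec_lambda_beta by (simp add: axis_def algebra_simps)
  finally show ?thesis ..
qed

lemma diagonal_sympl_down:
  fixes M :: "complex \<Rightarrow> complex^4^4"
  assumes D: "open D" and M: "mhol D M" and x: "vhol D x" and y: "vhol D y"
    and v: "\<And>p. p \<in> D \<Longrightarrow> vanish (Suc n) (\<lambda>w. sympl (M p *v x w) (y w)) p" and p: "p \<in> D"
  shows "vanish n (\<lambda>w. sympl (md M p *v x w) (y w)) p"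
proof -
  have d: "md M p $ i $ j = deriv (\<lambda>p. M p $ i $ j) p" for i j by (simp add: md_def)
  show ?thesis
    unfolding sympl_matvec_sum d
    by (rule diagonal_vanish_down[OF D finite_class.finite_UNIV mhol_D[OF M]
          holomorphic_on_mult[OF vhol_D[OF x] sympl_hol[OF vhol_const y]] v[unfolded sympl_matvec_sum] p])
qed

lemma diagonal_sympl_up:
  fixes M :: "complex \<Rightarrow> complex^4^4"
  assumes D: "open D" and M: "mhol D M" and x: "vhol D x" and y: "vhol D y"
    and 0: "\<And>p. p \<in> D \<Longrightarrow> sympl (M p *v x p) (y p) = 0"
    and v: "\<And>p. p \<in> D \<Longrightarrow> vanish n (\<lambda>w. sympl (md M p *v x w) (y w)) p" and p: "p \<in> D"
  shows "vanish (Suc n) (\<lambda>w. sympl (M p *v x w) (y w)) p"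
proof -
  have d: "md M p $ i $ j = deriv (\<lambda>p. M p $ i $ j) p" for i j p by (simp add: md_def)
  show ?thesis
    unfolding sympl_matvec_sum
    by (rule diagonal_vanish_up[OF D finite_class.finite_UNIV mhol_D[OF M]
          holomorphic_on_mult[OF vhol_D[OF x] sympl_hol[OF vhol_const y]] v[unfolded sympl_matvec_sum d]
          0[unfolded sympl_matvec_sum] p])
qed

section \<open>Legendrian curves\<close>

text \<open>The value 1 of the second pairing is a normalization of scale: it holds after rescaling,
  see \<open>legendrian_rescale\<close>, and determines \<open>v\<close> up to sign in a given
  coordinate.\<close>

definition legendrian :: "complex set \<Rightarrow> (complex \<Rightarrow> complex^4) \<Rightarrow> bool" where
  "legendrian D v \<longleftrightarrow> open D \<and> vhol D v \<and>
     (\<forall>z\<in>D. sympl (v z) (vd v z) = 0 \<and> sympl (vd v z) (vd (vd v) z) = 1)"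

lemma legendrian_jets:
  assumes "legendrian D v" "z \<in> D"
  shows "sympl (v z) (vd v z) = 0" "sympl (v z) (vd (vd v) z) = 0"
    "sympl (vd v z) (vd (vd v) z) = 1" "sympl (vd v z) (vd (vd (vd v)) z) = 0"
    "sympl (v z) (vd (vd (vd v)) z) = -1" "sympl (v z) (vd (vd (vd (vd v))) z) = 0"
proof -
  have D: "open D" and v: "vhol D v" and
    L: "\<And>z. z \<in> D \<Longrightarrow> sympl (v z) (vd v z) = 0" "\<And>z. z \<in> D \<Longrightarrow> sympl (vd v z) (vd (vd v) z) = 1"
    using assms by (auto simp: legendrian_def)
  note h = v vhol_vd[OF v D] vhol_vd[OF vhol_vd[OF v D] D] vhol_vd[OF vhol_vd[OF vhol_vd[OF v D] D] D]
  have 02: "sympl (v z) (vd (vd v) z) = 0" if "z \<in> D" for z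
    using sympl_const_vd[OF h(1,2) D L(1) that] by simp
  have 13: "sympl (vd v z) (vd (vd (vd v)) z) = 0" if "z \<in> D" for z
    using sympl_const_vd[OF h(2,3) D L(2) that] by simp
  have 03: "sympl (v z) (vd (vd (vd v)) z) = -1" if "z \<in> D" for z
    using sympl_const_vd[OF h(1,3) D 02 that] L(2)[OF that] by (simp add: add_eq_0_iff)
  have 04: "sympl (v z) (vd (vd (vd (vd v))) z) = 0" if "z \<in> D" for z
    using sympl_const_vd[OF h(1,4) D 03 that] 13[OF that] by simp
  show "sympl (v z) (vd v z) = 0" "sympl (v z) (vd (vd v) z) = 0"
    "sympl (vd v z) (vd (vd v) z) = 1" "sympl (vd v z) (vd (vd (vd v)) z) = 0"
    "sympl (v z) (vd (vd (vd v)) z) = -1" "sympl (v z) (vd (vd (vd (vd v))) z) = 0"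
    using L 02 13 03 04 assms(2) by auto
qed

lemma columns_exist: "\<exists>S :: complex \<Rightarrow> complex^4^4. \<forall>z. column 1 (S z) = a z \<and> column 2 (S z) = b z \<and> column 3 (S z) = c z \<and> column 4 (S z) = (d z :: complex^4)"
  by (rule exI[of _ "\<lambda>z. \<chi> i j. if j = 1 then a z $ i else if j = 2 then b z $ i else if j = 3 then c z $ i else d z $ i"])
    (simp add: column_def)

text \<open>Starting from columns \<open>v\<close> and \<open>v'\<close> with
  \<open>\<phi>\<^sup>4\<^sub>2 = 1\<close>, the equation for the first column gives
  \<open>\<phi>\<^sup>1\<^sub>1 = 0\<close>, hence \<open>\<phi>\<^sup>2\<^sub>2 = 0\<close>. The
  normalization then dictates the other columns through the derivatives of columns 2 and 4, up to
  one function \<open>a = \<phi>\<^sup>1\<^sub>2\<close>, which symplecticity fixes.\<close>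

lemma legendrian_frame:
  assumes "legendrian D v"
  obtains S where "Sp_hol D S" "\<And>z. z \<in> D \<Longrightarrow> column 1 (S z) = v z" "\<And>z. z \<in> D \<Longrightarrow> column 2 (S z) = vd v z"
    "\<And>z. z \<in> D \<Longrightarrow> \<exists>b c. column 3 (S z) = b *s vd v z - vd (vd (vd v)) z + c *s v z"
    "\<And>z. z \<in> D \<Longrightarrow> \<exists>a. column 4 (S z) = vd (vd v) z - a *s v z"
    "\<And>z. z \<in> D \<Longrightarrow> normalized_form (mcP S z)" "\<And>z. z \<in> D \<Longrightarrow> mcP S z $ 4 $ 2 = 1"
proof -
  have D: "open D" and v: "vhol D v" using assms by (auto simp: legendrian_def)
  note h = v vhol_vd[OF v D] vhol_vd[OF vhol_vd[OF v D] D] vhol_vd[OF vhol_vd[OF vhol_vd[OF v D] D] D]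
  note J = legendrian_jets[OF assms]
  define r where "r = (\<lambda>z. sympl (vd (vd v) z) (vd (vd (vd v)) z))"
  \<comment> \<open>\<open>7/3\<close> is forced by \<open>4 \<phi>\<^sup>1\<^sub>2 = 3 \<phi>\<^sup>2\<^sub>4\<close>, and then \<open>- 3/10\<close> by \<open>\<omega>(A\<^sub>3, A\<^sub>4) = 0\<close>.\<close>
  define a where "a = (\<lambda>z. - 3/10 * r z)"
  have a: "a holomorphic_on D" unfolding a_def r_def by (intro holomorphic_intros sympl_hol h)
  have a': "deriv a holomorphic_on D" using a D by (rule holomorphic_deriv)
  define A4 where "A4 = (\<lambda>z. vd (vd v) z - a z *s v z)"
  define A3 where "A3 = (\<lambda>z. (7/3 * a z) *s vd v z - vd (vd (vd v)) z + deriv a z *s v z)"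
  obtain S :: "complex \<Rightarrow> complex^4^4" where S: "\<And>z. column 1 (S z) = v z" "\<And>z. column 2 (S z) = vd v z"
    "\<And>z. column 3 (S z) = A3 z" "\<And>z. column 4 (S z) = A4 z"
    using columns_exist[of v "vd v" A3 A4] by blast
  have h4: "vhol D A4" unfolding A4_def by (intro vhol_diff vhol_scale h a)
  have h3: "vhol D A3" unfolding A3_def by (intro vhol_add vhol_diff vhol_scale h a a' holomorphic_intros)
  have hS: "mhol D S"
  proof (rule mhol_columns)
    show "vhol D (\<lambda>z. column k (S z))" for k
      using exhaust_4[of k] h h3 h4 by (auto simp: S)
  qed
  have s21: "sympl (vd v z) (v z) = 0" "sympl (vd (vd v) z) (v z) = 0" "sympl (vd (vd v) z) (vd v z) = -1"
    "sympl (vd (vd (vd v)) z) (vd v z) = 0" "sympl (vd (vd (vd v)) z) (v z) = 1"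
    "sympl (vd (vd v) z) (vd (vd (vd v)) z) = r z" "sympl (vd (vd (vd v)) z) (vd (vd v) z) = - r z" if "z \<in> D" for z
    using J[OF that] sympl_swap[of "vd v z" "v z"] sympl_swap[of "vd (vd v) z" "v z"]
      sympl_swap[of "vd (vd v) z" "vd v z"] sympl_swap[of "vd (vd (vd v)) z" "vd v z"]
      sympl_swap[of "vd (vd (vd v)) z" "v z"] sympl_swap[of "vd (vd (vd v)) z" "vd (vd v) z"]
    by (simp_all add: r_def)
  have Sp: "S z \<in> Sp" if "z \<in> D" for z
    by (rule SpI) (simp_all add: S A3_def A4_def sympl_linear J[OF that] s21[OF that], simp add: a_def)
  have SH: "Sp_hol D S" using D hS Sp by (simp add: Sp_hol_def)
  have md: "column 1 (md S z) = column 2 (S z)" "column 2 (md S z) = column 4 (S z) + a z *s column 1 (S z)"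
    "column 4 (md S z) = - column 3 (S z) + (4/3 * a z) *s column 2 (S z)" if "z \<in> D" for z
  proof -
    have "column k (md S z) = vd (\<lambda>z. column k (S z)) z" for k by (simp add: vd_column)
    moreover have "vd A4 z = - A3 z + (4/3 * a z) *s vd v z"
    proof -
      have "vd A4 z = vd (vd (vd v)) z - (deriv a z *s v z + a z *s vd v z)"
        unfolding A4_def by (simp add: vd_diff[OF h(3) vhol_scale[OF a h(1)] D that] vd_scale[OF a h(1) D that])
      then show ?thesis by (simp add: A3_def vec_eq_iff algebra_simps)
    qed
    ultimately show "column 1 (md S z) = column 2 (S z)" "column 2 (md S z) = column 4 (S z) + a z *s column 1 (S z)"
      "column 4 (md S z) = - column 3 (S z) + (4/3 * a z) *s column 2 (S z)"
      by (simp_all add: S A4_def)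
  qed
  have c: "sympl (column 2 (S z)) (column 1 (S z)) = 0" "sympl (column 4 (S z)) (column 3 (S z)) = 0"
    if "z \<in> D" for z
    using Sp_columns[OF Sp[OF that]] sympl_swap[of "column 2 (S z)" "column 1 (S z)"] sympl_swap[of "column 4 (S z)" "column 3 (S z)"] by simp_all
  have n: "normalized_form (mcP S z)" "mcP S z $ 4 $ 2 = 1" if "z \<in> D" for z
    using Sp_columns[OF Sp[OF that]] c[OF that]
    by (simp_all add: normalized_form_def mcP_nth md[OF that] sympl_linear)
  show ?thesis using that[OF SH S(1) S(2) _ _ n] S(3,4) unfolding A3_def A4_def by blast
qed

text \<open>The frame of \<open>legendrian_frame\<close> is a triangular combination of
  \<open>v\<close> and its first three derivatives, so these span the whole space and the form is
  nondegenerate.\<close>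

lemma legendrian_span:
  assumes L: "legendrian D v" and z: "z \<in> D"
    and 0: "sympl (v z) d = 0" "sympl (vd v z) d = 0" "sympl (vd (vd v) z) d = 0" "sympl (vd (vd (vd v)) z) d = 0"
  shows "d = 0"
proof -
  obtain S where S: "Sp_hol D S" "\<And>z. z \<in> D \<Longrightarrow> column 1 (S z) = v z" "\<And>z. z \<in> D \<Longrightarrow> column 2 (S z) = vd v z"
    "\<And>z. z \<in> D \<Longrightarrow> \<exists>b c. column 3 (S z) = b *s vd v z - vd (vd (vd v)) z + c *s v z"
    "\<And>z. z \<in> D \<Longrightarrow> \<exists>a. column 4 (S z) = vd (vd v) z - a *s v z"
    using legendrian_frame[OF L] by metis
  have Sp: "S z \<in> Sp" using S(1) z by (simp add: Sp_hol_def)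
  have "sympl (column k (S z)) d = 0" for k
    using exhaust_4[of k] S(2)[OF z] S(3)[OF z] S(4)[OF z] S(5)[OF z] by (auto simp: sympl_linear 0)
  then have "sympl d (column k (S z)) = 0" "sympl (column k (S z)) d = 0" for k
    using sympl_swap[of d "column k (S z)"] by simp_all
  then show ?thesis using Sp_expand[OF Sp, of d] by simp
qed

text \<open>A term with the third derivative would be visible in the pairing of \<open>v\<close>
  with its fourth derivative, which is zero. The coefficients come from pairing with the first three
  derivatives of \<open>v\<close>.\<close>

lemma legendrian_fourth_derivative:
  assumes L: "legendrian D v"
  obtains \<alpha> \<beta> \<gamma> where "\<alpha> holomorphic_on D" "\<beta> holomorphic_on D" "\<gamma> holomorphic_on D"
    "\<And>z. z \<in> D \<Longrightarrow> vd (vd (vd (vd v))) z = \<alpha> z *s v z + \<beta> z *s vd v z + \<gamma> z *s vd (vd v) z"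
proof -
  have D: "open D" and v: "vhol D v" using L by (auto simp: legendrian_def)
  note h1 = vhol_vd[OF v D]
  note h2 = vhol_vd[OF h1 D]
  note h3 = vhol_vd[OF h2 D]
  note h4 = vhol_vd[OF h3 D]
  let ?v2 = "vd (vd v)" let ?v3 = "vd ?v2" let ?v4 = "vd ?v3"
  define \<gamma> where "\<gamma> = (\<lambda>z. sympl (vd v z) (?v4 z))"
  define \<beta> where "\<beta> = (\<lambda>z. - sympl (?v2 z) (?v4 z))"
  define \<alpha> where "\<alpha> = (\<lambda>z. sympl (?v3 z) (?v4 z) + sympl (?v2 z) (?v3 z) * \<gamma> z)"
  show ?thesis
  proof
    show "\<alpha> holomorphic_on D" "\<beta> holomorphic_on D" "\<gamma> holomorphic_on D" unfolding \<alpha>_def \<beta>_def \<gamma>_def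
      by (intro holomorphic_intros sympl_hol h1 h2 h3 h4)+
    fix z assume z: "z \<in> D"
    note J = legendrian_jets[OF L z]
    have sw: "sympl (vd v z) (v z) = 0" "sympl (?v2 z) (v z) = 0" "sympl (?v2 z) (vd v z) = -1"
       "sympl (?v3 z) (v z) = 1" "sympl (?v3 z) (vd v z) = 0" "sympl (?v3 z) (?v2 z) = - sympl (?v2 z) (?v3 z)"
      using J sympl_swap[of "vd v z" "v z"] sympl_swap[of "?v2 z" "v z"] sympl_swap[of "?v2 z" "vd v z"]
        sympl_swap[of "?v3 z" "v z"] sympl_swap[of "?v3 z" "vd v z"] sympl_swap[of "?v3 z" "?v2 z"] by simp_all
    have "?v4 z - (\<alpha> z *s v z + \<beta> z *s vd v z + \<gamma> z *s ?v2 z) = 0"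
      by (rule legendrian_span[OF L z]) (simp_all add: sympl_linear J sw \<alpha>_def \<beta>_def \<gamma>_def)
    then show "?v4 z = \<alpha> z *s v z + \<beta> z *s vd v z + \<gamma> z *s ?v2 z" by simp
  qed
qed

text \<open>Successive differentiation bounds from below the orders of vanishing of all products
  \<open>Q(V i, V j)\<close>, \<open>V i\<close> the \<open>i\<close>-th derivative of \<open>v\<close>, with \<open>i, j \<le> 3\<close>; the process closes up because the fourth derivative of a
  Legendrian \<open>v\<close> is a combination of \<open>v\<close>, \<open>v'\<close> and \<open>v''\<close>.\<close>

lemma quadratic_form_rigid:
  fixes Q :: "complex^4 \<Rightarrow> complex^4 \<Rightarrow> complex"
  assumes L: "legendrian D v" and p: "p \<in> D"
    and Q: "\<And>x y. Q x y = sympl (N *v x) (M *v y)" and sym: "\<And>x y. Q x y = Q y x"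
    and v00: "vanish 5 (\<lambda>w. Q (v w) (v w)) p" and v01: "vanish 5 (\<lambda>w. Q (v w) (vd v w)) p"
    and v11: "vanish 5 (\<lambda>w. Q (vd v w) (vd v w)) p"
  shows "Q x y = 0"
proof -
  have D: "open D" and v: "vhol D v" using L by (auto simp: legendrian_def)
  define V where "V = (\<lambda>i::nat. (vd ^^ i) v)"
  have V: "vhol D (V i)" for i unfolding V_def by (induction i) (auto intro: v vhol_vd D)
  have Vn: "V 0 = v" "V 1 = vd v" "V 2 = vd (vd v)" "V 3 = vd (vd (vd v))" "V 4 = vd (vd (vd (vd v)))" "V (Suc i) = vd (V i)" for i
    by (simp_all add: V_def eval_nat_numeral)
  define q where "q = (\<lambda>i j w. Q (V i w) (V j w))"
  have qs: "q i j w = q j i w" for i j w unfolding q_def by (rule sym)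
  have qh: "q i j holomorphic_on D" for i j
    unfolding q_def Q by (intro sympl_hol vhol_matvec mhol_const V)
  have qa: "q i j analytic_on {p}" for i j using qh D p analytic_at by blast
  have qd: "deriv (q i j) w = q (Suc i) j w + q i (Suc j) w" if "w \<in> D" for i j w
  proof -
    have m: "vhol D (\<lambda>w. A *v V i w)" "vd (\<lambda>w. A *v V i w) w = A *v V (Suc i) w" for A :: "complex^4^4" and i
      using vhol_matvec[OF mhol_const V] vd_matvec[OF mhol_const V D that, of A i] by (simp_all add: md_const Vn)
    show ?thesis unfolding q_def Q
      using sympl_DERIV[OF m(1)[of N i] m(1)[of M j] D that] by (simp add: m(2) DERIV_imp_deriv)
  qed
  have step: "vanish k (\<lambda>w. q i' j w + q i j' w) p"
    if "vanish l (q i j) p" "l = Suc k" "i' = Suc i" "j' = Suc j" for i j k l i' j'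
  proof (rule vanish_congI[OF D p])
    show "q i' j w + q i j' w = deriv (q i j) w" if "w \<in> D" for w
      using qd[OF that] \<open>i' = Suc i\<close> \<open>j' = Suc j\<close> by simp
  qed (use that in \<open>simp add: vanish_Suc\<close>)
  have sub: "vanish k g p" if "vanish k (\<lambda>w. f w + g w) p" "vanish k f p" "f analytic_on {p}" "g analytic_on {p}" for f g k
    using vanish_diff[OF analytic_on_add[OF that(3,4)] that(3) that(1,2)] by simp
  have cm: "vanish k f p" if "vanish k (\<lambda>w. c * f w) p" "c \<noteq> 0" "f analytic_on {p}" for f k and c :: complex
    using vanish_mult[OF _ _ that(1), of "\<lambda>_. 1 / c"] that by (simp add: analytic_intros)
  obtain \<alpha> \<beta> \<gamma> where abc: "\<alpha> holomorphic_on D" "\<beta> holomorphic_on D" "\<gamma> holomorphic_on D"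
    "\<And>z. z \<in> D \<Longrightarrow> vd (vd (vd (vd v))) z = \<alpha> z *s v z + \<beta> z *s vd v z + \<gamma> z *s vd (vd v) z"
    using legendrian_fourth_derivative[OF L] by metis
  have abca: "\<alpha> analytic_on {p}" "\<beta> analytic_on {p}" "\<gamma> analytic_on {p}" using abc D p analytic_at by blast+
  have q4: "vanish k (q i 4) p" if "vanish k (q i 0) p" "vanish k (q i 1) p" "vanish k (q i 2) p" for i k
  proof -
    have e: "q i 4 w = \<alpha> w * q i 0 w + \<beta> w * q i 1 w + \<gamma> w * q i 2 w" if "w \<in> D" for w
      unfolding q_def Vn Q abc(4)[OF that] by (simp add: matrix_vector_right_distrib vector_scalar_commute sympl_linear)
    show ?thesis
      by (rule vanish_congI[OF D p], erule e) (intro vanish_add vanish_mult analytic_on_add analytic_on_mult abca qa that)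
  qed
  have 00: "vanish 5 (q 0 0) p" and 01: "vanish 5 (q 0 1) p" and 11: "vanish 5 (q 1 1) p"
    using v00 v01 v11 unfolding q_def Vn by simp_all
  note mono = vanish_mono
  have 02: "vanish 4 (q 0 2) p"
  proof -
    have "vanish 4 (\<lambda>w. q 1 1 w + q 0 2 w) p" by (rule step[OF 01]) simp_all
    then show ?thesis by (rule sub[OF _ mono[OF 11] qa qa]) simp
  qed
  have 12: "vanish 4 (q 1 2) p"
  proof -
    have "vanish 4 (\<lambda>w. q 2 1 w + q 1 2 w) p" by (rule step[OF 11]) simp_all
    then have "vanish 4 (\<lambda>w. 2 * q 1 2 w) p" unfolding qs[of 2 1] by (simp only: mult_2)
    then show ?thesis by (rule cm[OF _ _ qa]) simp
  qed
  have 03: "vanish 3 (q 0 3) p"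
  proof -
    have "vanish 3 (\<lambda>w. q 1 2 w + q 0 3 w) p" by (rule step[OF 02]) simp_all
    then show ?thesis by (rule sub[OF _ mono[OF 12] qa qa]) simp
  qed
  have s: "vanish 3 (\<lambda>w. q 2 2 w + q 1 3 w) p" by (rule step[OF 12]) simp_all
  \<comment> \<open>Here the order stops falling: the fourth derivative is a combination of lower
    ones, so \<open>q 0 4\<close> inherits order 4, more than \<open>q 0 3\<close> is known to have.
    This separates \<open>q 1 3\<close> from \<open>q 2 2\<close>, of which so far only the sum is
    controlled.\<close>
  have 04: "vanish 4 (q 0 4) p" by (rule q4[OF mono[OF 00] mono[OF 01] 02]) simp_all
  have 10: "vanish 5 (q 1 0) p" using 01 unfolding qs[of 0 1] .
  have 14: "vanish 4 (q 1 4) p" by (rule q4[OF mono[OF 10] mono[OF 11] 12]) simp_all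
  have 13: "vanish 2 (q 1 3) p"
  proof -
    have "vanish 2 (\<lambda>w. q 1 3 w + q 0 4 w) p" by (rule step[OF 03]) simp_all
    then have "vanish 2 (\<lambda>w. q 0 4 w + q 1 3 w) p" by (simp only: add.commute)
    then show ?thesis by (rule sub[OF _ mono[OF 04] qa qa]) simp
  qed
  have 22: "vanish 2 (q 2 2) p"
  proof -
    have "vanish 2 (\<lambda>w. q 1 3 w + q 2 2 w) p" using mono[OF s, of 2] by (simp add: add.commute)
    then show ?thesis by (rule sub[OF _ 13 qa qa])
  qed
  \<comment> \<open>Differentiating the sum \<open>q 2 2 + q 1 3\<close>, known to order 3, is
    better than differentiating \<open>q 2 2\<close>, known only to order 2.\<close>
  have 23: "vanish 2 (q 2 3) p"
  proof -
    have e: "q 1 4 w + 3 * q 2 3 w = deriv (\<lambda>w. q 2 2 w + q 1 3 w) w" if "w \<in> D" for w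
    proof -
      have "deriv (\<lambda>w. q 2 2 w + q 1 3 w) w = deriv (q 2 2) w + deriv (q 1 3) w"
        by (intro deriv_add holomorphic_on_imp_differentiable_at[OF qh D that])
      also have "\<dots> = (q 3 2 w + q 2 3 w) + (q 2 3 w + q 1 4 w)"
        using qd[OF that, of 2 2] qd[OF that, of 1 3] by (simp add: eval_nat_numeral)
      finally show ?thesis by (simp add: qs[of 3 2])
    qed
    have "vanish 2 (deriv (\<lambda>w. q 2 2 w + q 1 3 w)) p" using s unfolding numeral_3_eq_3 vanish_Suc[of 2, unfolded numeral_2_eq_2] by (simp add: numeral_2_eq_2)
    then have "vanish 2 (\<lambda>w. q 1 4 w + 3 * q 2 3 w) p" by (rule vanish_congI[OF D p, rotated]) (erule e)
    then have "vanish 2 (\<lambda>w. 3 * q 2 3 w) p"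
      by (rule sub[OF _ mono[OF 14] qa]) (auto intro!: analytic_intros qa)
    then show ?thesis by (rule cm[OF _ _ qa]) simp
  qed
  have 20: "vanish 4 (q 2 0) p" using 02 unfolding qs[of 0 2] .
  have 21: "vanish 4 (q 2 1) p" using 12 unfolding qs[of 1 2] .
  have 24: "vanish 2 (q 2 4) p" by (rule q4[OF mono[OF 20] mono[OF 21] 22]) simp_all
  \<comment> \<open>The last entry keeps a single order. Starting with 4 in place of 5 the argument
    would kill every entry but this one, which is the entry left by
    \<open>t \<omega>(x, v)\<^sup>2\<close>.\<close>
  have 33: "vanish 1 (q 3 3) p"
  proof -
    have "vanish 1 (\<lambda>w. q 3 3 w + q 2 4 w) p" by (rule step[OF 23]) simp_all
    then have "vanish 1 (\<lambda>w. q 2 4 w + q 3 3 w) p" by (simp only: add.commute)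
    then show ?thesis by (rule sub[OF _ mono[OF 24] qa qa]) simp
  qed
  have z: "q i j p = 0" if "vanish k (q i j) p" "k > 0" for i j k using that unfolding vanish_def by fastforce
  have "q 0 0 p = 0" "q 0 1 p = 0" "q 0 2 p = 0" "q 0 3 p = 0" "q 1 1 p = 0" "q 1 2 p = 0" "q 1 3 p = 0"
     "q 2 2 p = 0" "q 2 3 p = 0" "q 3 3 p = 0"
    using z[OF 00] z[OF 01] z[OF 02] z[OF 03] z[OF 11] z[OF 12] z[OF 13] z[OF 22] z[OF 23] z[OF 33] by simp_all
  then have qz: "q i j p = 0" if "i \<in> {0,1,2,3}" "j \<in> {0,1,2,3}" for i j
    using that qs[of 1 0] qs[of 2 0] qs[of 3 0] qs[of 2 1] qs[of 3 1] qs[of 3 2] by auto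
  obtain S where S: "Sp_hol D S" "\<And>z. z \<in> D \<Longrightarrow> column 1 (S z) = v z" "\<And>z. z \<in> D \<Longrightarrow> column 2 (S z) = vd v z"
    "\<And>z. z \<in> D \<Longrightarrow> \<exists>b c. column 3 (S z) = b *s vd v z - vd (vd (vd v)) z + c *s v z"
    "\<And>z. z \<in> D \<Longrightarrow> \<exists>a. column 4 (S z) = vd (vd v) z - a *s v z"
    using legendrian_frame[OF L] by metis
  have lin: "Q (x + y) z = Q x z + Q y z" "Q (x - y) z = Q x z - Q y z" "Q (c *s x) z = c * Q x z"
      "Q z (x + y) = Q z x + Q z y" "Q z (x - y) = Q z x - Q z y" "Q z (c *s x) = c * Q z x" for x y z c
    unfolding Q by (simp_all add: matrix_vector_right_distrib matrix_vector_mult_diff_distrib vector_scalar_commute sympl_linear)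
  have QV: "Q (column k (S p)) (V j p) = 0" if "j \<in> {0,1,2,3}" for j k
    using exhaust_4[of k] S(2-)[OF p] qz[OF _ that, of 0] qz[OF _ that, of 1] qz[OF _ that, of 2] qz[OF _ that, of 3]
    unfolding q_def Vn by (auto simp: lin)
  have QS: "Q (column k (S p)) (column l (S p)) = 0" for k l
    using exhaust_4[of l] S(2-)[OF p] QV[of 0 k] QV[of 1 k] QV[of 2 k] QV[of 3 k]
    unfolding Vn by (auto simp: lin)
  have Sp: "S p \<in> Sp" using S(1) p by (simp add: Sp_hol_def)
  obtain a b c d where x: "x = a *s column 1 (S p) + b *s column 2 (S p) + c *s column 3 (S p) + d *s column 4 (S p)"
    using Sp_expand[OF Sp, of x] by blast
  obtain a' b' c' d' where y: "y = a' *s column 1 (S p) + b' *s column 2 (S p) + c' *s column 3 (S p) + d' *s column 4 (S p)"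
    using Sp_expand[OF Sp, of y] by blast
  show "Q x y = 0" unfolding x y by (simp add: lin QS)
qed

section \<open>Contact of order five and of order four on a disc\<close>

text \<open>Order 6 of vanishing is contact of order five. Differentiating along the diagonal
  produces \<open>M'(p)\<close> at the price of one order, but pairs it with the moving vectors
  \<open>M(w) y(w)\<close>, while the quadratic form at \<open>p\<close> needs
  \<open>M(p) y(w)\<close>. Since the planes \<open>M(w) f(w)\<close> and \<open>M(p) f(w)\<close>
  agree to order 6, one set of vectors is expressed by the other modulo order 6 and the resulting
  linear system is inverted. \<open>quadratic_form_rigid\<close> then gives
  \<open>M'(p) = 0\<close>.\<close>

lemma rigid_plane:
  assumes L: "legendrian D v" and M: "Sp_hol D M" and p: "p \<in> D"
    and c: "\<And>p x y. p \<in> D \<Longrightarrow> x \<in> {v, vd v} \<Longrightarrow> y \<in> {v, vd v} \<Longrightarrow>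
      vanish 6 (\<lambda>w. sympl (M p *v x w) (M w *v y w)) p"
  shows "md M p = 0"
proof -
  have D: "open D" and v: "vhol D v" using L by (auto simp: legendrian_def)
  have hM: "mhol D M" and MSp: "\<And>z. z \<in> D \<Longrightarrow> M z \<in> Sp" using M by (auto simp: Sp_hol_def)
  have hx: "vhol D x" if "x \<in> {v, vd v}" for x using that v vhol_vd[OF v D] by auto
  define N where "N = md M p"
  have c5: "vanish 5 (\<lambda>w. sympl (N *v x w) (M w *v y w)) p" if "x \<in> {v, vd v}" "y \<in> {v, vd v}" for x y
    unfolding N_def using c[OF _ that]
    by (intro diagonal_sympl_down[OF D hM hx[OF that(1)] vhol_matvec[OF hM hx[OF that(2)]] _ p]) simp
  obtain S where S: "Sp_hol D S" "\<And>z. z \<in> D \<Longrightarrow> column 1 (S z) = v z" "\<And>z. z \<in> D \<Longrightarrow> column 2 (S z) = vd v z"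
    using legendrian_frame[OF L] by metis
  have hS: "mhol D S" and SSp: "\<And>z. z \<in> D \<Longrightarrow> S z \<in> Sp" using S(1) by (auto simp: Sp_hol_def)
  let ?B = "\<lambda>k w. M p *v column k (S w)"
  have hB: "vhol D (?B k)" for k by (intro vhol_matvec mhol_const vhol_column hS)
  have hMx: "vhol D (\<lambda>w. M w *v y w)" "vhol D (\<lambda>w. N *v y w)" if "y \<in> {v, vd v}" for y
    using vhol_matvec[OF hM hx[OF that]] vhol_matvec[OF mhol_const hx[OF that]] by auto
  have an: "f analytic_on {p}" if "f holomorphic_on D" for f using that D p analytic_at by blast
  define a1 where "a1 = (\<lambda>y w. sympl (M w *v y w) (?B 3 w))"
  define a2 where "a2 = (\<lambda>y w. sympl (M w *v y w) (?B 4 w))"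
  have ha: "a1 y holomorphic_on D" "a2 y holomorphic_on D" if "y \<in> {v, vd v}" for y
    unfolding a1_def a2_def by (intro sympl_hol hMx hB that)+
  \<comment> \<open>Expansion in the frame \<open>M(p) S(w)\<close>; the coefficients of its third
    and fourth columns are exactly the contact functions of \<open>c\<close>, hence
    negligible.\<close>
  have expand: "M w *v y w = a1 y w *s ?B 1 w + a2 y w *s ?B 2 w
      + sympl (?B 1 w) (M w *v y w) *s ?B 3 w + sympl (?B 2 w) (M w *v y w) *s ?B 4 w" if "w \<in> D" for w y
    using Sp_expand[OF Sp_mult[OF MSp[OF p] SSp[OF that]], of "M w *v y w"] by (simp add: a1_def a2_def column_mult)
  have lin: "vanish 5 (\<lambda>w. a1 y w * sympl (N *v x w) (?B 1 w) + a2 y w * sympl (N *v x w) (?B 2 w)) p"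
    if x: "x \<in> {v, vd v}" and y: "y \<in> {v, vd v}" for x y
  proof -
    have e: "a1 y w * sympl (N *v x w) (?B 1 w) + a2 y w * sympl (N *v x w) (?B 2 w) =
       sympl (N *v x w) (M w *v y w) - sympl (N *v x w) (?B 3 w) * sympl (M p *v v w) (M w *v y w)
        - sympl (N *v x w) (?B 4 w) * sympl (M p *v vd v w) (M w *v y w)" if "w \<in> D" for w
      using arg_cong[OF expand[OF that, of y], of "sympl (N *v x w)"] S(2,3)[OF that] by (simp add: sympl_linear algebra_simps)
    have v6: "vanish 5 (\<lambda>w. sympl (M p *v z w) (M w *v y w)) p" if "z \<in> {v, vd v}" for z
      by (rule vanish_mono[OF c[OF p that y]]) simp
    have hz: "(\<lambda>w. sympl (M p *v z w) (M w *v y w)) holomorphic_on D" if "z \<in> {v, vd v}" for z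
      by (intro sympl_hol hMx y vhol_matvec mhol_const hx that)
    have hb: "(\<lambda>w. sympl (N *v x w) (?B k w)) holomorphic_on D" for k
      by (intro sympl_hol hMx x hB)
    have h0: "(\<lambda>w. sympl (N *v x w) (M w *v y w)) holomorphic_on D" by (intro sympl_hol hMx x y)
    show ?thesis
      by (rule vanish_congI[OF D p], erule e) (intro vanish_diff vanish_mult c5[OF x y] v6 an holomorphic_on_diff holomorphic_on_mult hz hb h0, simp_all)
  qed
  \<comment> \<open>The determinant of the system in \<open>lin\<close>. It is 1 at
    \<open>p\<close>, where the frame and the vectors \<open>M(w) y(w)\<close> match, so Cramer's
    rule applies near \<open>p\<close> without loss of order.\<close>
  define \<Delta> where "\<Delta> = (\<lambda>w. a1 v w * a2 (vd v) w - a2 v w * a1 (vd v) w)"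
  have h\<Delta>: "\<Delta> holomorphic_on D" unfolding \<Delta>_def by (intro holomorphic_intros ha) auto
  have "\<Delta> p = 1"
    unfolding \<Delta>_def a1_def a2_def sympl_Sp[OF MSp[OF p]]
    using Sp_columns[OF SSp[OF p]] by (simp add: S(2,3)[OF p])
  then have "\<forall>\<^sub>F w in nhds p. \<Delta> w \<noteq> 0"
    using continuous_at_avoid[of p \<Delta> 0] holomorphic_on_imp_continuous_on[OF h\<Delta>] D p
    by (metis continuous_on_eq_continuous_at eventually_nhds_x_imp_x isCont_def t1_space_nhds tendsto_imp_eventually_ne eventually_nhds_conv_at zero_neq_one)
  then have ev: "\<forall>\<^sub>F w in nhds p. \<Delta> w \<noteq> 0 \<and> w \<in> D" using eventually_nhds_in_open[OF D p] eventually_conj by blast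
  then obtain E where E: "open E" "p \<in> E" "\<And>w. w \<in> E \<Longrightarrow> \<Delta> w \<noteq> 0 \<and> w \<in> D" unfolding eventually_nhds by blast
  have h\<Delta>i: "(\<lambda>w. 1 / \<Delta> w) analytic_on {p}"
  proof -
    have "E \<subseteq> D" using E by auto
    then have "(\<lambda>w. 1 / \<Delta> w) holomorphic_on E"
      using E(3) holomorphic_on_subset[OF h\<Delta>] by (intro holomorphic_intros) auto
    then show ?thesis using E(1,2) analytic_at by blast
  qed
  have fin: "vanish 5 (\<lambda>w. sympl (N *v x w) (?B 1 w)) p" "vanish 5 (\<lambda>w. sympl (N *v x w) (?B 2 w)) p"
    if x: "x \<in> {v, vd v}" for x
  proof -
    let ?z = "\<lambda>k w. sympl (N *v x w) (?B k w)"
    let ?l = "\<lambda>y w. a1 y w * ?z 1 w + a2 y w * ?z 2 w"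
    have hz: "?z k holomorphic_on D" for k by (intro sympl_hol hMx x hB)
    have hl: "?l v analytic_on {p}" "?l (vd v) analytic_on {p}" by (intro an holomorphic_intros ha hz; simp)+
    have a: "a1 y analytic_on {p}" "a2 y analytic_on {p}" if "y \<in> {v, vd v}" for y using an ha that by auto
    have l: "vanish 5 (?l v) p" "vanish 5 (?l (vd v)) p" using lin[OF x] by auto
    have 1: "vanish 5 (\<lambda>w. 1 / \<Delta> w * (a2 (vd v) w * ?l v w - a2 v w * ?l (vd v) w)) p"
      by (intro vanish_mult vanish_diff h\<Delta>i analytic_on_diff analytic_on_mult hl a l) simp_all
    have 2: "vanish 5 (\<lambda>w. 1 / \<Delta> w * (a1 v w * ?l (vd v) w - a1 (vd v) w * ?l v w)) p"
      by (intro vanish_mult vanish_diff h\<Delta>i analytic_on_diff analytic_on_mult hl a l) simp_all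
    have e: "?z 1 w = 1 / \<Delta> w * (a2 (vd v) w * ?l v w - a2 v w * ?l (vd v) w)"
      "?z 2 w = 1 / \<Delta> w * (a1 v w * ?l (vd v) w - a1 (vd v) w * ?l v w)" if "w \<in> E" for w
      using E(3)[OF that] by (simp_all add: field_simps) (simp_all add: \<Delta>_def algebra_simps)
    show "vanish 5 (?z 1) p" by (rule vanish_congI[OF E(1,2)], erule e, rule 1)
    show "vanish 5 (?z 2) p" by (rule vanish_congI[OF E(1,2)], erule e, rule 2)
  qed
  define Q where "Q = (\<lambda>x y. sympl (N *v x) (M p *v y))"
  \<comment> \<open>Differentiate the invariance of \<open>sympl\<close> under \<open>M w\<close> at
    \<open>w = p\<close>.\<close>
  have sym: "Q x y = Q y x" for x y
  proof -
    have m: "vhol D (\<lambda>w. M w *v x)" "vd (\<lambda>w. M w *v x) p = N *v x" for x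
      using vhol_matvec[OF hM vhol_const] vd_matvec[OF hM vhol_const D p, of x] by (simp_all add: vd_const N_def)
    have "sympl (N *v x) (M p *v y) + sympl (M p *v x) (N *v y) = 0"
      using sympl_const_vd[OF m(1) m(1) D _ p, of x y "sympl x y"] sympl_Sp[OF MSp] by (simp add: m(2))
    then show ?thesis unfolding Q_def using sympl_swap[of "N *v y" "M p *v x"] by (simp add: add_eq_0_iff)
  qed
  have "Q x y = 0" for x y
  proof (rule quadratic_form_rigid[OF L p Q_def[THEN fun_cong, THEN fun_cong] sym])
    show "vanish 5 (\<lambda>w. Q (v w) (v w)) p"
      by (rule vanish_congI[OF D p _ fin(1)[of v]]) (simp_all add: Q_def S)
    show "vanish 5 (\<lambda>w. Q (v w) (vd v w)) p"
      by (rule vanish_congI[OF D p _ fin(2)[of v]]) (simp_all add: Q_def S)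
    show "vanish 5 (\<lambda>w. Q (vd v w) (vd v w)) p"
      by (rule vanish_congI[OF D p _ fin(2)[of "vd v"]]) (simp_all add: Q_def S)
  qed
  then have "sympl (N *v x) (M p *v y) = 0" for x y by (simp add: Q_def)
  then have "N *v x = 0" for x
    using Sp_expand[OF MSp[OF p], of "N *v x"] sympl_swap[of "column _ (M p)" "N *v x"] by (simp flip: mat_vec_axis)
  then have "column k N = 0" for k by (simp flip: mat_vec_axis)
  then show ?thesis unfolding N_def[symmetric] by (simp add: vec_eq_iff column_def)
qed

text \<open>The converse mechanism: \<open>M'(p)\<close> contributes a product of two factors, each
  vanishing to order 2 along the planes of \<open>f\<close>, so order 4, and
  \<open>diagonal_sympl_up\<close> adds one. Order 5 of vanishing is contact of order four.\<close>

lemma deformation_plane: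
  assumes L: "legendrian (ball z0 r) v" and r: "r > 0"
  obtains \<rho> M where "\<rho> > 0" "\<rho> \<le> r" "Sp_hol (ball z0 \<rho>) M"
    "\<And>p x y. p \<in> ball z0 \<rho> \<Longrightarrow> x \<in> {v, vd v} \<Longrightarrow> y \<in> {v, vd v} \<Longrightarrow>
      vanish 5 (\<lambda>w. sympl (M p *v x w) (M w *v y w)) p"
    "\<And>S z. Sp_hol (ball z0 \<rho>) S \<Longrightarrow> z \<in> ball z0 \<rho> \<Longrightarrow> column 1 (S z) = v z \<Longrightarrow>
      mcP (\<lambda>z. M z ** S z) z = mcP S z + (\<chi> i j. if i = 1 \<and> j = 3 then - t else 0)"
proof -
  \<comment> \<open>The element of the Lie algebra that corresponds to the quadratic form \<open>t \<omega>(x, v)\<^sup>2\<close>.\<close>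
  define N where "N = (\<lambda>z. \<chi> i j. t * sympl (axis j 1) (v z) * v z $ i)"
  have v: "vhol (ball z0 r) v" using L by (auto simp: legendrian_def)
  have N: "mhol (ball z0 r) N"
    unfolding N_def mhol_def by (auto intro!: holomorphic_intros sympl_hol vhol_const v vhol_D[OF v])
  have Nv: "N z *v x = (t * sympl x (v z)) *s v z" for z x
    by (simp add: N_def vec_eq_iff matrix_vector_mult_def sum_4 sympl_def axis_def algebra_simps)
  have sp: "sympl (N z *v x) y + sympl x (N z *v y) = 0" for z x y
    unfolding Nv by (simp add: sympl_linear) (simp add: sympl_def algebra_simps)
  obtain \<rho> M where M: "\<rho> > 0" "\<rho> \<le> r" "Sp_hol (ball z0 \<rho>) M" "M z0 = mat 1"
    "\<And>z. z \<in> ball z0 \<rho> \<Longrightarrow> md M z = M z ** N z"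
    using linear_ode_symplectic[OF N r sp] by metis
  let ?D = "ball z0 \<rho>"
  have hM: "mhol ?D M" and MSp: "\<And>z. z \<in> ?D \<Longrightarrow> M z \<in> Sp" using M(3) by (auto simp: Sp_hol_def)
  have Dr: "z \<in> ball z0 r" if "z \<in> ?D" for z using that M(2) by auto
  note J = legendrian_jets[OF L Dr]
  have vD: "vhol ?D v" using v by (rule vhol_subset) (use M(2) in auto)
  note v1 = vhol_vd[OF vD open_ball]
  have Mx: "vhol ?D (\<lambda>w. M w *v x w)" "vd (\<lambda>w. M w *v x w) p = M p *v ((t * sympl (x p) (v p)) *s v p + vd x p)"
    if "vhol ?D x" "p \<in> ?D" for x p
    using vhol_matvec[OF hM that(1)] vd_matvec[OF hM that(1) open_ball that(2)]
    by (simp_all add: M(5)[OF that(2)] Nv matrix_vector_right_distrib flip: matrix_vector_mul_assoc)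
  have "vanish (Suc 4) (\<lambda>w. sympl (M p *v x w) (M w *v y w)) p"
    if p: "p \<in> ?D" and x: "x \<in> {v, vd v}" and y: "y \<in> {v, vd v}" for p x y
  proof (rule diagonal_sympl_up[OF open_ball hM _ Mx(1) _ _ p])
    have hx: "vhol ?D x" and hy: "vhol ?D y" using x y vD v1 by auto
    show "vhol ?D x" "vhol ?D y" "p \<in> ?D" using hx hy p by auto
    have sw: "sympl (vd v p) (v p) = 0" "sympl (vd (vd v) p) (v p) = 0" if "p \<in> ?D" for p
      using J[OF that] sympl_swap[of "vd v p" "v p"] sympl_swap[of "vd (vd v) p" "v p"] by simp_all
    show "sympl (M p *v x p) (M p *v y p) = 0" if "p \<in> ?D" for p
      using x y J[OF that] sw[OF that] by (auto simp: sympl_Sp[OF MSp[OF that]])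
    \<comment> \<open>One factor pairs \<open>x(w)\<close> with \<open>v(p)\<close>, the other
      \<open>M(p) v(p)\<close> with \<open>M(w) y(w)\<close>. Each has a double zero because
      \<open>v\<close> is orthogonal to \<open>v\<close>, \<open>v'\<close> and \<open>v''\<close>,
      so that differentiating \<open>v\<close> or \<open>v'\<close> once stays orthogonal to
      \<open>v\<close>; the extra term of \<open>M'\<close> is a multiple of
      \<open>M v\<close>.\<close>
    show "vanish 4 (\<lambda>w. sympl (md M p *v x w) (M w *v y w)) p" if p: "p \<in> ?D" for p
    proof -
      have e: "sympl (md M p *v x w) (M w *v y w) = (t * sympl (x w) (v p)) * sympl (M p *v v p) (M w *v y w)" for w
        by (simp add: M(5)[OF p] Nv vector_scalar_commute sympl_linear flip: matrix_vector_mul_assoc)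
      have h: "(\<lambda>w. t * sympl (x w) (v p)) holomorphic_on ?D" "(\<lambda>w. sympl (M p *v v p) (M w *v y w)) holomorphic_on ?D"
        by (intro holomorphic_intros sympl_hol hx vhol_const Mx(1)[OF hy p])+
      have an: "f analytic_on {p}" if "f holomorphic_on ?D" for f using that p analytic_at open_ball by blast
      have v2: "vanish 2 f p \<longleftrightarrow> f p = 0 \<and> deriv f p = 0" for f by (simp add: numeral_2_eq_2 vanish_Suc)
      have "vanish 2 (\<lambda>w. t * sympl (x w) (v p)) p"
      proof -
        have "((\<lambda>w. t * sympl (x w) (v p)) has_field_derivative t * sympl (vd x p) (v p)) (at p)"
          using DERIV_cmult[OF sympl_DERIV[OF hx vhol_const open_ball p]] by (simp add: vd_const sympl_linear)
        then show ?thesis using x sw[OF p] by (auto simp: v2 DERIV_imp_deriv)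
      qed
      moreover have "vanish 2 (\<lambda>w. sympl (M p *v v p) (M w *v y w)) p"
      proof -
        have "((\<lambda>w. sympl (M p *v v p) (M w *v y w)) has_field_derivative sympl (v p) ((t * sympl (y p) (v p)) *s v p + vd y p)) (at p)"
          using sympl_DERIV[OF vhol_const Mx(1)[OF hy p] open_ball p, of "M p *v v p"]
          by (simp add: vd_const sympl_linear Mx(2)[OF hy p] sympl_Sp[OF MSp[OF p]])
        then show ?thesis using y sw[OF p] J[OF p] by (auto simp: v2 DERIV_imp_deriv sympl_Sp[OF MSp[OF p]] sympl_linear)
      qed
      ultimately show ?thesis unfolding e using vanish_mult2[OF an[OF h(1)] an[OF h(2)], of 2 2] by simp
    qed
  qed
  then have contact: "vanish 5 (\<lambda>w. sympl (M p *v x w) (M w *v y w)) p"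
    if "p \<in> ?D" "x \<in> {v, vd v}" "y \<in> {v, vd v}" for p x y using that by (simp add: eval_nat_numeral)
  have "mcP (\<lambda>z. M z ** S z) z = mcP S z + (\<chi> i j. if i = 1 \<and> j = 3 then - t else 0)"
    if S: "Sp_hol ?D S" and z: "z \<in> ?D" and c: "column 1 (S z) = v z" for S z
  proof -
    have hS: "mhol ?D S" and SSp: "S z \<in> Sp" using S z by (auto simp: Sp_hol_def)
    have "mcP (\<lambda>z. M z ** S z) z = Sp_inv (S z) ** Sp_inv (M z) ** (M z ** N z ** S z + M z ** md S z)"
      unfolding mcP_def md_mult[OF hM hS open_ball z] Sp_inv_mult[OF MSp[OF z] SSp] M(5)[OF z] ..
    also have "\<dots> = Sp_inv (S z) ** (Sp_inv (M z) ** M z) ** (N z ** S z + md S z)"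
      by (simp add: matrix_mul_assoc matrix_add_ldistrib)
    also have "\<dots> = mcP S z + Sp_inv (S z) ** (N z ** S z)"
      by (simp add: Sp_inv_left[OF MSp[OF z]] matrix_add_ldistrib mcP_def)
    \<comment> \<open>\<open>N\<close> sends a vector to \<open>t\<close> times its pairing with
      \<open>v\<close>, times \<open>v\<close>. As \<open>v\<close> is column 1 of the frame, only
      column 3 pairs with it, with value -1 in this order.\<close>
    also have "Sp_inv (S z) ** (N z ** S z) = (\<chi> i j. if i = 1 \<and> j = 3 then - t else 0)"
    proof -
      note C = Sp_columns[OF SSp, unfolded c]
      have "column k (Sp_inv (S z) ** (N z ** S z)) = (t * sympl (column k (S z)) (v z)) *s axis 1 1" for k
      proof -
        have "Sp_inv (S z) *v v z = axis 1 1"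
          unfolding c[symmetric] column_mult[symmetric] Sp_inv_left[OF SSp] column_mat1 ..
        then show ?thesis by (simp add: column_mult Nv vector_scalar_commute)
      qed
      moreover have "sympl (column k (S z)) (v z) = (if k = 3 then -1 else 0)" for k
        using exhaust_4[of k] C sympl_swap[of "column 2 (S z)" "v z"] sympl_swap[of "column 3 (S z)" "v z"]
          sympl_swap[of "column 4 (S z)" "v z"] c by auto
      ultimately show ?thesis by (simp add: mat_eq_columns) (auto simp: vec_eq_iff column_def axis_def)
    qed
    finally show ?thesis .
  qed
  then show ?thesis using that[OF M(1-3) contact] by blast
qed

section \<open>Calculus in charts\<close>

definition pull :: "'a chart \<Rightarrow> ('a \<Rightarrow> 'b) \<Rightarrow> complex \<Rightarrow> 'b" where
  "pull c h w = h (inv_into (fst c) (snd c) w)"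

definition disc :: "'a chart \<Rightarrow> 'a \<Rightarrow> real \<Rightarrow> 'a set" where
  "disc c p r = {q \<in> fst c. snd c q \<in> ball (snd c p) r}"

lemma pull_abs: "pull c h = (\<lambda>w. h (inv_into (fst c) (snd c) w))"
  by (simp add: fun_eq_iff pull_def)

lemma coord_expr_pull: "coord_expr c h = pull c h"
  by (simp add: coord_expr_def pull_def fun_eq_iff)

lemma chart_deriv_pull: "chart_deriv c k h p = (deriv ^^ k) (pull c h) (snd c p)"
  by (simp add: chart_deriv_def coord_expr_pull)

lemma mat_deriv_pull: "mat_deriv c M p = md (pull c M) (snd c p)"
  by (simp add: mat_deriv_def chart_deriv_pull md_def pull_abs)

lemma holo_pull: "holo \<A> W h \<longleftrightarrow> (\<forall>c\<in>\<A>. pull c h holomorphic_on snd c ` (fst c \<inter> W))"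
  by (simp add: holo_def coord_expr_pull)

lemma holo_mat_pull: "holo_mat \<A> W M \<longleftrightarrow> (\<forall>c\<in>\<A>. mhol (snd c ` (fst c \<inter> W)) (pull c M))"
  by (auto simp: holo_mat_def holo_pull mhol_def pull_abs)

lemma holo_vec_pull: "holo_vec \<A> W M \<longleftrightarrow> (\<forall>c\<in>\<A>. vhol (snd c ` (fst c \<inter> W)) (pull c M))"
  by (auto simp: holo_vec_def holo_pull vhol_def pull_abs)

lemma holo_mono: "holo \<A> W h \<Longrightarrow> W' \<subseteq> W \<Longrightarrow> holo \<A> W' h"
  unfolding holo_pull by (meson holomorphic_on_subset image_mono inf_mono order_refl)

lemma holo_mat_mono: "holo_mat \<A> W h \<Longrightarrow> W' \<subseteq> W \<Longrightarrow> holo_mat \<A> W' h"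
  unfolding holo_mat_def using holo_mono by blast

lemma holo_vec_mono: "holo_vec \<A> W h \<Longrightarrow> W' \<subseteq> W \<Longrightarrow> holo_vec \<A> W' h"
  unfolding holo_vec_def using holo_mono by blast

lemma holo_mat_mult: "holo_mat \<A> W M \<Longrightarrow> holo_mat \<A> W N \<Longrightarrow> holo_mat \<A> W (\<lambda>q. M q ** N q)"
  unfolding holo_mat_pull pull_abs by (auto intro: mhol_mult)

lemma holo_mat_Sp_inv: "holo_mat \<A> W M \<Longrightarrow> holo_mat \<A> W (\<lambda>q. Sp_inv (M q))"
  unfolding holo_mat_pull pull_abs by (auto intro: mhol_Sp_inv)

lemma holo_mat_const: "holo_mat \<A> W (\<lambda>q. M)"
  unfolding holo_mat_pull pull_abs by (auto intro: mhol_const)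

text \<open>The conditions are homogeneous, so they survive the common factor that a change of chart
  puts on the form.\<close>

lemma normalized_form_scale:
  assumes "normalized_form \<phi>" "J \<noteq> 0" "\<And>i j. \<psi> $ i $ j = J * \<phi> $ i $ j"
  shows "normalized_form \<psi>"
  using assms unfolding normalized_form_def by (auto simp: algebra_simps)

locale rsurf =
  fixes X :: "'a topology" and \<A> :: "'a chart set"
  assumes rs: "riemann_surface X \<A>"
begin

lemma chart_openin: "c \<in> \<A> \<Longrightarrow> openin X (fst c)"
  using rs unfolding riemann_surface_def by (cases c) auto

lemma chart_img_open: "c \<in> \<A> \<Longrightarrow> open (snd c ` fst c)"
  using rs unfolding riemann_surface_def by (cases c) auto

lemma chart_homeo: "c \<in> \<A> \<Longrightarrow> homeomorphic_map (subtopology X (fst c)) (top_of_set (snd c ` fst c)) (snd c)"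
  using rs unfolding riemann_surface_def by (cases c) auto

lemma transition_holo:
  "c \<in> \<A> \<Longrightarrow> c' \<in> \<A> \<Longrightarrow> (\<lambda>w. snd c' (inv_into (fst c) (snd c) w)) holomorphic_on snd c ` (fst c \<inter> fst c')"
  using rs unfolding riemann_surface_def by (cases c; cases c') (auto simp: o_def)

lemma chart_exists: "p \<in> topspace X \<Longrightarrow> \<exists>c\<in>\<A>. p \<in> fst c"
  using rs unfolding riemann_surface_def by force

lemma chart_subset: "c \<in> \<A> \<Longrightarrow> fst c \<subseteq> topspace X"
  using chart_openin openin_subset by blast

lemma chart_inj: "c \<in> \<A> \<Longrightarrow> inj_on (snd c) (fst c)"
  using homeomorphic_imp_injective_map[OF chart_homeo, of c] chart_subset[of c]
  by (simp add: Int_absorb1)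

lemma chart_inv [simp]: "c \<in> \<A> \<Longrightarrow> p \<in> fst c \<Longrightarrow> inv_into (fst c) (snd c) (snd c p) = p"
  by (simp add: chart_inj)

lemma pull_chart [simp]: "c \<in> \<A> \<Longrightarrow> p \<in> fst c \<Longrightarrow> pull c h (snd c p) = h p"
  by (simp add: pull_def)

lemma img_open:
  assumes c: "c \<in> \<A>" and W: "openin X W" shows "open (snd c ` (fst c \<inter> W))"
proof -
  have "openin (subtopology X (fst c)) (fst c \<inter> W)" using W by (auto simp: openin_subtopology)
  then have "openin (top_of_set (snd c ` fst c)) (snd c ` (fst c \<inter> W))"
    using homeomorphic_imp_open_map[OF chart_homeo[OF c]] unfolding open_map_def by blast
  then show ?thesis using chart_img_open[OF c] openin_open_trans by blast
qed

lemma preimage_open: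
  assumes c: "c \<in> \<A>" and O: "open O'" shows "openin X {q \<in> fst c. snd c q \<in> O'}"
proof -
  have "openin (subtopology X (fst c)) {q \<in> topspace (subtopology X (fst c)). snd c q \<in> O' \<inter> snd c ` fst c}"
    by (rule openin_continuous_map_preimage[OF homeomorphic_imp_continuous_map[OF chart_homeo[OF c]]])
      (use O in \<open>auto simp: openin_open\<close>)
  then have "openin X {q \<in> topspace (subtopology X (fst c)). snd c q \<in> O' \<inter> snd c ` fst c}"
    using chart_openin[OF c] openin_trans_full by blast
  moreover have "{q \<in> topspace (subtopology X (fst c)). snd c q \<in> O' \<inter> snd c ` fst c} = {q \<in> fst c. snd c q \<in> O'}"
    using chart_subset[OF c] by auto
  ultimately show ?thesis by simp
qed

lemma disc_properties:
  assumes c: "c \<in> \<A>" and p: "p \<in> fst c" and r: "r > 0" "ball (snd c p) r \<subseteq> snd c ` fst c"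
  shows "openin X (disc c p r)" "p \<in> disc c p r" "snd c ` disc c p r = ball (snd c p) r"
    "connectedin X (disc c p r)" "disc c p r \<subseteq> fst c"
proof -
  show o: "openin X (disc c p r)" unfolding disc_def by (rule preimage_open[OF c]) simp
  show "p \<in> disc c p r" using p r by (simp add: disc_def)
  show i: "snd c ` disc c p r = ball (snd c p) r" using r unfolding disc_def by blast
  show s: "disc c p r \<subseteq> fst c" by (auto simp: disc_def)
  have "connectedin (top_of_set (snd c ` fst c)) (snd c ` disc c p r)"
    unfolding i using r by (simp add: connectedin_subtopology)
  then have "connectedin (subtopology X (fst c)) (disc c p r)"
    using homeomorphic_map_connectedness[OF chart_homeo[OF c], of "disc c p r"] s chart_subset[OF c] by auto
  then show "connectedin X (disc c p r)" by (simp add: connectedin_subtopology)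
qed

lemma disc_exists:
  assumes c: "c \<in> \<A>" and p: "p \<in> fst c" and W: "openin X W" "p \<in> W"
  obtains r where "r > 0" "\<And>s. 0 < s \<Longrightarrow> s \<le> r \<Longrightarrow> ball (snd c p) s \<subseteq> snd c ` fst c \<and> disc c p s \<subseteq> W"
proof -
  have "open (snd c ` (fst c \<inter> W))" "snd c p \<in> snd c ` (fst c \<inter> W)" using img_open[OF c W(1)] p W by auto
  then obtain r where r: "r > 0" "ball (snd c p) r \<subseteq> snd c ` (fst c \<inter> W)" using openE by blast
  have "ball (snd c p) s \<subseteq> snd c ` fst c \<and> disc c p s \<subseteq> W" if s: "0 < s" "s \<le> r" for s
  proof
    have b: "ball (snd c p) s \<subseteq> snd c ` (fst c \<inter> W)" using r s by auto
    then show "ball (snd c p) s \<subseteq> snd c ` fst c" by blast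
    show "disc c p s \<subseteq> W"
    proof
      fix q assume q: "q \<in> disc c p s"
      then obtain q' where "q' \<in> fst c" "q' \<in> W" "snd c q = snd c q'" using b unfolding disc_def by blast
      then show "q \<in> W" using inj_onD[OF chart_inj[OF c]] q by (metis (no_types, lifting) disc_def mem_Collect_eq)
    qed
  qed
  then show ?thesis using that r(1) by blast
qed

text \<open>Compatibility of the atlas: one chart around \<open>W\<close> decides holomorphy in all
  charts.\<close>

lemma holo_chartI:
  assumes c: "c \<in> \<A>" and W: "W \<subseteq> fst c" and h: "pull c h holomorphic_on snd c ` W"
  shows "holo \<A> W h"
  unfolding holo_pull
proof
  fix c' assume c': "c' \<in> \<A>"
  let ?t = "\<lambda>w. snd c (inv_into (fst c') (snd c') w)"
  have t: "?t holomorphic_on snd c' ` (fst c' \<inter> W)"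
    by (rule holomorphic_on_subset[OF transition_holo[OF c' c]]) (use W in auto)
  have "(pull c h \<circ> ?t) holomorphic_on snd c' ` (fst c' \<inter> W)"
    by (rule holomorphic_on_compose_gen[OF t h]) (use c' in auto)
  then show "pull c' h holomorphic_on snd c' ` (fst c' \<inter> W)"
    by (rule holomorphic_transform) (use W c c' in \<open>auto simp: pull_def subset_iff\<close>)
qed

lemma holo_mat_chartI:
  assumes c: "c \<in> \<A>" and W: "W \<subseteq> fst c" and h: "mhol (snd c ` W) (pull c M)"
  shows "holo_mat \<A> W M"
  using h unfolding holo_mat_def mhol_def pull_abs
  by (auto intro!: holo_chartI[OF c W] simp: pull_abs)

lemma holo_vec_chartI:
  assumes c: "c \<in> \<A>" and W: "W \<subseteq> fst c" and h: "vhol (snd c ` W) (pull c M)"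
  shows "holo_vec \<A> W M"
  using h unfolding holo_vec_def vhol_def pull_abs
  by (auto intro!: holo_chartI[OF c W] simp: pull_abs)

text \<open>The derivative is nonzero because the transition in the other direction is an inverse,
  and the chain rule makes the product of the two derivatives 1.\<close>

lemma transition_props:
  assumes c: "c \<in> \<A>" and c': "c' \<in> \<A>" and p: "p \<in> fst c" "p \<in> fst c'"
  defines "\<tau> \<equiv> \<lambda>w. snd c (inv_into (fst c') (snd c') w)"
  shows "\<tau> analytic_on {snd c' p}" "\<tau> (snd c' p) = snd c p" "deriv \<tau> (snd c' p) \<noteq> 0"
    "\<forall>\<^sub>F w in nhds (snd c' p). pull c' h w = pull c h (\<tau> w)"
proof -
  let ?D = "snd c' ` (fst c' \<inter> fst c)" and ?E = "snd c ` (fst c \<inter> fst c')"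
  let ?s = "\<lambda>w. snd c' (inv_into (fst c) (snd c) w)"
  have oD: "open ?D" "open ?E" using img_open chart_openin c c' by auto
  have pD: "snd c' p \<in> ?D" using p by auto
  have t: "\<tau> holomorphic_on ?D" unfolding \<tau>_def by (rule transition_holo[OF c' c])
  have s: "?s holomorphic_on ?E" by (rule transition_holo[OF c c'])
  show "\<tau> analytic_on {snd c' p}" using oD(1) pD t analytic_at by blast
  show tp: "\<tau> (snd c' p) = snd c p" using p c' by (simp add: \<tau>_def)
  have ev: "\<forall>\<^sub>F w in nhds (snd c' p). w \<in> ?D" by (rule eventually_nhds_in_open[OF oD(1) pD])
  then show "\<forall>\<^sub>F w in nhds (snd c' p). pull c' h w = pull c h (\<tau> w)"
    by (rule eventually_mono) (use c c' in \<open>auto simp: pull_def \<tau>_def\<close>)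
  have "(\<tau> has_field_derivative deriv \<tau> (snd c' p)) (at (snd c' p))"
    by (rule holomorphic_derivI[OF t oD(1) pD])
  moreover have "(?s has_field_derivative deriv ?s (\<tau> (snd c' p))) (at (\<tau> (snd c' p)))"
    by (rule holomorphic_derivI[OF s oD(2)]) (use p tp in auto)
  ultimately have "((\<lambda>w. ?s (\<tau> w)) has_field_derivative deriv ?s (\<tau> (snd c' p)) * deriv \<tau> (snd c' p)) (at (snd c' p))"
    by (rule DERIV_chain2[rotated])
  moreover have "((\<lambda>w. ?s (\<tau> w)) has_field_derivative 1) (at (snd c' p))"
    by (rule has_field_derivative_transform_within_open[OF DERIV_ident oD(1) pD])
      (use c c' in \<open>auto simp: \<tau>_def\<close>)
  ultimately have "deriv ?s (\<tau> (snd c' p)) * deriv \<tau> (snd c' p) = 1" by (rule DERIV_unique)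
  then show "deriv \<tau> (snd c' p) \<noteq> 0" by auto
qed

lemma pull_analytic:
  assumes "c \<in> \<A>" "p \<in> fst c" "openin X W" "p \<in> W" "holo \<A> W h"
  shows "pull c h analytic_on {snd c p}"
proof -
  have "pull c h holomorphic_on snd c ` (fst c \<inter> W)" "open (snd c ` (fst c \<inter> W))"
    "snd c p \<in> snd c ` (fst c \<inter> W)" using assms img_open by (auto simp: holo_pull)
  then show ?thesis using analytic_at by blast
qed

lemma vanish_chart_change:
  assumes c: "c \<in> \<A>" and c': "c' \<in> \<A>" and p: "p \<in> fst c" "p \<in> fst c'"
    and W: "openin X W" "p \<in> W" "holo \<A> W h" and v: "vanish k (pull c h) (snd c p)"
  shows "vanish k (pull c' h) (snd c' p)"
proof -
  note t = transition_props[OF c c' p]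
  show ?thesis unfolding vanish_cong[OF t(4)]
    by (rule vanish_compose[OF t(1)]) (use v pull_analytic[OF c p(1) W] in \<open>simp_all add: t(2)\<close>)
qed

text \<open>\<open>J\<close> is the derivative of the coordinate change at \<open>p\<close>. It is
  one factor for all maps and all entries, so the whole form is scaled at once.\<close>

lemma mat_deriv_chart_change:
  assumes c: "c \<in> \<A>" and c': "c' \<in> \<A>" and p: "p \<in> fst c" "p \<in> fst c'"
  obtains J where "J \<noteq> 0" "\<And>W M i j. openin X W \<Longrightarrow> p \<in> W \<Longrightarrow> holo_mat \<A> W M \<Longrightarrow>
      mat_deriv c' M p $ i $ j = J * mat_deriv c M p $ i $ j"
    "\<And>W M i j. openin X W \<Longrightarrow> p \<in> W \<Longrightarrow> holo_mat \<A> W M \<Longrightarrow> mc c' M p $ i $ j = J * mc c M p $ i $ j"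
proof -
  note t = transition_props[OF c c' p]
  let ?t = "\<lambda>w. snd c (inv_into (fst c') (snd c') w)"
  have 1: "mat_deriv c' M p $ i $ j = deriv ?t (snd c' p) * mat_deriv c M p $ i $ j"
    if W: "openin X W" "p \<in> W" "holo_mat \<A> W M" for W i j and M :: "'a \<Rightarrow> complex^'m^'n"
  proof -
    let ?h = "\<lambda>q. M q $ i $ j"
    have h: "holo \<A> W ?h" using W(3) by (simp add: holo_mat_def)
    have "deriv (pull c' ?h) (snd c' p) = deriv (\<lambda>w. pull c ?h (?t w)) (snd c' p)"
      by (rule deriv_cong_ev[OF t(4) refl])
    also have "\<dots> = deriv (pull c ?h) (snd c p) * deriv ?t (snd c' p)"
      using deriv_chain[of ?t "snd c' p" "pull c ?h"] t(1,2) pull_analytic[OF c p(1) W(1,2) h]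
      by (simp add: o_def analytic_on_imp_differentiable_at)
    finally show ?thesis by (simp add: mat_deriv_def chart_deriv_pull)
  qed
  have 2: "mc c' M p $ i $ j = deriv ?t (snd c' p) * mc c M p $ i $ j"
    if W: "openin X W" "p \<in> W" "holo_mat \<A> W M" for W i j and M
    using 1[OF W] by (simp add: mc_def matrix_matrix_mult_def sum_distrib_left algebra_simps)
  show ?thesis using that[OF t(3)] 1 2 by blast
qed

lemma mc_pull: "c \<in> \<A> \<Longrightarrow> p \<in> fst c \<Longrightarrow> A p \<in> Sp \<Longrightarrow> mc c A p = mcP (pull c A) (snd c p)"
  by (simp add: mc_def mcP_def mat_deriv_pull matrix_inv_Sp)

lemma lift_Sp_hol:
  assumes "lift X \<A> W f A" "c \<in> \<A>" shows "Sp_hol (snd c ` (fst c \<inter> W)) (pull c A)"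
  using assms img_open by (auto simp: lift_def Sp_hol_def holo_mat_pull)

lemma Sp_hol_subset: "Sp_hol D S \<Longrightarrow> E \<subseteq> D \<Longrightarrow> open E \<Longrightarrow> Sp_hol E S"
  unfolding Sp_hol_def using mhol_subset by blast

lemma lift_mono: "lift X \<A> W f A \<Longrightarrow> W' \<subseteq> W \<Longrightarrow> openin X W' \<Longrightarrow> lift X \<A> W' f A"
  unfolding lift_def using holo_mat_mono by blast

text \<open>The identity principle with its analytic content isolated in \<open>loc\<close>. The
  open set \<open>G\<close> collects the open parts of \<open>T\<close>, and \<open>H\<close> the
  open sets missing \<open>G\<close>; by \<open>loc\<close> every point of \<open>U\<close> lies in
  one of them, so connectedness leaves only \<open>G\<close>.\<close>

lemma continuation:
  assumes U: "openin X U" "connectedin X U" and N: "openin X N" "N \<noteq> {}" "N \<subseteq> U" "N \<subseteq> T"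
    and loc: "\<And>p. p \<in> U \<Longrightarrow> \<exists>W. openin X W \<and> p \<in> W \<and> W \<subseteq> U \<and>
       (\<forall>O'. openin X O' \<and> O' \<noteq> {} \<and> O' \<subseteq> W \<and> O' \<subseteq> T \<longrightarrow> W \<subseteq> T)"
  shows "U \<subseteq> T"
proof -
  define G where "G = \<Union>{O'. openin X O' \<and> O' \<subseteq> U \<and> O' \<subseteq> T}"
  define H where "H = \<Union>{W. openin X W \<and> W \<subseteq> U \<and> W \<inter> G = {}}"
  have oG: "openin X G" unfolding G_def by (rule openin_Union) auto
  have oH: "openin X H" unfolding H_def by (rule openin_Union) auto
  have "N \<subseteq> G" unfolding G_def by (rule Union_upper) (simp add: N)
  have "p \<in> G \<union> H" if p: "p \<in> U" for p
  proof -
    from loc[OF p] obtain W where W0: "openin X W \<and> p \<in> W \<and> W \<subseteq> U \<and>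
       (\<forall>O'. openin X O' \<and> O' \<noteq> {} \<and> O' \<subseteq> W \<and> O' \<subseteq> T \<longrightarrow> W \<subseteq> T)" ..
    note W = W0[THEN conjunct1] W0[THEN conjunct2, THEN conjunct1] W0[THEN conjunct2, THEN conjunct2, THEN conjunct1]
    have WT: "W \<subseteq> T" if "openin X O'" "O' \<noteq> {}" "O' \<subseteq> W" "O' \<subseteq> T" for O'
      by (rule W0[THEN conjunct2, THEN conjunct2, THEN conjunct2, rule_format, of O']) (intro conjI that)
    show ?thesis
    proof (cases "W \<inter> G = {}")
      case True
      then have "W \<subseteq> H" unfolding H_def by (intro Union_upper) (simp add: W)
      then show ?thesis using W(2) by auto
    next
      case False
      then obtain x O' where O: "openin X O'" "O' \<subseteq> T" "x \<in> O'" "x \<in> W" unfolding G_def by auto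
      then have "W \<subseteq> T" by (intro WT[of "O' \<inter> W"]) (use W in auto)
      then have "W \<subseteq> G" unfolding G_def by (intro Union_upper) (simp add: W)
      then show ?thesis using W(2) by auto
    qed
  qed
  then have cover: "U \<subseteq> G \<union> H" by (rule subsetI)
  have "G \<inter> H = {}" unfolding H_def by auto
  moreover have "G \<inter> U \<noteq> {}" using \<open>N \<subseteq> G\<close> N(2,3) by auto
  ultimately have "H \<inter> U = {}"
    using U(2) oG oH cover unfolding connectedin by (metis Int_assoc inf.commute inf_bot_right)
  then have "U \<subseteq> G" using cover by auto
  moreover have "G \<subseteq> T" unfolding G_def by auto
  ultimately show ?thesis by (rule order_trans)
qed

lemma holo_mat_const_continuation:
  assumes U: "openin X U" "connectedin X U" and M: "holo_mat \<A> U M"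
    and N: "openin X N" "N \<noteq> {}" "N \<subseteq> U" "\<And>q. q \<in> N \<Longrightarrow> M q = B"
  shows "\<forall>q\<in>U. M q = B"
proof -
  have "U \<subseteq> {q. M q = B}"
  proof (rule continuation[OF U N(1-3)])
    show "N \<subseteq> {q. M q = B}" using N(4) by blast
    fix p assume p: "p \<in> U"
    obtain c where c: "c \<in> \<A>" "p \<in> fst c" using chart_exists p openin_subset[OF U(1)] by blast
    obtain r where r: "r > 0" "\<And>s. 0 < s \<Longrightarrow> s \<le> r \<Longrightarrow> ball (snd c p) s \<subseteq> snd c ` fst c \<and> disc c p s \<subseteq> U"
      using disc_exists[OF c U(1) p] by blast
    let ?W = "disc c p r"
    have b: "ball (snd c p) r \<subseteq> snd c ` fst c" "?W \<subseteq> U" using r by auto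
    note d = disc_properties[OF c r(1) b(1)]
    have h: "mhol (ball (snd c p) r) (pull c M)"
      unfolding d(3)[symmetric]
      by (rule mhol_subset[OF M[unfolded holo_mat_pull, rule_format, OF c(1)]]) (use d(5) b(2) in auto)
    have "?W \<subseteq> {q. M q = B}" if O: "openin X O'" "O' \<noteq> {}" "O' \<subseteq> ?W" "O' \<subseteq> {q. M q = B}" for O'
    proof
      fix q assume q: "q \<in> ?W"
      obtain a where a: "a \<in> O'" using O by blast
      have Oc: "O' \<subseteq> fst c" using O(3) d(5) by blast
      then have oi: "open (snd c ` O')" using img_open[OF c(1) O(1)] by (simp add: Int_absorb1)
      have sub: "snd c ` O' \<subseteq> ball (snd c p) r" using O(3) d(3) by blast
      have "pull c M (snd c q) $ i $ j = B $ i $ j" for i j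
      proof (rule analytic_continuation_open[where f = "\<lambda>w. pull c M w $ i $ j" and g = "\<lambda>w. B $ i $ j", OF oi open_ball _ connected_ball sub])
        show "snd c ` O' \<noteq> {}" using a by blast
        show "(\<lambda>w. pull c M w $ i $ j) holomorphic_on ball (snd c p) r" using h by (rule mhol_D)
        show "pull c M z $ i $ j = B $ i $ j" if "z \<in> snd c ` O'" for z
          using that O(4) Oc c(1) by (auto simp: subset_iff)
        show "snd c q \<in> ball (snd c p) r" using q d(3) by blast
      qed auto
      then show "q \<in> {q. M q = B}" using q d(5) c by (auto simp: vec_eq_iff)
    qed
    then show "\<exists>W. openin X W \<and> p \<in> W \<and> W \<subseteq> U \<and>
       (\<forall>O'. openin X O' \<and> O' \<noteq> {} \<and> O' \<subseteq> W \<and> O' \<subseteq> {q. M q = B} \<longrightarrow> W \<subseteq> {q. M q = B})"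
      using d(1,2) b(2) by blast
  qed
  then show ?thesis by blast
qed

end

lemma vanish_cancel:
  assumes f: "f analytic_on {p}" "f p \<noteq> 0" and g: "g analytic_on {p}" and v: "vanish k (\<lambda>w. f w * g w) p"
  shows "vanish k g p"
proof -
  obtain A where A: "open A" "p \<in> A" "f holomorphic_on A" using f(1) analytic_at by blast
  have "open (A \<inter> f -` (- {0}))"
    by (rule continuous_open_preimage[OF holomorphic_on_imp_continuous_on[OF A(3)] A(1)]) auto
  then have E: "open (A \<inter> f -` (- {0}))" "p \<in> A \<inter> f -` (- {0})" using A f by auto
  show ?thesis
  proof (rule vanish_congI[OF E])
    show "g w = inverse (f w) * (f w * g w)" if "w \<in> A \<inter> f -` (- {0})" for w using that by simp
    show "vanish k (\<lambda>w. inverse (f w) * (f w * g w)) p"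
      by (rule vanish_mult[OF analytic_on_inverse[OF f(1)] analytic_on_mult[OF f(1) g] v]) (simp add: f(2))
  qed
qed

section \<open>Big cells and contact\<close>

text \<open>The pairing of two vectors from graphs over the same cell is linear in the difference of
  the graph matrices. This is the bridge between contact, defined by coordinates, and vanishing of
  pairings.\<close>

lemma sympl_graph:
  assumes A: "A \<in> Sp" and u: "u \<in> Q3_param A m" and v: "v \<in> Q3_param A n"
    and y: "y = Sp_inv A *v u" "y' = Sp_inv A *v v"
  shows "sympl u v = (n$1 - m$1) * (y$1 * y'$1) + (n$2 - m$2) * (y$1 * y'$2 + y$2 * y'$1) + (n$3 - m$3) * (y$2 * y'$2)"
proof -
  have "sympl u v = sympl y y'" unfolding y by (simp add: sympl_Sp Sp_Sp_inv A)
  moreover have "y$3 = m$1 * y$1 + m$2 * y$2" "y$4 = m$2 * y$1 + m$3 * y$2"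
    "y'$3 = n$1 * y'$1 + n$2 * y'$2" "y'$4 = n$2 * y'$1 + n$3 * y'$2"
    using u v by (simp_all add: Q3_param_mem A Let_def y)
  ultimately show ?thesis by (simp add: sympl_def algebra_simps)
qed

lemma plane_change:
  assumes "y1 = a *s x1 + b *s x2" "y2 = c *s x1 + d *s x2" "a * d - b * c \<noteq> 0"
  shows "plane y1 y2 = plane x1 x2"
proof -
  have x: "x1 = (d / (a * d - b * c)) *s y1 + (- b / (a * d - b * c)) *s y2"
    "x2 = (- c / (a * d - b * c)) *s y1 + (a / (a * d - b * c)) *s y2"
    using assms(3) by (simp_all add: assms(1,2) vec_eq_iff) (simp_all add: divide_simps, simp_all add: algebra_simps)
  have "vec.span {y1, y2} \<subseteq> vec.span {x1, x2}"
  proof (rule vec.span_minimal)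
    show "{y1, y2} \<subseteq> vec.span {x1, x2}" unfolding plane_def[symmetric] using assms(1,2) by (auto simp: plane_mem)
  qed (rule vec.subspace_span)
  moreover have "vec.span {x1, x2} \<subseteq> vec.span {y1, y2}"
  proof (rule vec.span_minimal)
    have "x1 \<in> plane y1 y2" "x2 \<in> plane y1 y2" unfolding plane_mem by (intro exI, rule x)+
    then show "{x1, x2} \<subseteq> vec.span {y1, y2}" by (simp add: plane_def)
  qed (rule vec.subspace_span)
  ultimately show ?thesis by (simp add: plane_def)
qed

text \<open>The lower left 2 x 2 block of \<open>Y\<close> times the inverse of the upper left one,
  by Cramer's rule. The off-diagonal entry is stored once, taken from the first row; the block
  product is symmetric when \<open>Y\<close> is symplectic.\<close>

definition cell_coord :: "complex^4^4 \<Rightarrow> complex^3" where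
  "cell_coord Y = (\<chi> i. if i = 1 then (Y$3$1 * Y$2$2 - Y$3$2 * Y$2$1) / (Y$1$1 * Y$2$2 - Y$1$2 * Y$2$1)
     else if i = 2 then (Y$3$2 * Y$1$1 - Y$3$1 * Y$1$2) / (Y$1$1 * Y$2$2 - Y$1$2 * Y$2$1)
     else (Y$4$2 * Y$1$1 - Y$4$1 * Y$1$2) / (Y$1$1 * Y$2$2 - Y$1$2 * Y$2$1))"

lemma cell_coord_nth:
  "cell_coord Y $ 1 = (Y$3$1 * Y$2$2 - Y$3$2 * Y$2$1) / (Y$1$1 * Y$2$2 - Y$1$2 * Y$2$1)"
  "cell_coord Y $ 2 = (Y$3$2 * Y$1$1 - Y$3$1 * Y$1$2) / (Y$1$1 * Y$2$2 - Y$1$2 * Y$2$1)"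
  "cell_coord Y $ 3 = (Y$4$2 * Y$1$1 - Y$4$1 * Y$1$2) / (Y$1$1 * Y$2$2 - Y$1$2 * Y$2$1)"
  by (simp_all add: cell_coord_def)

lemma Q3_param_cell_coord:
  assumes A: "A \<in> Sp" and L: "L \<in> Sp" and Y: "Y = Sp_inv A ** L" and d: "Y$1$1 * Y$2$2 - Y$1$2 * Y$2$1 \<noteq> 0"
  shows "plane (column 1 L) (column 2 L) = Q3_param A (cell_coord Y)"
proof -
  have YS: "Y \<in> Sp" unfolding Y by (intro Sp_mult Sp_Sp_inv A L)
  have LY: "L = A ** Y" unfolding Y by (simp add: matrix_mul_assoc Sp_inv_right A)
  let ?\<Delta> = "Y$1$1 * Y$2$2 - Y$1$2 * Y$2$1"
  have s: "Y$1$1 * Y$3$2 - Y$3$1 * Y$1$2 = Y$4$1 * Y$2$2 - Y$2$1 * Y$4$2"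
    using Sp_columns(1)[OF YS] unfolding sympl_def column_def by simp algebra
  let ?x1 = "column 1 (cell (cell_coord Y))" and ?x2 = "column 2 (cell (cell_coord Y))"
  \<comment> \<open>The second expression for the off-diagonal coordinate: symmetry of the graph
    matrix, which is the Lagrangian condition \<open>s\<close>.\<close>
  have m2: "cell_coord Y $ 2 = (Y$4$1 * Y$2$2 - Y$4$2 * Y$2$1) / ?\<Delta>"
    unfolding cell_coord_nth using s by (simp add: algebra_simps)
  have k: "cell_coord Y $ 1 * Y$1$1 + cell_coord Y $ 2 * Y$2$1 = Y$3$1" "cell_coord Y $ 1 * Y$1$2 + cell_coord Y $ 2 * Y$2$2 = Y$3$2"
    "cell_coord Y $ 2 * Y$1$1 + cell_coord Y $ 3 * Y$2$1 = Y$4$1" "cell_coord Y $ 2 * Y$1$2 + cell_coord Y $ 3 * Y$2$2 = Y$4$2"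
    subgoal unfolding cell_coord_nth using d by (simp add: divide_simps) algebra
    subgoal unfolding cell_coord_nth using d by (simp add: divide_simps) algebra
    subgoal unfolding m2 cell_coord_nth(3) using d by (simp add: divide_simps) algebra
    subgoal unfolding m2 cell_coord_nth(3) using d by (simp add: divide_simps) algebra
    done
  have "plane (column 1 Y) (column 2 Y) = plane ?x1 ?x2"
  proof (rule plane_change)
    show "column 1 Y = Y$1$1 *s ?x1 + Y$2$1 *s ?x2" "column 2 Y = Y$1$2 *s ?x1 + Y$2$2 *s ?x2"
      using k by (simp_all add: vec_eq_iff[where 'b=4] forall_4 column_cell) (simp_all add: column_def axis_def algebra_simps)
    show "Y$1$1 * Y$2$2 - Y$2$1 * Y$1$2 \<noteq> 0" using d by (simp add: mult.commute)
  qed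
  then have "act A (plane (column 1 Y) (column 2 Y)) = act A (plane ?x1 ?x2)" by simp
  then show ?thesis unfolding Q3_param_cell plane_image column_mult LY .
qed

context rsurf begin

lemma avoid_zero:
  assumes W: "openin X W" "p \<in> W" and h: "holo \<A> W h" "h p \<noteq> 0"
  obtains W' where "openin X W'" "p \<in> W'" "W' \<subseteq> W" "\<And>q. q \<in> W' \<Longrightarrow> h q \<noteq> 0"
proof -
  obtain c where c: "c \<in> \<A>" "p \<in> fst c" using chart_exists openin_subset[OF W(1)] W(2) by blast
  let ?D = "snd c ` (fst c \<inter> W)"
  have "pull c h holomorphic_on ?D" using h c by (simp add: holo_pull)
  then have "open (?D \<inter> pull c h -` (- {0}))"
    using img_open[OF c(1) W(1)] by (intro continuous_open_preimage holomorphic_on_imp_continuous_on) auto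
  then have o: "openin X ({q \<in> fst c. snd c q \<in> ?D \<inter> pull c h -` (- {0})} \<inter> W)"
    using preimage_open[OF c(1)] W(1) by blast
  show ?thesis
    by (rule that[OF o]) (use c W h in \<open>auto dest: inj_onD[OF chart_inj[OF c(1)]]\<close>)
qed

lemma holo_const: "holo \<A> W (\<lambda>q. k)"
  unfolding holo_pull pull_abs by simp

lemma holo_add: "holo \<A> W f \<Longrightarrow> holo \<A> W g \<Longrightarrow> holo \<A> W (\<lambda>q. f q + g q)"
  unfolding holo_pull pull_abs by (auto intro!: holomorphic_on_add)

lemma holo_diff: "holo \<A> W f \<Longrightarrow> holo \<A> W g \<Longrightarrow> holo \<A> W (\<lambda>q. f q - g q)"
  unfolding holo_pull pull_abs by (auto intro!: holomorphic_on_diff)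

lemma holo_mult: "holo \<A> W f \<Longrightarrow> holo \<A> W g \<Longrightarrow> holo \<A> W (\<lambda>q. f q * g q)"
  unfolding holo_pull pull_abs by (auto intro!: holomorphic_on_mult)

lemma holo_divide: "holo \<A> W f \<Longrightarrow> holo \<A> W g \<Longrightarrow> (\<And>q. q \<in> W \<Longrightarrow> g q \<noteq> 0) \<Longrightarrow> holo \<A> W (\<lambda>q. f q / g q)"
  unfolding holo_pull
proof
  fix c assume a: "\<forall>c\<in>\<A>. pull c f holomorphic_on snd c ` (fst c \<inter> W)"
    "\<forall>c\<in>\<A>. pull c g holomorphic_on snd c ` (fst c \<inter> W)" "\<And>q. q \<in> W \<Longrightarrow> g q \<noteq> 0" and c: "c \<in> \<A>"
  have "(\<lambda>w. pull c f w / pull c g w) holomorphic_on snd c ` (fst c \<inter> W)"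
    using a c by (intro holomorphic_on_divide) auto
  then show "pull c (\<lambda>q. f q / g q) holomorphic_on snd c ` (fst c \<inter> W)" by (simp add: pull_abs)
qed

lemma holo_matD: "holo_mat \<A> W M \<Longrightarrow> holo \<A> W (\<lambda>q. M q $ i $ j)"
  by (simp add: holo_mat_def)

lemma holo_vecD: "holo_vec \<A> W M \<Longrightarrow> holo \<A> W (\<lambda>q. M q $ i)"
  by (simp add: holo_vec_def)

lemma holo_vec_column: "holo_mat \<A> W M \<Longrightarrow> holo_vec \<A> W (\<lambda>q. column j (M q))"
  by (simp add: holo_mat_def holo_vec_def column_def)

lemma holo_sympl: "holo_vec \<A> W u \<Longrightarrow> holo_vec \<A> W v \<Longrightarrow> holo \<A> W (\<lambda>q. sympl (u q) (v q))"
  unfolding sympl_def by (intro holo_add holo_diff holo_mult holo_vecD)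

lemma holo_vec_matvec: "holo_mat \<A> W M \<Longrightarrow> holo_vec \<A> W v \<Longrightarrow> holo_vec \<A> W (\<lambda>q. M q *v v q)"
  unfolding holo_mat_pull holo_vec_pull pull_abs by (auto intro: vhol_matvec)

lemma holo_mat_cell:
  assumes "holo_vec \<A> W m" shows "holo_mat \<A> W (\<lambda>q. cell (m q))"
  unfolding holo_mat_def
proof (intro allI)
  fix i j :: 4
  show "holo \<A> W (\<lambda>q. cell (m q) $ i $ j)"
    using exhaust_4[of i] exhaust_4[of j] holo_vecD[OF assms] holo_const
    by (elim disjE) (simp_all add: cell_def)
qed

lemma cell_lift:
  assumes "Q3_coords X \<A> W f A m" shows "lift X \<A> W f (\<lambda>q. A ** cell (m q))"
  using assms unfolding Q3_coords_def lift_def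
  by (auto intro!: holo_mat_mult holo_mat_const holo_mat_cell Sp_mult cell_Sp simp: Q3_param_cell)

lemma Q3_coords_mono: "Q3_coords X \<A> W f A m \<Longrightarrow> openin X W' \<Longrightarrow> W' \<subseteq> W \<Longrightarrow> Q3_coords X \<A> W' f A m"
  unfolding Q3_coords_def using holo_vec_mono by blast

lemma lift_coords:
  assumes L: "lift X \<A> W f L" and p: "p \<in> W"
  obtains W' where "openin X W'" "p \<in> W'" "W' \<subseteq> W"
    "Q3_coords X \<A> W' f (L p) (\<lambda>q. cell_coord (Sp_inv (L p) ** L q))"
    "\<And>q. q \<in> W' \<Longrightarrow> (Sp_inv (L p) ** L q)$1$1 * (Sp_inv (L p) ** L q)$2$2 - (Sp_inv (L p) ** L q)$1$2 * (Sp_inv (L p) ** L q)$2$1 \<noteq> 0"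
proof -
  have W: "openin X W" and hL: "holo_mat \<A> W L" and Sp: "\<And>q. q \<in> W \<Longrightarrow> L q \<in> Sp"
    and f: "\<And>q. q \<in> W \<Longrightarrow> f q = plane (column 1 (L q)) (column 2 (L q))"
    using L by (auto simp: lift_def)
  define Y where "Y = (\<lambda>q. Sp_inv (L p) ** L q)"
  have hY: "holo_mat \<A> W Y" unfolding Y_def by (intro holo_mat_mult holo_mat_const hL)
  define d where "d = (\<lambda>q. Y q $1$1 * Y q $2$2 - Y q $1$2 * Y q $2$1)"
  have hd: "holo \<A> W d" unfolding d_def by (intro holo_diff holo_mult holo_matD hY)
  have "Y p = mat 1" by (simp add: Y_def Sp_inv_left Sp p)
  then have "d p \<noteq> 0" by (simp add: d_def mat_def)
  then obtain W' where W': "openin X W'" "p \<in> W'" "W' \<subseteq> W" "\<And>q. q \<in> W' \<Longrightarrow> d q \<noteq> 0"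
    using avoid_zero[OF W p hd] by blast
  have hY': "holo \<A> W' (\<lambda>q. Y q $ i $ j)" for i j using holo_mono[OF holo_matD[OF hY] W'(3)] .
  have m: "holo_vec \<A> W' (\<lambda>q. cell_coord (Y q))"
    unfolding holo_vec_def
  proof
    fix i :: 3
    show "holo \<A> W' (\<lambda>q. cell_coord (Y q) $ i)"
      using exhaust_3[of i] W'(4) unfolding d_def
      by (elim disjE; simp only: cell_coord_nth) (intro holo_divide holo_diff holo_mult hY'; simp)+
  qed
  have "Q3_coords X \<A> W' f (L p) (\<lambda>q. cell_coord (Y q))"
    unfolding Q3_coords_def using W' m Sp p f Q3_param_cell_coord[OF Sp Sp, of p _ "Y _"]
    by (auto simp: subset_iff Y_def d_def)
  then show ?thesis using that[OF W'(1-3)] W'(4) unfolding Y_def d_def by blast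
qed

lemma lift_holo_Q3:
  assumes L: "lift X \<A> U f L" shows "holo_Q3 X \<A> U f"
proof -
  have "\<exists>W A m. p \<in> W \<and> W \<subseteq> U \<and> Q3_coords X \<A> W f A m" if "p \<in> U" for p
    using lift_coords[OF L that] by metis
  moreover have "f ` U \<subseteq> Q3" using L plane_Sp_in_Q3 by (auto simp: lift_def)
  ultimately show ?thesis by (simp add: holo_Q3_def)
qed

text \<open>By \<open>sympl_graph\<close> the pairings are combinations of the coordinate
  differences with holomorphic coefficients, whatever the lifts. The index is \<open>Suc k\<close>
  because contact of order \<open>k\<close> includes the \<open>k\<close>-th derivatives.\<close>

lemma contact_vanish:
  assumes con: "analytic_contact X \<A> k p f g"
    and L: "lift X \<A> W f L" "lift X \<A> W' g L'" and p: "p \<in> W" "p \<in> W'" and c: "c \<in> \<A>" "p \<in> fst c"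
    and x: "x = 1 \<or> x = 2" and y: "y = 1 \<or> y = 2"
  shows "vanish (Suc k) (pull c (\<lambda>q. sympl (column x (L q)) (column y (L' q)))) (snd c p)"
proof -
  obtain W1 A m n c1 where 1: "c1 \<in> \<A>" "p \<in> W1" "p \<in> fst c1" "Q3_coords X \<A> W1 f A m" "Q3_coords X \<A> W1 g A n"
    "\<And>j i. j \<le> k \<Longrightarrow> chart_deriv c1 j (\<lambda>q. m q $ i) p = chart_deriv c1 j (\<lambda>q. n q $ i) p"
    using con unfolding analytic_contact_def by blast
  define V where "V = W \<inter> W' \<inter> W1"
  have V: "openin X V" "p \<in> V" using L 1 p by (auto simp: V_def lift_def Q3_coords_def)
  have hL: "holo_mat \<A> V L" "holo_mat \<A> V L'" using L by (auto simp: lift_def V_def intro: holo_mat_mono)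
  have hm: "holo_vec \<A> V m" "holo_vec \<A> V n" using 1 by (auto simp: Q3_coords_def V_def intro: holo_vec_mono)
  have A: "A \<in> Sp" using 1 by (simp add: Q3_coords_def)
  let ?h = "\<lambda>q. sympl (column x (L q)) (column y (L' q))"
  have h: "holo \<A> V ?h" by (intro holo_sympl holo_vec_column hL)
  define u where "u = (\<lambda>q. Sp_inv A *v column x (L q))"
  define u' where "u' = (\<lambda>q. Sp_inv A *v column y (L' q))"
  have hu: "holo_vec \<A> V u" "holo_vec \<A> V u'"
    unfolding u_def u'_def by (intro holo_vec_matvec holo_mat_const holo_vec_column hL)+
  have e: "?h q = (n q$1 - m q$1) * (u q$1 * u' q$1) + (n q$2 - m q$2) * (u q$1 * u' q$2 + u q$2 * u' q$1)
      + (n q$3 - m q$3) * (u q$2 * u' q$2)" if q: "q \<in> V" for q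
  proof (rule sympl_graph[OF A])
    have "column x (L q) \<in> f q" "column y (L' q) \<in> g q"
      using L q x y vec.span_base[of _ "{column 1 (L q), column 2 (L q)}"] vec.span_base[of _ "{column 1 (L' q), column 2 (L' q)}"]
      unfolding lift_def V_def plane_def by auto
    then show "column x (L q) \<in> Q3_param A (m q)" "column y (L' q) \<in> Q3_param A (n q)"
      using 1 q by (auto simp: Q3_coords_def V_def)
  qed (simp_all add: u_def u'_def)
  have an: "pull c1 f analytic_on {snd c1 p}" if "holo \<A> V f" for f using pull_analytic[OF 1(1,3) V that] .
  have vm: "vanish (Suc k) (pull c1 (\<lambda>q. n q $ i - m q $ i)) (snd c1 p)" for i
  proof -
    have a: "pull c1 (\<lambda>q. n q $ i) analytic_on {snd c1 p}" "pull c1 (\<lambda>q. m q $ i) analytic_on {snd c1 p}"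
      using an hm by (simp_all add: holo_vecD)
    have "vanish (Suc k) (\<lambda>w. pull c1 (\<lambda>q. n q $ i) w - pull c1 (\<lambda>q. m q $ i) w) (snd c1 p)"
      unfolding vanish_def using 1(6) higher_deriv_diff_at[OF a] by (simp add: chart_deriv_pull)
    then show ?thesis by (simp add: pull_abs)
  qed
  have r: "vanish (Suc k) (\<lambda>w. pull c1 (\<lambda>q. u q$1 * u' q$1) w * pull c1 (\<lambda>q. n q $ 1 - m q $ 1) w
     + pull c1 (\<lambda>q. u q$1 * u' q$2 + u q$2 * u' q$1) w * pull c1 (\<lambda>q. n q $ 2 - m q $ 2) w
     + pull c1 (\<lambda>q. u q$2 * u' q$2) w * pull c1 (\<lambda>q. n q $ 3 - m q $ 3) w) (snd c1 p)"
    by (intro vanish_add vanish_mult vm analytic_on_add analytic_on_mult an holo_diff holo_add holo_mult holo_vecD hm hu)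
  have "vanish (Suc k) (pull c1 ?h) (snd c1 p)"
  proof (rule vanish_congI[OF img_open[OF 1(1) V(1)] _ _ r])
    show "snd c1 p \<in> snd c1 ` (fst c1 \<inter> V)" using 1 V by auto
    fix w assume "w \<in> snd c1 ` (fst c1 \<inter> V)"
    then obtain q where q: "q \<in> fst c1" "q \<in> V" "w = snd c1 q" by auto
    then show "pull c1 ?h w = pull c1 (\<lambda>q. u q$1 * u' q$1) w * pull c1 (\<lambda>q. n q $ 1 - m q $ 1) w
     + pull c1 (\<lambda>q. u q$1 * u' q$2 + u q$2 * u' q$1) w * pull c1 (\<lambda>q. n q $ 2 - m q $ 2) w
     + pull c1 (\<lambda>q. u q$2 * u' q$2) w * pull c1 (\<lambda>q. n q $ 3 - m q $ 3) w"
      using e[OF q(2)] 1(1) by (simp add: mult.commute)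
  qed
  then show ?thesis using vanish_chart_change[OF 1(1) c(1) 1(3) c(2) V h] by blast
qed

text \<open>The relation of \<open>sympl_graph\<close> is solved for the coordinate differences.
  Since the lifts agree at \<open>p\<close>, one cell, based at their common value, contains both
  curves near \<open>p\<close>.\<close>

lemma vanish_contact:
  assumes L: "lift X \<A> W f L" "lift X \<A> W' g L'" and p: "p \<in> W" "p \<in> W'" and eq: "L p = L' p"
    and c: "c \<in> \<A>" "p \<in> fst c"
    and v: "\<And>x y. x = 1 \<or> x = 2 \<Longrightarrow> y = 1 \<or> y = 2 \<Longrightarrow>
      vanish (Suc k) (pull c (\<lambda>q. sympl (column x (L q)) (column y (L' q)))) (snd c p)"
  shows "analytic_contact X \<A> k p f g"
proof -
  define Y where "Y = (\<lambda>q. Sp_inv (L p) ** L q)"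
  define Z where "Z = (\<lambda>q. Sp_inv (L p) ** L' q)"
  obtain W1 where 1: "openin X W1" "p \<in> W1" "W1 \<subseteq> W" "Q3_coords X \<A> W1 f (L p) (\<lambda>q. cell_coord (Y q))"
    "\<And>q. q \<in> W1 \<Longrightarrow> Y q$1$1 * Y q$2$2 - Y q$1$2 * Y q$2$1 \<noteq> 0"
    using lift_coords[OF L(1) p(1)] unfolding Y_def by metis
  obtain W2 where 2: "openin X W2" "p \<in> W2" "W2 \<subseteq> W'" "Q3_coords X \<A> W2 g (L p) (\<lambda>q. cell_coord (Z q))"
    "\<And>q. q \<in> W2 \<Longrightarrow> Z q$1$1 * Z q$2$2 - Z q$1$2 * Z q$2$1 \<noteq> 0"
    using lift_coords[OF L(2) p(2)] unfolding Z_def eq by metis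
  define V where "V = W1 \<inter> W2"
  have V: "openin X V" "p \<in> V" "V \<subseteq> W1" "V \<subseteq> W2" using 1 2 by (auto simp: V_def)
  define m where "m = (\<lambda>q. cell_coord (Y q))"
  define n where "n = (\<lambda>q. cell_coord (Z q))"
  have Cf: "Q3_coords X \<A> V f (L p) m" and Cg: "Q3_coords X \<A> V g (L p) n"
    using Q3_coords_mono 1 2 V unfolding m_def n_def by blast+
  have A: "L p \<in> Sp" using Cf by (simp add: Q3_coords_def)
  have hm: "holo_vec \<A> V m" "holo_vec \<A> V n" using Cf Cg by (auto simp: Q3_coords_def)
  have hL: "holo_mat \<A> V L" "holo_mat \<A> V L'" using L holo_mat_mono[of \<A> W L V] holo_mat_mono[of \<A> W' L' V] V 1(3) 2(3) by (auto simp: lift_def)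
  have hY: "holo_mat \<A> V Y" "holo_mat \<A> V Z" unfolding Y_def Z_def by (intro holo_mat_mult holo_mat_const hL)+
  define h where "h = (\<lambda>x y q. sympl (column x (L q)) (column y (L' q)))"
  have hh: "holo \<A> V (h x y)" for x y unfolding h_def by (intro holo_sympl holo_vec_column hL)
  have e: "h x y q = (n q$1 - m q$1) * (Y q$1$x * Z q$1$y) + (n q$2 - m q$2) * (Y q$1$x * Z q$2$y + Y q$2$x * Z q$1$y)
      + (n q$3 - m q$3) * (Y q$2$x * Z q$2$y)" if q: "q \<in> V" and x: "x = 1 \<or> x = 2" and y: "y = 1 \<or> y = 2" for q x y
  proof -
    have c: "column x (L q) \<in> f q" "column y (L' q) \<in> g q"
      using L q x y 1(3) 2(3) vec.span_base[of _ "{column 1 (L q), column 2 (L q)}"] vec.span_base[of _ "{column 1 (L' q), column 2 (L' q)}"]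
      unfolding lift_def V_def plane_def by auto
    then have c: "column x (L q) \<in> Q3_param (L p) (m q)" "column y (L' q) \<in> Q3_param (L p) (n q)"
      using Cf Cg q by (auto simp: Q3_coords_def)
    show ?thesis unfolding h_def
      using sympl_graph[OF A c refl refl] by (simp add: Y_def Z_def flip: column_mult) (simp add: column_def)
  qed
  define d where "d = (\<lambda>q. (Y q$1$1 * Y q$2$2 - Y q$1$2 * Y q$2$1) * (Z q$1$1 * Z q$2$2 - Z q$1$2 * Z q$2$1))"
  have hd: "holo \<A> V d" unfolding d_def by (intro holo_diff holo_mult holo_matD hY)
  have d0: "d p \<noteq> 0" using 1(5)[OF 1(2)] 2(5)[OF 2(2)] by (simp add: d_def)
  have an: "pull c f analytic_on {snd c p}" if "holo \<A> V f" for f using pull_analytic[OF c V(1,2) that] .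
  have v': "vanish (Suc k) (pull c (h x y)) (snd c p)" if "x = 1 \<or> x = 2" "y = 1 \<or> y = 2" for x y
    unfolding h_def using v[OF that] .
  have vs: "vanish (Suc k) (pull c (\<lambda>q. n q $ i - m q $ i)) (snd c p)"
    if al: "\<And>q. q \<in> V \<Longrightarrow> d q * (n q $ i - m q $ i) = a q * h 1 1 q + b q * h 1 2 q + b' q * h 2 1 q + a' q * h 2 2 q"
     and ha: "holo \<A> V a" "holo \<A> V b" "holo \<A> V b'" "holo \<A> V a'" for i a b b' a'
  proof (rule vanish_cancel[OF an[OF hd]])
    show "pull c d (snd c p) \<noteq> 0" using d0 c by simp
    show "pull c (\<lambda>q. n q $ i - m q $ i) analytic_on {snd c p}" by (intro an holo_diff holo_vecD hm)
    have r: "vanish (Suc k) (\<lambda>w. pull c a w * pull c (h 1 1) w + pull c b w * pull c (h 1 2) w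
        + pull c b' w * pull c (h 2 1) w + pull c a' w * pull c (h 2 2) w) (snd c p)"
      by (intro vanish_add vanish_mult analytic_on_add analytic_on_mult an ha hh v'; simp)
    show "vanish (Suc k) (\<lambda>w. pull c d w * pull c (\<lambda>q. n q $ i - m q $ i) w) (snd c p)"
    proof (rule vanish_congI[OF img_open[OF c(1) V(1)] _ _ r])
      show "snd c p \<in> snd c ` (fst c \<inter> V)" using c V by auto
      fix w assume "w \<in> snd c ` (fst c \<inter> V)"
      then obtain q where q: "q \<in> fst c" "q \<in> V" "w = snd c q" by auto
      then show "pull c d w * pull c (\<lambda>q. n q $ i - m q $ i) w = pull c a w * pull c (h 1 1) w + pull c b w * pull c (h 1 2) w
        + pull c b' w * pull c (h 2 1) w + pull c a' w * pull c (h 2 2) w"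
        using al[OF q(2)] c(1) by simp
    qed
  qed
  \<comment> \<open>The four pairings form the matrix \<open>Y\<^sup>T (n - m) Z\<close> in the
    upper left blocks of \<open>Y\<close> and \<open>Z\<close>. The coefficients here and in
    \<open>v2\<close>, \<open>v3\<close> are the products of entries of the two adjugates that undo
    this, up to the factor \<open>d\<close>.\<close>
  have v1: "vanish (Suc k) (pull c (\<lambda>q. n q $ 1 - m q $ 1)) (snd c p)"
    by (rule vs[of 1 "\<lambda>q. Y q$2$2 * Z q$2$2" "\<lambda>q. 0 - Y q$2$2 * Z q$2$1" "\<lambda>q. 0 - Y q$2$1 * Z q$2$2" "\<lambda>q. Y q$2$1 * Z q$2$1"])
      (simp add: e d_def, algebra, (intro holo_mult holo_diff holo_const holo_matD hY)+)
  have v2: "vanish (Suc k) (pull c (\<lambda>q. n q $ 2 - m q $ 2)) (snd c p)"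
    by (rule vs[of 2 "\<lambda>q. 0 - Y q$2$2 * Z q$1$2" "\<lambda>q. Y q$2$2 * Z q$1$1" "\<lambda>q. Y q$2$1 * Z q$1$2" "\<lambda>q. 0 - Y q$2$1 * Z q$1$1"])
      (simp add: e d_def, algebra, (intro holo_mult holo_diff holo_const holo_matD hY)+)
  have v3: "vanish (Suc k) (pull c (\<lambda>q. n q $ 3 - m q $ 3)) (snd c p)"
    by (rule vs[of 3 "\<lambda>q. Y q$1$2 * Z q$1$2" "\<lambda>q. 0 - Y q$1$2 * Z q$1$1" "\<lambda>q. 0 - Y q$1$1 * Z q$1$2" "\<lambda>q. Y q$1$1 * Z q$1$1"])
      (simp add: e d_def, algebra, (intro holo_mult holo_diff holo_const holo_matD hY)+)
  have "chart_deriv c j (\<lambda>q. m q $ i) p = chart_deriv c j (\<lambda>q. n q $ i) p" if j: "j \<le> k" for j i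
  proof -
    have a: "pull c (\<lambda>q. n q $ i) analytic_on {snd c p}" "pull c (\<lambda>q. m q $ i) analytic_on {snd c p}"
      using an hm by (simp_all add: holo_vecD)
    have "vanish (Suc k) (pull c (\<lambda>q. n q $ i - m q $ i)) (snd c p)" using exhaust_3[of i] v1 v2 v3 by auto
    then have "vanish (Suc k) (\<lambda>w. pull c (\<lambda>q. n q $ i) w - pull c (\<lambda>q. m q $ i) w) (snd c p)"
      by (simp add: pull_abs)
    then show ?thesis
      using j higher_deriv_diff_at[OF a] by (simp add: chart_deriv_pull vanish_def less_Suc_eq_le)
  qed
  then show ?thesis unfolding analytic_contact_def using Cf Cg V c by blast
qed

lemma contact_value:
  assumes "analytic_contact X \<A> k p f g" shows "f p = g p"
proof -
  obtain W A m n c where 1: "c \<in> \<A>" "p \<in> W" "p \<in> fst c" "Q3_coords X \<A> W f A m" "Q3_coords X \<A> W g A n"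
    "\<And>j i. j \<le> k \<Longrightarrow> chart_deriv c j (\<lambda>q. m q $ i) p = chart_deriv c j (\<lambda>q. n q $ i) p"
    using assms unfolding analytic_contact_def by blast
  have "m p $ i = n p $ i" for i using 1(6)[of 0 i] 1(1,3) by (simp add: chart_deriv_pull)
  then have "m p = n p" by (simp add: vec_eq_iff)
  then show ?thesis using 1 by (simp add: Q3_coords_def)
qed

end

section \<open>The Legendre associate\<close>

lemma plane_two:
  assumes "a \<in> plane x y" "b \<in> plane x y" "\<And>s t. s *s a + t *s b = 0 \<Longrightarrow> s = 0 \<and> t = 0"
  shows "plane a b = plane x y"
proof -
  obtain \<alpha> \<beta> \<gamma> \<delta> where ab: "a = \<alpha> *s x + \<beta> *s y" "b = \<gamma> *s x + \<delta> *s y"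
    using assms(1,2) unfolding plane_mem by blast
  show ?thesis
  proof (rule plane_change[OF ab])
    show "\<alpha> * \<delta> - \<beta> * \<gamma> \<noteq> 0"
    proof
      assume 0: "\<alpha> * \<delta> - \<beta> * \<gamma> = 0"
      have "\<delta> *s a + (- \<beta>) *s b = (\<alpha> * \<delta> - \<beta> * \<gamma>) *s x" unfolding ab by (simp add: vec_eq_iff algebra_simps)
      then have "\<delta> *s a + (- \<beta>) *s b = 0" using 0 by simp
      then have 1: "\<delta> = 0 \<and> - \<beta> = 0" by (rule assms(3))
      have "(- \<gamma>) *s a + \<alpha> *s b = (\<alpha> * \<delta> - \<beta> * \<gamma>) *s y" unfolding ab by (simp add: vec_eq_iff algebra_simps)
      then have "(- \<gamma>) *s a + \<alpha> *s b = 0" using 0 by simp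
      then have 2: "- \<gamma> = 0 \<and> \<alpha> = 0" by (rule assms(3))
      have "1 *s a + 0 *s b = 0" using 1 2 by (simp add: ab)
      from assms(3)[OF this] show False by simp
    qed
  qed
qed

text \<open>Scaling \<open>v\<close> by \<open>l\<close> multiplies the pairing of \<open>v'\<close>
  and \<open>v''\<close> by \<open>l\<^sup>2\<close>, as all other terms vanish by isotropy. A
  holomorphic root of its reciprocal exists because the disc is simply connected.\<close>

lemma legendrian_rescale:
  assumes v: "vhol (ball z0 r) v" and 0: "\<And>z. z \<in> ball z0 r \<Longrightarrow> sympl (v z) (vd v z) = 0"
    and 1: "\<And>z. z \<in> ball z0 r \<Longrightarrow> sympl (vd v z) (vd (vd v) z) \<noteq> 0"
  obtains u where "legendrian (ball z0 r) u" "\<And>z. z \<in> ball z0 r \<Longrightarrow> plane (u z) (vd u z) = plane (v z) (vd v z)"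
proof -
  let ?D = "ball z0 r"
  note v1 = vhol_vd[OF v open_ball]
  note v2 = vhol_vd[OF v1 open_ball]
  let ?\<rho> = "\<lambda>z. sympl (vd v z) (vd (vd v) z)"
  have h: "(\<lambda>z. 1 / ?\<rho> z) holomorphic_on ?D" by (intro holomorphic_intros sympl_hol v1 v2 1)
  obtain l where l: "l holomorphic_on ?D" "\<And>z. z \<in> ?D \<Longrightarrow> 1 / ?\<rho> z = (l z)^2"
    using contractible_imp_holomorphic_sqrt[OF h convex_imp_contractible[OF convex_ball]] 1 by auto
  define u where "u = (\<lambda>z. l z *s v z)"
  have hl: "deriv l holomorphic_on ?D" by (rule holomorphic_deriv[OF l(1) open_ball])
  have hu: "vhol ?D u" unfolding u_def by (intro vhol_scale l v)
  have du: "vd u z = deriv l z *s v z + l z *s vd v z" if "z \<in> ?D" for z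
    unfolding u_def by (rule vd_scale[OF l(1) v open_ball that])
  have ddu: "vd (vd u) z = deriv (deriv l) z *s v z + (2 * deriv l z) *s vd v z + l z *s vd (vd v) z" if "z \<in> ?D" for z
  proof -
    have "vd (vd u) z = vd (\<lambda>z. deriv l z *s v z + l z *s vd v z) z" by (rule vd_cong[OF open_ball that du])
    then show ?thesis
      by (simp add: vd_add[OF vhol_scale[OF hl v] vhol_scale[OF l(1) v1] open_ball that]
          vd_scale[OF hl v open_ball that] vd_scale[OF l(1) v1 open_ball that])
        (simp add: vec_eq_iff algebra_simps)
  qed
  have l0: "l z \<noteq> 0" if "z \<in> ?D" for z using l(2)[OF that] 1[OF that] by auto
  have v02: "sympl (v z) (vd (vd v) z) = 0" if "z \<in> ?D" for z
    using sympl_const_vd[OF v v1 open_ball 0 that] by simp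
  have sw: "sympl (vd v z) (v z) = 0" if "z \<in> ?D" for z using 0[OF that] sympl_swap[of "vd v z" "v z"] by simp
  have "legendrian ?D u"
    unfolding legendrian_def
  proof (intro conjI ballI hu open_ball)
    fix z assume z: "z \<in> ?D"
    show "sympl (u z) (vd u z) = 0" unfolding du[OF z] by (simp add: u_def sympl_linear 0[OF z])
    have "sympl (vd u z) (vd (vd u) z) = (l z)^2 * ?\<rho> z"
      unfolding du[OF z] ddu[OF z] by (simp add: sympl_linear 0[OF z] v02[OF z] sw[OF z] power2_eq_square)
    then show "sympl (vd u z) (vd (vd u) z) = 1" using l(2)[OF z, symmetric] 1[OF z] by simp
  qed
  moreover have "plane (u z) (vd u z) = plane (v z) (vd v z)" if "z \<in> ?D" for z
    by (rule plane_change[of _ "l z" _ 0 _ _ "deriv l z" "l z"]) (use l0[OF that] du[OF that] in \<open>simp_all add: u_def\<close>)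
  ultimately show ?thesis by (rule that)
qed

text \<open>Dividing by \<open>w - z\<close> as long as all members of the family vanish at
  \<open>z\<close> stops, since one member has a zero of finite order. It is applied to the
  components of the derivative of \<open>f\<close> at a possibly critical point.\<close>

lemma common_zeros_factor:
  fixes h :: "'i \<Rightarrow> complex \<Rightarrow> complex"
  assumes h: "\<And>i. h i holomorphic_on ball z r" and r: "r > 0" and ne: "\<exists>i. \<exists>w\<in>ball z r. h i w \<noteq> 0"
  shows "\<exists>k n. (\<forall>i. n i holomorphic_on ball z r) \<and> (\<forall>i. \<forall>w\<in>ball z r. h i w = (w - z) ^ k * n i w) \<and> (\<exists>i. n i z \<noteq> 0)"
proof -
  have z: "z \<in> ball z r" using r by simp
  obtain i0 w0 where "w0 \<in> ball z r" "h i0 w0 \<noteq> 0" using ne by blast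
  then obtain j where "(deriv ^^ j) (h i0) z \<noteq> 0"
    using holomorphic_fun_eq_0_on_connected[OF h open_ball connected_ball _ z] by blast
  then have "\<not> vanish (Suc j) (h i0) z" unfolding vanish_def by blast
  then show ?thesis
    using h
  proof (induction "Suc j" arbitrary: j h rule: nat_less_induct)
    case (1 j h)
    show ?case
    proof (cases "\<exists>i. h i z \<noteq> 0")
      case True then show ?thesis using "1.prems" by (intro exI[of _ 0] exI[of _ h]) simp
    next
      case False
      \<comment> \<open>The quotient by \<open>w - z\<close>, its removable singularity filled
        in.\<close>
      define g where "g = (\<lambda>i w. if w = z then deriv (h i) z else (h i w - h i z) / (w - z))"
      have g: "g i holomorphic_on ball z r" for i
        unfolding g_def by (rule pole_lemma_open[OF "1.prems"(2) open_ball])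
      have e: "h i w = (w - z) * g i w" for i w using False by (simp add: g_def)
      have ga: "g i analytic_on {z}" for i using g z analytic_at open_ball by blast
      have "\<not> vanish j (g i0) z"
      proof
        assume "vanish j (g i0) z"
        then have "vanish (1 + j) (\<lambda>w. (w - z) * g i0 w) z"
          by (intro vanish_mult2 ga) (auto intro!: analytic_intros simp: vanish_def)
        then show False using "1.prems"(1) by (simp flip: e)
      qed
      then obtain j' where j: "j = Suc j'" by (cases j) auto
      then have "\<exists>k n. (\<forall>i. n i holomorphic_on ball z r) \<and> (\<forall>i. \<forall>w\<in>ball z r. g i w = (w - z) ^ k * n i w) \<and> (\<exists>i. n i z \<noteq> 0)"
        using "1.hyps"[rule_format, of j j' g] \<open>\<not> vanish j (g i0) z\<close> g by simp
      then obtain k n where kn: "\<And>i. n i holomorphic_on ball z r" "\<And>i w. w \<in> ball z r \<Longrightarrow> g i w = (w - z) ^ k * n i w" "\<exists>i. n i z \<noteq> 0"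
        by blast
      have "h i w = (w - z) ^ Suc k * n i w" if "w \<in> ball z r" for i w
        using kn(2)[OF that, of i] by (simp add: e)
      then show ?thesis using kn(1,3) by blast
    qed
  qed
qed

lemma cell_md:
  assumes m: "vhol D m" and D: "open D" "z \<in> D"
  shows "column 1 (md (\<lambda>w. cell (m w)) z) = vd m z $ 1 *s axis 3 1 + vd m z $ 2 *s axis 4 1"
    "column 2 (md (\<lambda>w. cell (m w)) z) = vd m z $ 2 *s axis 3 1 + vd m z $ 3 *s axis 4 1"
proof -
  show "column 1 (md (\<lambda>w. cell (m w)) z) = vd m z $ 1 *s axis 3 1 + vd m z $ 2 *s axis 4 1"
    by (simp add: vec_eq_iff[where 'b=4] forall_4 column_def md_def cell_def vd_def axis_def)
  show "column 2 (md (\<lambda>w. cell (m w)) z) = vd m z $ 2 *s axis 3 1 + vd m z $ 3 *s axis 4 1"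
    by (simp add: vec_eq_iff[where 'b=4] forall_4 column_def md_def cell_def vd_def axis_def)
qed

lemma mhol_cell: "vhol D m \<Longrightarrow> mhol D (\<lambda>w. cell (m w))"
  unfolding mhol_def
proof (intro allI)
  fix i j :: 4
  assume "vhol D m"
  then show "(\<lambda>w. cell (m w) $ i $ j) holomorphic_on D"
    using exhaust_4[of i] exhaust_4[of j] vhol_D[of D m]
    by (elim disjE) (simp_all add: cell_def)
qed

context rsurf begin

lemma holo_vec_vhol: "holo_vec \<A> W v \<Longrightarrow> c \<in> \<A> \<Longrightarrow> vhol (snd c ` (fst c \<inter> W)) (pull c v)"
  by (simp add: holo_vec_pull)

text \<open>For the lift \<open>A ** cell m\<close> the lower left block of the Maurer-Cartan form
  is the derivative of \<open>m\<close>: critical points, nullity and the kernel of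
  \<open>mdot\<close> can all be read off it.\<close>

lemma cell_lift_mdot:
  assumes Q: "Q3_coords X \<A> W f A m" and c: "c \<in> \<A>" and q: "q \<in> W" "q \<in> fst c"
  defines "L \<equiv> \<lambda>q. A ** cell (m q)" and "h \<equiv> vd (pull c m) (snd c q)"
  shows "sympl (column 1 (L q)) (column 1 (mat_deriv c L q)) = h $ 1"
    "sympl (column 1 (L q)) (column 2 (mat_deriv c L q)) = h $ 2"
    "sympl (column 2 (L q)) (column 1 (mat_deriv c L q)) = h $ 2"
    "sympl (column 2 (L q)) (column 2 (mat_deriv c L q)) = h $ 3"
proof -
  let ?D = "snd c ` (fst c \<inter> W)"
  have W: "openin X W" and A: "A \<in> Sp" and m: "holo_vec \<A> W m" using Q by (auto simp: Q3_coords_def)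
  have D: "open ?D" "snd c q \<in> ?D" using img_open[OF c W] q by auto
  have hm: "vhol ?D (pull c m)" by (rule holo_vec_vhol[OF m c])
  have "md (pull c L) (snd c q) = A ** md (\<lambda>w. cell (pull c m w)) (snd c q)"
    using md_mult[OF mhol_const mhol_cell[OF hm] D, of A] by (simp add: md_const L_def pull_abs)
  then have e: "column k (mat_deriv c L q) = A *v column k (md (\<lambda>w. cell (pull c m w)) (snd c q))" for k
    by (simp add: mat_deriv_pull column_mult)
  show "sympl (column 1 (L q)) (column 1 (mat_deriv c L q)) = h $ 1"
    "sympl (column 1 (L q)) (column 2 (mat_deriv c L q)) = h $ 2"
    "sympl (column 2 (L q)) (column 1 (mat_deriv c L q)) = h $ 2"
    "sympl (column 2 (L q)) (column 2 (mat_deriv c L q)) = h $ 3"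
    unfolding e by (simp_all add: L_def column_mult sympl_Sp[OF A] cell_md[OF hm D] column_cell h_def[symmetric])
      (simp_all add: sympl_def axis_def)
qed

text \<open>On a disc inside a cell, constancy of \<open>f\<close> is constancy of the coordinates
  \<open>m\<close>, to which the identity theorem applies; \<open>continuation\<close> passes from
  disc to disc.\<close>

lemma isotropic_locally_nonconstant:
  assumes iso: "isotropic_curve X \<A> U f" and N: "openin X N" "N \<noteq> {}" "N \<subseteq> U"
  shows "\<not> (\<forall>q\<in>N. f q = P)"
proof
  assume NP: "\<forall>q\<in>N. f q = P"
  have U: "openin X U" "connectedin X U" and hol: "holo_Q3 X \<A> U f" using iso by (auto simp: isotropic_curve_def)
  have "U \<subseteq> {q. f q = P}"
  proof (rule continuation[OF U N])
    show "N \<subseteq> {q. f q = P}" using NP by blast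
    fix p assume p: "p \<in> U"
    obtain W A m where W: "p \<in> W" "W \<subseteq> U" "Q3_coords X \<A> W f A m" using hol p by (auto simp: holo_Q3_def)
    have oW: "openin X W" and A: "A \<in> Sp" and m: "holo_vec \<A> W m" and f: "\<And>q. q \<in> W \<Longrightarrow> f q = Q3_param A (m q)"
      using W by (auto simp: Q3_coords_def)
    obtain c where c: "c \<in> \<A>" "p \<in> fst c" using chart_exists p openin_subset[OF U(1)] by blast
    obtain r where r: "r > 0" "\<And>s. 0 < s \<Longrightarrow> s \<le> r \<Longrightarrow> ball (snd c p) s \<subseteq> snd c ` fst c \<and> disc c p s \<subseteq> W"
      using disc_exists[OF c oW W(1)] by blast
    let ?V = "disc c p r"
    have b: "ball (snd c p) r \<subseteq> snd c ` fst c" "?V \<subseteq> W" using r by auto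
    note d = disc_properties[OF c r(1) b(1)]
    have "?V \<subseteq> {q. f q = P}" if O: "openin X O' \<and> O' \<noteq> {} \<and> O' \<subseteq> ?V \<and> O' \<subseteq> {q. f q = P}" for O'
    proof -
      obtain a where a: "a \<in> O'" using O by blast
      have aV: "a \<in> ?V" using a O by blast
      then have aW: "a \<in> W" using b by blast
      have "m q = m a" if "q \<in> O'" for q
      proof -
        have "q \<in> W" "f q = f a" using that a O b by blast+
        then show ?thesis using f aW Q3_param_inj[OF A] by metis
      qed
      then have mc: "\<And>q. q \<in> O' \<Longrightarrow> cell (m q) = cell (m a)" by simp
      have "\<forall>q\<in>?V. cell (m q) = cell (m a)"
        by (rule holo_mat_const_continuation[OF d(1,4) holo_mat_mono[OF holo_mat_cell[OF m] b(2)] _ _ _ mc])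
          (use O in auto)
      then have e: "f q = f a" if "q \<in> ?V" for q
        using f that aW b(2) by (simp add: Q3_param_cell subset_iff)
      have "f a = P" using a O by blast
      then show ?thesis using e by auto
    qed
    then show "\<exists>W. openin X W \<and> p \<in> W \<and> W \<subseteq> U \<and>
       (\<forall>O'. openin X O' \<and> O' \<noteq> {} \<and> O' \<subseteq> W \<and> O' \<subseteq> {q. f q = P} \<longrightarrow> W \<subseteq> {q. f q = P})"
      using d(1,2) b(2) W(2) by (intro exI[of _ ?V] conjI allI impI) auto
  qed
  then show False using iso by (auto simp: isotropic_curve_def)
qed

lemma coords_derivative_nonzero:
  assumes iso: "isotropic_curve X \<A> U f" and Q: "Q3_coords X \<A> W f A m" and W: "W \<subseteq> U"
    and c: "c \<in> \<A>" "p \<in> fst c" and r: "r > 0" "ball (snd c p) r \<subseteq> snd c ` fst c" "disc c p r \<subseteq> W"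
  shows "\<exists>w\<in>ball (snd c p) r. vd (pull c m) w \<noteq> 0"
proof (rule ccontr)
  assume "\<not> ?thesis"
  then have 0: "vd (pull c m) w = 0" if "w \<in> ball (snd c p) r" for w using that by blast
  note d = disc_properties[OF c r(1,2)]
  have m: "holo_vec \<A> W m" using Q by (simp add: Q3_coords_def)
  have hm: "vhol (ball (snd c p) r) (pull c m)"
    by (rule vhol_subset[OF holo_vec_vhol[OF m c(1)]]) (use d(3,5) r(3) in blast)
  have "md (\<lambda>w. cell (pull c m w)) w = 0" if w: "w \<in> ball (snd c p) r" for w
  proof -
    have "column 1 (md (\<lambda>w. cell (pull c m w)) w) = 0" "column 2 (md (\<lambda>w. cell (pull c m w)) w) = 0"
      using cell_md[OF hm open_ball w] 0[OF w] by simp_all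
    moreover have "column 3 (md (\<lambda>w. cell (pull c m w)) w) = 0" "column 4 (md (\<lambda>w. cell (pull c m w)) w) = 0"
      unfolding vd_column[symmetric] column_cell vd_const by simp_all
    moreover have "column k (0::complex^4^4) = 0" for k by (simp add: column_def vec_eq_iff)
    ultimately show ?thesis using forall_4[of "\<lambda>k. column k (md (\<lambda>w. cell (pull c m w)) w) = column k 0"]
      by (simp add: mat_eq_columns)
  qed
  then have "cell (pull c m w) = cell (pull c m (snd c p))" if "w \<in> ball (snd c p) r" for w
    by (rule md_zero_const[OF mhol_cell[OF hm] open_ball connected_ball _ that]) (use r in auto)
  then have e: "cell (pull c m (snd c q)) = cell (pull c m (snd c p))" if "q \<in> disc c p r" for q
    using that by (simp add: disc_def)
  have ce: "cell (m q) = cell (m p)" if "q \<in> disc c p r" for q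
  proof -
    have "q \<in> fst c" using that d(5) by blast
    then show ?thesis using e[OF that] c by simp
  qed
  have f: "f q = Q3_param A (m q)" if "q \<in> W" for q using Q that by (simp add: Q3_coords_def)
  have pW: "p \<in> W" using d(2) r(3) by blast
  have "f q = f p" if "q \<in> disc c p r" for q
  proof -
    have "q \<in> W" using that r(3) by blast
    then show ?thesis using f pW ce[OF that] by (simp add: Q3_param_cell)
  qed
  then have "\<forall>q\<in>disc c p r. f q = f p" by blast
  moreover have "disc c p r \<noteq> {}" "disc c p r \<subseteq> U" using d(2) r(3) W by blast+
  ultimately show False using isotropic_locally_nonconstant[OF iso d(1)] by blast
qed

lemma null_coords:
  assumes iso: "isotropic_curve X \<A> U f" and Q: "Q3_coords X \<A> W f A m" and W: "W \<subseteq> U"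
    and c: "c \<in> \<A>" "q \<in> fst c" "q \<in> W"
  shows "vd (pull c m) (snd c q) $ 1 * vd (pull c m) (snd c q) $ 3 = (vd (pull c m) (snd c q) $ 2)^2"
proof -
  define L where "L = (\<lambda>q. A ** cell (m q))"
  have L: "lift X \<A> W f L" unfolding L_def by (rule cell_lift[OF Q])
  have "mc c L q $ 3 $ 1 * mc c L q $ 4 $ 2 - (mc c L q $ 4 $ 1)\<^sup>2 = 0"
    using iso W L c unfolding isotropic_curve_def null_curve_def by blast
  moreover have "L q \<in> Sp" using L c by (simp add: lift_def)
  moreover have Lq: "A ** cell (m q) = L q" for q by (simp add: L_def)
  ultimately show ?thesis
    using cell_lift_mdot[OF Q c(1,3,2), unfolded Lq] c
    by (simp add: mc_pull mcP_nth mat_deriv_pull)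
qed

lemma vd_chart_change:
  assumes c: "c \<in> \<A>" and c': "c' \<in> \<A>" and p: "p \<in> fst c" "p \<in> fst c'"
    and W: "openin X W" "p \<in> W" "holo_vec \<A> W (v :: 'a \<Rightarrow> complex^'n)"
  obtains J where "J \<noteq> 0" "vd (pull c' v) (snd c' p) = J *s vd (pull c v) (snd c p)"
proof -
  define M :: "'a \<Rightarrow> complex^1^'n" where "M = (\<lambda>q. \<chi> i j. v q $ i)"
  have M: "holo_mat \<A> W M" using W(3) by (simp add: M_def holo_mat_def holo_vec_def)
  have e: "mat_deriv c M p $ i $ 1 = vd (pull c v) (snd c p) $ i" for i c
    by (simp add: mat_deriv_pull md_def vd_def pull_abs M_def)
  obtain J where J: "J \<noteq> 0" "\<And>i. mat_deriv c' M p $ i $ 1 = J * mat_deriv c M p $ i $ 1"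
    using mat_deriv_chart_change[OF c c' p] W(1,2) M by metis
  then have "vd (pull c' v) (snd c' p) = J *s vd (pull c v) (snd c p)" unfolding e by (simp add: vec_eq_iff)
  then show ?thesis using that J(1) by blast
qed

text \<open>The Legendre associate of \<open>f\<close> is spanned by the sections \<open>v\<close> of \<open>f\<close> such that \<open>v'\<close> is also a
  section of \<open>f\<close>; this description makes sense where \<open>f\<close> is singular, too.\<close>

definition leg_section :: "('a \<Rightarrow> (complex^4) set) \<Rightarrow> 'a set \<Rightarrow> ('a \<Rightarrow> complex^4) \<Rightarrow> bool" where
  "leg_section f W v \<longleftrightarrow> openin X W \<and> holo_vec \<A> W v \<and>
     (\<forall>q\<in>W. v q \<noteq> 0 \<and> v q \<in> f q \<and> (\<forall>c\<in>\<A>. q \<in> fst c \<longrightarrow> vd (pull c v) (snd c q) \<in> f q))"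

text \<open>With \<open>m'\<close> divided by its common zero at \<open>p\<close>, the remaining
  matrix \<open>n\<close> is nonzero at \<open>p\<close> and still has determinant 0, so it has a
  holomorphic kernel vector \<open>y\<close> without zeros near \<open>p\<close>. For
  \<open>v = L y\<close> the derivative \<open>L' y + L y'\<close> is in \<open>f\<close>: its first
  summand pairs with the columns of \<open>L\<close> as \<open>m' y\<close>, which is 0.\<close>

lemma leg_section_exists:
  assumes iso: "isotropic_curve X \<A> U f" and p: "p \<in> U"
  obtains W v where "p \<in> W" "W \<subseteq> U" "leg_section f W v"
proof -
  have U: "openin X U" and hol: "holo_Q3 X \<A> U f" using iso by (auto simp: isotropic_curve_def)
  obtain W A m where W: "p \<in> W" "W \<subseteq> U" "Q3_coords X \<A> W f A m" using hol p by (auto simp: holo_Q3_def)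
  have oW: "openin X W" and A: "A \<in> Sp" and m: "holo_vec \<A> W m"
    using W by (auto simp: Q3_coords_def)
  obtain c where c: "c \<in> \<A>" "p \<in> fst c" using chart_exists p openin_subset[OF U(1)] by blast
  obtain r where r: "r > 0" "\<And>s. 0 < s \<Longrightarrow> s \<le> r \<Longrightarrow> ball (snd c p) s \<subseteq> snd c ` fst c \<and> disc c p s \<subseteq> W"
    using disc_exists[OF c oW W(1)] by blast
  let ?z = "snd c p"
  let ?B = "ball ?z r"
  have b: "?B \<subseteq> snd c ` fst c" "disc c p r \<subseteq> W" using r by auto
  note d = disc_properties[OF c r(1) b(1)]
  have hm: "vhol ?B (pull c m)"
    by (rule vhol_subset[OF holo_vec_vhol[OF m c(1)]]) (use d(3,5) b(2) in blast)
  define h where "h = (\<lambda>i w. vd (pull c m) w $ i)"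
  have hh: "h i holomorphic_on ?B" for i unfolding h_def by (rule vhol_D[OF vhol_vd[OF hm open_ball]])
  have "\<exists>i. \<exists>w\<in>?B. h i w \<noteq> 0"
    using coords_derivative_nonzero[OF iso W(3,2) c r(1) b] by (auto simp: h_def vec_eq_iff)
  from common_zeros_factor[where h = h, OF hh r(1) this]
  obtain k n where kn: "(\<forall>i. n i holomorphic_on ?B) \<and> (\<forall>i. \<forall>w\<in>?B. h i w = (w - ?z) ^ k * n i w) \<and> (\<exists>i. n i ?z \<noteq> 0)"
    by (elim exE)
  note n = kn[THEN conjunct1, rule_format] kn[THEN conjunct2, THEN conjunct1, rule_format] kn[THEN conjunct2, THEN conjunct2]
  have null: "h 1 w * h 3 w = (h 2 w)^2" if "w \<in> ?B" for w
  proof -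
    have "w \<in> snd c ` disc c p r" unfolding d(3) by (rule that)
    then obtain q where q: "q \<in> disc c p r" "w = snd c q" by (elim imageE)
    show ?thesis unfolding h_def q(2)
      by (rule null_coords[OF iso W(3,2) c(1) subsetD[OF d(5) q(1)] subsetD[OF b(2) q(1)]])
  qed
  \<comment> \<open>Off the centre the power of \<open>w - ?z\<close> cancels; the identity theorem
    supplies the centre.\<close>
  have n0: "n 1 w * n 3 w = (n 2 w)^2" if w: "w \<in> ?B" for w
  proof (rule analytic_continuation_open[where f = "\<lambda>w. n 1 w * n 3 w" and g = "\<lambda>w. (n 2 w)^2" and s = "?B - {?z}" and s' = "?B"])
    show "open (?B - {?z})" by auto
    show "?B - {?z} \<noteq> {}"
    proof -
      have "?z + of_real (r/2) \<in> ?B - {?z}" using r(1) by (auto simp: dist_norm)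
      then show ?thesis by blast
    qed
    show "n 1 w * n 3 w = (n 2 w)^2" if "w \<in> ?B - {?z}" for w
    proof -
      have "(w - ?z) ^ k * (w - ?z) ^ k * (n 1 w * n 3 w) = (w - ?z) ^ k * (w - ?z) ^ k * (n 2 w)^2"
        using null[of w] n(2)[of w 1] n(2)[of w 2] n(2)[of w 3] that by (simp add: power2_eq_square algebra_simps)
      then show ?thesis using that by simp
    qed
    show "(\<lambda>w. n 1 w * n 3 w) holomorphic_on ?B" "(\<lambda>w. (n 2 w)^2) holomorphic_on ?B"
      by (intro holomorphic_intros n(1))+
  qed (use w in auto)
  \<comment> \<open>A column of the adjugate of \<open>n\<close>, chosen so that it is nonzero at
    the centre. If \<open>n 3\<close> vanishes there, so does \<open>n 2\<close> by
    \<open>n0\<close>, and \<open>n 1\<close> does not.\<close>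
  obtain y1 y2 where y: "y1 holomorphic_on ?B" "y2 holomorphic_on ?B" "\<And>w. w \<in> ?B \<Longrightarrow> n 1 w * y1 w + n 2 w * y2 w = 0"
    "\<And>w. w \<in> ?B \<Longrightarrow> n 2 w * y1 w + n 3 w * y2 w = 0" "y1 ?z \<noteq> 0 \<or> y2 ?z \<noteq> 0"
  proof (cases "n 3 ?z = 0")
    case False
    show ?thesis
      by (rule that[of "n 3" "\<lambda>w. - n 2 w"])
        (use n(1) n0 False in \<open>auto intro!: holomorphic_intros simp: power2_eq_square algebra_simps\<close>)
  next
    case True
    then have "n 2 ?z = 0" using n0[of ?z] r(1) by simp
    then have "n 1 ?z \<noteq> 0" using True n(3) by (metis exhaust_3)
    then show ?thesis
      by (intro that[of "\<lambda>w. - n 2 w" "n 1"])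
        (use n(1) n0 in \<open>auto intro!: holomorphic_intros simp: power2_eq_square algebra_simps\<close>)
  qed
  obtain e where e: "e > 0" "e \<le> r" "\<And>w. w \<in> ball ?z e \<Longrightarrow> y1 w \<noteq> 0 \<or> y2 w \<noteq> 0"
  proof -
    have ex: "\<exists>e>0. \<forall>w. dist ?z w < e \<longrightarrow> y w \<noteq> 0" if "y holomorphic_on ?B" "y ?z \<noteq> 0" for y
    proof -
      have "y field_differentiable at ?z"
        by (rule holomorphic_on_imp_differentiable_at[OF that(1) open_ball]) (use r(1) in simp)
      then have "isCont y ?z" by (rule field_differentiable_imp_continuous_at)
      then show ?thesis using continuous_at_avoid that(2) by blast
    qed
    then obtain e where "e > 0" "\<forall>w. dist ?z w < e \<longrightarrow> y1 w \<noteq> 0 \<or> y2 w \<noteq> 0" using y(1,2,5) by metis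
    then show ?thesis using that[of "min e r"] r(1) by auto
  qed
  let ?E = "ball ?z e"
  have be: "?E \<subseteq> snd c ` fst c" "disc c p e \<subseteq> W" using r e by auto
  note de = disc_properties[OF c e(1) be(1)]
  have EB: "?E \<subseteq> ?B" using e by auto
  define L where "L = (\<lambda>q. A ** cell (m q))"
  have L: "lift X \<A> W f L" unfolding L_def by (rule cell_lift[OF W(3)])
  define y where "y = (\<lambda>w. y1 w *s axis 1 1 + y2 w *s (axis 2 1 :: complex^4))"
  have hy: "vhol ?E y" unfolding y_def
    by (intro vhol_add vhol_scale vhol_const holomorphic_on_subset[OF y(1) EB] holomorphic_on_subset[OF y(2) EB])
  define v where "v = (\<lambda>q. L q *v y (snd c q))"
  have pv: "pull c v w = pull c L w *v y w" if "w \<in> ?E" for w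
  proof -
    have "w \<in> snd c ` disc c p e" unfolding de(3) by (rule that)
    then obtain q where "q \<in> disc c p e" "w = snd c q" by (elim imageE)
    then show ?thesis using de(5) c(1) by (auto simp: v_def)
  qed
  have hL: "mhol ?E (pull c L)"
  proof (rule mhol_subset)
    show "mhol (snd c ` (fst c \<inter> W)) (pull c L)" using L c by (simp add: lift_def holo_mat_pull)
    show "?E \<subseteq> snd c ` (fst c \<inter> W)" using de(3,5) be(2) by blast
  qed
  have hv: "vhol ?E (pull c v)" by (rule vhol_cong[OF vhol_matvec[OF hL hy] pv])
  have hv': "holo_vec \<A> (disc c p e) v" by (rule holo_vec_chartI[OF c(1) de(5)]) (simp add: de(3) hv)
  have my: "M *v y w = y1 w *s column 1 M + y2 w *s column 2 M" for w and M :: "complex^4^4"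
    by (simp add: y_def matrix_vector_right_distrib vector_scalar_commute mat_vec_axis)
  have inf: "M *v x \<in> f q" if "q \<in> W" "M = L q" "x $ 3 = 0" "x $ 4 = 0" for M x q
  proof -
    have "M *v x = x$1 *s column 1 M + x$2 *s column 2 M" using that by (simp add: mat_vec_4)
    then show ?thesis using L that by (auto simp: lift_def plane_mem)
  qed
  have "leg_section f (disc c p e) v"
    unfolding leg_section_def
  proof (intro conjI ballI de(1) hv' impI)
    fix q assume q: "q \<in> disc c p e"
    have qW: "q \<in> W" and qc: "q \<in> fst c" and qE: "snd c q \<in> ?E" using q be de by blast+
    have LS: "L q \<in> Sp" using L qW by (simp add: lift_def)
    show "v q \<noteq> 0"
    proof
      assume "v q = 0"
      then have "Sp_inv (L q) *v (L q *v y (snd c q)) = 0" by (simp add: v_def)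
      then have "y (snd c q) = 0" by (simp add: Sp_inv_vec_cancel LS)
      then have "y (snd c q) $ 1 = 0" "y (snd c q) $ 2 = 0" by simp_all
      then show False using e(3)[OF qE] by (simp add: y_def axis_def)
    qed
    show "v q \<in> f q" unfolding v_def by (rule inf[OF qW refl]) (simp_all add: y_def axis_def)
    have main: "vd (pull c v) (snd c q) \<in> f q"
    proof -
      have "vd (pull c v) (snd c q) = md (pull c L) (snd c q) *v y (snd c q) + L q *v vd y (snd c q)"
        using vd_cong[OF open_ball qE pv] vd_matvec[OF hL hy open_ball qE] c(1) qc by simp
      moreover have "L q *v vd y (snd c q) \<in> f q"
        by (rule inf[OF qW refl]) (simp_all add: vd_def y_def axis_def)
      moreover have "md (pull c L) (snd c q) *v y (snd c q) \<in> f q"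
      proof -
        let ?w = "snd c q"
        have hw: "h 1 ?w * y1 ?w + h 2 ?w * y2 ?w = 0" "h 2 ?w * y1 ?w + h 3 ?w * y2 ?w = 0"
        proof -
          have B: "?w \<in> ?B" using qE EB by blast
          have "h 1 ?w * y1 ?w + h 2 ?w * y2 ?w = (?w - ?z) ^ k * (n 1 ?w * y1 ?w + n 2 ?w * y2 ?w)"
            "h 2 ?w * y1 ?w + h 3 ?w * y2 ?w = (?w - ?z) ^ k * (n 2 ?w * y1 ?w + n 3 ?w * y2 ?w)"
            unfolding n(2)[OF B] by (simp_all add: algebra_simps)
          then show "h 1 ?w * y1 ?w + h 2 ?w * y2 ?w = 0" "h 2 ?w * y1 ?w + h 3 ?w * y2 ?w = 0"
            using y(3,4)[OF B] by simp_all
        qed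
        have Lq: "A ** cell (m q) = L q" for q by (simp add: L_def)
        note md = cell_lift_mdot[OF W(3) c(1) qW qc, unfolded Lq mat_deriv_pull]
        have "sympl (column 1 (L q)) (md (pull c L) ?w *v y ?w) = 0" "sympl (column 2 (L q)) (md (pull c L) ?w *v y ?w) = 0"
          unfolding my using hw by (simp_all add: sympl_linear md h_def mult.commute)
        then show ?thesis using L qW lagrangian_plane_mem[OF LS] by (simp add: lift_def)
      qed
      moreover have "a + b \<in> f q" if "a \<in> f q" "b \<in> f q" for a b
      proof -
        have "f q = plane (column 1 (L q)) (column 2 (L q))" using L qW by (simp add: lift_def)
        then show ?thesis using that by (simp add: plane_def vec.span_add)
      qed
      ultimately show ?thesis by simp
    qed
    fix c' assume c': "c' \<in> \<A>" "q \<in> fst c'"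
    obtain J where "vd (pull c' v) (snd c' q) = J *s vd (pull c v) (snd c q)"
      using vd_chart_change[OF c(1) c'(1) qc c'(2) de(1) q hv'] by blast
    moreover have "f q = plane (column 1 (L q)) (column 2 (L q))" using L qW by (simp add: lift_def)
    ultimately show "vd (pull c' v) (snd c' q) \<in> f q"
      using main by (simp add: plane_def vec.span_scale)
  qed
  then show ?thesis using that[OF de(2) _ ] be(2) W(2) by blast
qed

end

lemma span_scale_eq: "k \<noteq> 0 \<Longrightarrow> vec.span {k *s v} = vec.span {v :: complex^'n}"
proof -
  assume k: "k \<noteq> 0"
  have "v = (1/k) *s (k *s v)" using k by (simp add: vec_eq_iff)
  then have "v \<in> vec.span {k *s v}" by (metis vec.span_base vec.span_scale insertI1)
  moreover have "k *s v \<in> vec.span {v}" by (simp add: vec.span_base vec.span_scale)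
  ultimately show ?thesis by (intro equalityI vec.span_minimal vec.subspace_span) auto
qed

lemma span_proportional:
  fixes a b a' b' :: complex
  assumes "a * b' = b * a'" "a \<noteq> 0 \<or> b \<noteq> 0" "a' \<noteq> 0 \<or> b' \<noteq> 0"
  shows "vec.span {a *s x + b *s y} = vec.span {a' *s x + b' *s (y :: complex^'n)}"
proof (cases "a = 0")
  case True
  then have "b \<noteq> 0" "a' = 0" "b' \<noteq> 0" using assms by auto
  then show ?thesis using True span_scale_eq[of b y] span_scale_eq[of b' y] by simp
next
  case False
  then have "a' \<noteq> 0" using assms by auto
  have "a' *s x + b' *s y = (a' / a) *s (a *s x + b *s y)"
    using False assms(1) by (simp add: vec_eq_iff field_simps)
  then have "vec.span {a' *s x + b' *s y} = vec.span {(a' / a) *s (a *s x + b *s y)}" by (simp only:)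
  also have "\<dots> = vec.span {a *s x + b *s y}" using False \<open>a' \<noteq> 0\<close> by (intro span_scale_eq) simp
  finally show ?thesis ..
qed

lemma sympl_plane_zero:
  assumes "sympl a x = 0" "sympl a y = 0" "z \<in> plane x y" shows "sympl a z = 0"
  using assms by (auto simp: plane_mem sympl_linear)

lemma plane_base: "x \<in> plane x y" "y \<in> plane x y"
  by (simp_all add: plane_def vec.span_base)

context rsurf begin

lemma isotropic_lift:
  assumes iso: "isotropic_curve X \<A> U f" and p: "p \<in> U"
  obtains W A m where "p \<in> W" "W \<subseteq> U" "Q3_coords X \<A> W f A m" "lift X \<A> W f (\<lambda>q. A ** cell (m q))"
proof -
  have "holo_Q3 X \<A> U f" using iso by (simp add: isotropic_curve_def)
  then obtain W A m where "p \<in> W \<and> W \<subseteq> U \<and> Q3_coords X \<A> W f A m" using p unfolding holo_Q3_def by blast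
  then show ?thesis using that cell_lift by blast
qed

lemma vhol_pull_mono:
  assumes "holo_vec \<A> W v" "c \<in> \<A>" "V \<subseteq> W" shows "vhol (snd c ` (fst c \<inter> V)) (pull c v)"
  by (rule holo_vec_vhol[OF holo_vec_mono[OF assms(1,3)] assms(2)])

lemma sympl_zero_deriv:
  assumes W: "openin X W" and v: "holo_vec \<A> W v" "holo_vec \<A> W s" and 0: "\<And>q. q \<in> W \<Longrightarrow> sympl (v q) (s q) = k"
    and c: "c \<in> \<A>" "q \<in> W" "q \<in> fst c"
  shows "sympl (vd (pull c v) (snd c q)) (s q) + sympl (v q) (vd (pull c s) (snd c q)) = 0"
proof -
  let ?D = "snd c ` (fst c \<inter> W)"
  have D: "open ?D" "snd c q \<in> ?D" using img_open[OF c(1) W] c by auto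
  have "sympl (vd (pull c v) (snd c q)) (pull c s (snd c q)) + sympl (pull c v (snd c q)) (vd (pull c s) (snd c q)) = 0"
    by (rule sympl_const_vd[OF holo_vec_vhol[OF v(1) c(1)] holo_vec_vhol[OF v(2) c(1)] D(1) _ D(2), of k]) (use 0 c in auto)
  then show ?thesis using c by simp
qed

text \<open>Differentiating \<open>\<omega>(v, s) = 0\<close> moves the derivative from
  \<open>s\<close> to \<open>v\<close>, and \<open>v'\<close> is again in the isotropic plane
  \<open>f q\<close>.\<close>

lemma leg_kernel:
  assumes v: "leg_section f W v" and W1: "openin X W1" and s: "holo_vec \<A> W1 s" "\<And>q. q \<in> W1 \<Longrightarrow> s q \<in> f q"
    and Q: "\<And>q. q \<in> W1 \<Longrightarrow> f q \<in> Q3" and c: "c \<in> \<A>" "q \<in> fst c" "q \<in> W" "q \<in> W1"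
  shows "sympl (v q) (vd (pull c s) (snd c q)) = 0"
proof -
  have W: "openin X (W \<inter> W1)" "q \<in> W \<inter> W1" using v W1 c by (auto simp: leg_section_def)
  have iso: "sympl x y = 0" if "q \<in> W1" "x \<in> f q" "y \<in> f q" for x y q using Q[OF that(1)] that by (auto simp: Q3_def)
  have hv: "holo_vec \<A> (W \<inter> W1) v" "holo_vec \<A> (W \<inter> W1) s"
    using v s by (auto simp: leg_section_def intro: holo_vec_mono)
  have "sympl (vd (pull c v) (snd c q)) (s q) + sympl (v q) (vd (pull c s) (snd c q)) = 0"
    by (rule sympl_zero_deriv[OF W(1) hv _ c(1) W(2) c(2), of 0]) (use v s iso in \<open>auto simp: leg_section_def\<close>)
  moreover have "sympl (vd (pull c v) (snd c q)) (s q) = 0"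
    using v s(2)[OF c(4)] iso[OF c(4)] c by (auto simp: leg_section_def)
  ultimately show ?thesis by simp
qed

lemma lift_Q3: "lift X \<A> W f L \<Longrightarrow> q \<in> W \<Longrightarrow> f q \<in> Q3"
  using plane_Sp_in_Q3 by (auto simp: lift_def)

lemma vd_pull_column: "vd (pull c (\<lambda>q. column j (L q))) (snd c q) = column j (mat_deriv c L q)"
  unfolding mat_deriv_pull vd_column[symmetric] by (simp add: pull_abs)

lemma lift_plane: "lift X \<A> W f L \<Longrightarrow> q \<in> W \<Longrightarrow> plane (column 1 (L q)) (column 2 (L q)) = f q"
  by (simp add: lift_def)

lemma lift_column_mem: "lift X \<A> W f L \<Longrightarrow> q \<in> W \<Longrightarrow> column 1 (L q) \<in> f q" "lift X \<A> W f L \<Longrightarrow> q \<in> W \<Longrightarrow> column 2 (L q) \<in> f q"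
  using plane_base by (auto simp: lift_def)

text \<open>If the two sections were independent at \<open>q\<close>, they would span
  \<open>f\<close> near \<open>q\<close>, and by \<open>leg_kernel\<close> the derivative of every
  section of \<open>f\<close> would stay in \<open>f\<close>. Then \<open>m' = 0\<close> on a disc,
  against \<open>coords_derivative_nonzero\<close>.\<close>

lemma leg_unique:
  assumes iso: "isotropic_curve X \<A> U f" and v: "leg_section f W v" and v': "leg_section f W' v'"
    and W: "W \<subseteq> U" and q: "q \<in> W" "q \<in> W'"
  shows "vec.span {v q} = vec.span {v' q}"
proof -
  obtain W1 A m where 1: "q \<in> W1" "W1 \<subseteq> U" "Q3_coords X \<A> W1 f A m" "lift X \<A> W1 f (\<lambda>q. A ** cell (m q))"
    using isotropic_lift[OF iso] q W by blast
  define L where "L = (\<lambda>q. A ** cell (m q))"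
  have L: "lift X \<A> W1 f L" using 1(4) by (simp add: L_def)
  have A: "A \<in> Sp" using 1(3) by (simp add: Q3_coords_def)
  define y where "y = (\<lambda>q. Sp_inv A *v v q)"
  define y' where "y' = (\<lambda>q. Sp_inv A *v v' q)"
  define V where "V = W \<inter> W' \<inter> W1"
  have V: "openin X V" "q \<in> V" using v v' L q 1 by (auto simp: V_def leg_section_def lift_def)
  have hv: "holo_vec \<A> V v" "holo_vec \<A> V v'" using v v' by (auto simp: leg_section_def V_def intro: holo_vec_mono)
  have hy: "holo_vec \<A> V y" "holo_vec \<A> V y'"
    unfolding y_def y'_def by (intro holo_vec_matvec holo_mat_const hv)+
  have ex: "a = (Sp_inv A *v a)$1 *s column 1 (L q) + (Sp_inv A *v a)$2 *s column 2 (L q)" if "q \<in> W1" "a \<in> f q" for a q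
  proof -
    define b where "b = Sp_inv A *v a"
    have "a \<in> Q3_param A (m q)" using that 1(3) by (simp add: Q3_coords_def)
    then have "b$3 = m q$1 * b$1 + m q$2 * b$2" "b$4 = m q$2 * b$1 + m q$3 * b$2"
      by (simp_all add: Q3_param_mem A Let_def b_def)
    then have "b = b$1 *s column 1 (cell (m q)) + b$2 *s column 2 (cell (m q))"
      by (simp add: column_cell vec_eq_iff[where 'b=4] forall_4 axis_def algebra_simps)
    then have "A *v b = b$1 *s column 1 (L q) + b$2 *s column 2 (L q)"
      unfolding L_def column_mult by (metis matrix_vector_right_distrib vector_scalar_commute)
    moreover have "A *v b = a" by (simp add: b_def Sp_inv_vec_cancel A)
    ultimately show ?thesis by (simp add: b_def)
  qed
  have ev: "v q = y q$1 *s column 1 (L q) + y q$2 *s column 2 (L q)" "v' q = y' q$1 *s column 1 (L q) + y' q$2 *s column 2 (L q)"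
     "v q \<noteq> 0" "v' q \<noteq> 0"
    if "q \<in> V" for q
    using ex[of q "v q"] ex[of q "v' q"] that v v' by (auto simp: V_def y_def y'_def leg_section_def)
  define d where "d = (\<lambda>q. y q$1 * y' q$2 - y q$2 * y' q$1)"
  have hd: "holo \<A> V d" unfolding d_def by (intro holo_diff holo_mult holo_vecD hy)
  have "d q = 0"
  proof (rule ccontr)
    assume "d q \<noteq> 0"
    then obtain V' where V': "openin X V'" "q \<in> V'" "V' \<subseteq> V" "\<And>q. q \<in> V' \<Longrightarrow> d q \<noteq> 0"
      using avoid_zero[OF V hd] by blast
    obtain c where c: "c \<in> \<A>" "q \<in> fst c" using chart_exists openin_subset[OF V(1)] V(2) by blast
    obtain r where r: "r > 0" "\<And>s. 0 < s \<Longrightarrow> s \<le> r \<Longrightarrow> ball (snd c q) s \<subseteq> snd c ` fst c \<and> disc c q s \<subseteq> V'"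
      using disc_exists[OF c V'(1,2)] by blast
    have b: "ball (snd c q) r \<subseteq> snd c ` fst c" "disc c q r \<subseteq> V'" using r by auto
    note D = disc_properties[OF c r(1) b(1)]
    have "disc c q r \<subseteq> W1" using b V' by (auto simp: V_def)
    then obtain w where w: "w \<in> ball (snd c q) r" "vd (pull c m) w \<noteq> 0"
      using coords_derivative_nonzero[OF iso 1(3,2) c r(1) b(1)] by blast
    then have "w \<in> snd c ` disc c q r" by (simp only: D(3))
    then obtain p where p: "p \<in> disc c q r" "w = snd c p" by (elim imageE)
    have pV: "p \<in> V'" "p \<in> V" "p \<in> fst c" "p \<in> W" "p \<in> W'" "p \<in> W1" using p b V' D(5) by (auto simp: V_def)
    have hL: "openin X W1" "holo_vec \<A> W1 (\<lambda>q. column j (L q))" for j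
      using L by (auto simp: lift_def intro: holo_vec_column)
    have k: "sympl (u p) (column j (mat_deriv c L p)) = 0" if "j = 1 \<or> j = 2" "leg_section f W0 u" "p \<in> W0" for j u W0
      unfolding vd_pull_column[symmetric]
      by (rule leg_kernel[OF that(2) hL _ lift_Q3[OF L] c(1) pV(3) that(3) pV(6)]) (use that(1) lift_column_mem[OF L] in auto)
    have z: "sympl (column 1 (L p)) (column j (mat_deriv c L p)) = 0 \<and> sympl (column 2 (L p)) (column j (mat_deriv c L p)) = 0" if j: "j = 1 \<or> j = 2" for j
    proof -
      let ?a = "sympl (column 1 (L p)) (column j (mat_deriv c L p))" and ?b = "sympl (column 2 (L p)) (column j (mat_deriv c L p))"
      have "y p$1 * ?a + y p$2 * ?b = 0" "y' p$1 * ?a + y' p$2 * ?b = 0"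
        using k[OF j v pV(4)] k[OF j v' pV(5)] unfolding ev(1,2)[OF pV(2)] by (simp_all add: sympl_linear)
      then have "d p * ?a = 0" "d p * ?b = 0" unfolding d_def by algebra+
      then show ?thesis using V'(4)[OF pV(1)] by simp
    qed
    have "vd (pull c m) (snd c p) = 0"
      using cell_lift_mdot[OF 1(3) c(1) pV(6,3)] z[of 1] z[of 2] by (simp add: L_def vec_eq_iff forall_3)
    then show False using w p by simp
  qed
  then show ?thesis
    unfolding ev(1,2)[OF V(2)]
    by (intro span_proportional) (use ev[OF V(2)] in \<open>auto simp: d_def\<close>)
qed

text \<open>The spans of Legendre sections, coherent by \<open>leg_unique\<close>, form a
  holomorphic map. For an arbitrary frame \<open>u\<close>, \<open>leg_kernel\<close> puts the
  section into the kernel of \<open>mdot\<close>, which is a line where \<open>mdot\<close> is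
  nonzero.\<close>

lemma legendre_exists:
  assumes iso: "isotropic_curve X \<A> U f"
  shows "is_legendre_associate X \<A> U f (legendre_associate X \<A> U f)"
proof -
  have U: "openin X U" using iso by (simp add: isotropic_curve_def)
  define g where "g = (\<lambda>q. SOME l. \<exists>W v. q \<in> W \<and> W \<subseteq> U \<and> leg_section f W v \<and> l = vec.span {v q})"
  have gv: "g q = vec.span {v q}" if "q \<in> W" "W \<subseteq> U" "leg_section f W v" for q W v
  proof -
    have "\<exists>W v. q \<in> W \<and> W \<subseteq> U \<and> leg_section f W v \<and> g q = vec.span {v q}"
      unfolding g_def by (rule someI_ex) (use that in blast)
    then show ?thesis using leg_unique[OF iso] that by metis
  qed
  have "holo_CP3 X \<A> U g"
    unfolding holo_CP3_def
  proof
    fix p assume p: "p \<in> U"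
    obtain W v where W: "p \<in> W" "W \<subseteq> U" "leg_section f W v" using leg_section_exists[OF iso p] by blast
    have oW: "openin X W" and hv: "holo_vec \<A> W v" and "v p \<noteq> 0" using W by (auto simp: leg_section_def)
    then obtain i where i: "v p $ i \<noteq> 0" by (auto simp: vec_eq_iff)
    obtain W' where W': "openin X W'" "p \<in> W'" "W' \<subseteq> W" "\<And>q. q \<in> W' \<Longrightarrow> v q $ i \<noteq> 0"
      using avoid_zero[OF oW W(1) holo_vecD[OF hv] i] by blast
    have "holo_vec \<A> W' (\<lambda>q. (1 / v q $ i) *s v q)"
      unfolding holo_vec_def using holo_mono[OF holo_vecD[OF hv] W'(3)] holo_const W'(4)
      by (auto intro!: holo_mult holo_divide)
    moreover have "g q = vec.span {(1 / v q $ i) *s v q}" if "q \<in> W'" for q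
      using gv[of q W v] that W W' by (simp add: span_scale_eq subset_iff)
    ultimately have "CP3_coords X \<A> W' g i (\<lambda>q. (1 / v q $ i) *s v q)"
      using W' by (simp add: CP3_coords_def)
    then show "\<exists>W i v. p \<in> W \<and> W \<subseteq> U \<and> CP3_coords X \<A> W g i v" using W' W by blast
  qed
  moreover have "g q = vec.span {x$1 *s (u q $ 1) + x$2 *s (u q $ 2)}"
    if c: "c \<in> \<A>" and W: "openin X W" "W \<subseteq> U \<inter> fst c" and u: "holo_mat \<A> W u" "\<And>q. q \<in> W \<Longrightarrow> f q = plane (u q $ 1) (u q $ 2)"
      and q: "q \<in> W" "mdot c u q \<noteq> 0" and x: "x \<noteq> 0" "mdot c u q *v x = 0" for W u c q x
  proof -
    have qU: "q \<in> U" "q \<in> fst c" using q W by auto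
    obtain W1 v where 1: "q \<in> W1" "W1 \<subseteq> U" "leg_section f W1 v" using leg_section_exists[OF iso qU(1)] by blast
    have Q: "f q \<in> Q3" if "q \<in> W" for q using iso that W by (auto simp: isotropic_curve_def holo_Q3_def)
    have hu: "holo_vec \<A> W (\<lambda>q. u q $ j)" for j using u(1) by (simp add: holo_mat_def holo_vec_def)
    have uf: "u q $ j \<in> f q" if "q \<in> W" for j q using u(2)[OF that] plane_base exhaust_2[of j] by auto
    have e: "vd (pull c (\<lambda>q. u q $ j)) (snd c q) = mat_deriv c u q $ j" for j
      by (simp add: mat_deriv_pull md_def vd_def pull_abs)
    have k: "sympl (v q) (mat_deriv c u q $ j) = 0" for j
      unfolding e[symmetric] by (rule leg_kernel[OF 1(3) W(1) hu uf Q c qU(2) 1(1) q(1)])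
    have "sympl (u q $ 1) (u q $ 2) = 0" if "q \<in> W" for q using Q[OF that] uf[OF that] by (auto simp: Q3_def)
    then have s: "sympl (mat_deriv c u q $ 1) (u q $ 2) + sympl (u q $ 1) (mat_deriv c u q $ 2) = 0"
      unfolding e[symmetric] by (rule sympl_zero_deriv[OF W(1) hu hu _ c q(1) qU(2)])
    define M where "M = mdot c u q"
    have M: "M $ i $ j = sympl (u q $ i) (mat_deriv c u q $ j)" for i j by (simp add: M_def mdot_def)
    have sym: "M $ 2 $ 1 = M $ 1 $ 2" using s sympl_swap[of "u q $ 2" "mat_deriv c u q $ 1"] by (simp add: M add_eq_0_iff)
    have "v q \<in> plane (u q $ 1) (u q $ 2)"
      using 1(1,3) unfolding leg_section_def u(2)[OF q(1), symmetric] by blast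
    then obtain a b where ab: "v q = a *s (u q $ 1) + b *s (u q $ 2)"
      unfolding plane_mem by blast
    have ab0: "a \<noteq> 0 \<or> b \<noteq> 0" using ab 1 by (auto simp: leg_section_def)
    have r1: "a * M $ 1 $ 1 + b * M $ 1 $ 2 = 0" "a * M $ 1 $ 2 + b * M $ 2 $ 2 = 0"
      using k[of 1] k[of 2] unfolding ab by (simp_all add: sympl_linear M[symmetric] sym)
    have r2: "M $ 1 $ 1 * x $ 1 + M $ 1 $ 2 * x $ 2 = 0" "M $ 1 $ 2 * x $ 1 + M $ 2 $ 2 * x $ 2 = 0"
      using x(2) by (simp_all add: M_def[symmetric] vec_eq_iff forall_2 matrix_vector_mult_def sum_2 sym)
    have "M $ 1 $ 1 \<noteq> 0 \<or> M $ 1 $ 2 \<noteq> 0 \<or> M $ 2 $ 2 \<noteq> 0" using q(2) sym by (auto simp: M_def[symmetric] vec_eq_iff forall_2)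
    \<comment> \<open>Two kernel vectors of a nonzero symmetric matrix with the determinant of the
      two as common factor: some entry is nonzero, so they are proportional.\<close>
    moreover have "M $ 1 $ 1 * (a * x $ 2 - b * x $ 1) = 0" "M $ 1 $ 2 * (a * x $ 2 - b * x $ 1) = 0" "M $ 2 $ 2 * (a * x $ 2 - b * x $ 1) = 0"
      using r1 r2 by algebra+
    ultimately have "a * x $ 2 = b * x $ 1" by auto
    then have "vec.span {v q} = vec.span {x$1 *s (u q $ 1) + x$2 *s (u q $ 2)}"
      unfolding ab by (rule span_proportional[OF _ ab0]) (use x(1) in \<open>auto simp: vec_eq_iff forall_2\<close>)
    then show ?thesis using gv[OF 1] by simp
  qed
  ultimately have "is_legendre_associate X \<A> U f g"
    unfolding is_legendre_associate_def by blast
  then show ?thesis unfolding legendre_associate_def by (rule someI[of "is_legendre_associate X \<A> U f"])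
qed

section \<open>Normalized lifts and the reduction\<close>

text \<open>Stands in for a section of the reduction before the reduction is available. That
  \<open>W\<close> lies in \<open>S_star\<close> is a consequence, proved in
  \<open>nlift_S_star\<close>.\<close>

definition nlift :: "'a set \<Rightarrow> ('a \<Rightarrow> (complex^4) set) \<Rightarrow> 'a set \<Rightarrow> ('a \<Rightarrow> complex^4^4) \<Rightarrow> bool" where
  "nlift U f W \<sigma> \<longleftrightarrow> W \<subseteq> U \<and> lift X \<A> W f \<sigma> \<and> (\<forall>c\<in>\<A>. \<forall>q\<in>W \<inter> fst c. normalized_form (mc c \<sigma> q))"

lemma nlift_chartI:
  assumes W: "W \<subseteq> U" "W \<subseteq> fst c" and c: "c \<in> \<A>" and L: "lift X \<A> W f \<sigma>"
    and n: "\<And>q. q \<in> W \<Longrightarrow> normalized_form (mc c \<sigma> q)"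
  shows "nlift U f W \<sigma>"
  unfolding nlift_def
proof (intro conjI ballI W(1) L)
  fix c' q assume c': "c' \<in> \<A>" and q: "q \<in> W \<inter> fst c'"
  then have qc: "q \<in> fst c" "q \<in> fst c'" "q \<in> W" using W by auto
  obtain J where "J \<noteq> 0" "\<And>i j. mc c' \<sigma> q $ i $ j = J * mc c \<sigma> q $ i $ j"
    using mat_deriv_chart_change[OF c c' qc(1,2)] L qc(3) unfolding lift_def by metis
  then show "normalized_form (mc c' \<sigma> q)" using normalized_form_scale[OF n[OF qc(3)]] by blast
qed

lemma nlift_Sp_hol:
  assumes "nlift U f W \<sigma>" "c \<in> \<A>" "openin X V" "V \<subseteq> W"
  shows "Sp_hol (snd c ` (fst c \<inter> V)) (pull c \<sigma>)"
    and "\<And>z. z \<in> snd c ` (fst c \<inter> V) \<Longrightarrow> normalized_form (mcP (pull c \<sigma>) z)"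
proof -
  have L: "lift X \<A> W f \<sigma>" using assms by (simp add: nlift_def)
  show "Sp_hol (snd c ` (fst c \<inter> V)) (pull c \<sigma>)" using lift_Sp_hol[OF lift_mono[OF L assms(4,3)] assms(2)] .
  fix z assume "z \<in> snd c ` (fst c \<inter> V)"
  then obtain q where q: "q \<in> fst c" "q \<in> W" "z = snd c q" using assms(4) by auto
  have "\<sigma> q \<in> Sp" using L q by (simp add: lift_def)
  then show "normalized_form (mcP (pull c \<sigma>) z)"
    using assms q unfolding nlift_def by (simp flip: mc_pull)
qed

lemma nlift_unique:
  assumes s: "nlift U f W \<sigma>" and s': "nlift U f W' \<sigma>'" and q: "q \<in> W" "q \<in> W'"
  shows "\<exists>h\<in>H1. \<sigma>' q = \<sigma> q ** h"
    and "c \<in> \<A> \<Longrightarrow> q \<in> fst c \<Longrightarrow> mc c \<sigma>' q $ 1 $ 3 * (mc c \<sigma>' q $ 4 $ 2)^3 = mc c \<sigma> q $ 1 $ 3 * (mc c \<sigma> q $ 4 $ 2)^3"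
proof -
  have L: "lift X \<A> W f \<sigma>" "lift X \<A> W' f \<sigma>'" using s s' by (simp_all add: nlift_def)
  define V where "V = W \<inter> W'"
  have V: "openin X V" "V \<subseteq> W" "V \<subseteq> W'" "q \<in> V" using L q by (auto simp: V_def lift_def)
  have Sp: "\<sigma> q \<in> Sp" "\<sigma>' q \<in> Sp" using L q by (auto simp: lift_def)
  have *: "Sp_inv (\<sigma> q) ** \<sigma>' q \<in> H1 \<and> mc c \<sigma>' q $ 1 $ 3 * (mc c \<sigma>' q $ 4 $ 2)^3 = mc c \<sigma> q $ 1 $ 3 * (mc c \<sigma> q $ 4 $ 2)^3"
    if c: "c \<in> \<A>" "q \<in> fst c" for c
  proof -
    let ?D = "snd c ` (fst c \<inter> V)"
    note n = nlift_Sp_hol[OF s c(1) V(1,2)] and n' = nlift_Sp_hol[OF s' c(1) V(1,3)]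
    have p: "plane (column 1 (pull c \<sigma> z)) (column 2 (pull c \<sigma> z)) = plane (column 1 (pull c \<sigma>' z)) (column 2 (pull c \<sigma>' z))"
      if z: "z \<in> ?D" for z
    proof -
      obtain q where q: "q \<in> fst c" "q \<in> W" "q \<in> W'" "z = snd c q" using z by (auto simp: V_def)
      then show ?thesis using lift_plane[OF L(1) q(2)] lift_plane[OF L(2) q(3)] c by simp
    qed
    have qD: "snd c q \<in> ?D" using c V by auto
    show ?thesis
      using normalized_transition[OF n(1) n'(1) n(2) n'(2) p qD] c Sp by (simp add: mc_pull)
  qed
  obtain c0 where c0: "c0 \<in> \<A>" "q \<in> fst c0" using chart_exists openin_subset[OF V(1)] V(4) by blast
  have "\<sigma>' q = \<sigma> q ** (Sp_inv (\<sigma> q) ** \<sigma>' q)" by (simp add: matrix_mul_assoc Sp_inv_right Sp)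
  then show "\<exists>h\<in>H1. \<sigma>' q = \<sigma> q ** h" using *[OF c0] by blast
  show "c \<in> \<A> \<Longrightarrow> q \<in> fst c \<Longrightarrow> mc c \<sigma>' q $ 1 $ 3 * (mc c \<sigma>' q $ 4 $ 2)^3 = mc c \<sigma> q $ 1 $ 3 * (mc c \<sigma> q $ 4 $ 2)^3"
    using * by blast
qed

lemma H1_props:
  assumes "h \<in> H1"
  shows "h \<in> Sp" "plane (column 1 (S ** h)) (column 2 (S ** h)) = plane (column 1 S) (column 2 S)"
proof -
  obtain a t where h: "h = hmat a t" "a \<noteq> 0" using assms by (auto simp: H1_eq)
  show "h \<in> Sp" using h hmat_Sp by simp
  show "plane (column 1 (S ** h)) (column 2 (S ** h)) = plane (column 1 S) (column 2 S)"
  proof (rule plane_change)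
    show "column 1 (S ** h) = a^3 *s column 1 S + 0 *s column 2 S" "column 2 (S ** h) = (a^2 * t) *s column 1 S + a *s column 2 S"
      unfolding column_mult mat_vec_4[of S] h by (simp_all add: column_def hmat_nth vec_eq_iff)
    show "a^3 * a - 0 * (a^2 * t) \<noteq> 0" using h by simp
  qed
qed

lemma nlift_H1:
  assumes s: "nlift U f W \<sigma>" and h: "holo_mat \<A> W h" "\<And>q. q \<in> W \<Longrightarrow> h q \<in> H1"
  shows "nlift U f W (\<lambda>q. \<sigma> q ** h q)"
proof -
  have L: "lift X \<A> W f \<sigma>" and W: "W \<subseteq> U" "openin X W" using s by (auto simp: nlift_def lift_def)
  have L': "lift X \<A> W f (\<lambda>q. \<sigma> q ** h q)"
    using L H1_props h by (auto simp: lift_def intro!: holo_mat_mult Sp_mult)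
  have "normalized_form (mc c (\<lambda>q. \<sigma> q ** h q) q)" if c: "c \<in> \<A>" and q: "q \<in> W \<inter> fst c" for c q
  proof -
    let ?D = "snd c ` (fst c \<inter> W)"
    note n = nlift_Sp_hol[OF s c W(2) order_refl]
    have hh: "mhol ?D (pull c h)" using h c by (simp add: holo_mat_pull)
    have hH: "pull c h z \<in> H1" if "z \<in> ?D" for z using that h c by auto
    have z: "snd c q \<in> ?D" using q by auto
    have "normalized_form (mcP (\<lambda>z. pull c \<sigma> z ** pull c h z) (snd c q))"
      by (rule normalized_mult_H1[OF n(1) hh hH z n(2)[OF z]])
    moreover have "(\<lambda>z. pull c \<sigma> z ** pull c h z) = pull c (\<lambda>q. \<sigma> q ** h q)" by (simp add: pull_abs)
    moreover have "\<sigma> q ** h q \<in> Sp" using L' q by (simp add: lift_def)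
    ultimately show ?thesis using mc_pull[of c q "\<lambda>q. \<sigma> q ** h q"] c q by simp
  qed
  then show ?thesis using L' W by (simp add: nlift_def)
qed

lemma nlift_entries:
  assumes s: "nlift U f W \<sigma>" and q: "q \<in> W" and c: "c \<in> \<A>" "q \<in> fst c"
  shows "sympl (column 1 (\<sigma> q)) (column 1 (mat_deriv c \<sigma> q)) = 0" "sympl (column 2 (\<sigma> q)) (column 1 (mat_deriv c \<sigma> q)) = 0"
    "sympl (column 1 (\<sigma> q)) (column 2 (mat_deriv c \<sigma> q)) = 0"
    "sympl (column 2 (\<sigma> q)) (column 2 (mat_deriv c \<sigma> q)) \<noteq> 0" "sympl (column 1 (mat_deriv c \<sigma> q)) (column 4 (\<sigma> q)) \<noteq> 0"
proof -
  have W: "openin X W" using s by (simp add: nlift_def lift_def)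
  note m = nlift_Sp_hol[OF s c(1) W order_refl]
  have z: "snd c q \<in> snd c ` (fst c \<inter> W)" using q c by auto
  show "sympl (column 1 (\<sigma> q)) (column 1 (mat_deriv c \<sigma> q)) = 0" "sympl (column 2 (\<sigma> q)) (column 1 (mat_deriv c \<sigma> q)) = 0"
    "sympl (column 1 (\<sigma> q)) (column 2 (mat_deriv c \<sigma> q)) = 0"
    "sympl (column 2 (\<sigma> q)) (column 2 (mat_deriv c \<sigma> q)) \<noteq> 0" "sympl (column 1 (mat_deriv c \<sigma> q)) (column 4 (\<sigma> q)) \<noteq> 0"
    using m(2)[OF z] mcP_sp(6)[OF m(1) z] c unfolding normalized_form_def mcP_nth mat_deriv_pull by auto
qed

text \<open>Column 1 spans the Legendre associate. A critical point of \<open>f\<close> would force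
  \<open>\<phi>\<^sup>4\<^sub>2 = 0\<close>, a critical point of the associate
  \<open>\<phi>\<^sup>2\<^sub>1 = 0\<close>; but these two entries are equal and nonzero.\<close>

lemma nlift_S_star:
  assumes iso: "isotropic_curve X \<A> U f" and s: "nlift U f W \<sigma>" and q: "q \<in> W"
  shows "q \<in> S_star X \<A> U f"
proof -
  let ?g = "legendre_associate X \<A> U f"
  have L: "lift X \<A> W f \<sigma>" and W: "W \<subseteq> U" "openin X W" using s by (auto simp: nlift_def lift_def)
  have hs: "holo_vec \<A> W (\<lambda>q. column j (\<sigma> q))" for j using L by (auto simp: lift_def intro: holo_vec_column)
  have SSp: "\<sigma> q \<in> Sp" if "q \<in> W" for q using L that by (simp add: lift_def)
  note n = nlift_entries[OF s]
  have gs: "?g q = vec.span {column 1 (\<sigma> q)}" if "q \<in> W" "c \<in> \<A>" "q \<in> fst c" for q c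
  proof -
    define u :: "'a \<Rightarrow> complex^4^2" where "u = (\<lambda>q. \<chi> i. if i = 1 then column 1 (\<sigma> q) else column 2 (\<sigma> q))"
    let ?W = "W \<inter> fst c"
    have oW: "openin X ?W" by (rule openin_Int[OF W(2) chart_openin[OF that(2)]])
    have hu: "holo_mat \<A> ?W u"
    proof -
      have "holo \<A> ?W (\<lambda>q. u q $ i $ j)" for i j
        using holo_mono[OF holo_vecD[OF hs]] exhaust_2[of i] by (auto simp: u_def)
      then show ?thesis by (simp add: holo_mat_def)
    qed
    have fu: "f q = plane (u q $ 1) (u q $ 2)" if "q \<in> ?W" for q using L that by (auto simp: lift_def u_def)
    have du: "mat_deriv c u q $ 1 = column 1 (mat_deriv c \<sigma> q)" "mat_deriv c u q $ 2 = column 2 (mat_deriv c \<sigma> q)"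
      by (simp_all add: mat_deriv_pull md_def pull_abs u_def column_def)
    have md: "mdot c u q $ 1 $ 1 = 0" "mdot c u q $ 2 $ 1 = 0" "mdot c u q $ 2 $ 2 \<noteq> 0"
      using n[OF that] by (simp_all add: mdot_def du) (simp_all add: u_def)
    define x :: "complex^2" where "x = axis 1 1"
    have x: "x \<noteq> 0" "x $ 1 = 1" "x $ 2 = 0" by (auto simp: x_def axis_def vec_eq_iff)
    have "mdot c u q *v x = 0"
      by (simp add: vec_eq_iff forall_2 matrix_vector_mult_def sum_2 x md)
    moreover have "mdot c u q \<noteq> 0" using md(3) by auto
    ultimately have "?g q = vec.span {x$1 *s (u q $ 1) + x$2 *s (u q $ 2)}"
      using legendre_exists[OF iso] x(1) oW hu fu that W unfolding is_legendre_associate_def by blast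
    then show ?thesis by (simp add: x u_def)
  qed
  have "q \<notin> crit_Q3 X \<A> U f"
  proof
    assume "q \<in> crit_Q3 X \<A> U f"
    then obtain W1 A m c where 1: "c \<in> \<A>" "q \<in> W1" "q \<in> fst c" "Q3_coords X \<A> W1 f A m" "\<And>i. chart_deriv c 1 (\<lambda>q. m q $ i) q = 0"
      unfolding crit_Q3_def by blast
    define L1 where "L1 = (\<lambda>q. A ** cell (m q))"
    have L1: "lift X \<A> W1 f L1" unfolding L1_def by (rule cell_lift[OF 1(4)])
    have "vd (pull c m) (snd c q) = 0" using 1(5) by (simp add: vec_eq_iff vd_def chart_deriv_pull pull_abs)
    moreover have A: "A \<in> Sp" using 1(4) by (simp add: Q3_coords_def)
    let ?D = "snd c ` (fst c \<inter> W1)"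
    have m: "holo_vec \<A> W1 m" "openin X W1" using 1(4) by (auto simp: Q3_coords_def)
    have D: "open ?D" "snd c q \<in> ?D" using img_open[OF 1(1) m(2)] 1 by auto
    have hm: "vhol ?D (pull c m)" by (rule holo_vec_vhol[OF m(1) 1(1)])
    have "md (pull c L1) (snd c q) = A ** md (\<lambda>w. cell (pull c m w)) (snd c q)"
      using md_mult[OF mhol_const mhol_cell[OF hm] D, of A] by (simp add: md_const L1_def pull_abs)
    then have L1': "column j (mat_deriv c L1 q) = 0" if "j = 1 \<or> j = 2" for j
      using that cell_md[OF hm D] \<open>vd (pull c m) (snd c q) = 0\<close> by (auto simp: mat_deriv_pull column_mult)
    define V where "V = W \<inter> W1"
    have V: "openin X V" "q \<in> V" using W m q 1 by (auto simp: V_def)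
    have hV: "holo_vec \<A> V (\<lambda>q. column 2 (\<sigma> q))" "holo_vec \<A> V (\<lambda>q. column j (L1 q))" for j
      using hs L1 by (auto simp: V_def lift_def intro: holo_vec_mono holo_vec_column)
    have "sympl (column 2 (\<sigma> q)) (column j (L1 q)) = 0" if "q \<in> V" "j = 1 \<or> j = 2" for q j
    proof -
      have "column 2 (\<sigma> q) \<in> f q" "column j (L1 q) \<in> f q" "f q \<in> Q3"
        using that lift_column_mem[OF L] lift_column_mem[OF L1] lift_Q3[OF L] by (auto simp: V_def)
      then show ?thesis by (auto simp: Q3_def)
    qed
    then have "sympl (column 2 (mat_deriv c \<sigma> q)) (column j (L1 q)) + sympl (column 2 (\<sigma> q)) (column j (mat_deriv c L1 q)) = 0"
      if "j = 1 \<or> j = 2" for j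
      unfolding vd_pull_column[symmetric] using that
      by (intro sympl_zero_deriv[OF V(1) hV _ 1(1) V(2) 1(3), of _ 0]) auto
    then have "sympl (column 2 (mat_deriv c \<sigma> q)) (column 1 (L1 q)) = 0" "sympl (column 2 (mat_deriv c \<sigma> q)) (column 2 (L1 q)) = 0"
      using L1' by (simp_all add: sympl_linear)
    then have "sympl (column 2 (mat_deriv c \<sigma> q)) (column 2 (\<sigma> q)) = 0"
      by (rule sympl_plane_zero) (simp add: lift_column_mem(2)[OF L q] lift_plane[OF L1 1(2)])
    then show False using n(4)[OF q 1(1,3)] sympl_swap[of "column 2 (mat_deriv c \<sigma> q)" "column 2 (\<sigma> q)"] by simp
  qed
  moreover have "q \<notin> crit_CP3 X \<A> U ?g"
  proof
    assume "q \<in> crit_CP3 X \<A> U ?g"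
    then obtain W1 i v c where 1: "c \<in> \<A>" "q \<in> W1" "q \<in> fst c" "CP3_coords X \<A> W1 ?g i v" "\<And>j. chart_deriv c 1 (\<lambda>q. v q $ j) q = 0"
      unfolding crit_CP3_def by blast
    have dv: "vd (pull c v) (snd c q) = 0" using 1(5) by (simp add: vec_eq_iff vd_def chart_deriv_pull pull_abs)
    have v: "openin X W1" "holo_vec \<A> W1 v" "\<And>q. q \<in> W1 \<Longrightarrow> v q $ i = 1" "\<And>q. q \<in> W1 \<Longrightarrow> ?g q = vec.span {v q}"
      using 1(4) by (auto simp: CP3_coords_def)
    define V where "V = W \<inter> W1 \<inter> fst c"
    have V: "openin X V" "q \<in> V"
      unfolding V_def using openin_Int[OF openin_Int[OF W(2) v(1)] chart_openin[OF 1(1)]] q 1 by auto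
    let ?D = "snd c ` (fst c \<inter> V)"
    have D: "open ?D" "snd c q \<in> ?D" using img_open[OF 1(1) V(1)] 1 V by auto
    have e: "column 1 (\<sigma> q) = (column 1 (\<sigma> q) $ i) *s v q" if "q \<in> V" for q
    proof -
      have "column 1 (\<sigma> q) \<in> vec.span {v q}"
        using gs[of q c] v(4)[of q] that 1 vec.span_base[of "column 1 (\<sigma> q)" "{column 1 (\<sigma> q)}"] by (auto simp: V_def)
      then obtain k where "column 1 (\<sigma> q) = k *s v q" by (auto simp: vec.span_singleton)
      then show ?thesis using v(3)[of q] that by (simp add: V_def)
    qed
    have h: "vhol ?D (pull c v)" "vhol ?D (pull c (\<lambda>q. column 1 (\<sigma> q)))"
      by (rule vhol_pull_mono[OF v(2) 1(1)] vhol_pull_mono[OF hs 1(1)], simp add: V_def inf.coboundedI1 inf.coboundedI2)+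
    let ?k = "\<lambda>w. pull c (\<lambda>q. column 1 (\<sigma> q)) w $ i"
    have "vd (pull c (\<lambda>q. column 1 (\<sigma> q))) (snd c q) = vd (\<lambda>w. ?k w *s pull c v w) (snd c q)"
    proof (rule vd_cong[OF D])
      fix w assume "w \<in> ?D"
      then obtain q where "q \<in> V" "q \<in> fst c" "w = snd c q" by auto
      then show "pull c (\<lambda>q. column 1 (\<sigma> q)) w = ?k w *s pull c v w" using e[of q] 1(1) by simp
    qed
    also have "\<dots> = deriv ?k (snd c q) *s v q"
      using vd_scale[OF vhol_D[OF h(2)] h(1) D] 1 dv by simp
    finally have "column 1 (mat_deriv c \<sigma> q) = deriv ?k (snd c q) *s v q" unfolding vd_pull_column .
    moreover have "sympl (v q) (column 4 (\<sigma> q)) = 0"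
    proof -
      have "sympl (column 1 (\<sigma> q)) (column 4 (\<sigma> q)) = 0" using Sp_columns[OF SSp[OF q]] by simp
      then have "column 1 (\<sigma> q) $ i = 0 \<or> sympl (v q) (column 4 (\<sigma> q)) = 0" by (subst (asm) e[OF V(2)]) (simp add: sympl_linear)
      moreover have "column 1 (\<sigma> q) $ i \<noteq> 0"
      proof
        assume "column 1 (\<sigma> q) $ i = 0"
        then have "column 1 (\<sigma> q) = 0" using e[OF V(2)] by simp
        then show False using Sp_columns(2)[OF SSp[OF q]] by (simp add: sympl_linear)
      qed
      ultimately show ?thesis by blast
    qed
    ultimately have "sympl (column 1 (mat_deriv c \<sigma> q)) (column 4 (\<sigma> q)) = 0" by (simp add: sympl_linear)
    then show False using n(5)[OF q 1(1,3)] by simp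
  qed
  ultimately show ?thesis using W q by (auto simp: S_star_def)
qed

section \<open>Existence of normalized lifts and uniqueness of the reduction\<close>

lemma plane_lift:
  assumes c: "c \<in> \<A>" "p \<in> fst c" and r: "r > 0" "ball (snd c p) r \<subseteq> snd c ` fst c"
    and S: "Sp_hol (ball (snd c p) r) S"
    and f: "\<And>q. q \<in> disc c p r \<Longrightarrow> f q = plane (column 1 (S (snd c q))) (column 2 (S (snd c q)))"
  shows "lift X \<A> (disc c p r) f (\<lambda>q. S (snd c q))"
    "\<And>q. q \<in> disc c p r \<Longrightarrow> mc c (\<lambda>q. S (snd c q)) q = mcP S (snd c q)"
    "\<And>w. w \<in> ball (snd c p) r \<Longrightarrow> pull c (\<lambda>q. S (snd c q)) w = S w"
proof -
  note d = disc_properties[OF c r]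
  show pS: "pull c (\<lambda>q. S (snd c q)) w = S w" if "w \<in> ball (snd c p) r" for w
  proof -
    have "w \<in> snd c ` fst c" using that r by blast
    then show ?thesis using c by (auto simp: pull_def)
  qed
  have hS: "mhol (ball (snd c p) r) S" and SSp: "\<And>w. w \<in> ball (snd c p) r \<Longrightarrow> S w \<in> Sp" using S by (auto simp: Sp_hol_def)
  have B: "snd c q \<in> ball (snd c p) r" if "q \<in> disc c p r" for q using that by (simp add: disc_def)
  have "holo_mat \<A> (disc c p r) (\<lambda>q. S (snd c q))"
    by (rule holo_mat_chartI[OF c(1) d(5)]) (unfold d(3), rule mhol_cong[OF hS pS])
  then show "lift X \<A> (disc c p r) f (\<lambda>q. S (snd c q))"
    unfolding lift_def using d(1) SSp[OF B] f by blast
  show "mc c (\<lambda>q. S (snd c q)) q = mcP S (snd c q)" if "q \<in> disc c p r" for q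
  proof -
    have q: "q \<in> fst c" using that d(5) by blast
    have "md (pull c (\<lambda>q. S (snd c q))) (snd c q) = md S (snd c q)"
      by (rule md_cong[OF open_ball B[OF that] pS])
    then show ?thesis using c q SSp[OF B[OF that]] by (simp add: mc_pull mcP_def)
  qed
qed

lemma plane_nlift:
  assumes c: "c \<in> \<A>" "p \<in> fst c" and r: "r > 0" "ball (snd c p) r \<subseteq> snd c ` fst c" "disc c p r \<subseteq> U"
    and S: "Sp_hol (ball (snd c p) r) S"
    and f: "\<And>q. q \<in> disc c p r \<Longrightarrow> f q = plane (column 1 (S (snd c q))) (column 2 (S (snd c q)))"
    and n: "\<And>w. w \<in> ball (snd c p) r \<Longrightarrow> normalized_form (mcP S w)"
  shows "nlift U f (disc c p r) (\<lambda>q. S (snd c q))"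
proof (rule nlift_chartI[OF r(3) _ c(1) plane_lift(1)[OF c r(1,2) S f]])
  show "disc c p r \<subseteq> fst c" by (rule disc_properties(5)[OF c r(1,2)])
  show "normalized_form (mc c (\<lambda>q. S (snd c q)) q)" if "q \<in> disc c p r" for q
  proof -
    have e: "mc c (\<lambda>q. S (snd c q)) q = mcP S (snd c q)" by (rule plane_lift(2)[OF c r(1,2) S f that])
    show ?thesis unfolding e by (rule n) (use that in \<open>simp add: disc_def\<close>)
  qed
qed

lemma S_star_section:
  assumes iso: "isotropic_curve X \<A> U f" and p: "p \<in> S_star X \<A> U f" and c: "c \<in> \<A>" "p \<in> fst c"
  obtains r W A m i v k where "r > 0" "ball (snd c p) r \<subseteq> snd c ` fst c" "disc c p r \<subseteq> W" "W \<subseteq> U"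
    "Q3_coords X \<A> W f A m" "vhol (ball (snd c p) r) (pull c v)" "\<And>q. q \<in> disc c p r \<Longrightarrow> v q $ i = 1"
    "\<And>q. q \<in> disc c p r \<Longrightarrow> legendre_associate X \<A> U f q = vec.span {v q}"
    "\<And>w. w \<in> ball (snd c p) r \<Longrightarrow> vd (pull c v) w $ k \<noteq> 0" "\<And>w. w \<in> ball (snd c p) r \<Longrightarrow> vd (pull c m) w \<noteq> 0"
proof -
  let ?g = "legendre_associate X \<A> U f"
  have pU: "p \<in> U" and np: "p \<notin> crit_Q3 X \<A> U f" "p \<notin> crit_CP3 X \<A> U ?g" using p by (auto simp: S_star_def)
  have hol: "holo_Q3 X \<A> U f" using iso by (simp add: isotropic_curve_def)
  then obtain W A m where W: "p \<in> W" "W \<subseteq> U" "Q3_coords X \<A> W f A m" using pU by (auto simp: holo_Q3_def)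
  have hg: "holo_CP3 X \<A> U ?g" using legendre_exists[OF iso] by (simp add: is_legendre_associate_def)
  obtain W' i v where W': "p \<in> W'" "W' \<subseteq> U" "CP3_coords X \<A> W' ?g i v" using hg pU by (auto simp: holo_CP3_def)
  have oW: "openin X W" "holo_vec \<A> W m" "openin X W'" "holo_vec \<A> W' v" using W W' by (auto simp: Q3_coords_def CP3_coords_def)
  obtain j where j: "vd (pull c m) (snd c p) $ j \<noteq> 0"
  proof -
    have "\<exists>j. chart_deriv c 1 (\<lambda>q. m q $ j) p \<noteq> 0" using np(1) pU W c unfolding crit_Q3_def by blast
    then show ?thesis using that by (auto simp: chart_deriv_pull vd_def pull_abs)
  qed
  obtain k where k: "vd (pull c v) (snd c p) $ k \<noteq> 0"
  proof -
    have "\<exists>k. chart_deriv c 1 (\<lambda>q. v q $ k) p \<noteq> 0" using np(2) pU W' c unfolding crit_CP3_def by blast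
    then show ?thesis using that by (auto simp: chart_deriv_pull vd_def pull_abs)
  qed
  have V: "openin X (W \<inter> W')" "p \<in> W \<inter> W'" using oW W W' by auto
  obtain r0 where r0: "r0 > 0" "\<And>s. 0 < s \<Longrightarrow> s \<le> r0 \<Longrightarrow> ball (snd c p) s \<subseteq> snd c ` fst c \<and> disc c p s \<subseteq> W \<inter> W'"
    using disc_exists[OF c V] by blast
  have b0: "ball (snd c p) r0 \<subseteq> snd c ` fst c" "disc c p r0 \<subseteq> W \<inter> W'" using r0 by auto
  note d0 = disc_properties[OF c r0(1) b0(1)]
  have sub: "ball (snd c p) r0 \<subseteq> snd c ` (fst c \<inter> W)" "ball (snd c p) r0 \<subseteq> snd c ` (fst c \<inter> W')"
    unfolding d0(3)[symmetric] using d0(5) b0(2) by auto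
  have hm: "vhol (ball (snd c p) r0) (pull c m)" by (rule vhol_subset[OF holo_vec_vhol[OF oW(2) c(1)] sub(1)])
  have hv: "vhol (ball (snd c p) r0) (pull c v)" by (rule vhol_subset[OF holo_vec_vhol[OF oW(4) c(1)] sub(2)])
  let ?e = "\<lambda>w. vd (pull c m) w $ j * vd (pull c v) w $ k"
  have he: "?e holomorphic_on ball (snd c p) r0"
    by (intro holomorphic_on_mult vhol_D vhol_vd hm hv open_ball)
  have "?e field_differentiable at (snd c p)"
    by (rule holomorphic_on_imp_differentiable_at[OF he open_ball]) (use r0(1) in simp)
  then have "isCont ?e (snd c p)" by (rule field_differentiable_imp_continuous_at)
  moreover have "?e (snd c p) \<noteq> 0" using j k by simp
  ultimately obtain e where e: "e > 0" "\<forall>w. dist (snd c p) w < e \<longrightarrow> ?e w \<noteq> 0" using continuous_at_avoid by blast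
  define r where "r = min e r0"
  have r: "r > 0" "r \<le> r0" using e r0 by (auto simp: r_def)
  have rr: "ball (snd c p) r \<subseteq> snd c ` fst c" "disc c p r \<subseteq> W \<inter> W'" using r0(2)[OF r] by auto
  have nz: "?e w \<noteq> 0" if "w \<in> ball (snd c p) r" for w using that e by (simp add: r_def)
  show ?thesis
  proof (rule that[OF r(1) rr(1) _ W(2,3)])
    show "disc c p r \<subseteq> W" using rr by blast
    show "vhol (ball (snd c p) r) (pull c v)" by (rule vhol_subset[OF hv]) (use r in auto)
    show "v q $ i = 1" "?g q = vec.span {v q}" if "q \<in> disc c p r" for q
      using that rr W' by (auto simp: CP3_coords_def)
    show "vd (pull c v) w $ k \<noteq> 0" if "w \<in> ball (snd c p) r" for w using nz[OF that] by auto
    show "vd (pull c m) w \<noteq> 0" if "w \<in> ball (snd c p) r" for w using nz[OF that] by auto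
  qed
qed

text \<open>An affine representative \<open>V\<close> of the Legendre associate lies in the kernel
  of \<open>m'\<close>, so \<open>V'\<close> is again in \<open>f\<close>. Regularity of the
  associate makes \<open>V\<close> and \<open>V'\<close> independent, and regularity of
  \<open>f\<close> makes the pairing of \<open>V'\<close> and \<open>V''\<close> nonzero; rescaling
  does the rest.\<close>

lemma S_star_legendrian:
  assumes iso: "isotropic_curve X \<A> U f" and p: "p \<in> S_star X \<A> U f" and c: "c \<in> \<A>" "p \<in> fst c"
  obtains r u where "r > 0" "ball (snd c p) r \<subseteq> snd c ` fst c" "disc c p r \<subseteq> U" "legendrian (ball (snd c p) r) u"
    "\<And>q. q \<in> disc c p r \<Longrightarrow> f q = plane (u (snd c q)) (vd u (snd c q))"
proof -
  let ?g = "legendre_associate X \<A> U f"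
  obtain r W A m i v k where r: "r > 0" "ball (snd c p) r \<subseteq> snd c ` fst c" "disc c p r \<subseteq> W" "W \<subseteq> U"
    "Q3_coords X \<A> W f A m" "vhol (ball (snd c p) r) (pull c v)" "\<And>q. q \<in> disc c p r \<Longrightarrow> v q $ i = 1"
    "\<And>q. q \<in> disc c p r \<Longrightarrow> ?g q = vec.span {v q}"
    "\<And>w. w \<in> ball (snd c p) r \<Longrightarrow> vd (pull c v) w $ k \<noteq> 0" "\<And>w. w \<in> ball (snd c p) r \<Longrightarrow> vd (pull c m) w \<noteq> 0"
    using S_star_section[OF iso p c] by metis
  note d = disc_properties[OF c r(1,2)]
  let ?B = "ball (snd c p) r"
  define L where "L = (\<lambda>q. A ** cell (m q))"
  have Lq: "A ** cell (m q) = L q" for q by (simp add: L_def)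
  have L: "lift X \<A> W f L" using cell_lift[OF r(5)] by (simp add: L_def)
  define V where "V = pull c v"
  have hV: "vhol ?B V" "vhol ?B (vd V)" using r(6) vhol_vd by (auto simp: V_def)
  have sub: "?B \<subseteq> snd c ` (fst c \<inter> W)" unfolding d(3)[symmetric] using d(5) r(3) by auto
  have hL: "vhol ?B (\<lambda>w. column j (pull c L w))" for j
    by (rule vhol_column) (rule mhol_subset[OF _ sub], use L c in \<open>simp add: lift_def holo_mat_pull\<close>)
  have at: "\<exists>q. q \<in> disc c p r \<and> w = snd c q \<and> q \<in> fst c \<and> q \<in> W \<and> V w = v q \<and> pull c L w = L q" if "w \<in> ?B" for w
  proof -
    have "w \<in> snd c ` disc c p r" unfolding d(3) by (rule that)
    then obtain q where "q \<in> disc c p r" "w = snd c q" by (elim imageE)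
    then show ?thesis using d(5) r(3) c(1) by (intro exI[of _ q]) (auto simp: V_def)
  qed
  have hd: "sympl (column 1 (L q)) (column 1 (mat_deriv c L q)) = vd (pull c m) (snd c q) $ 1"
    "sympl (column 1 (L q)) (column 2 (mat_deriv c L q)) = vd (pull c m) (snd c q) $ 2"
    "sympl (column 2 (L q)) (column 1 (mat_deriv c L q)) = vd (pull c m) (snd c q) $ 2"
    "sympl (column 2 (L q)) (column 2 (mat_deriv c L q)) = vd (pull c m) (snd c q) $ 3"
    "(vd (pull c m) (snd c q) $ 2)^2 = vd (pull c m) (snd c q) $ 1 * vd (pull c m) (snd c q) $ 3"
    if "q \<in> W" "q \<in> fst c" for q
    using cell_lift_mdot[OF r(5) c(1) that, unfolded Lq] null_coords[OF iso r(5,4) c(1) that(2,1)] by simp_all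
  \<comment> \<open>The columns of \<open>L\<close> serve as the frame in the definition of the
    associate; there \<open>mdot\<close> is \<open>m'\<close>, nonzero on this disc.\<close>
  have kern: "v q \<in> f q \<and> sympl (v q) (column 1 (mat_deriv c L q)) = 0 \<and> sympl (v q) (column 2 (mat_deriv c L q)) = 0"
    if q: "q \<in> disc c p r" for q
  proof -
    have qW: "q \<in> W" "q \<in> fst c" using q r(3) d(5) by auto
    have qB: "snd c q \<in> ?B" using q by (simp add: disc_def)
    define h where "h = vd (pull c m) (snd c q)"
    note H = hd[OF qW, folded h_def]
    have h0: "h $ 1 \<noteq> 0 \<or> h $ 2 \<noteq> 0 \<or> h $ 3 \<noteq> 0" using r(10)[OF qB] by (auto simp: h_def vec_eq_iff forall_3)
    define u :: "'a \<Rightarrow> complex^4^2" where "u = (\<lambda>q. \<chi> i. if i = 1 then column 1 (L q) else column 2 (L q))"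
    let ?W = "W \<inter> fst c"
    have oW: "openin X ?W" by (rule openin_Int) (use L c chart_openin in \<open>auto simp: lift_def\<close>)
    have hu: "holo_mat \<A> ?W u"
    proof -
      have hl: "holo_vec \<A> W (\<lambda>q. column j (L q))" for j using L by (auto simp: lift_def intro: holo_vec_column)
      have "holo \<A> ?W (\<lambda>q. u q $ i $ j)" for i j
        using holo_mono[OF holo_vecD[OF hl]] exhaust_2[of i] by (auto simp: u_def)
      then show ?thesis by (simp add: holo_mat_def)
    qed
    have fu: "f q = plane (u q $ 1) (u q $ 2)" if "q \<in> ?W" for q using L that by (auto simp: lift_def u_def)
    have du: "mat_deriv c u q $ 1 = column 1 (mat_deriv c L q)" "mat_deriv c u q $ 2 = column 2 (mat_deriv c L q)"
      by (simp_all add: mat_deriv_pull md_def pull_abs u_def column_def)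
    have md: "mdot c u q $ 1 $ 1 = h $ 1" "mdot c u q $ 1 $ 2 = h $ 2" "mdot c u q $ 2 $ 1 = h $ 2" "mdot c u q $ 2 $ 2 = h $ 3"
      using H by (simp_all add: mdot_def du) (simp_all add: u_def)
    obtain a b where ab: "a \<noteq> 0 \<or> b \<noteq> 0" "h $ 1 * a + h $ 2 * b = 0" "h $ 2 * a + h $ 3 * b = 0"
    proof (cases "h $ 3 = 0")
      case True
      then show ?thesis using that[of 0 1] H(5) by simp
    next
      case False
      then show ?thesis using that[of "h $ 3" "- h $ 2"] H(5) by (simp add: power2_eq_square)
    qed
    define x :: "complex^2" where "x = (\<chi> i. if i = 1 then a else b)"
    have x: "x \<noteq> 0" "x $ 1 = a" "x $ 2 = b" using ab(1) by (auto simp: x_def vec_eq_iff forall_2)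
    have "mdot c u q *v x = 0"
      using ab by (simp add: vec_eq_iff forall_2 matrix_vector_mult_def sum_2 x md)
    moreover have "mdot c u q \<noteq> 0" using h0 md by auto
    ultimately have "?g q = vec.span {x$1 *s (u q $ 1) + x$2 *s (u q $ 2)}"
      using legendre_exists[OF iso] x(1) oW hu fu qW c(1) r(4) unfolding is_legendre_associate_def by blast
    then have "v q \<in> vec.span {a *s column 1 (L q) + b *s column 2 (L q)}"
      using r(8)[OF q] vec.span_base[of "v q" "{v q}"] by (simp add: x u_def)
    then obtain t where t: "v q = t *s (a *s column 1 (L q) + b *s column 2 (L q))" by (auto simp: vec.span_singleton)
    have "v q = (t * a) *s column 1 (L q) + (t * b) *s column 2 (L q)" unfolding t by (simp add: vec_eq_iff algebra_simps)
    then have "v q \<in> f q" unfolding lift_plane[OF L qW(1), symmetric] plane_mem by blast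
    moreover have "sympl (v q) (column 1 (mat_deriv c L q)) = t * (h $ 1 * a + h $ 2 * b)"
      "sympl (v q) (column 2 (mat_deriv c L q)) = t * (h $ 2 * a + h $ 3 * b)"
      unfolding t by (simp_all only: sympl_linear H) (simp_all only: mult.commute)
    ultimately show ?thesis using ab by simp
  qed
  have iso0: "sympl x y = 0" if "q \<in> W" "x \<in> f q" "y \<in> f q" for x y q using lift_Q3[OF L that(1)] that by (auto simp: Q3_def)
  have LW: "column j (pull c L w) \<in> f q" if "w = snd c q" "q \<in> fst c" "q \<in> W" "j = 1 \<or> j = 2" for w q j
    using that lift_column_mem[OF L] c by auto
  have dL: "vd (\<lambda>w. column j (pull c L w)) (snd c q) = column j (mat_deriv c L q)" for j q
    by (simp add: vd_column mat_deriv_pull)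
  have V'f: "vd V (snd c q) \<in> f q" if q: "q \<in> disc c p r" for q
  proof -
    have qW: "q \<in> W" "q \<in> fst c" using q r(3) d(5) by auto
    have qB: "snd c q \<in> ?B" using q by (simp add: disc_def)
    have "sympl (vd V (snd c q)) (column j (L q)) = 0" if j: "j = 1 \<or> j = 2" for j
    proof -
      have "sympl (vd V (snd c q)) (column j (pull c L (snd c q))) + sympl (V (snd c q)) (vd (\<lambda>w. column j (pull c L w)) (snd c q)) = 0"
      proof (rule sympl_const_vd[OF hV(1) hL open_ball _ qB, of _ 0])
        fix w assume "w \<in> ?B"
        from at[OF this] obtain q where "q \<in> disc c p r" "w = snd c q" "q \<in> fst c" "q \<in> W" "V w = v q" by blast
        then show "sympl (V w) (column j (pull c L w)) = 0" using kern LW[OF _ _ _ j] iso0 by metis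
      qed
      moreover have "sympl (V (snd c q)) (vd (\<lambda>w. column j (pull c L w)) (snd c q)) = 0"
        unfolding dL using kern[OF q] j qW c by (auto simp: V_def)
      ultimately show ?thesis using qW c by simp
    qed
    then have "sympl (column j (L q)) (vd V (snd c q)) = 0" if "j = 1 \<or> j = 2" for j
      using that sympl_swap[of "column j (L q)" "vd V (snd c q)"] by simp
    then show ?thesis using lagrangian_plane_mem[of "L q"] L qW by (simp add: lift_def)
  qed
  have fV: "f q = plane (V (snd c q)) (vd V (snd c q))" if q: "q \<in> disc c p r" for q
  proof -
    have qW: "q \<in> W" "q \<in> fst c" using q r(3) d(5) by auto
    have qB: "snd c q \<in> ?B" using q by (simp add: disc_def)
    have Vq: "V (snd c q) = v q" using qW c by (simp add: V_def)
    \<comment> \<open>The affine normalization \<open>V $ i = 1\<close> separates \<open>V\<close>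
      from its nonzero derivative.\<close>
    have Vi: "vd V (snd c q) $ i = 0"
    proof -
      have "((\<lambda>w. V w $ i) has_field_derivative vd V (snd c q) $ i) (at (snd c q))" by (rule vd_DERIV[OF hV(1) open_ball qB])
      moreover have "V w $ i = 1" if "w \<in> ?B" for w using at[OF that] r(7) by metis
      ultimately show ?thesis using DERIV_eq_on_open[OF open_ball qB, of "\<lambda>w. V w $ i" "\<lambda>w. 1"] DERIV_const by blast
    qed
    have "plane (V (snd c q)) (vd V (snd c q)) = plane (column 1 (L q)) (column 2 (L q))"
    proof (rule plane_two)
      show "V (snd c q) \<in> plane (column 1 (L q)) (column 2 (L q))" "vd V (snd c q) \<in> plane (column 1 (L q)) (column 2 (L q))"
        unfolding lift_plane[OF L qW(1)] using kern[OF q] V'f[OF q] by (simp_all add: Vq)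
      fix s t assume st: "s *s V (snd c q) + t *s vd V (snd c q) = 0"
      then have "(s *s V (snd c q) + t *s vd V (snd c q)) $ i = 0" by simp
      then have s: "s = 0" using Vi r(7)[OF q] by (simp add: Vq)
      then have "(t *s vd V (snd c q)) $ k = 0" using st by (simp only: vector_smult_lzero add_0_left zero_index)
      then show "s = 0 \<and> t = 0" using s r(9)[OF qB] by (simp add: V_def)
    qed
    then show ?thesis unfolding lift_plane[OF L qW(1)] by simp
  qed
  have V01: "sympl (V w) (vd V w) = 0" if w: "w \<in> ?B" for w
  proof -
    from at[OF w] obtain q where q: "q \<in> disc c p r" "w = snd c q" "q \<in> W" by blast
    show ?thesis by (rule iso0[OF q(3)]) (simp_all add: fV[OF q(1)] q(2) plane_base)
  qed
  \<comment> \<open>Otherwise \<open>V'\<close> as well as \<open>V\<close> would be orthogonal to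
    the derivatives of the columns of \<open>L\<close>; as the two span \<open>f\<close>, all of
    \<open>m'\<close> would vanish.\<close>
  have V12: "sympl (vd V w) (vd (vd V) w) \<noteq> 0" if w: "w \<in> ?B" for w
  proof
    assume 0: "sympl (vd V w) (vd (vd V) w) = 0"
    obtain q where q: "q \<in> disc c p r" "w = snd c q" "q \<in> fst c" "q \<in> W" "V w = v q" "pull c L w = L q" using at[OF w] by blast
    have 02: "sympl (V w) (vd (vd V) w) = 0" using sympl_const_vd[OF hV open_ball V01 w] by simp
    have s2: "sympl (vd (vd V) w) (V w) = 0" "sympl (vd (vd V) w) (vd V w) = 0"
      using 0 02 sympl_swap[of "vd (vd V) w" "V w"] sympl_swap[of "vd (vd V) w" "vd V w"] by simp_all
    have Lp: "column j (L q) \<in> plane (V w) (vd V w)" if "j = 1 \<or> j = 2" for j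
      using fV[OF q(1)] LW[OF q(2-4) that] q by simp
    have "sympl (column l (L q)) (column j (mat_deriv c L q)) = 0" if j: "j = 1 \<or> j = 2" and l: "l = 1 \<or> l = 2" for j l
    proof -
      have "sympl (vd (vd V) w) (column j (pull c L w)) + sympl (vd V w) (vd (\<lambda>w. column j (pull c L w)) w) = 0"
      proof (rule sympl_const_vd[OF hV(2) hL open_ball _ w, of _ 0])
        fix w assume "w \<in> ?B"
        from at[OF this] obtain q where q: "q \<in> disc c p r" "w = snd c q" "q \<in> fst c" "q \<in> W" by blast
        then show "sympl (vd V w) (column j (pull c L w)) = 0" using V'f[OF q(1)] LW[OF q(2-4) j] iso0[OF q(4)] by simp
      qed
      then have "sympl (vd V w) (column j (mat_deriv c L q)) = 0"
        using sympl_plane_zero[OF s2 Lp[OF j]] q dL by simp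
      moreover have "sympl (V w) (column j (mat_deriv c L q)) = 0" using kern[OF q(1)] j q by auto
      ultimately have "sympl (column j (mat_deriv c L q)) (column l (L q)) = 0"
        using sympl_plane_zero[OF _ _ Lp[OF l], of "column j (mat_deriv c L q)"]
          sympl_swap[of "column j (mat_deriv c L q)" "V w"] sympl_swap[of "column j (mat_deriv c L q)" "vd V w"] by simp
      then show ?thesis using sympl_swap[of "column l (L q)" "column j (mat_deriv c L q)"] by simp
    qed
    then have "vd (pull c m) w = 0" using hd[OF q(4,3)] q(2) by (simp add: vec_eq_iff forall_3)
    then show False using r(10)[OF w] by simp
  qed
  obtain u where u: "legendrian ?B u" "\<And>z. z \<in> ?B \<Longrightarrow> plane (u z) (vd u z) = plane (V z) (vd V z)"
    using legendrian_rescale[OF hV(1) V01 V12] by blast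
  have "f q = plane (u (snd c q)) (vd u (snd c q))" if q: "q \<in> disc c p r" for q
    using u(2)[of "snd c q"] fV[OF q] q by (simp add: disc_def)
  moreover have "disc c p r \<subseteq> U" using r(3,4) by blast
  ultimately show ?thesis using that[OF r(1,2) _ u(1)] by blast
qed

lemma S_star_nlift:
  assumes iso: "isotropic_curve X \<A> U f" and p: "p \<in> S_star X \<A> U f"
  obtains W \<sigma> where "p \<in> W" "nlift U f W \<sigma>"
proof -
  have "openin X U" "p \<in> U" using iso p by (auto simp: isotropic_curve_def S_star_def)
  then obtain c where c: "c \<in> \<A>" "p \<in> fst c" using chart_exists openin_subset by blast
  obtain r u where r: "r > 0" "ball (snd c p) r \<subseteq> snd c ` fst c" "disc c p r \<subseteq> U" "legendrian (ball (snd c p) r) u"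
    "\<And>q. q \<in> disc c p r \<Longrightarrow> f q = plane (u (snd c q)) (vd u (snd c q))"
    using S_star_legendrian[OF iso p c] by blast
  obtain S where S: "Sp_hol (ball (snd c p) r) S" "\<And>z. z \<in> ball (snd c p) r \<Longrightarrow> column 1 (S z) = u z"
    "\<And>z. z \<in> ball (snd c p) r \<Longrightarrow> column 2 (S z) = vd u z" "\<And>z. z \<in> ball (snd c p) r \<Longrightarrow> normalized_form (mcP S z)"
    using legendrian_frame[OF r(4)] by metis
  have B: "snd c q \<in> ball (snd c p) r" if "q \<in> disc c p r" for q using that by (simp add: disc_def)
  have "nlift U f (disc c p r) (\<lambda>q. S (snd c q))"
    by (rule plane_nlift[OF c r(1-3) S(1) _ S(4)]) (use r(5) S(2,3)[OF B] in simp_all)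
  then show ?thesis using that disc_properties(2)[OF c r(1,2)] by blast
qed

text \<open>The only possible reduction: local sections of any reduction are normalized lifts, and
  by \<open>nlift_unique\<close> these meet each fibre in a single \<open>H1\<close>-orbit.\<close>

definition redF :: "'a set \<Rightarrow> ('a \<Rightarrow> (complex^4) set) \<Rightarrow> ('a \<times> (complex^4^4)) set" where
  "redF U f = {(p, B). \<exists>W \<sigma>. p \<in> W \<and> nlift U f W \<sigma> \<and> \<sigma> p = B}"

lemma redF_fibre:
  assumes s: "nlift U f W \<sigma>" and q: "q \<in> W"
  shows "{B. (q, B) \<in> redF U f} = (\<lambda>h. \<sigma> q ** h) ` H1"
proof (intro equalityI subsetI)
  fix B assume "B \<in> {B. (q, B) \<in> redF U f}"
  then obtain W' \<sigma>' where "q \<in> W'" "nlift U f W' \<sigma>'" "\<sigma>' q = B" by (auto simp: redF_def)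
  then show "B \<in> (\<lambda>h. \<sigma> q ** h) ` H1" using nlift_unique(1)[OF s _ q] by blast
next
  fix B assume "B \<in> (\<lambda>h. \<sigma> q ** h) ` H1"
  then obtain h where "h \<in> H1" "B = \<sigma> q ** h" by blast
  then show "B \<in> {B. (q, B) \<in> redF U f}"
    using nlift_H1[OF s holo_mat_const] q unfolding redF_def by blast
qed

text \<open>Membership in \<open>redF\<close> is pointwise, with a different lift at each point.
  Near \<open>q\<close> one lift is fixed; the section differs from it by a map that is holomorphic
  and \<open>H1\<close>-valued, and \<open>nlift_H1\<close> applies.\<close>

lemma F_section_redF:
  assumes F: "F_section X \<A> (redF U f) W \<sigma>"
  shows "nlift U f W \<sigma>"
proof -
  have W: "openin X W" and hs: "holo_mat \<A> W \<sigma>" and m: "\<And>q. q \<in> W \<Longrightarrow> (q, \<sigma> q) \<in> redF U f"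
    using F by (auto simp: F_section_def)
  have "q \<in> U \<and> \<sigma> q \<in> Sp \<and> f q = plane (column 1 (\<sigma> q)) (column 2 (\<sigma> q))" if "q \<in> W" for q
    using m[OF that] by (auto simp: redF_def nlift_def lift_def)
  then have L: "W \<subseteq> U \<and> lift X \<A> W f \<sigma>" using W hs unfolding lift_def by blast
  have "normalized_form (mc c \<sigma> q)" if c: "c \<in> \<A>" and q: "q \<in> W \<inter> fst c" for c q
  proof -
    obtain W0 s0 where s0: "q \<in> W0" "nlift U f W0 s0" using m[of q] q by (auto simp: redF_def)
    have L0: "lift X \<A> W0 f s0" using s0 by (simp add: nlift_def)
    define V where "V = W \<inter> W0"
    have V: "openin X V" "q \<in> V" "V \<subseteq> W" "V \<subseteq> W0" using W L0 q s0 by (auto simp: V_def lift_def)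
    have s0V: "nlift U f V s0"
      using s0(2) lift_mono[OF L0 V(4,1)] V(4) unfolding nlift_def by blast
    define h where "h = (\<lambda>q. Sp_inv (s0 q) ** \<sigma> q)"
    have Sp0: "s0 q \<in> Sp" if "q \<in> V" for q using L0 that V(4) by (auto simp: lift_def)
    have "holo_mat \<A> W0 s0" using L0 by (simp add: lift_def)
    then have hh: "holo_mat \<A> V h"
      unfolding h_def by (intro holo_mat_mult holo_mat_Sp_inv holo_mat_mono[OF hs V(3)] holo_mat_mono[OF _ V(4)])
    have hH: "h q \<in> H1" if "q \<in> V" for q
    proof -
      have "\<sigma> q \<in> {B. (q, B) \<in> redF U f}" using m that V(3) by blast
      then have "\<sigma> q \<in> (\<lambda>h. s0 q ** h) ` H1" unfolding redF_fibre[OF s0V that] .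
      then obtain k where "k \<in> H1" "\<sigma> q = s0 q ** k" by blast
      then show ?thesis by (simp add: h_def matrix_mul_assoc Sp_inv_left Sp0 that)
    qed
    have "nlift U f V (\<lambda>q. s0 q ** h q)" by (rule nlift_H1[OF s0V hh hH])
    then have n: "normalized_form (mc c (\<lambda>q. s0 q ** h q) q)" using c q V(2) by (simp add: nlift_def)
    have e: "s0 q ** h q = \<sigma> q" if "q \<in> V" for q
      unfolding h_def by (simp add: matrix_mul_assoc Sp_inv_right Sp0 that)
    have "mat_deriv c (\<lambda>q. s0 q ** h q) q = mat_deriv c \<sigma> q"
      unfolding mat_deriv_pull
    proof (rule md_cong[OF img_open[OF c V(1)]])
      show "snd c q \<in> snd c ` (fst c \<inter> V)" using q V by auto
      fix w assume "w \<in> snd c ` (fst c \<inter> V)"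
      then show "pull c (\<lambda>q. s0 q ** h q) w = pull c \<sigma> w" using e c by auto
    qed
    then show ?thesis using n e[OF V(2)] by (simp add: mc_def)
  qed
  then show ?thesis using L by (simp add: nlift_def)
qed

text \<open>Uniqueness: over \<open>S_star\<close> the fibres of any reduction are the orbits of
  normalized lifts, hence those of \<open>redF\<close>; elsewhere both are empty.\<close>

lemma reduction_redF:
  assumes iso: "isotropic_curve X \<A> U f"
  shows "reduction X \<A> U f = redF U f"
  unfolding reduction_def
proof (rule the_equality)
  have sec: "F_section X \<A> (redF U f) W \<sigma>" if "nlift U f W \<sigma>" for W \<sigma>
    using that unfolding F_section_def redF_def nlift_def lift_def by blast
  show "is_reduction X \<A> U f (redF U f)"
    unfolding is_reduction_def
  proof (intro conjI)
    show "redF U f \<subseteq> {(p, A). p \<in> S_star X \<A> U f \<and> A \<in> Sp \<and> f p = plane (column 1 A) (column 2 A)}"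
      using nlift_S_star[OF iso] unfolding redF_def nlift_def lift_def by blast
    show "\<forall>p\<in>S_star X \<A> U f. \<exists>W \<sigma>. p \<in> W \<and> F_section X \<A> (redF U f) W \<sigma> \<and>
        (\<forall>q\<in>W. {B. (q, B) \<in> redF U f} = (\<lambda>h. \<sigma> q ** h) ` H1)"
      using S_star_nlift[OF iso] sec redF_fibre by metis
    show "\<forall>W \<sigma>. F_section X \<A> (redF U f) W \<sigma> \<longrightarrow> (\<forall>c\<in>\<A>. \<forall>q\<in>W \<inter> fst c. normalized_form (mc c \<sigma> q))"
      using F_section_redF unfolding nlift_def by blast
  qed
  fix F assume F: "is_reduction X \<A> U f F"
  have F1: "p \<in> S_star X \<A> U f \<and> B \<in> Sp \<and> f p = plane (column 1 B) (column 2 B)" if "(p, B) \<in> F" for p B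
  proof -
    have "F \<subseteq> {(p, A). p \<in> S_star X \<A> U f \<and> A \<in> Sp \<and> f p = plane (column 1 A) (column 2 A)}"
      using F unfolding is_reduction_def by (elim conjE)
    from subsetD[OF this that] show ?thesis by simp
  qed
  have F2: "\<forall>p\<in>S_star X \<A> U f. \<exists>W \<sigma>. p \<in> W \<and> F_section X \<A> F W \<sigma> \<and>
        (\<forall>q\<in>W. {B. (q, B) \<in> F} = (\<lambda>h. \<sigma> q ** h) ` H1)"
    using F unfolding is_reduction_def by (elim conjE)
  have F3: "\<forall>W \<sigma>. F_section X \<A> F W \<sigma> \<longrightarrow> (\<forall>c\<in>\<A>. \<forall>q\<in>W \<inter> fst c. normalized_form (mc c \<sigma> q))"
    using F unfolding is_reduction_def by (elim conjE)
  have nl: "nlift U f W \<sigma>" if FW: "F_section X \<A> F W \<sigma>" for W \<sigma>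
  proof -
    have W: "openin X W" "holo_mat \<A> W \<sigma>" and m: "\<And>q. q \<in> W \<Longrightarrow> (q, \<sigma> q) \<in> F"
      using FW by (simp_all add: F_section_def)
    have "W \<subseteq> U" using F1[OF m] by (auto simp: S_star_def)
    moreover have "lift X \<A> W f \<sigma>" using W F1[OF m] by (simp add: lift_def)
    ultimately show ?thesis using F3[rule_format, OF FW] by (simp add: nlift_def)
  qed
  have fib: "{B. (p, B) \<in> F} = {B. (p, B) \<in> redF U f}" if p: "p \<in> S_star X \<A> U f" for p
  proof -
    obtain W \<sigma> where W: "p \<in> W" "F_section X \<A> F W \<sigma>" "\<forall>q\<in>W. {B. (q, B) \<in> F} = (\<lambda>h. \<sigma> q ** h) ` H1"
      using bspec[OF F2 p] by (elim exE conjE)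
    then show ?thesis using redF_fibre[OF nl[OF W(2)] W(1)] by simp
  qed
  have "(p, B) \<in> F \<longleftrightarrow> (p, B) \<in> redF U f" for p B
  proof (cases "p \<in> S_star X \<A> U f")
    case True then show ?thesis using fib by blast
  next
    case False then show ?thesis using F1 nlift_S_star[OF iso] by (auto simp: redF_def)
  qed
  then show "F = redF U f" by auto
qed

text \<open>Any normalized lift computes the coefficient, because \<open>nlift_unique\<close> makes
  the description in \<open>quartic_coeff\<close> independent of the section.\<close>

lemma quartic_value:
  assumes iso: "isotropic_curve X \<A> U f" and s: "nlift U f W \<sigma>" and p: "p \<in> W" and c: "c \<in> \<A>" "p \<in> fst c"
  shows "quartic_coeff X \<A> U f c p = mc c \<sigma> p $ 1 $ 3 * (mc c \<sigma> p $ 4 $ 2) ^ 3"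
proof -
  have "F_section X \<A> (redF U f) W \<sigma>"
    using s unfolding F_section_def redF_def nlift_def lift_def by blast
  moreover have "d = mc c \<sigma> p $ 1 $ 3 * (mc c \<sigma> p $ 4 $ 2) ^ 3"
    if "p \<in> W' \<and> F_section X \<A> (redF U f) W' \<sigma>' \<and> d = mc c \<sigma>' p $ 1 $ 3 * (mc c \<sigma>' p $ 4 $ 2) ^ 3" for W' \<sigma>' d
    using nlift_unique(2)[OF s F_section_redF p _ c] that by blast
  ultimately have "(THE d. \<exists>W \<sigma>. p \<in> W \<and> F_section X \<A> (redF U f) W \<sigma> \<and>
       d = mc c \<sigma> p $ 1 $ 3 * (mc c \<sigma> p $ 4 $ 2) ^ 3) = mc c \<sigma> p $ 1 $ 3 * (mc c \<sigma> p $ 4 $ 2) ^ 3"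
    using p by (intro the_equality) blast+
  then show ?thesis
    using nlift_S_star[OF iso s p] c by (simp add: quartic_coeff_def reduction_redF[OF iso])
qed

end

section \<open>Rigidity to order five and deformations of order four\<close>

lemma legendrian_mono: "legendrian D v \<Longrightarrow> E \<subseteq> D \<Longrightarrow> open E \<Longrightarrow> legendrian E v"
  unfolding legendrian_def using vhol_subset by blast

lemma mcP_const_mult:
  assumes S: "Sp_hol D S" and z: "z \<in> D" and A: "A \<in> Sp"
  shows "mcP (\<lambda>w. A ** S w) z = mcP S z" "Sp_hol D (\<lambda>w. A ** S w)"
proof -
  have D: "open D" and hS: "mhol D S" and Sp: "\<And>z. z \<in> D \<Longrightarrow> S z \<in> Sp" using S by (auto simp: Sp_hol_def)
  have "mcP (\<lambda>w. A ** S w) z = Sp_inv (S z) ** Sp_inv A ** (A ** md S z)"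
    unfolding mcP_def md_mult[OF mhol_const hS D z] Sp_inv_mult[OF A Sp[OF z]] by (simp add: md_const)
  also have "\<dots> = Sp_inv (S z) ** (Sp_inv A ** A) ** md S z" by (simp add: matrix_mul_assoc)
  finally show "mcP (\<lambda>w. A ** S w) z = mcP S z" by (simp add: Sp_inv_left A mcP_def)
  show "Sp_hol D (\<lambda>w. A ** S w)"
    using D mhol_mult[OF mhol_const hS] Sp Sp_mult A by (auto simp: Sp_hol_def)
qed

lemma vanish_sympl_swap:
  assumes "(\<lambda>w. sympl (x w) (y w)) analytic_on {p}" "vanish k (\<lambda>w. sympl (x w) (y w)) p"
  shows "vanish k (\<lambda>w. sympl (y w) (x w)) p"
proof -
  have "vanish k (\<lambda>w. (-1) * sympl (x w) (y w)) p" using assms by (intro vanish_mult) auto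
  moreover have "(-1) * sympl (x w) (y w) = sympl (y w) (x w)" for w using sympl_swap[of "y w" "x w"] by simp
  ultimately show ?thesis by (simp only:)
qed

context rsurf begin

lemma nlift_leg_section:
  assumes s: "nlift U f W \<sigma>" shows "leg_section f W (\<lambda>q. column 1 (\<sigma> q))"
proof -
  have L: "lift X \<A> W f \<sigma>" using s by (simp add: nlift_def)
  have Sp: "\<sigma> q \<in> Sp" if "q \<in> W" for q using L that by (simp add: lift_def)
  have 1: "column 1 (\<sigma> q) \<noteq> 0" if "q \<in> W" for q
    using Sp_columns(2)[OF Sp[OF that]] by (metis sympl_linear(9) zero_neq_one)
  have "column 1 (mat_deriv c \<sigma> q) \<in> f q" if "q \<in> W" "c \<in> \<A>" "q \<in> fst c" for q c
    unfolding lift_plane[OF L that(1), symmetric] lagrangian_plane_mem[OF Sp[OF that(1)]]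
    using nlift_entries[OF s that] by simp
  then show ?thesis
    unfolding leg_section_def vd_pull_column
    using L 1 lift_column_mem[OF L] by (auto simp: lift_def intro: holo_vec_column)
qed

text \<open>Shows that the deformed map is an isotropic curve, from its normalized frame alone. Any
  lift is a combination of columns 1 and 2 of \<open>\<sigma>\<close>, and only column 2 contributes
  to the conformal form, which has rank one and is therefore null.\<close>

lemma nlift_isotropic:
  assumes U: "connectedin X U" "U \<noteq> {}" and s: "nlift U f U \<sigma>"
  shows "isotropic_curve X \<A> U f"
proof -
  have L: "lift X \<A> U f \<sigma>" and oU: "openin X U" using s by (auto simp: nlift_def lift_def)
  have Sp: "\<sigma> q \<in> Sp" if "q \<in> U" for q using L that by (simp add: lift_def)
  have hs: "holo_vec \<A> U (\<lambda>q. column j (\<sigma> q))" for j using L by (auto simp: lift_def intro: holo_vec_column)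
  have chart: "\<exists>c\<in>\<A>. q \<in> fst c" if "q \<in> U" for q using chart_exists openin_subset[OF oU] that by blast
  have null: "null_curve X \<A> U f"
    unfolding null_curve_def
  proof (intro allI impI ballI)
    fix W A c p assume WA: "W \<subseteq> U \<and> lift X \<A> W f A" and c: "c \<in> \<A>" and p: "p \<in> W \<inter> fst c"
    then have W: "W \<subseteq> U" "lift X \<A> W f A" "openin X W" and pW: "p \<in> W" "p \<in> fst c" "p \<in> U" by (auto simp: lift_def)
    have hA: "holo_vec \<A> W (\<lambda>q. column j (A q))" for j using W by (auto simp: lift_def intro: holo_vec_column)
    note n = nlift_entries[OF s pW(3) c pW(2)]
    define h where "h = sympl (column 2 (\<sigma> p)) (column 2 (mat_deriv c \<sigma> p))"
    define \<alpha> where "\<alpha> = (\<lambda>j. sympl (column j (A p)) (column 3 (\<sigma> p)))"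
    define \<beta> where "\<beta> = (\<lambda>j. sympl (column j (A p)) (column 4 (\<sigma> p)))"
    have Af: "column j (A q) \<in> f q" if "q \<in> W" "j = 1 \<or> j = 2" for j q using lift_column_mem[OF W(2)] that by auto
    have ex: "column j (A p) = \<alpha> j *s column 1 (\<sigma> p) + \<beta> j *s column 2 (\<sigma> p)" if j: "j = 1 \<or> j = 2" for j
    proof -
      have "sympl (column 1 (\<sigma> p)) (column j (A p)) = 0 \<and> sympl (column 2 (\<sigma> p)) (column j (A p)) = 0"
        using Af[OF pW(1) j] lagrangian_plane_mem[OF Sp[OF pW(3)]] lift_plane[OF L pW(3)] by simp
      then show ?thesis using Sp_expand[OF Sp[OF pW(3)], of "column j (A p)"] by (simp add: \<alpha>_def \<beta>_def)
    qed
    have 1: "sympl (column 1 (\<sigma> p)) (column j (mat_deriv c A p)) = 0" if j: "j = 1 \<or> j = 2" for j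
      unfolding vd_pull_column[symmetric]
      by (rule leg_kernel[OF nlift_leg_section[OF s] W(3) hA Af[OF _ j] lift_Q3[OF W(2)] c pW(2,3,1)])
    have 2: "sympl (column 2 (\<sigma> p)) (column j (mat_deriv c A p)) = \<beta> j * h" if j: "j = 1 \<or> j = 2" for j
    proof -
      have "sympl (column 2 (mat_deriv c \<sigma> p)) (column j (A p)) + sympl (column 2 (\<sigma> p)) (column j (mat_deriv c A p)) = 0"
        unfolding vd_pull_column[symmetric]
      proof (rule sympl_zero_deriv[OF W(3) holo_vec_mono[OF hs W(1)] hA _ c pW(1,2), of _ _ 0])
        fix q assume q: "q \<in> W"
        then have "column 2 (\<sigma> q) \<in> f q" "column j (A q) \<in> f q" "f q \<in> Q3"
          using lift_column_mem[OF L] Af[OF q j] lift_Q3[OF W(2)] W(1) by auto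
        then show "sympl (column 2 (\<sigma> q)) (column j (A q)) = 0" by (auto simp: Q3_def)
      qed
      moreover have "sympl (column 2 (mat_deriv c \<sigma> p)) (column j (A p)) = - (\<beta> j * h)"
        unfolding ex[OF j] using n(3) sympl_swap[of "column 2 (mat_deriv c \<sigma> p)" "column 1 (\<sigma> p)"]
          sympl_swap[of "column 2 (mat_deriv c \<sigma> p)" "column 2 (\<sigma> p)"]
        by (simp add: sympl_linear h_def)
      ultimately show ?thesis by simp
    qed
    have "sympl (column i (A p)) (column j (mat_deriv c A p)) = \<beta> i * \<beta> j * h" if "i = 1 \<or> i = 2" "j = 1 \<or> j = 2" for i j
      unfolding ex[OF that(1)] by (simp add: sympl_linear 1[OF that(2)] 2[OF that(2)])
    moreover have "A p \<in> Sp" using W pW by (simp add: lift_def)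
    ultimately show "mc c A p $ 3 $ 1 * mc c A p $ 4 $ 2 - (mc c A p $ 4 $ 1)\<^sup>2 = 0"
      using c pW by (simp add: mc_pull mcP_nth mat_deriv_pull) (simp add: power2_eq_square)
  qed
  have ray: "\<not> f ` U \<subseteq> null_ray \<xi>" if \<xi>: "\<xi> \<noteq> 0" for \<xi>
  proof
    assume R: "f ` U \<subseteq> null_ray \<xi>"
    have xf: "\<xi> \<in> f q" if "q \<in> U" for q using R that vec.span_base[of \<xi> "{\<xi>}"] by (auto simp: null_ray_def)
    have x0: "sympl (column 1 (\<sigma> q)) \<xi> = 0" "sympl (column 2 (\<sigma> q)) \<xi> = 0" if "q \<in> U" for q
      using xf[OF that] lagrangian_plane_mem[OF Sp[OF that]] lift_plane[OF L that] by auto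
    have hx: "holo_vec \<A> U (\<lambda>q. \<xi>)" by (simp add: holo_vec_def holo_const)
    have x: "\<xi> = sympl \<xi> (column 3 (\<sigma> q)) *s column 1 (\<sigma> q) + sympl \<xi> (column 4 (\<sigma> q)) *s column 2 (\<sigma> q)" if "q \<in> U" for q
      using Sp_expand[OF Sp[OF that], of \<xi>] x0[OF that] by simp
    have dx: "vd (pull c (\<lambda>q. \<xi>)) z = 0" for c z by (simp add: pull_abs vd_const)
    \<comment> \<open>A constant vector in all planes is a combination of columns 1 and 2.
      Differentiating its orthogonality to column 2 kills the coefficient of column 2, as
      \<open>\<phi>\<^sup>4\<^sub>2\<close> is nonzero; differentiating the result kills the other,
      as \<open>\<phi>\<^sup>2\<^sub>1\<close> is.\<close>
    have b: "sympl \<xi> (column 4 (\<sigma> q)) = 0" if q: "q \<in> U" for q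
    proof -
      obtain c where c: "c \<in> \<A>" "q \<in> fst c" using chart[OF q] by blast
      note n = nlift_entries[OF s q c]
      have "sympl (column 2 (mat_deriv c \<sigma> q)) \<xi> = 0"
        using sympl_zero_deriv[OF oU hs hx x0(2) c(1) q c(2)] unfolding vd_pull_column dx by (simp add: sympl_linear)
      moreover have "sympl (column 2 (mat_deriv c \<sigma> q)) \<xi> =
          - (sympl \<xi> (column 4 (\<sigma> q)) * sympl (column 2 (\<sigma> q)) (column 2 (mat_deriv c \<sigma> q)))"
        using arg_cong[OF x[OF q], of "sympl (column 2 (mat_deriv c \<sigma> q))"] n(3)
          sympl_swap[of "column 2 (mat_deriv c \<sigma> q)" "column 1 (\<sigma> q)"]
          sympl_swap[of "column 2 (mat_deriv c \<sigma> q)" "column 2 (\<sigma> q)"] by (simp add: sympl_linear)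
      ultimately show ?thesis using n(4) by simp
    qed
    obtain q where q: "q \<in> U" using U(2) by blast
    obtain c where c: "c \<in> \<A>" "q \<in> fst c" using chart[OF q] by blast
    note n = nlift_entries[OF s q c]
    have "sympl \<xi> (column 4 (mat_deriv c \<sigma> q)) = 0"
      using sympl_zero_deriv[OF oU hx hs b c(1) q c(2)] unfolding vd_pull_column dx by (simp add: sympl_linear)
    moreover have "sympl (column 1 (mat_deriv c \<sigma> q)) (column 4 (\<sigma> q)) + sympl (column 1 (\<sigma> q)) (column 4 (mat_deriv c \<sigma> q)) = 0"
      unfolding vd_pull_column[symmetric]
      by (rule sympl_zero_deriv[OF oU hs hs _ c(1) q c(2), of _ _ 0]) (rule Sp_columns(3)[OF Sp])
    moreover have "sympl \<xi> (column 4 (mat_deriv c \<sigma> q)) = sympl \<xi> (column 3 (\<sigma> q)) * sympl (column 1 (\<sigma> q)) (column 4 (mat_deriv c \<sigma> q))"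
      using arg_cong[OF x[OF q], of "\<lambda>v. sympl v (column 4 (mat_deriv c \<sigma> q))"] b[OF q] by (simp add: sympl_linear)
    ultimately have "sympl \<xi> (column 3 (\<sigma> q)) = 0" using n(5) by auto
    then have "\<xi> = 0" using x[OF q] b[OF q] by simp
    then show False using \<xi> by simp
  qed
  \<comment> \<open>A constant map would lie in the null ray of column 1 at any point.\<close>
  have "\<exists>p\<in>U. \<exists>q\<in>U. f p \<noteq> f q"
  proof (rule ccontr)
    assume c: "\<not> ?thesis"
    obtain p where p: "p \<in> U" using U(2) by blast
    have "f q \<in> null_ray (column 1 (\<sigma> p))" if q: "q \<in> U" for q
    proof -
      have "f q = f p" using c p q by blast
      moreover have "vec.span {column 1 (\<sigma> p)} \<subseteq> f p"
        unfolding lift_plane[OF L p, symmetric] plane_def by (rule vec.span_mono) simp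
      ultimately show ?thesis using lift_Q3[OF L p] by (simp add: null_ray_def)
    qed
    moreover have "column 1 (\<sigma> p) \<noteq> 0" using nlift_leg_section[OF s] p by (simp add: leg_section_def)
    ultimately show False using ray by blast
  qed
  then show ?thesis
    using oU U(1) lift_holo_Q3[OF L] null ray by (simp add: isotropic_curve_def)
qed

text \<open>Around a point of \<open>S_star\<close> the coefficient is holomorphic, so its limit is
  its value: finite and nonzero in every chart. It supplies a point at which
  \<open>deformable\<close> makes an assertion.\<close>

lemma nonzero_quartic_not_support:
  assumes iso: "isotropic_curve X \<A> U f" and p: "p \<in> S_star X \<A> U f"
    and c0: "c0 \<in> \<A>" "p \<in> fst c0" and nz: "quartic_coeff X \<A> U f c0 p \<noteq> 0"
  shows "p \<notin> quartic_support X \<A> U f"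
proof
  assume "p \<in> quartic_support X \<A> U f"
  then obtain c where c: "c \<in> \<A>" "p \<in> fst c"
    and S: "(pull c (quartic_coeff X \<A> U f c) \<longlongrightarrow> 0) (at (snd c p)) \<or> is_pole (pull c (quartic_coeff X \<A> U f c)) (snd c p)"
    unfolding quartic_support_def Let_def coord_expr_pull by blast
  obtain W \<sigma> where W: "p \<in> W" "nlift U f W \<sigma>" using S_star_nlift[OF iso p] by blast
  have L: "lift X \<A> W f \<sigma>" and oW: "openin X W" using W by (auto simp: nlift_def lift_def)
  let ?D = "snd c ` (fst c \<inter> W)"
  have D: "open ?D" "snd c p \<in> ?D" using img_open[OF c(1) oW] c W by auto
  let ?q = "\<lambda>w. mcP (pull c \<sigma>) w $ 1 $ 3 * (mcP (pull c \<sigma>) w $ 4 $ 2)^3"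
  have hS: "Sp_hol ?D (pull c \<sigma>)" by (rule lift_Sp_hol[OF L c(1)])
  have "mhol ?D (mcP (pull c \<sigma>))"
    unfolding mcP_def using hS by (intro mhol_mult mhol_Sp_inv mhol_md) (auto simp: Sp_hol_def)
  then have hq: "?q holomorphic_on ?D" by (intro holomorphic_intros mhol_D)
  have e: "pull c (quartic_coeff X \<A> U f c) w = ?q w" if "w \<in> ?D" for w
  proof -
    obtain q where q: "q \<in> fst c" "q \<in> W" "w = snd c q" using \<open>w \<in> ?D\<close> by auto
    have "\<sigma> q \<in> Sp" using L q by (simp add: lift_def)
    then show ?thesis using quartic_value[OF iso W(2) q(2) c(1) q(1)] c q by (simp add: mc_pull)
  qed
  have "pull c (quartic_coeff X \<A> U f c) holomorphic_on ?D" by (rule holomorphic_transform[OF hq]) (simp add: e)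
  then have "pull c (quartic_coeff X \<A> U f c) field_differentiable at (snd c p)"
    by (rule holomorphic_on_imp_differentiable_at[OF _ D])
  then have "isCont (pull c (quartic_coeff X \<A> U f c)) (snd c p)" by (rule field_differentiable_imp_continuous_at)
  then have lim: "(pull c (quartic_coeff X \<A> U f c) \<longlongrightarrow> quartic_coeff X \<A> U f c p) (at (snd c p))"
    using c by (simp add: isCont_def)
  obtain J where J: "\<And>i j. mc c0 \<sigma> p $ i $ j = J * mc c \<sigma> p $ i $ j"
    using mat_deriv_chart_change[OF c(1) c0(1) c(2) c0(2)] L W(1) oW unfolding lift_def by metis
  have "quartic_coeff X \<A> U f c0 p = J^4 * quartic_coeff X \<A> U f c p"
    unfolding quartic_value[OF iso W(2,1) c0] quartic_value[OF iso W(2,1) c] J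
    by (simp add: power_mult_distrib eval_nat_numeral)
  then have "quartic_coeff X \<A> U f c p \<noteq> 0" using nz by auto
  then show False
    using S lim tendsto_unique[OF _ lim] not_tendsto_and_filterlim_at_infinity[OF _ lim]
    unfolding is_pole_def by (metis trivial_limit_at)
qed

text \<open>With \<open>S\<close> a frame of \<open>f\<close>, \<open>M S\<close> lifts
  \<open>g\<close> and \<open>D(p) S\<close> lifts the translated curve. They agree at
  \<open>p\<close>, as \<open>vanish_contact\<close> demands, and their pairings are those on the
  right with arguments exchanged.\<close>

lemma contact_plane:
  assumes c: "c \<in> \<A>" "p0 \<in> fst c" and r: "r > 0" "ball (snd c p0) r \<subseteq> snd c ` fst c"
    and u: "legendrian (ball (snd c p0) r) u" and f: "\<And>q. q \<in> disc c p0 r \<Longrightarrow> f q = plane (u (snd c q)) (vd u (snd c q))"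
    and M: "Sp_hol (ball (snd c p0) r) M" and D: "\<And>q. q \<in> disc c p0 r \<Longrightarrow> D q = M (snd c q)"
    and g: "\<And>q. q \<in> disc c p0 r \<Longrightarrow> g q = act (D q) (f q)" and p: "p \<in> disc c p0 r"
  shows "analytic_contact X \<A> k p g (\<lambda>q. act (D p) (f q)) \<longleftrightarrow>
     (\<forall>x\<in>{u, vd u}. \<forall>y\<in>{u, vd u}. vanish (Suc k) (\<lambda>w. sympl (M (snd c p) *v x w) (M w *v y w)) (snd c p))"
proof -
  let ?B = "ball (snd c p0) r" and ?U = "disc c p0 r"
  note d = disc_properties[OF c r]
  have B: "snd c q \<in> ?B" if "q \<in> ?U" for q using that by (simp add: disc_def)
  obtain S where S: "Sp_hol ?B S" "\<And>z. z \<in> ?B \<Longrightarrow> column 1 (S z) = u z" "\<And>z. z \<in> ?B \<Longrightarrow> column 2 (S z) = vd u z"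
    using legendrian_frame[OF u] by metis
  have hS: "mhol ?B S" and hM: "mhol ?B M" and MSp: "\<And>w. w \<in> ?B \<Longrightarrow> M w \<in> Sp" and SSp: "\<And>w. w \<in> ?B \<Longrightarrow> S w \<in> Sp"
    using S(1) M by (auto simp: Sp_hol_def)
  have fS: "f q = plane (column 1 (S (snd c q))) (column 2 (S (snd c q)))" if "q \<in> ?U" for q
    using f[OF that] S(2,3)[OF B[OF that]] by simp
  have DSp: "D p \<in> Sp" using D[OF p] MSp B[OF p] by simp
  let ?L = "\<lambda>q. M (snd c q) ** S (snd c q)" and ?L' = "\<lambda>q. D p ** S (snd c q)"
  have L: "lift X \<A> ?U g ?L"
  proof (rule plane_lift(1)[OF c r, of "\<lambda>w. M w ** S w"])
    show "Sp_hol ?B (\<lambda>w. M w ** S w)" using mhol_mult[OF hM hS] MSp SSp by (auto simp: Sp_hol_def intro: Sp_mult)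
    show "g q = plane (column 1 (M (snd c q) ** S (snd c q))) (column 2 (M (snd c q) ** S (snd c q)))" if "q \<in> ?U" for q
      using g[OF that] D[OF that] fS[OF that] by (simp add: plane_image column_mult)
  qed
  have L': "lift X \<A> ?U (\<lambda>q. act (D p) (f q)) ?L'"
  proof (rule plane_lift(1)[OF c r, of "\<lambda>w. D p ** S w"])
    show "Sp_hol ?B (\<lambda>w. D p ** S w)" using mcP_const_mult(2)[OF S(1) B[OF p] DSp] .
    show "act (D p) (f q) = plane (column 1 (D p ** S (snd c q))) (column 2 (D p ** S (snd c q)))" if "q \<in> ?U" for q
      using fS[OF that] by (simp add: plane_image column_mult)
  qed
  have pc: "p \<in> fst c" using p d(5) by blast
  have iff: "vanish (Suc k) (pull c (\<lambda>q. sympl (column x (?L q)) (column y (?L' q)))) (snd c p) \<longleftrightarrow>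
      vanish (Suc k) (\<lambda>w. sympl (M (snd c p) *v column y (S w)) (M w *v column x (S w))) (snd c p)" for x y
  proof -
    let ?h = "\<lambda>w. sympl (M w *v column x (S w)) (M (snd c p) *v column y (S w))"
    have e: "pull c (\<lambda>q. sympl (column x (?L q)) (column y (?L' q))) w = ?h w" if "w \<in> ?B" for w
    proof -
      have "w \<in> snd c ` ?U" unfolding d(3) by (rule that)
      then obtain q where q: "q \<in> ?U" "w = snd c q" by (elim imageE)
      have "q \<in> fst c" using q d(5) by blast
      then show ?thesis using c q D[OF p] by (simp add: column_mult)
    qed
    have h: "?h analytic_on {snd c p}" "(\<lambda>w. sympl (M (snd c p) *v column y (S w)) (M w *v column x (S w))) analytic_on {snd c p}"
    proof -
      have "?h holomorphic_on ?B" "(\<lambda>w. sympl (M (snd c p) *v column y (S w)) (M w *v column x (S w))) holomorphic_on ?B"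
        by (intro sympl_hol vhol_matvec vhol_column mhol_const hM hS)+
      then show "?h analytic_on {snd c p}" "(\<lambda>w. sympl (M (snd c p) *v column y (S w)) (M w *v column x (S w))) analytic_on {snd c p}"
        using B[OF p] analytic_at open_ball by blast+
    qed
    have "vanish (Suc k) (pull c (\<lambda>q. sympl (column x (?L q)) (column y (?L' q)))) (snd c p) \<longleftrightarrow> vanish (Suc k) ?h (snd c p)"
      by (rule vanish_cong_open[OF open_ball B[OF p] e])
    also have "\<dots> \<longleftrightarrow> vanish (Suc k) (\<lambda>w. sympl (M (snd c p) *v column y (S w)) (M w *v column x (S w))) (snd c p)"
      using vanish_sympl_swap[OF h(1)] vanish_sympl_swap[OF h(2)] by blast
    finally show ?thesis .
  qed
  define E where "E = (\<lambda>x y. vanish (Suc k) (\<lambda>w. sympl (M (snd c p) *v x w) (M w *v y w)) (snd c p))"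
  have E: "vanish (Suc k) (\<lambda>w. sympl (M (snd c p) *v column y (S w)) (M w *v column x (S w))) (snd c p) \<longleftrightarrow>
     E (if y = 1 then u else vd u) (if x = 1 then u else vd u)" if "x = 1 \<or> x = 2" "y = 1 \<or> y = 2" for x y
    unfolding E_def by (rule vanish_cong_open[OF open_ball B[OF p]]) (use that S(2,3) in auto)
  have "analytic_contact X \<A> k p g (\<lambda>q. act (D p) (f q)) \<longleftrightarrow>
    (\<forall>x y. (x = 1 \<or> x = 2) \<longrightarrow> (y = 1 \<or> y = 2) \<longrightarrow>
       vanish (Suc k) (pull c (\<lambda>q. sympl (column x (?L q)) (column y (?L' q)))) (snd c p))"
  proof
    assume "analytic_contact X \<A> k p g (\<lambda>q. act (D p) (f q))"
    then show "\<forall>x y. (x = 1 \<or> x = 2) \<longrightarrow> (y = 1 \<or> y = 2) \<longrightarrow>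
       vanish (Suc k) (pull c (\<lambda>q. sympl (column x (?L q)) (column y (?L' q)))) (snd c p)"
      using contact_vanish[OF _ L L' p p c(1) pc] by blast
  next
    assume a: "\<forall>x y. (x = 1 \<or> x = 2) \<longrightarrow> (y = 1 \<or> y = 2) \<longrightarrow>
       vanish (Suc k) (pull c (\<lambda>q. sympl (column x (?L q)) (column y (?L' q)))) (snd c p)"
    show "analytic_contact X \<A> k p g (\<lambda>q. act (D p) (f q))"
      by (rule vanish_contact[OF L L' p p _ c(1) pc]) (use a D[OF p] in auto)
  qed
  also have "\<dots> \<longleftrightarrow> (\<forall>x\<in>{u, vd u}. \<forall>y\<in>{u, vd u}. E x y)"
    unfolding iff using E[of 1 1] E[of 1 2] E[of 2 1] E[of 2 2]
    by (simp add: imp_disjL all_conj_distrib) blast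
  finally show ?thesis unfolding E_def .
qed

text \<open>\<open>rigid_plane\<close> needs a Legendrian lift and so makes \<open>D\<close>
  constant only on a disc around \<open>p0\<close>. The identity theorem extends this to the
  connected set \<open>U\<close>, which may contain critical points of \<open>f\<close>.\<close>

lemma rigid_order_5:
  assumes iso: "isotropic_curve X \<A> S f" and p0: "p0 \<in> S_star X \<A> S f"
    and U: "openin X U" "connectedin X U" "p0 \<in> U" and cd: "conformal_deformation X \<A> U 5 f g"
  shows "congruent_on U f g"
proof -
  obtain D where D: "holo_mat \<A> U D" "\<And>p. p \<in> U \<Longrightarrow> D p \<in> Sp"
    "\<And>p. p \<in> U \<Longrightarrow> analytic_contact X \<A> 5 p g (\<lambda>q. act (D p) (f q))"
    using cd unfolding conformal_deformation_def by blast
  have g: "g q = act (D q) (f q)" if "q \<in> U" for q using contact_value[OF D(3)[OF that]] .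
  obtain c where c: "c \<in> \<A>" "p0 \<in> fst c" using chart_exists openin_subset[OF U(1)] U(3) by blast
  obtain r u where r: "r > 0" "ball (snd c p0) r \<subseteq> snd c ` fst c" "disc c p0 r \<subseteq> S" "legendrian (ball (snd c p0) r) u"
    "\<And>q. q \<in> disc c p0 r \<Longrightarrow> f q = plane (u (snd c q)) (vd u (snd c q))"
    using S_star_legendrian[OF iso p0 c] by blast
  obtain r1 where r1: "r1 > 0" "\<And>s. 0 < s \<Longrightarrow> s \<le> r1 \<Longrightarrow> ball (snd c p0) s \<subseteq> snd c ` fst c \<and> disc c p0 s \<subseteq> U"
    using disc_exists[OF c U(1,3)] by blast
  define s where "s = min r r1"
  have s: "s > 0" "ball (snd c p0) s \<subseteq> snd c ` fst c" "disc c p0 s \<subseteq> U" using r1(2)[of s] r(1) r1(1) by (auto simp: s_def)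
  have sr: "ball (snd c p0) s \<subseteq> ball (snd c p0) r" "disc c p0 s \<subseteq> disc c p0 r" by (auto simp: s_def disc_def)
  note d = disc_properties[OF c s(1,2)]
  let ?B = "ball (snd c p0) s"
  have u: "legendrian ?B u" by (rule legendrian_mono[OF r(4) sr(1) open_ball])
  have f: "f q = plane (u (snd c q)) (vd u (snd c q))" if "q \<in> disc c p0 s" for q using r(5) that sr by blast
  define M where "M = pull c D"
  have DM: "D q = M (snd c q)" if "q \<in> disc c p0 s" for q
  proof -
    have "q \<in> fst c" using that d(5) by blast
    then show ?thesis using c by (simp add: M_def)
  qed
  have im: "\<exists>q. q \<in> disc c p0 s \<and> w = snd c q" if "w \<in> ?B" for w
  proof -
    have "w \<in> snd c ` disc c p0 s" unfolding d(3) by (rule that)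
    then show ?thesis by blast
  qed
  have M: "Sp_hol ?B M"
    unfolding Sp_hol_def
  proof (intro conjI ballI open_ball)
    show "mhol ?B M" unfolding M_def d(3)[symmetric]
      by (rule mhol_subset[OF D(1)[unfolded holo_mat_pull, rule_format, OF c(1)]]) (use d(5) s(3) in auto)
    fix w assume "w \<in> ?B"
    then obtain q where "q \<in> disc c p0 s" "w = snd c q" using im by blast
    then show "M w \<in> Sp" using DM D(2) s(3) by (metis subsetD)
  qed
  have M0: "md M w = 0" if w: "w \<in> ?B" for w
  proof (rule rigid_plane[OF u M w])
    fix p x y assume p: "p \<in> ?B" and x: "x \<in> {u, vd u}" and y: "y \<in> {u, vd u}"
    obtain q where q: "q \<in> disc c p0 s" "p = snd c q" using im[OF p] by blast
    have "analytic_contact X \<A> 5 q g (\<lambda>r. act (D q) (f r))" using D(3) q s(3) by blast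
    then have "vanish (Suc 5) (\<lambda>w. sympl (M p *v x w) (M w *v y w)) p"
      using contact_plane[where D = D and g = g, OF c s(1,2) u f M DM _ q(1), of 5] g s(3) x y q(2) by blast
    then show "vanish 6 (\<lambda>w. sympl (M p *v x w) (M w *v y w)) p" by simp
  qed
  have hM: "mhol ?B M" using M by (simp add: Sp_hol_def)
  have z0: "snd c p0 \<in> ?B" using s(1) by simp
  have "M w = M (snd c p0)" if "w \<in> ?B" for w
    by (rule md_zero_const[OF hM open_ball connected_ball M0 that z0])
  then have "D q = D p0" if "q \<in> disc c p0 s" for q
    using DM[OF that] DM[OF d(2)] that by (simp add: disc_def)
  then have "\<forall>q\<in>U. D q = D p0"
    using holo_mat_const_continuation[OF U(1,2) D(1) d(1) _ s(3), of "D p0"] d(2) by blast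
  then show ?thesis using g D(2)[OF U(3)] unfolding congruent_on_def by metis
qed

lemma deformable_order_4:
  assumes iso: "isotropic_curve X \<A> S f" and p0: "p0 \<in> S_star X \<A> S f"
  shows "\<exists>U g. openin X U \<and> p0 \<in> U \<and> general_type X \<A> U g \<and> conformal_deformation X \<A> U 4 f g \<and> \<not> congruent_on U f g"
proof -
  have "openin X S" "p0 \<in> S" using iso p0 by (auto simp: isotropic_curve_def S_star_def)
  then obtain c where c: "c \<in> \<A>" "p0 \<in> fst c" using chart_exists openin_subset by blast
  obtain r u where r: "r > 0" "ball (snd c p0) r \<subseteq> snd c ` fst c" "disc c p0 r \<subseteq> S" "legendrian (ball (snd c p0) r) u"
    "\<And>q. q \<in> disc c p0 r \<Longrightarrow> f q = plane (u (snd c q)) (vd u (snd c q))"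
    using S_star_legendrian[OF iso p0 c] by blast
  let ?z = "snd c p0"
  obtain Sf where Sf: "Sp_hol (ball ?z r) Sf" "\<And>z. z \<in> ball ?z r \<Longrightarrow> column 1 (Sf z) = u z"
    "\<And>z. z \<in> ball ?z r \<Longrightarrow> column 2 (Sf z) = vd u z" "\<And>z. z \<in> ball ?z r \<Longrightarrow> normalized_form (mcP Sf z)"
    "\<And>z. z \<in> ball ?z r \<Longrightarrow> mcP Sf z $ 4 $ 2 = 1"
    by (rule legendrian_frame[OF r(4)], rule that)
  \<comment> \<open>Any nonzero number other than the value of \<open>\<phi>\<^sup>1\<^sub>3\<close>
    at the centre: nonzero for a nontrivial deformation, different for a nonzero quartic
    differential.\<close>
  define t :: complex where "t = (if mcP Sf ?z $ 1 $ 3 = 1 then 2 else 1)"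
  have t: "t \<noteq> 0" "mcP Sf ?z $ 1 $ 3 - t \<noteq> 0" by (auto simp: t_def)
  obtain \<rho> M where M: "\<rho> > 0" "\<rho> \<le> r" "Sp_hol (ball ?z \<rho>) M"
    "\<And>p x y. p \<in> ball ?z \<rho> \<Longrightarrow> x \<in> {u, vd u} \<Longrightarrow> y \<in> {u, vd u} \<Longrightarrow> vanish 5 (\<lambda>w. sympl (M p *v x w) (M w *v y w)) p"
    "\<And>S z. Sp_hol (ball ?z \<rho>) S \<Longrightarrow> z \<in> ball ?z \<rho> \<Longrightarrow> column 1 (S z) = u z \<Longrightarrow>
      mcP (\<lambda>z. M z ** S z) z = mcP S z + (\<chi> i j. if i = 1 \<and> j = 3 then - t else 0)"
    by (rule deformation_plane[OF r(4,1), where t = t], rule that)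
  let ?B = "ball ?z \<rho>" and ?U = "disc c p0 \<rho>"
  have Br: "?B \<subseteq> ball ?z r" "?U \<subseteq> disc c p0 r" using M(2) by (auto simp: disc_def)
  have bc: "?B \<subseteq> snd c ` fst c" using Br r(2) by blast
  note d = disc_properties[OF c M(1) bc]
  have B: "snd c q \<in> ?B" if "q \<in> ?U" for q using that by (simp add: disc_def)
  have u: "legendrian ?B u" by (rule legendrian_mono[OF r(4) Br(1) open_ball])
  have f: "f q = plane (u (snd c q)) (vd u (snd c q))" if "q \<in> ?U" for q using r(5) that Br by blast
  have S: "Sp_hol ?B Sf" by (rule Sp_hol_subset[OF Sf(1) Br(1) open_ball])
  have Sfr: "column 1 (Sf z) = u z" "column 2 (Sf z) = vd u z" "normalized_form (mcP Sf z)" "mcP Sf z $ 4 $ 2 = 1"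
    if "z \<in> ?B" for z using Sf(2-5) that Br(1) by blast+
  have fS: "f q = plane (column 1 (Sf (snd c q))) (column 2 (Sf (snd c q)))" if "q \<in> ?U" for q
    using f[OF that] Sfr(1,2)[OF B[OF that]] by simp
  define D where "D = (\<lambda>q. M (snd c q))"
  define g where "g = (\<lambda>q. act (D q) (f q))"
  define T where "T = (\<lambda>w. M w ** Sf w)"
  have T: "Sp_hol ?B T" using M(3) S unfolding T_def Sp_hol_def by (auto intro: mhol_mult Sp_mult)
  have mcT: "mcP T z $ i $ j = mcP Sf z $ i $ j + (if i = 1 \<and> j = 3 then - t else 0)" if "z \<in> ?B" for z i j
    using M(5)[OF S that Sfr(1)[OF that]] unfolding T_def by simp
  have nT: "normalized_form (mcP T z)" if "z \<in> ?B" for z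
    using Sfr(3)[OF that] unfolding normalized_form_def mcT[OF that] by simp
  have gT: "g q = plane (column 1 (T (snd c q))) (column 2 (T (snd c q)))" if "q \<in> ?U" for q
    unfolding g_def D_def T_def fS[OF that] by (simp add: plane_image column_mult)
  have ng: "nlift ?U g ?U (\<lambda>q. T (snd c q))" by (rule plane_nlift[OF c M(1) bc order_refl T gT nT])
  have ig: "isotropic_curve X \<A> ?U g" by (rule nlift_isotropic[OF d(4) _ ng]) (use d(2) in blast)
  have mT: "mc c (\<lambda>q. T (snd c q)) p0 = mcP T ?z" by (rule plane_lift(2)[OF c M(1) bc T gT d(2)])
  have zB: "?z \<in> ?B" using M(1) by simp
  have "quartic_coeff X \<A> ?U g c p0 = mcP Sf ?z $ 1 $ 3 - t"
    unfolding quartic_value[OF ig ng d(2) c] mT mcT[OF zB] using Sfr(4)[OF zB] by simp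
  then have gt: "general_type X \<A> ?U g"
    using t(2) ig nlift_S_star[OF ig ng d(2)] c unfolding general_type_def by (metis (no_types))
  have hD: "holo_mat \<A> ?U D"
  proof (rule holo_mat_chartI[OF c(1) d(5)])
    have "pull c D w = M w" if "w \<in> ?B" for w
    proof -
      have "w \<in> snd c ` fst c" using that bc by blast
      then show ?thesis using c by (auto simp: pull_def D_def)
    qed
    then show "mhol (snd c ` ?U) (pull c D)"
      unfolding d(3) using M(3) mhol_cong[of ?B M "pull c D"] by (auto simp: Sp_hol_def)
  qed
  have DSp: "D p \<in> Sp" if "p \<in> ?U" for p using M(3) B[OF that] by (simp add: D_def Sp_hol_def)
  have "analytic_contact X \<A> 4 p g (\<lambda>q. act (D p) (f q))" if p: "p \<in> ?U" for p
  proof -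
    have "\<forall>x\<in>{u, vd u}. \<forall>y\<in>{u, vd u}. vanish (Suc 4) (\<lambda>w. sympl (M (snd c p) *v x w) (M w *v y w)) (snd c p)"
      using M(4)[OF B[OF p]] by (simp add: eval_nat_numeral)
    then show ?thesis
      using contact_plane[where D = D and g = g, OF c M(1) bc u f M(3) _ _ p, of 4] by (simp add: D_def g_def)
  qed
  then have cd: "conformal_deformation X \<A> ?U 4 f g" using hD DSp unfolding conformal_deformation_def by blast
  have "\<not> congruent_on ?U f g"
  proof
    assume "congruent_on ?U f g"
    then obtain C where C: "C \<in> Sp" "\<And>q. q \<in> ?U \<Longrightarrow> g q = act C (f q)" unfolding congruent_on_def by blast
    \<comment> \<open>A congruence would give a second normalized lift of \<open>g\<close>, with the
      unchanged form of \<open>Sf\<close>. Since \<open>\<phi>\<^sup>4\<^sub>2 = 1\<close>,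
      invariance of the quartic coefficient would equate \<open>\<phi>\<^sup>1\<^sub>3\<close> with
      \<open>\<phi>\<^sup>1\<^sub>3 - t\<close>.\<close>
    let ?S' = "\<lambda>w. C ** Sf w"
    have S': "Sp_hol ?B ?S'" by (rule mcP_const_mult(2)[OF S zB C(1)])
    have gS': "g q = plane (column 1 (?S' (snd c q))) (column 2 (?S' (snd c q)))" if "q \<in> ?U" for q
      unfolding C(2)[OF that] fS[OF that] by (simp add: plane_image column_mult)
    have nS': "normalized_form (mcP ?S' z)" if "z \<in> ?B" for z
      unfolding mcP_const_mult(1)[OF S that C(1)] by (rule Sfr(3)[OF that])
    have n': "nlift ?U g ?U (\<lambda>q. ?S' (snd c q))" by (rule plane_nlift[OF c M(1) bc order_refl S' gS' nS'])
    have mS': "mc c (\<lambda>q. ?S' (snd c q)) p0 = mcP ?S' ?z" by (rule plane_lift(2)[OF c M(1) bc S' gS' d(2)])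
    have "mcP Sf ?z $ 1 $ 3 = mcP Sf ?z $ 1 $ 3 - t"
      using nlift_unique(2)[OF ng n' d(2,2) c] Sfr(4)[OF zB]
      unfolding mT mS' mcT[OF zB] mcP_const_mult(1)[OF S zB C(1)] by simp
    then show False using t(1) by simp
  qed
  then show ?thesis using d(1,2) gt cd by blast
qed

end

theorem theorem4:
  fixes X :: "'a topology" and \<A> :: "'a chart set" and f :: "'a \<Rightarrow> (complex^4) set"
  assumes "riemann_surface X \<A>" and "connected_space X"
    and "general_type X \<A> (topspace X) f"
  shows "deformable X \<A> 4 f \<and> rigid X \<A> 5 f"
proof -
  interpret rsurf X \<A> by unfold_locales (rule assms(1))
  let ?S = "topspace X"
  have iso: "isotropic_curve X \<A> ?S f" using assms(3) by (simp add: general_type_def)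
  obtain p c where p: "p \<in> S_star X \<A> ?S f" "c \<in> \<A>" "p \<in> fst c" "quartic_coeff X \<A> ?S f c p \<noteq> 0"
    using assms(3) unfolding general_type_def by blast
  have "deformable X \<A> 4 f"
    unfolding deformable_def Let_def
    using deformable_order_4[OF iso] by (auto simp: S_star_def)
  moreover have "\<not> deformable X \<A> 5 f"
  proof
    assume def: "deformable X \<A> 5 f"
    \<comment> \<open>Deformability is a statement about all points off the three supports; to
      refute it one such point suffices, and general type provides it.\<close>
    have "p \<notin> quartic_support X \<A> ?S f" by (rule nonzero_quartic_not_support[OF iso p])
    then obtain U g where U: "openin X U" "p \<in> U" "general_type X \<A> U g"
      "conformal_deformation X \<A> U 5 f g" "\<not> congruent_on U f g"
      using def p(1) unfolding deformable_def Let_def S_star_def by blast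
    then have "connectedin X U" by (simp add: general_type_def isotropic_curve_def)
    then show False using rigid_order_5[OF iso p(1) U(1) _ U(2,4)] U(5) by blast
  qed
  ultimately show ?thesis by (simp add: rigid_def)
qed

end
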